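(* Let $r>3$ be the order of accuracy of the subspaces $S_h\subset H_0^2(\Omega)$. Let $u$ be the solution of the weak problem (P1) and $u^h$ the solution of the semidiscrete problem (P1h) with initial value $u_0^h\in S_h$. Assume $u\in L^\infty(I;H_0^2(\Omega))\cap L^2(I;H^r(\Omega))$, $\partial_tu\in L^2(I;H^r(\Omega))$ and $u_0\in H_0^r(\Omega)$. Then there exists a positive constant $C$ (independent of $h$) such that $$\|u-u^h\|_{L^\infty(I;H_0^2(\Omega))}^2+\|u-u^h\|_{L^2(I;H_0^1(\Omega))}^2\le C\left(\|u_0-u_0^h\|_2^2+h^{2(r-2)}\right).$$
   Context: $\Omega\subset\mathbb{R}^n$, $n\le2$, is a bounded polyhedral Lipschitz domain; $T>0$, $I=(0,T)$, $\alpha>0$. $(\cdot,\cdot)$, $\|\cdot\|$ are the $L^2(\Omega)$ inner product and norm. $g:\mathbb{R}\to\mathbb{R}^n$ has components $g_i(u)=-(u+\tfrac12u^2)$. Norms: $\|u\|_1^2=\|u\|^2+\|\nabla u\|^2$, $\|u\|_2^2=\|u\|^2+\|\nabla u\|^2+\|\Delta u\|^2$; $\|\cdot\|_r$ is the norm of the Sobolev space $H^r(\Omega)$. $H_0^1(\Omega)=\{u\in H^1(\Omega):u|_{\partial\Omega}=0\}$ (on which $\|\nabla\cdot\|$ is a norm, equivalent to $\|\cdot\|_1$), $H_0^2(\Omega)=\{u\in H^2(\Omega):u|_{\partial\Omega}=0,\ \partial u/\partial n|_{\partial\Omega}=0\}$ with norm $\|\cdot\|_2$; $H_0^r(\Omega)$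 is the corresponding vanishing-trace Sobolev space of order $r$. $L^p(I;\mathcal Z)$ are Bochner spaces. (P1): $u\in L^\infty(I;H_0^2(\Omega))\cap L^2(I;H_0^1(\Omega))$ with $u_t\in L^2(I;H^2(\Omega))$ satisfies $(u_t(t),\chi)+(\Delta u_t(t),\Delta\chi)+\alpha(\nabla u(t),\nabla\chi)=(\nabla\cdot g(u(t)),\chi)$ for all $\chi\in H_0^2(\Omega)$, and $u(\cdot,0)=u_0$. Finite element spaces: for mesh parameters $0<h<1$ of conformal, quasi-uniform simplicial triangulations of $\Omega$, $S_h$ is a finite-dimensional subspace of $H_0^2(\Omega)$; it has order of accuracy $r>3$, meaning that there is a constant $K$ independent of $h$ with $\inf_{\phi\in S_h}\|v-\phi\|_2\le Kh^{r-2}\|v\|_r$ for all $v\in H_0^2(\Omega)\cap H^r(\Omega)$. (P1h): $u^h:[0,T]\to S_h$ satisfies $(u^h_t(t),\chi)+(\Delta u^h_t(t),\Delta\chi)+\alpha(\nabla u^h(t),\nabla\chi)=-(g(u^h(t)),\nabla\chi)$ and $(u^h(0),\chi)=(u_0^h,\chi)$ for all $\chi\in S_h$, where $u_0^h\in S_h$ is a given approximation of $u_0$. *)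

theory Defs
  imports "HOL-Analysis.Analysis" "HOL-Probability.Essential_Supremum"
begin

(* Elements of function spaces over Omega are represented by functions on the whole of R^n;
   only their values in Omega, up to null sets, matter. *)

section \<open>Polyhedral Lipschitz domains and their triangulations\<close>

definition lipschitz_boundary :: "'a::euclidean_space set \<Rightarrow> bool" where
  "lipschitz_boundary \<Omega> \<longleftrightarrow>
     (\<forall>x\<in>frontier \<Omega>. \<exists>\<rho>>0. \<exists>L. \<exists>e. \<exists>f::'a \<Rightarrow> real.
        norm e = 1 \<and> lipschitz_on L UNIV f \<and>
        (\<forall>y\<in>ball x \<rho>. y \<in> \<Omega> \<longleftrightarrow> f (y - (y \<bullet> e) *\<^sub>R e) < y \<bullet> e))"

definition polyhedral_lipschitz_domain :: "'a::euclidean_space set \<Rightarrow> bool" where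
  "polyhedral_lipschitz_domain \<Omega> \<longleftrightarrow>
     open \<Omega> \<and> connected \<Omega> \<and> \<Omega> \<noteq> {} \<and> bounded \<Omega> \<and> lipschitz_boundary \<Omega> \<and>
     (\<exists>\<P>. finite \<P> \<and> (\<forall>P\<in>\<P>. polytope P) \<and> closure \<Omega> = \<Union>\<P>)"

(* The inscribed balls of radius c * h, with c the same for all meshes, express
   quasi-uniformity (which includes shape regularity).  Conformity is part of
   the library notion triangulation: any two simplices meet in a common face. *)
definition quasi_uniform_triangulations ::
    "'a::euclidean_space set \<Rightarrow> real set \<Rightarrow> (real \<Rightarrow> 'a set set) \<Rightarrow> bool" where
  "quasi_uniform_triangulations \<Omega> H \<T> \<longleftrightarrow>
     (\<forall>h\<in>H. triangulation (\<T> h) \<and> (\<forall>K\<in>\<T> h. int DIM('a) simplex K) \<and>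
        \<Union>(\<T> h) = closure \<Omega> \<and> Max (diameter ` \<T> h) = h) \<and>
     (\<exists>c>0. \<forall>h\<in>H. \<forall>K\<in>\<T> h. \<exists>x. cball x (c * h) \<subseteq> K)"

section \<open>Smooth functions\<close>

definition partial :: "'n::finite \<Rightarrow> (real^'n \<Rightarrow> real) \<Rightarrow> real^'n \<Rightarrow> real" where
  "partial j f x = frechet_derivative f (at x) (axis j 1)"

fun partials :: "'n::finite list \<Rightarrow> (real^'n \<Rightarrow> real) \<Rightarrow> real^'n \<Rightarrow> real" where
  "partials [] f = f"
| "partials (j # js) f = partial j (partials js f)"

definition smooth :: "(real^'n::finite \<Rightarrow> real) \<Rightarrow> bool" where
  "smooth f \<longleftrightarrow> (\<forall>js x. partials js f differentiable (at x))"

definition test_function :: "(real^'n::finite) set \<Rightarrow> (real^'n \<Rightarrow> real) \<Rightarrow> bool" where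
  "test_function \<Omega> \<phi> \<longleftrightarrow>
     smooth \<phi> \<and> (\<exists>K. compact K \<and> K \<subseteq> \<Omega> \<and> (\<forall>x. x \<notin> K \<longrightarrow> \<phi> x = 0))"

section \<open>Lebesgue space and weak derivatives\<close>

definition L2_space :: "(real^'n::finite) set \<Rightarrow> (real^'n \<Rightarrow> real) set" where
  "L2_space \<Omega> = {f. f \<in> borel_measurable (lebesgue_on \<Omega>) \<and>
                    integrable (lebesgue_on \<Omega>) (\<lambda>x. (f x)\<^sup>2)}"

definition L2_inner ::
    "(real^'n::finite) set \<Rightarrow> (real^'n \<Rightarrow> 'b::real_inner) \<Rightarrow> (real^'n \<Rightarrow> 'b) \<Rightarrow> real" where
  "L2_inner \<Omega> f g = (LINT x|lebesgue_on \<Omega>. f x \<bullet> g x)"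

definition L2_norm ::
    "(real^'n::finite) set \<Rightarrow> (real^'n \<Rightarrow> 'b::real_inner) \<Rightarrow> real" where
  "L2_norm \<Omega> f = sqrt (L2_inner \<Omega> f f)"

definition loc_integrable :: "(real^'n::finite) set \<Rightarrow> (real^'n \<Rightarrow> real) \<Rightarrow> bool" where
  "loc_integrable \<Omega> f \<longleftrightarrow> (\<forall>K. compact K \<and> K \<subseteq> \<Omega> \<longrightarrow> integrable (lebesgue_on K) f)"

definition is_weak_deriv ::
    "(real^'n::finite) set \<Rightarrow> 'n list \<Rightarrow> (real^'n \<Rightarrow> real) \<Rightarrow> (real^'n \<Rightarrow> real) \<Rightarrow> bool" where
  "is_weak_deriv \<Omega> js f g \<longleftrightarrow>
     loc_integrable \<Omega> f \<and> loc_integrable \<Omega> g \<and>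
     (\<forall>\<phi>. test_function \<Omega> \<phi> \<longrightarrow>
        L2_inner \<Omega> f (partials js \<phi>) = (-1) ^ length js * L2_inner \<Omega> g \<phi>)"

(* Weak derivatives are unique up to null sets; this picks a representative. *)
definition wderiv ::
    "(real^'n::finite) set \<Rightarrow> 'n list \<Rightarrow> (real^'n \<Rightarrow> real) \<Rightarrow> real^'n \<Rightarrow> real" where
  "wderiv \<Omega> js f = (SOME g. is_weak_deriv \<Omega> js f g)"

definition wgrad :: "(real^'n::finite) set \<Rightarrow> (real^'n \<Rightarrow> real) \<Rightarrow> real^'n \<Rightarrow> real^'n" where
  "wgrad \<Omega> f x = (\<chi> j. wderiv \<Omega> [j] f x)"

definition wlaplace :: "(real^'n::finite) set \<Rightarrow> (real^'n \<Rightarrow> real) \<Rightarrow> real^'n \<Rightarrow> real" where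
  "wlaplace \<Omega> f x = (\<Sum>j\<in>UNIV. wderiv \<Omega> [j, j] f x)"

definition wdiv :: "(real^'n::finite) set \<Rightarrow> (real^'n \<Rightarrow> real^'n) \<Rightarrow> real^'n \<Rightarrow> real" where
  "wdiv \<Omega> F x = (\<Sum>j\<in>UNIV. wderiv \<Omega> [j] (\<lambda>y. F y $ j) x)"

section \<open>Sobolev spaces of real order\<close>

(* Square of the Sobolev--Slobodeckij (Gagliardo) seminorm of order \<theta>, 0 < \<theta> < 1. *)
definition slobodeckij :: "real \<Rightarrow> (real^'n::finite) set \<Rightarrow> (real^'n \<Rightarrow> real) \<Rightarrow> ennreal" where
  "slobodeckij \<theta> \<Omega> f =
     (\<integral>\<^sup>+x. (\<integral>\<^sup>+y. ennreal ((f x - f y)\<^sup>2 / dist x y powr (real CARD('n) + 2 * \<theta>))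
        \<partial>lebesgue_on \<Omega>) \<partial>lebesgue_on \<Omega>)"

definition sobolev_space :: "real \<Rightarrow> (real^'n::finite) set \<Rightarrow> (real^'n \<Rightarrow> real) set" where
  "sobolev_space r \<Omega> =
     {v. (\<forall>js. length js \<le> nat \<lfloor>r\<rfloor> \<longrightarrow> (\<exists>g\<in>L2_space \<Omega>. is_weak_deriv \<Omega> js v g)) \<and>
         (frac r > 0 \<longrightarrow>
            (\<forall>js. length js = nat \<lfloor>r\<rfloor> \<longrightarrow> slobodeckij (frac r) \<Omega> (wderiv \<Omega> js v) < \<infinity>))}"

(* Summing over lists of directions gives the Frobenius norms of the tensors of derivatives. *)
definition sobolev_norm :: "real \<Rightarrow> (real^'n::finite) set \<Rightarrow> (real^'n \<Rightarrow> real) \<Rightarrow> real" where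
  "sobolev_norm r \<Omega> v =
     sqrt ((\<Sum>js | length js \<le> nat \<lfloor>r\<rfloor>. (L2_norm \<Omega> (wderiv \<Omega> js v))\<^sup>2) +
           (if frac r > 0
            then (\<Sum>js | length js = nat \<lfloor>r\<rfloor>. enn2real (slobodeckij (frac r) \<Omega> (wderiv \<Omega> js v)))
            else 0))"

definition norm1 :: "(real^'n::finite) set \<Rightarrow> (real^'n \<Rightarrow> real) \<Rightarrow> real" where
  "norm1 \<Omega> v = sqrt ((L2_norm \<Omega> v)\<^sup>2 + (L2_norm \<Omega> (wgrad \<Omega> v))\<^sup>2)"

definition norm2 :: "(real^'n::finite) set \<Rightarrow> (real^'n \<Rightarrow> real) \<Rightarrow> real" where
  "norm2 \<Omega> v =
     sqrt ((L2_norm \<Omega> v)\<^sup>2 + (L2_norm \<Omega> (wgrad \<Omega> v))\<^sup>2 + (L2_norm \<Omega> (wlaplace \<Omega> v))\<^sup>2)"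

section \<open>Traces and spaces with vanishing traces\<close>

(* The empty set has to be treated separately because x ^ 0 = 1.  The factor that normalises
   d-dimensional Hausdorff measure to agree with Lebesgue measure equals 1 for d = 0 and d = 1,
   the only boundary dimensions that occur below. *)
definition hausdorff_pre :: "nat \<Rightarrow> real \<Rightarrow> 'a::metric_space set \<Rightarrow> ennreal" where
  "hausdorff_pre d \<delta> A =
     (INF C\<in>{C::nat \<Rightarrow> 'a set. A \<subseteq> (\<Union>i. C i) \<and> (\<forall>i. bounded (C i) \<and> diameter (C i) \<le> \<delta>)}.
        \<Sum>i. if C i = {} then 0 else ennreal (diameter (C i) ^ d))"

definition hausdorff_measure :: "nat \<Rightarrow> 'a::metric_space measure" where
  "hausdorff_measure d = measure_of UNIV (sets borel) (\<lambda>A. SUP \<delta>\<in>{0<..}. hausdorff_pre d \<delta> A)"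

definition surface_measure :: "(real^'n::finite) set \<Rightarrow> (real^'n) measure" where
  "surface_measure \<Omega> = restrict_space (hausdorff_measure (CARD('n) - 1)) (frontier \<Omega>)"

(* f is the trace of w: the trace operator is the continuous extension, from the H^s(Omega) norm
   (s > 1/2) to the L^2 norm on the boundary, of the restriction of smooth functions. *)
definition has_trace ::
    "real \<Rightarrow> (real^'n::finite) set \<Rightarrow> (real^'n \<Rightarrow> real) \<Rightarrow> (real^'n \<Rightarrow> real) \<Rightarrow> bool" where
  "has_trace s \<Omega> w f \<longleftrightarrow>
     w \<in> sobolev_space s \<Omega> \<and>
     f \<in> borel_measurable (surface_measure \<Omega>) \<and>
     integrable (surface_measure \<Omega>) (\<lambda>x. (f x)\<^sup>2) \<and>
     (\<exists>\<phi>. (\<forall>k::nat. smooth (\<phi> k)) \<and>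
        (\<lambda>k. sobolev_norm s \<Omega> (\<lambda>x. w x - \<phi> k x)) \<longlonglongrightarrow> 0 \<and>
        (\<lambda>k. \<integral>\<^sup>+x. ennreal ((\<phi> k x - f x)\<^sup>2) \<partial>surface_measure \<Omega>) \<longlonglongrightarrow> 0)"

(* A polyhedral domain coincides with a half-space near almost every boundary point. *)
definition outward_normal :: "'a::euclidean_space set \<Rightarrow> 'a \<Rightarrow> 'a \<Rightarrow> bool" where
  "outward_normal \<Omega> x \<nu> \<longleftrightarrow>
     norm \<nu> = 1 \<and> (\<exists>\<rho>>0. \<forall>y\<in>ball x \<rho>. y \<in> \<Omega> \<longleftrightarrow> (y - x) \<bullet> \<nu> < 0)"

definition vanishing_normal_derivative :: "(real^'n::finite) set \<Rightarrow> (real^'n \<Rightarrow> real) \<Rightarrow> bool" where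
  "vanishing_normal_derivative \<Omega> v \<longleftrightarrow>
     (\<exists>f::real^'n \<Rightarrow> real^'n.
        (\<forall>j. has_trace 1 \<Omega> (wderiv \<Omega> [j] v) (\<lambda>x. f x $ j)) \<and>
        (AE x in surface_measure \<Omega>. \<forall>\<nu>. outward_normal \<Omega> x \<nu> \<longrightarrow> f x \<bullet> \<nu> = 0))"

definition H01 :: "(real^'n::finite) set \<Rightarrow> (real^'n \<Rightarrow> real) set" where
  "H01 \<Omega> = {v \<in> sobolev_space 1 \<Omega>. has_trace 1 \<Omega> v (\<lambda>_. 0)}"

definition H02 :: "(real^'n::finite) set \<Rightarrow> (real^'n \<Rightarrow> real) set" where
  "H02 \<Omega> = {v \<in> sobolev_space 2 \<Omega>. has_trace 1 \<Omega> v (\<lambda>_. 0) \<and> vanishing_normal_derivative \<Omega> v}"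

(* All traces that exist in H^r vanish: a derivative of order k lies in H^(r-k)
   and has a trace if r - k > 1/2. *)
definition H0 :: "real \<Rightarrow> (real^'n::finite) set \<Rightarrow> (real^'n \<Rightarrow> real) set" where
  "H0 r \<Omega> = {v \<in> sobolev_space r \<Omega>.
     \<forall>js. r - real (length js) > 1/2 \<longrightarrow>
        has_trace (r - real (length js)) \<Omega> (wderiv \<Omega> js v) (\<lambda>_. 0)}"

section \<open>Bochner spaces over the time interval\<close>

(* Z is the underlying set of a space of (representatives of) functions, N its norm. *)

definition strongly_measurable ::
    "real \<Rightarrow> ('a \<Rightarrow> real) set \<Rightarrow> (('a \<Rightarrow> real) \<Rightarrow> real) \<Rightarrow> (real \<Rightarrow> 'a \<Rightarrow> real) \<Rightarrow> bool" where
  "strongly_measurable T Z N u \<longleftrightarrow>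
     (\<exists>s::nat \<Rightarrow> real \<Rightarrow> 'a \<Rightarrow> real.
        (\<forall>k. finite (range (s k)) \<and> range (s k) \<subseteq> Z \<and>
             (\<forall>f. {t \<in> {0<..<T}. s k t = f} \<in> sets lebesgue)) \<and>
        (AE t in lebesgue_on {0<..<T}. (\<lambda>k. N (\<lambda>x. s k t x - u t x)) \<longlonglongrightarrow> 0))"

definition bochner_L2 ::
    "real \<Rightarrow> ('a \<Rightarrow> real) set \<Rightarrow> (('a \<Rightarrow> real) \<Rightarrow> real) \<Rightarrow> (real \<Rightarrow> 'a \<Rightarrow> real) set" where
  "bochner_L2 T Z N = {u. strongly_measurable T Z N u \<and>
     (AE t in lebesgue_on {0<..<T}. u t \<in> Z) \<and>
     integrable (lebesgue_on {0<..<T}) (\<lambda>t. (N (u t))\<^sup>2)}"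

definition bochner_L2_norm ::
    "real \<Rightarrow> (('a \<Rightarrow> real) \<Rightarrow> real) \<Rightarrow> (real \<Rightarrow> 'a \<Rightarrow> real) \<Rightarrow> real" where
  "bochner_L2_norm T N u = sqrt (LINT t|lebesgue_on {0<..<T}. (N (u t))\<^sup>2)"

definition bochner_Linf ::
    "real \<Rightarrow> ('a \<Rightarrow> real) set \<Rightarrow> (('a \<Rightarrow> real) \<Rightarrow> real) \<Rightarrow> (real \<Rightarrow> 'a \<Rightarrow> real) set" where
  "bochner_Linf T Z N = {u. strongly_measurable T Z N u \<and>
     (AE t in lebesgue_on {0<..<T}. u t \<in> Z) \<and>
     (\<exists>M. AE t in lebesgue_on {0<..<T}. N (u t) \<le> M)}"

definition bochner_Linf_norm ::
    "real \<Rightarrow> (('a \<Rightarrow> real) \<Rightarrow> real) \<Rightarrow> (real \<Rightarrow> 'a \<Rightarrow> real) \<Rightarrow> real" where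
  "bochner_Linf_norm T N u = real_of_ereal (esssup (lebesgue_on {0<..<T}) (\<lambda>t. ereal (N (u t))))"

definition time_test_function :: "real \<Rightarrow> (real \<Rightarrow> real) \<Rightarrow> bool" where
  "time_test_function T \<psi> \<longleftrightarrow>
     (\<forall>k t. ((deriv ^^ k) \<psi>) differentiable (at t)) \<and>
     (\<exists>a b. 0 < a \<and> b < T \<and> (\<forall>t. t \<notin> {a..b} \<longrightarrow> \<psi> t = 0))"

(* w is the weak time derivative of u: the identity
   (integral of \<psi>' u) = - (integral of \<psi> w) between Bochner integrals in L^2(Omega),
   tested with all v in L^2(Omega). *)
definition weak_time_deriv ::
    "real \<Rightarrow> (real^'n::finite) set \<Rightarrow> (real \<Rightarrow> real^'n \<Rightarrow> real) \<Rightarrow> (real \<Rightarrow> real^'n \<Rightarrow> real) \<Rightarrow> bool" where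
  "weak_time_deriv T \<Omega> u w \<longleftrightarrow>
     (\<forall>\<psi>. time_test_function T \<psi> \<longrightarrow> (\<forall>v\<in>L2_space \<Omega>.
        (LINT t|lebesgue_on {0<..<T}. deriv \<psi> t * L2_inner \<Omega> (u t) v) =
        - (LINT t|lebesgue_on {0<..<T}. \<psi> t * L2_inner \<Omega> (w t) v)))"

section \<open>The continuous and the semidiscrete problem\<close>

definition flux :: "real \<Rightarrow> real^'n::finite" where
  "flux s = (\<chi> i. - (s + s\<^sup>2 / 2))"

(* To give u(0) a meaning, u is taken to be the representative that is continuous
   on [0,T] with values in L^2(Omega); ut is its time derivative. *)
definition weak_solution ::
    "real \<Rightarrow> (real^'n::finite) set \<Rightarrow> real \<Rightarrow> (real^'n \<Rightarrow> real) \<Rightarrow>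
     (real \<Rightarrow> real^'n \<Rightarrow> real) \<Rightarrow> (real \<Rightarrow> real^'n \<Rightarrow> real) \<Rightarrow> bool" where
  "weak_solution T \<Omega> \<alpha> u0 u ut \<longleftrightarrow>
     u \<in> bochner_Linf T (H02 \<Omega>) (norm2 \<Omega>) \<and>
     u \<in> bochner_L2 T (H01 \<Omega>) (norm1 \<Omega>) \<and>
     ut \<in> bochner_L2 T (sobolev_space 2 \<Omega>) (sobolev_norm 2 \<Omega>) \<and>
     weak_time_deriv T \<Omega> u ut \<and>
     (AE t in lebesgue_on {0<..<T}. \<forall>v\<in>H02 \<Omega>.
        L2_inner \<Omega> (ut t) v + L2_inner \<Omega> (wlaplace \<Omega> (ut t)) (wlaplace \<Omega> v)
          + \<alpha> * L2_inner \<Omega> (wgrad \<Omega> (u t)) (wgrad \<Omega> v)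
        = L2_inner \<Omega> (wdiv \<Omega> (\<lambda>x. flux (u t x))) v) \<and>
     (\<forall>t\<in>{0..T}. u t \<in> L2_space \<Omega> \<and>
        ((\<lambda>s. L2_norm \<Omega> (\<lambda>x. u s x - u t x)) \<longlongrightarrow> 0) (at t within {0..T})) \<and>
     (AE x in lebesgue_on \<Omega>. u 0 x = u0 x)"

definition finite_dim_subspace :: "('a \<Rightarrow> real) set \<Rightarrow> ('a \<Rightarrow> real) set \<Rightarrow> bool" where
  "finite_dim_subspace S V \<longleftrightarrow>
     S \<subseteq> V \<and> (\<exists>B. finite B \<and> S = {v. \<exists>c. v = (\<lambda>x. \<Sum>b\<in>B. c b * b x)})"

definition order_of_accuracy ::
    "real \<Rightarrow> (real^'n::finite) set \<Rightarrow> real set \<Rightarrow> (real \<Rightarrow> (real^'n \<Rightarrow> real) set) \<Rightarrow> bool" where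
  "order_of_accuracy r \<Omega> H S \<longleftrightarrow>
     (\<exists>K. \<forall>h\<in>H. \<forall>v \<in> H02 \<Omega> \<inter> sobolev_space r \<Omega>.
        (INF \<phi>\<in>S h. norm2 \<Omega> (\<lambda>x. v x - \<phi> x)) \<le> K * h powr (r - 2) * sobolev_norm r \<Omega> v)"

definition semidiscrete_solution ::
    "real \<Rightarrow> (real^'n::finite) set \<Rightarrow> real \<Rightarrow> (real^'n \<Rightarrow> real) set \<Rightarrow> (real^'n \<Rightarrow> real) \<Rightarrow>
     (real \<Rightarrow> real^'n \<Rightarrow> real) \<Rightarrow> bool" where
  "semidiscrete_solution T \<Omega> \<alpha> S u0h uh \<longleftrightarrow>
     (\<forall>t\<in>{0..T}. uh t \<in> S) \<and>
     (\<exists>uht. \<forall>t\<in>{0..T}. uht t \<in> S \<and>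
        ((\<lambda>s. norm2 \<Omega> (\<lambda>x. (uh s x - uh t x) / (s - t) - uht t x)) \<longlongrightarrow> 0) (at t within {0..T}) \<and>
        (\<forall>v\<in>S.
           L2_inner \<Omega> (uht t) v + L2_inner \<Omega> (wlaplace \<Omega> (uht t)) (wlaplace \<Omega> v)
             + \<alpha> * L2_inner \<Omega> (wgrad \<Omega> (uh t)) (wgrad \<Omega> v)
           = - L2_inner \<Omega> (\<lambda>x. flux (uh t x)) (wgrad \<Omega> v))) \<and>
     (\<forall>v\<in>S. L2_inner \<Omega> (uh 0) v = L2_inner \<Omega> u0h v)"

end

(* The error is split as u - u_h = \<rho> + \<vartheta>, where \<vartheta> is the projection of the error
   onto S_h with respect to the inner product a(v, w) = (v, w) + (\<Delta> v, \<Delta> w) of the problem.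
   Since \<rho> is a-orthogonal to S_h, it is dominated by the best approximation error, which is
   O(h^(r-2)) uniformly in time because u_t is integrable with values in H^r.  Testing the
   difference of the two equations with \<vartheta> leaves a right-hand side that is quadratic in
   (\<rho>, \<vartheta>): the cubic term (\<vartheta>^2, \<partial>_j \<vartheta>) vanishes, and the other terms are controlled by
   the L^4 bound nrm (v^2) \<le> C a(v, v), a Ladyzhenskaya inequality on H_0^1 in dimension at most 2.
   Gronwall's lemma then bounds a(\<vartheta>, \<vartheta>).  All traces are handled by slicing along coordinate lines:
   the frontier lies in finitely many hyperplanes, so almost every line meets it in finitely
   many points. *)
theory Submission
  imports Defs "HOL-Computational_Algebra.Polynomial"
begin

section \<open>Smooth cut-off functions\<close>

text \<open>The time derivative occurs only inside the form a, so projecting with a removes the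
  derivative of \<open>\<rho>\<close> from the energy identity and leaves the approximation error of
  u(t) alone. The price is that u(t) has to be bounded in H^r uniformly in time, while u itself is
  only given as square integrable in time with values in H^r. Integrating u_t gives identities
  tested with fixed L^2 functions; norms are recovered from them by duality, and for fractional r
  the Gagliardo seminorm is truncated so that its quadratic form is bounded on L^2. A zero trace is
  known only through smooth functions whose boundary values are small in L^2 without vanishing. Each
  inequality is therefore proved for smooth functions with a boundary term measured by Hausdorff
  measure, and that term disappears in the limit. The projected error is not known to be
  differentiable in time. The energy argument works with its coordinates in an a-orthonormal basis
  of S_h: each is a constant plus the primitive of an integrable function, and for these the
  derivative of a square is an instance of Fubini's theorem.\<close>

primrec diffn :: "nat \<Rightarrow> (real \<Rightarrow> real) \<Rightarrow> bool" where
 "diffn 0 f \<longleftrightarrow> (\<forall>t. f differentiable (at t))"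
| "diffn (Suc n) f \<longleftrightarrow> (\<forall>t. f differentiable (at t)) \<and> diffn n (deriv f)"

text \<open>\<open>diffn n\<close> asks for n + 1 derivatives, peeled off one at a time, so that the
  calculus rules below follow by induction on n before being collected here.\<close>

definition smooth1 :: "(real \<Rightarrow> real) \<Rightarrow> bool" where
 "smooth1 f \<longleftrightarrow> (\<forall>n. diffn n f)"

lemma diffn_imp_differentiable: "diffn n f \<Longrightarrow> f differentiable (at t)"
 by (cases n) auto

lemma diffn_mono: "diffn n f \<Longrightarrow> m \<le> n \<Longrightarrow> diffn m f"
proof (induction n arbitrary: m f)
 case (Suc n)
 then show ?case by (cases m) auto
qed simp

lemma diffn_deriv_power: "diffn n f \<Longrightarrow> k \<le> n \<Longrightarrow> (deriv ^^ k) f differentiable (at t)"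
proof (induction n arbitrary: f k)
 case (Suc n)
 then show ?case
  by (cases k) (auto simp del: funpow.simps simp: funpow_Suc_right)
qed simp

lemma smooth1_deriv_power: "smooth1 f \<Longrightarrow> (deriv ^^ k) f differentiable (at t)"
 unfolding smooth1_def using diffn_deriv_power by blast

lemma smooth1_deriv: "smooth1 f \<Longrightarrow> smooth1 (deriv f)"
 unfolding smooth1_def using diffn.simps(2) by blast

lemma smooth1_DERIV: "smooth1 f \<Longrightarrow> (f has_real_derivative deriv f t) (at t)"
 unfolding smooth1_def
 using diffn_imp_differentiable field_differentiable_derivI field_differentiable_def
  real_differentiable_def DERIV_deriv_iff_real_differentiable by blast

lemma smooth1_continuous_on: "smooth1 f \<Longrightarrow> continuous_on A f"
 by (meson DERIV_isCont continuous_at_imp_continuous_on smooth1_DERIV)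

text \<open>Avoids iterated derivatives altogether: a family that contains a derivative of each
  member supplies the next derivative at every level.\<close>

lemma smooth1_coinduct:
 assumes "f \<in> F" and "\<And>f. f \<in> F \<Longrightarrow> \<exists>g\<in>F. \<forall>t. (f has_real_derivative g t) (at t)"
 shows "smooth1 f"
proof -
 have "diffn n f" if "f \<in> F" for n f
  using that
 proof (induction n arbitrary: f)
  case 0
  then show ?case using assms(2) real_differentiable_def by fastforce
 next
  case (Suc n)
  obtain g where g: "g \<in> F" "\<forall>t. (f has_real_derivative g t) (at t)"
   using assms(2) Suc.prems by blast
  have "deriv f = g" using g(2) DERIV_imp_deriv by blast
  then show ?case using g Suc.IH real_differentiable_def by auto
 qed
 then show ?thesis using assms(1) by (simp add: smooth1_def)
qed

lemma diffn_DERIV: "diffn n f \<Longrightarrow> (f has_real_derivative deriv f t) (at t)"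
 using DERIV_deriv_iff_real_differentiable diffn_imp_differentiable by blast

lemma diffn_SucI:
 assumes "\<And>t. (f has_real_derivative g t) (at t)" "diffn n g"
 shows "diffn (Suc n) f"
proof -
 have "deriv f = g" using assms(1) DERIV_imp_deriv by blast
 then show ?thesis using assms real_differentiable_def by auto
qed

lemma diffn_0I: "(\<And>t. (f has_real_derivative g t) (at t)) \<Longrightarrow> diffn 0 f"
 using real_differentiable_def by fastforce

lemma diffn_add: "diffn n f \<Longrightarrow> diffn n g \<Longrightarrow> diffn n (\<lambda>t. f t + g t)"
proof (induction n arbitrary: f g)
 case (Suc n)
 have "((\<lambda>t. f t + g t) has_real_derivative deriv f t + deriv g t) (at t)" for t
  using Suc.prems by (intro DERIV_add diffn_DERIV)
 then show ?case using Suc by (intro diffn_SucI[where g="\<lambda>t. deriv f t + deriv g t"]) auto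
qed simp

lemma diffn_mult: "diffn n f \<Longrightarrow> diffn n g \<Longrightarrow> diffn n (\<lambda>t. f t * g t)"
proof (induction n arbitrary: f g)
 case (Suc n)
 have 1: "((\<lambda>t. f t * g t) has_real_derivative deriv f t * g t + f t * deriv g t) (at t)" for t
  by (auto intro!: derivative_eq_intros diffn_DERIV Suc.prems)
 have "diffn n f" "diffn n g" using Suc.prems diffn_mono[of "Suc n" _ n] by auto
 then have "diffn n (\<lambda>t. deriv f t * g t + f t * deriv g t)"
  using Suc by (intro diffn_add Suc.IH) auto
 then show ?case by (rule diffn_SucI[OF 1])
qed simp

lemma diffn_const: "diffn n (\<lambda>t. c)"
proof (induction n arbitrary: c)
 case (Suc n)
 show ?case by (rule diffn_SucI[where g="\<lambda>t. 0"]) (auto intro: Suc)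
qed simp

text \<open>The derivative of 1/f is built from f' and two factors 1/f, and the induction hypothesis
  one level down already covers 1/f.\<close>

lemma diffn_inverse:
 assumes "\<And>t. f t \<noteq> 0"
 shows "diffn n f \<Longrightarrow> diffn n (\<lambda>t. inverse (f t))"
proof (induction n)
 case 0
 then show ?case using assms by auto
next
 case (Suc n)
 have 1: "((\<lambda>t. inverse (f t)) has_real_derivative
   (-1) * (deriv f t * (inverse (f t) * inverse (f t)))) (at t)" for t
  using assms by (auto intro!: derivative_eq_intros diffn_DERIV Suc.prems simp: field_simps)
 have "diffn n f" using Suc.prems diffn_mono[of "Suc n" _ n] by auto
 then have "diffn n (\<lambda>t. (-1) * (deriv f t * (inverse (f t) * inverse (f t))))"
  using Suc by (intro diffn_mult diffn_const) auto
 then show ?case by (rule diffn_SucI[OF 1])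
qed

lemma diffn_affine: "diffn n f \<Longrightarrow> diffn n (\<lambda>t. f (a * t + b))"
proof (induction n arbitrary: f)
 case 0
 then have "(f has_real_derivative deriv f t) (at t)" for t
  by (rule diffn_DERIV)
 then have "((\<lambda>t. f (a * t + b)) has_real_derivative deriv f (a * t + b) * a) (at t)" for t
  by (rule DERIV_chain2) (auto intro!: derivative_eq_intros)
 then show ?case by (rule diffn_0I)
next
 case (Suc n)
 have "(f has_real_derivative deriv f t) (at t)" for t
  by (rule diffn_DERIV[OF Suc.prems])
 then have "((\<lambda>t. f (a * t + b)) has_real_derivative deriv f (a * t + b) * a) (at t)" for t
  by (rule DERIV_chain2) (auto intro!: derivative_eq_intros)
 then show ?case
  by (rule diffn_SucI) (use Suc in \<open>auto intro!: diffn_mult diffn_const Suc.IH\<close>)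
qed

lemma smooth1_add: "smooth1 f \<Longrightarrow> smooth1 g \<Longrightarrow> smooth1 (\<lambda>t. f t + g t)"
 and smooth1_mult: "smooth1 f \<Longrightarrow> smooth1 g \<Longrightarrow> smooth1 (\<lambda>t. f t * g t)"
 and smooth1_const: "smooth1 (\<lambda>t. c)"
 and smooth1_affine: "smooth1 f \<Longrightarrow> smooth1 (\<lambda>t. f (a * t + b))"
 by (simp_all add: smooth1_def diffn_add diffn_mult diffn_const diffn_affine)

lemma smooth1_inverse: "smooth1 f \<Longrightarrow> (\<And>t. f t \<noteq> 0) \<Longrightarrow> smooth1 (\<lambda>t. inverse (f t))"
 by (simp add: smooth1_def diffn_inverse)

text \<open>\<open>flat 1\<close> is the classical function exp(-1/x), extended by 0. General
  polynomials in 1/x are carried along because all derivatives of exp(-1/x) have this shape, so that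
  \<open>range flat\<close> is closed under differentiation.\<close>

definition flat :: "real poly \<Rightarrow> real \<Rightarrow> real" where
 "flat p x = (if x > 0 then poly p (1 / x) * exp (- (1 / x)) else 0)"

lemma poly_times_exp_tendsto_0: "((\<lambda>y::real. poly p y * exp (- y)) \<longlongrightarrow> 0) at_top"
proof -
 have "((\<lambda>y::real. \<Sum>i\<le>degree p. coeff p i * (y ^ i / exp y)) \<longlongrightarrow> (\<Sum>i\<le>degree p. coeff p i * 0)) at_top"
  by (intro tendsto_sum tendsto_mult tendsto_const tendsto_power_div_exp_0)
 then show ?thesis
  by (simp add: poly_altdef sum_distrib_right exp_minus divide_inverse mult.assoc)
qed

text \<open>The polynomial arises from differentiating p(1/x) exp(-1/x): the inner derivatives
  contribute 1/x^2 with opposite signs, which is X^2 (p - p') evaluated at 1/x.\<close>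

lemma flat_DERIV:
 "(flat p has_real_derivative flat ([:0, 0, 1:] * (p - pderiv p)) x) (at x)"
proof -
 consider "x > 0" | "x < 0" | "x = 0" by linarith
 then show ?thesis
 proof cases
  case 1
  have "((\<lambda>x. poly p (1 / x) * exp (- (1 / x))) has_real_derivative
    flat ([:0, 0, 1:] * (p - pderiv p)) x) (at x)"
  proof -
   have "((\<lambda>x. poly p (1 / x)) has_real_derivative poly (pderiv p) (1 / x) * (- 1 / x\<^sup>2)) (at x)"
    by (rule DERIV_chain2[OF poly_DERIV])
     (use 1 in \<open>auto intro!: derivative_eq_intros simp: power2_eq_square\<close>)
   moreover have "((\<lambda>x. exp (- (1 / x))) has_real_derivative exp (- (1 / x)) * (1 / x\<^sup>2)) (at x)"
    by (rule DERIV_chain2[OF DERIV_exp])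
     (use 1 in \<open>auto intro!: derivative_eq_intros simp: power2_eq_square\<close>)
   ultimately show ?thesis
    by (rule DERIV_mult'[THEN DERIV_cong])
     (use 1 in \<open>simp add: flat_def power2_eq_square field_simps\<close>)
  qed
  then show ?thesis
   by (rule has_field_derivative_transform_within_open[where S="{0<..}"])
    (use 1 in \<open>auto simp: flat_def\<close>)
 next
  case 2
  have "((\<lambda>x. 0) has_real_derivative flat ([:0, 0, 1:] * (p - pderiv p)) x) (at x)"
   using 2 by (simp add: flat_def)
  then show ?thesis
   by (rule has_field_derivative_transform_within_open[where S="{..<0}"])
    (use 2 in \<open>auto simp: flat_def\<close>)
 next
  case 3
  \<comment> \<open>At the origin the difference quotient is again a polynomial in 1/y times
    exp(-1/y), with X p in place of p, so the exponential wins.\<close>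
  have r: "((\<lambda>y. flat p y / y) \<longlongrightarrow> 0) (at_right 0)"
  proof -
   have "((\<lambda>y::real. poly ([:0,1:] * p) (inverse y) * exp (- inverse y)) \<longlongrightarrow> 0) (at_right 0)"
    by (rule filterlim_compose[OF poly_times_exp_tendsto_0 filterlim_inverse_at_top_right])
   moreover have "\<forall>\<^sub>F y in at_right 0. poly ([:0,1:] * p) (inverse y) * exp (- inverse y)
     = flat p y / y"
    by (auto simp: eventually_at_filter flat_def field_simps)
   ultimately show ?thesis by (rule Lim_transform_eventually)
  qed
  have l: "((\<lambda>y. flat p y / y) \<longlongrightarrow> 0) (at_left 0)"
  proof -
   have "\<forall>\<^sub>F y in at_left 0. 0 = flat p y / y"
    by (auto simp: eventually_at_filter flat_def)
   then show ?thesis by (rule Lim_transform_eventually[OF tendsto_const])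
  qed
  have "((\<lambda>y. flat p y / y) \<longlongrightarrow> 0) (at 0)"
   by (rule filterlim_split_at[OF l r])
  then show ?thesis
   using 3 by (simp add: has_field_derivative_iff flat_def)
 qed
qed

lemma smooth1_flat: "smooth1 (flat p)"
 by (rule smooth1_coinduct[where F="range flat"]) (use flat_DERIV in blast)+

text \<open>The standard smooth transition, 0 for t \<le> 0 and 1 for t \<ge> 1. It serves twice:
  for bump functions in space and, through its derivative, as a mollifier in time.\<close>

definition step :: "real \<Rightarrow> real" where
 "step t = flat 1 t * inverse (flat 1 t + flat 1 (1 - t))"

lemma flat_1_pos: "x > 0 \<Longrightarrow> flat 1 x > 0" and flat_1_nonneg: "flat 1 x \<ge> 0"
 and flat_nonpos: "x \<le> 0 \<Longrightarrow> flat p x = 0"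
 by (simp_all add: flat_def)

lemma step_denom: "flat 1 t + flat 1 (1 - t) > 0"
 by (cases "t > 0") (auto intro: add_pos_nonneg add_nonneg_pos simp: flat_1_pos flat_1_nonneg)

lemma smooth1_step: "smooth1 step"
proof -
 have "smooth1 (\<lambda>t. flat 1 t * inverse (flat 1 t + flat 1 ((-1) * t + 1)))"
  using step_denom
  by (intro smooth1_mult smooth1_flat smooth1_inverse smooth1_add smooth1_affine)
   (metis add.commute less_numeral_extra(3) mult_minus1 uminus_add_conv_diff)
 then show ?thesis by (simp add: step_def[abs_def])
qed

lemma step_nonpos: "t \<le> 0 \<Longrightarrow> step t = 0"
 by (simp add: step_def flat_def)

lemma step_ge_1: "t \<ge> 1 \<Longrightarrow> step t = 1"
 using step_denom[of t] by (simp add: step_def flat_nonpos)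

lemma step_nonneg: "step t \<ge> 0" and step_le_1: "step t \<le> 1"
 using step_denom[of t] flat_1_nonneg[of t] flat_1_nonneg[of "1-t"]
 by (simp_all add: step_def flip: divide_inverse)

text \<open>The parameter k is a slope: the two transitions have width 1/k and run inwards from l
  and u, so for growing k the function tends to the indicator of the open interval while keeping its
  support in the closed one.\<close>

definition plateau :: "real \<Rightarrow> real \<Rightarrow> real \<Rightarrow> real \<Rightarrow> real" where
 "plateau l u k t = step (k * (t - l)) * step (k * (u - t))"

lemma smooth1_plateau: "smooth1 (plateau l u k)"
proof -
 have "smooth1 (\<lambda>t. step (k * t + (- k * l)) * step ((- k) * t + k * u))"
  by (intro smooth1_mult smooth1_affine smooth1_step)
 then show ?thesis by (simp add: plateau_def[abs_def] algebra_simps)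
qed

lemma plateau_bounds: "0 \<le> plateau l u k t" "plateau l u k t \<le> 1"
 by (auto simp: plateau_def step_nonneg step_le_1 intro: mult_le_one)

lemma plateau_eq_0: "k \<ge> 0 \<Longrightarrow> t \<notin> {l<..<u} \<Longrightarrow> plateau l u k t = 0"
 by (auto simp: plateau_def not_less step_nonpos mult_nonneg_nonpos)

lemma plateau_tendsto:
 "(\<lambda>k. plateau l u (real k) t) \<longlonglongrightarrow> indicator {l<..<u} t"
proof (cases "t \<in> {l<..<u}")
 case True
 have ev: "\<forall>\<^sub>F k in sequentially. real k * c \<ge> 1" if "c > 0" for c :: real
  using filterlim_at_top_mult_tendsto_pos[OF tendsto_const that filterlim_real_sequentially]
  by (simp add: filterlim_at_top)
 have "\<forall>\<^sub>F k in sequentially. real k * (t - l) \<ge> 1 \<and> real k * (u - t) \<ge> 1"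
  by (rule eventually_conj; rule ev) (use True in auto)
 then have "\<forall>\<^sub>F k in sequentially. plateau l u (real k) t = 1"
  by eventually_elim (simp add: plateau_def step_ge_1)
 then show ?thesis using True by (simp add: tendsto_eventually)
next
 case False
 then show ?thesis by (simp add: plateau_eq_0)
qed

section \<open>Square integrable functions\<close>

text \<open>Stated over an arbitrary measure, since it is applied to the domain, its surface
  measure, the time interval and the product of the domain with itself. Elements are functions, not
  classes, so \<open>nrm\<close> is only a seminorm.\<close>

definition L2 :: "'a measure \<Rightarrow> ('a \<Rightarrow> real) set" where
 "L2 M = {f \<in> borel_measurable M. integrable M (\<lambda>x. (f x)\<^sup>2)}"

definition nrm :: "'a measure \<Rightarrow> ('a \<Rightarrow> real) \<Rightarrow> real" where
 "nrm M f = sqrt (LINT x|M. (f x)\<^sup>2)"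

lemma L2_measurable: "f \<in> L2 M \<Longrightarrow> f \<in> borel_measurable M"
 and L2_integrable_power2: "f \<in> L2 M \<Longrightarrow> integrable M (\<lambda>x. (f x)\<^sup>2)"
 by (simp_all add: L2_def)

lemma L2I: "f \<in> borel_measurable M \<Longrightarrow> integrable M (\<lambda>x. (f x)\<^sup>2) \<Longrightarrow> f \<in> L2 M"
 by (simp add: L2_def)

lemma nrm_nonneg: "nrm M f \<ge> 0" and nrm_power2: "(nrm M f)\<^sup>2 = (LINT x|M. (f x)\<^sup>2)"
 by (simp_all add: nrm_def)

lemma nrm_cmult: "nrm M (\<lambda>x. c * f x) = \<bar>c\<bar> * nrm M f"
 by (simp add: nrm_def power_mult_distrib real_sqrt_mult)

lemma L2_mult_integrable:
 assumes "f \<in> L2 M" "g \<in> L2 M"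
 shows "integrable M (\<lambda>x. f x * g x)"
proof (rule Bochner_Integration.integrable_bound)
 show "integrable M (\<lambda>x. (f x)\<^sup>2 + (g x)\<^sup>2)"
  using assms by (simp add: L2_def)
 show "(\<lambda>x. f x * g x) \<in> borel_measurable M"
  using assms by (auto simp: L2_def)
 have "\<bar>a * b\<bar> \<le> a\<^sup>2 + b\<^sup>2" for a b :: real
 proof -
  have "2 * (\<bar>a\<bar> * \<bar>b\<bar>) \<le> a\<^sup>2 + b\<^sup>2"
   using zero_le_power2[of "\<bar>a\<bar> - \<bar>b\<bar>"] by (simp add: power2_diff)
  then show ?thesis by (simp add: abs_mult) (smt (verit) mult_nonneg_nonneg abs_ge_zero)
 qed
 then show "AE x in M. norm (f x * g x) \<le> norm ((f x)\<^sup>2 + (g x)\<^sup>2)"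
  by simp
qed

lemma L2_add: "f \<in> L2 M \<Longrightarrow> g \<in> L2 M \<Longrightarrow> (\<lambda>x. f x + g x) \<in> L2 M"
 using L2_mult_integrable[of f M g]
 by (auto simp: L2_def power2_sum mult.assoc)

lemma L2_cmult: "f \<in> L2 M \<Longrightarrow> (\<lambda>x. c * f x) \<in> L2 M"
 by (auto simp: L2_def power_mult_distrib)

lemma L2_minus: "f \<in> L2 M \<Longrightarrow> (\<lambda>x. - f x) \<in> L2 M"
 by (auto simp: L2_def)

lemma L2_diff: "f \<in> L2 M \<Longrightarrow> g \<in> L2 M \<Longrightarrow> (\<lambda>x. f x - g x) \<in> L2 M"
 using L2_add[OF _ L2_minus, of f M g] by simp

lemma L2_zero: "(\<lambda>x. 0) \<in> L2 M"
 by (simp add: L2_def)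

lemma L2_sum: "(\<And>i. i \<in> I \<Longrightarrow> f i \<in> L2 M) \<Longrightarrow> (\<lambda>x. \<Sum>i\<in>I. f i x) \<in> L2 M"
 by (induction I rule: infinite_finite_induct) (auto intro: L2_zero L2_add)

lemma L2_cong_AE:
 assumes "f \<in> L2 M" "g \<in> borel_measurable M" "AE x in M. f x = g x"
 shows "g \<in> L2 M"
proof (rule L2I[OF assms(2)])
 have "integrable M (\<lambda>x. (f x)\<^sup>2)" using assms by (simp add: L2_def)
 then show "integrable M (\<lambda>x. (g x)\<^sup>2)"
  by (rule Bochner_Integration.integrable_cong_AE_imp) (use assms in auto)
qed

lemma L2_bounded:
 assumes "finite_measure M" "f \<in> borel_measurable M" "\<And>x. x \<in> space M \<Longrightarrow> \<bar>f x\<bar> \<le> B"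
 shows "f \<in> L2 M"
proof (rule L2I)
 have "(f x)\<^sup>2 \<le> B\<^sup>2" if "x \<in> space M" for x
  using assms(3)[OF that] abs_le_square_iff[of "f x" B] by linarith
 then show "integrable M (\<lambda>x. (f x)\<^sup>2)"
  using assms by (intro finite_measure.integrable_const_bound[where B="B\<^sup>2"]) auto
qed (use assms in auto)

lemma nrm_cong_AE: "AE x in M. f x = g x \<Longrightarrow> f \<in> borel_measurable M \<Longrightarrow> g \<in> borel_measurable M
  \<Longrightarrow> nrm M f = nrm M g"
 unfolding nrm_def by (auto intro!: arg_cong[where f=sqrt] integral_cong_AE)

text \<open>The integral of (f - s g)^2 is a nonnegative quadratic polynomial in s, and its
  discriminant gives the claim.\<close>

lemma L2_Cauchy_Schwarz:
 assumes f: "f \<in> L2 M" and g: "g \<in> L2 M"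
 shows "\<bar>LINT x|M. f x * g x\<bar> \<le> nrm M f * nrm M g"
proof -
 define a b c where "a = (LINT x|M. (f x)\<^sup>2)" and "b = (LINT x|M. f x * g x)"
  and "c = (LINT x|M. (g x)\<^sup>2)"
 have int: "integrable M (\<lambda>x. (f x)\<^sup>2)" "integrable M (\<lambda>x. (g x)\<^sup>2)" "integrable M (\<lambda>x. f x * g x)"
  using f g L2_mult_integrable by (auto simp: L2_def)
 have q: "0 \<le> a - 2 * s * b + s\<^sup>2 * c" for s
 proof -
  have "0 \<le> (LINT x|M. (f x - s * g x)\<^sup>2)" by simp
  also have "\<dots> = (LINT x|M. (f x)\<^sup>2 - 2 * s * (f x * g x) + s\<^sup>2 * (g x)\<^sup>2)"
   by (intro Bochner_Integration.integral_cong) (auto simp: power2_eq_square algebra_simps)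
  also have "\<dots> = a - 2 * s * b + s\<^sup>2 * c"
   using int by (simp add: a_def b_def c_def)
  finally show ?thesis .
 qed
 have "a \<ge> 0" "c \<ge> 0" by (simp_all add: a_def c_def)
 have "b\<^sup>2 \<le> a * c"
 proof (cases "c = 0")
  case True
  have "b = 0"
  proof (rule ccontr)
   assume "b \<noteq> 0"
   \<comment> \<open>For c = 0 the polynomial is linear in s, and this choice of s gives it the
     value -1.\<close>
   then show False using q[of "(a + 1) / (2 * b)"] True \<open>a \<ge> 0\<close> by (simp add: field_simps)
  qed
  then show ?thesis by (simp add: True)
 next
  case False
  then have "c > 0" using \<open>c \<ge> 0\<close> by simp
  have "0 \<le> c * (a - 2 * (b / c) * b + (b / c)\<^sup>2 * c)"
   using q[of "b / c"] \<open>c \<ge> 0\<close> by (intro mult_nonneg_nonneg)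
  also have "\<dots> = a * c - b\<^sup>2"
   using \<open>c > 0\<close> by (simp add: field_simps power2_eq_square)
  finally show ?thesis by simp
 qed
 then have "\<bar>b\<bar> \<le> sqrt (a * c)"
  by (metis real_sqrt_abs real_sqrt_le_mono)
 then show ?thesis by (simp add: nrm_def a_def b_def c_def real_sqrt_mult)
qed

lemma nrm_add_power2:
 assumes "f \<in> L2 M" "g \<in> L2 M"
 shows "(nrm M (\<lambda>x. f x + g x))\<^sup>2 = (nrm M f)\<^sup>2 + 2 * (LINT x|M. f x * g x) + (nrm M g)\<^sup>2"
 using assms L2_mult_integrable[OF assms]
 by (simp add: nrm_power2 power2_sum L2_def mult.assoc)

lemma nrm_triangle:
 assumes "f \<in> L2 M" "g \<in> L2 M"
 shows "nrm M (\<lambda>x. f x + g x) \<le> nrm M f + nrm M g"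
proof (rule power2_le_imp_le)
 show "(nrm M (\<lambda>x. f x + g x))\<^sup>2 \<le> (nrm M f + nrm M g)\<^sup>2"
  using L2_Cauchy_Schwarz[OF assms] unfolding nrm_add_power2[OF assms] power2_sum by linarith
qed (simp add: nrm_nonneg)

lemma nrm_minus_commute: "nrm M (\<lambda>x. f x - g x) = nrm M (\<lambda>x. g x - f x)"
 by (simp add: nrm_def power2_commute)

lemma L2_inner_tendsto:
 assumes "\<And>k. f k \<in> L2 M" "\<And>k. g k \<in> L2 M" "f' \<in> L2 M" "g' \<in> L2 M"
  and "(\<lambda>k. nrm M (\<lambda>x. f k x - f' x)) \<longlonglongrightarrow> 0" "(\<lambda>k. nrm M (\<lambda>x. g k x - g' x)) \<longlonglongrightarrow> 0"
 shows "(\<lambda>k. LINT x|M. f k x * g k x) \<longlonglongrightarrow> (LINT x|M. f' x * g' x)"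
proof -
 let ?F = "\<lambda>k x. f k x - f' x" and ?G = "\<lambda>k x. g k x - g' x"
 have F: "?F k \<in> L2 M" and G: "?G k \<in> L2 M" for k using assms by (auto intro: L2_diff)
 have *: "(LINT x|M. f k x * g k x) - (LINT x|M. f' x * g' x) =
  (LINT x|M. ?F k x * ?G k x) + (LINT x|M. ?F k x * g' x) + (LINT x|M. f' x * ?G k x)" for k
 proof -
  have int: "integrable M (\<lambda>x. ?F k x * ?G k x)" "integrable M (\<lambda>x. ?F k x * g' x)"
   "integrable M (\<lambda>x. f' x * ?G k x)" "integrable M (\<lambda>x. f k x * g k x)"
   "integrable M (\<lambda>x. f' x * g' x)"
   using F G assms by (auto intro!: L2_mult_integrable)
  have "(LINT x|M. f k x * g k x) - (LINT x|M. f' x * g' x) = (LINT x|M. f k x * g k x - f' x * g' x)"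
   using int by simp
  also have "\<dots> = (LINT x|M. ?F k x * ?G k x + ?F k x * g' x + f' x * ?G k x)"
   by (intro Bochner_Integration.integral_cong) (auto simp: algebra_simps)
  finally show ?thesis using int(1-3) by simp
 qed
 have "(\<lambda>k. (LINT x|M. f k x * g k x) - (LINT x|M. f' x * g' x)) \<longlonglongrightarrow> 0"
 proof (rule Lim_null_comparison)
  show "\<forall>\<^sub>F k in sequentially. norm ((LINT x|M. f k x * g k x) - (LINT x|M. f' x * g' x)) \<le>
    nrm M (?F k) * nrm M (?G k) + nrm M (?F k) * nrm M g' + nrm M f' * nrm M (?G k)"
  proof (rule always_eventually, rule allI)
   fix k
   show "norm ((LINT x|M. f k x * g k x) - (LINT x|M. f' x * g' x)) \<le>
    nrm M (?F k) * nrm M (?G k) + nrm M (?F k) * nrm M g' + nrm M f' * nrm M (?G k)"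
    unfolding * using L2_Cauchy_Schwarz[OF F[of k] G[of k]] L2_Cauchy_Schwarz[OF F[of k] assms(4)]
     L2_Cauchy_Schwarz[OF assms(3) G[of k]] by (simp add: abs_le_iff)
  qed
  have "(\<lambda>k. nrm M (?F k) * nrm M (?G k) + nrm M (?F k) * nrm M g' + nrm M f' * nrm M (?G k))
   \<longlonglongrightarrow> 0 * 0 + 0 * nrm M g' + nrm M f' * 0"
   by (intro tendsto_intros assms)
  then show "(\<lambda>k. nrm M (?F k) * nrm M (?G k) + nrm M (?F k) * nrm M g' + nrm M f' * nrm M (?G k))
   \<longlonglongrightarrow> 0" by simp
 qed
 then show ?thesis by (rule LIM_zero_cancel)
qed

lemma L2_inner_tendsto_left:
 assumes "\<And>k. f k \<in> L2 M" "f' \<in> L2 M" "g \<in> L2 M" "(\<lambda>k. nrm M (\<lambda>x. f k x - f' x)) \<longlonglongrightarrow> 0"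
 shows "(\<lambda>k. LINT x|M. f k x * g x) \<longlonglongrightarrow> (LINT x|M. f' x * g x)"
 by (rule L2_inner_tendsto) (use assms in \<open>auto simp: nrm_def\<close>)

lemma nrm_tendsto:
 assumes "\<And>k. f k \<in> L2 M" "f' \<in> L2 M" "(\<lambda>k. nrm M (\<lambda>x. f k x - f' x)) \<longlonglongrightarrow> 0"
 shows "(\<lambda>k. nrm M (f k)) \<longlonglongrightarrow> nrm M f'"
proof -
 have "(\<lambda>k. LINT x|M. f k x * f k x) \<longlonglongrightarrow> (LINT x|M. f' x * f' x)"
  by (rule L2_inner_tendsto) (use assms in auto)
 then show ?thesis unfolding nrm_def by (simp add: power2_eq_square tendsto_real_sqrt)
qed

text \<open>The squared differences converge to 0 in L^1, where a subsequence converging almost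
  everywhere is available.\<close>

lemma L2_AE_subseq:
 assumes "\<And>k. f k \<in> L2 M" "f' \<in> L2 M" "(\<lambda>k. nrm M (\<lambda>x. f k x - f' x)) \<longlonglongrightarrow> 0"
 obtains s :: "nat \<Rightarrow> nat" where "strict_mono s" "AE x in M. (\<lambda>k. f (s k) x) \<longlonglongrightarrow> f' x"
proof -
 have d: "(\<lambda>x. f k x - f' x) \<in> L2 M" for k using assms by (auto intro: L2_diff)
 have "(\<lambda>k. (nrm M (\<lambda>x. f k x - f' x))\<^sup>2) \<longlonglongrightarrow> 0\<^sup>2"
  by (intro tendsto_intros assms)
 then have "(\<lambda>k. LINT x|M. norm ((f k x - f' x)\<^sup>2)) \<longlonglongrightarrow> 0"
  by (simp add: nrm_power2)
 then obtain s :: "nat \<Rightarrow> nat" where s: "strict_mono s" "AE x in M. (\<lambda>k. (f (s k) x - f' x)\<^sup>2) \<longlonglongrightarrow> 0"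
  using tendsto_L1_AE_subseq[of M "\<lambda>k x. (f k x - f' x)\<^sup>2"] L2_integrable_power2[OF d] by blast
 have "AE x in M. (\<lambda>k. f (s k) x) \<longlonglongrightarrow> f' x"
  using s(2)
 proof eventually_elim
  case (elim x)
  then have "(\<lambda>k. sqrt ((f (s k) x - f' x)\<^sup>2)) \<longlonglongrightarrow> sqrt 0"
   by (rule tendsto_real_sqrt)
  then show ?case by (simp add: tendsto_rabs_zero_iff LIM_zero_iff)
 qed
 with s(1) show ?thesis by (rule that)
qed

lemma L2_nn_integral:
 assumes "f \<in> borel_measurable M"
 shows "f \<in> L2 M \<longleftrightarrow> (\<integral>\<^sup>+x. ennreal ((f x)\<^sup>2) \<partial>M) < \<infinity>"
 using assms by (auto simp: L2_def integrable_iff_bounded)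

lemma nrm_nn_integral:
 "f \<in> L2 M \<Longrightarrow> (\<integral>\<^sup>+x. ennreal ((f x)\<^sup>2) \<partial>M) = ennreal ((nrm M f)\<^sup>2)"
 unfolding nrm_power2 by (rule nn_integral_eq_integral) (auto simp: L2_def)

lemma L2_integrable:
 assumes "finite_measure M" "f \<in> L2 M"
 shows "integrable M f"
proof -
 have "(\<lambda>x. 1) \<in> L2 M" using assms(1) by (intro L2_bounded[where B=1]) auto
 from L2_mult_integrable[OF assms(2) this] show ?thesis by simp
qed

section \<open>Partial derivatives, smooth functions and test functions\<close>

lemma partial_eqI: "(f has_derivative D) (at x) \<Longrightarrow> partial j f x = D (axis j 1)"
 unfolding partial_def using frechet_derivative_at by metis

lemma smooth_differentiable: "smooth f \<Longrightarrow> f differentiable (at x)"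
 unfolding smooth_def by (metis partials.simps(1))

lemma partials_append: "partials (js @ ks) f = partials js (partials ks f)"
 by (induction js) auto

lemma smooth_partial: "smooth f \<Longrightarrow> smooth (partial j f)"
 unfolding smooth_def
proof (intro allI)
 fix js x assume "\<forall>js x. partials js f differentiable at x"
 then have "partials (js @ [j]) f differentiable at x" by blast
 then show "partials js (partial j f) differentiable at x" by (simp add: partials_append)
qed

lemma smooth_partials: "smooth f \<Longrightarrow> smooth (partials js f)"
 by (induction js) (auto intro: smooth_partial)

lemma smooth_continuous_on: "smooth f \<Longrightarrow> continuous_on A f"
 by (meson smooth_differentiable differentiable_imp_continuous_within continuous_at_imp_continuous_on)

lemma smooth_coinduct:
 assumes "f \<in> F"
  and "\<And>f x. f \<in> F \<Longrightarrow> f differentiable (at x)"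
  and "\<And>f j. f \<in> F \<Longrightarrow> partial j f \<in> F"
 shows "smooth f"
proof -
 have "partials js f \<in> F" for js by (induction js) (use assms in auto)
 then show ?thesis unfolding smooth_def using assms(2) by blast
qed

lemma partial_lincomb:
 assumes "f differentiable (at x)" "g differentiable (at x)"
 shows "partial j (\<lambda>x. a * f x + b * g x) x = a * partial j f x + b * partial j g x"
proof -
 have "((\<lambda>x. a * f x + b * g x) has_derivative
   (\<lambda>h. a * frechet_derivative f (at x) h + b * frechet_derivative g (at x) h)) (at x)"
  using assms by (auto intro!: derivative_eq_intros simp: frechet_derivative_works[symmetric])
 then show ?thesis by (subst partial_eqI, assumption) (simp add: partial_def)
qed

lemma smooth_lincomb:
 assumes "smooth f" "smooth g"
 shows "smooth (\<lambda>x. a * f x + b * g x)"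
proof (rule smooth_coinduct[where F="{\<lambda>x. a * f x + b * g x | f g. smooth f \<and> smooth g}"])
 show "(\<lambda>x. a * f x + b * g x) \<in> {\<lambda>x. a * f x + b * g x | f g. smooth f \<and> smooth g}"
  using assms by blast
next
 fix h x assume "h \<in> {\<lambda>x. a * f x + b * g x | f g. smooth f \<and> smooth g}"
 then show "h differentiable (at x)"
  by (auto intro!: derivative_intros dest: smooth_differentiable)
next
 fix h j assume "h \<in> {\<lambda>x. a * f x + b * g x | f g. smooth f \<and> smooth g}"
 then obtain f g where h: "h = (\<lambda>x. a * f x + b * g x)" "smooth f" "smooth g" by blast
 have "partial j h = (\<lambda>x. a * partial j f x + b * partial j g x)"
  unfolding h(1) using h by (intro ext partial_lincomb smooth_differentiable)
 then show "partial j h \<in> {\<lambda>x. a * f x + b * g x | f g. smooth f \<and> smooth g}"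
  using h smooth_partial by blast
qed

lemma smooth_const: "smooth (\<lambda>x. c)"
proof (rule smooth_coinduct[where F="range (\<lambda>c x. c)"])
 fix f :: "real^'a \<Rightarrow> real" and j assume "f \<in> range (\<lambda>c x. c)"
 then obtain c where "f = (\<lambda>x. c)" by auto
 then have "partial j f = (\<lambda>x. 0)"
  by (auto intro!: ext partial_eqI[THEN trans, OF has_derivative_const])
 then show "partial j f \<in> range (\<lambda>c x. c)" by auto
qed auto

text \<open>Products of functions of one coordinate each are closed under partial derivatives:
  differentiating in direction j replaces the factor \<open>g j\<close> by its derivative.\<close>

lemma smooth_prod:
 assumes "\<And>i. smooth1 (g i)"
 shows "smooth (\<lambda>x::real^'n::finite. \<Prod>i\<in>UNIV. g i (x $ i))"
proof (rule smooth_coinduct[where F="{\<lambda>x. \<Prod>i\<in>UNIV. g i (x $ i) | g. \<forall>i. smooth1 (g i)}"])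
 show "(\<lambda>x. \<Prod>i\<in>UNIV. g i (x $ i)) \<in> {\<lambda>x. \<Prod>i\<in>UNIV. g i (x $ i) | g. \<forall>i. smooth1 (g i)}"
  using assms by blast
next
 have der: "((\<lambda>x::real^'n. \<Prod>i\<in>UNIV. g i (x $ i)) has_derivative
   (\<lambda>h. \<Sum>i\<in>UNIV. (deriv (g i) (x $ i) * h $ i) * (\<Prod>k\<in>UNIV-{i}. g k (x $ k)))) (at x)"
  if "\<forall>i. smooth1 (g i)" for g x
 proof (rule has_derivative_prod)
  fix i
  have "((\<lambda>x::real^'n. x $ i) has_derivative (\<lambda>h. h $ i)) (at x)"
   by (rule bounded_linear_imp_has_derivative) (rule bounded_linear_vec_nth)
  moreover have "(g i has_derivative (\<lambda>h. deriv (g i) (x $ i) * h)) (at (x $ i))"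
   using smooth1_DERIV[of "g i"] that by (simp add: has_field_derivative_def)
  ultimately show "((\<lambda>x. g i (x $ i)) has_derivative (\<lambda>h. deriv (g i) (x $ i) * h $ i)) (at x)"
   by (rule has_derivative_compose)
 qed
 {
  fix f :: "real^'n \<Rightarrow> real" and x
  assume "f \<in> {\<lambda>x. \<Prod>i\<in>UNIV. g i (x $ i) | g. \<forall>i. smooth1 (g i)}"
  then show "f differentiable (at x)" using der by (auto simp: differentiable_def)
 next
  fix f :: "real^'n \<Rightarrow> real" and j
  assume "f \<in> {\<lambda>x. \<Prod>i\<in>UNIV. g i (x $ i) | g. \<forall>i. smooth1 (g i)}"
  then obtain g where f: "f = (\<lambda>x. \<Prod>i\<in>UNIV. g i (x $ i))" and g: "\<forall>i. smooth1 (g i)" by blast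
  let ?g = "g(j := deriv (g j))"
  have "partial j f = (\<lambda>x. \<Prod>i\<in>UNIV. ?g i (x $ i))"
  proof
   fix x
   have "partial j f x =
    (\<Sum>i\<in>UNIV. (deriv (g i) (x $ i) * axis j 1 $ i) * (\<Prod>k\<in>UNIV-{i}. g k (x $ k)))"
    unfolding f by (rule partial_eqI[OF der[OF g]])
   also have "\<dots> = (\<Sum>i\<in>UNIV. if i = j then deriv (g j) (x $ j) * (\<Prod>k\<in>UNIV-{j}. g k (x $ k)) else 0)"
    by (intro sum.cong) (auto simp: axis_def)
   also have "\<dots> = deriv (g j) (x $ j) * (\<Prod>k\<in>UNIV-{j}. g k (x $ k))"
    by simp
   also have "\<dots> = (\<Prod>i\<in>UNIV. ?g i (x $ i))"
    by (subst prod.remove[of UNIV j]) (auto intro!: prod.cong)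
   finally show "partial j f x = (\<Prod>i\<in>UNIV. ?g i (x $ i))" .
  qed
  moreover have "\<forall>i. smooth1 (?g i)" using g smooth1_deriv by auto
  ultimately show "partial j f \<in> {\<lambda>x. \<Prod>i\<in>UNIV. g i (x $ i) | g. \<forall>i. smooth1 (g i)}" by blast
 }
qed

definition boxbump :: "real^'n \<Rightarrow> real^'n \<Rightarrow> real \<Rightarrow> real^'n::finite \<Rightarrow> real" where
 "boxbump l u k x = (\<Prod>i\<in>UNIV. plateau (l $ i) (u $ i) k (x $ i))"

lemma smooth_boxbump: "smooth (boxbump l u k)"
 unfolding boxbump_def[abs_def] by (rule smooth_prod) (rule smooth1_plateau)

lemma boxbump_bounds: "0 \<le> boxbump l u k x" "boxbump l u k x \<le> 1"
 by (auto simp: boxbump_def plateau_bounds intro!: prod_nonneg prod_le_1)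

lemma boxbump_eq_0: "k \<ge> 0 \<Longrightarrow> x \<notin> box l u \<Longrightarrow> boxbump l u k x = 0"
 by (force simp: boxbump_def mem_box_cart intro: plateau_eq_0)

lemma boxbump_tendsto: "(\<lambda>k. boxbump l u (real k) x) \<longlonglongrightarrow> indicator (box l u) x"
proof -
 have "(\<lambda>k. boxbump l u (real k) x) \<longlonglongrightarrow> (\<Prod>i\<in>UNIV. indicator {l $ i<..<u $ i} (x $ i))"
  unfolding boxbump_def by (intro tendsto_prod plateau_tendsto)
 also have "(\<Prod>i\<in>UNIV. indicator {l $ i<..<u $ i} (x $ i)) = (indicator (box l u) x :: real)"
  by (auto simp: indicator_def mem_box_cart)
 finally show ?thesis .
qed

lemma test_function_boxbump: "cbox l u \<subseteq> \<Omega> \<Longrightarrow> k \<ge> 0 \<Longrightarrow> test_function \<Omega> (boxbump l u k)"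
 unfolding test_function_def using box_subset_cbox[of l u]
 by (intro conjI smooth_boxbump exI[of _ "cbox l u"]) (auto intro!: boxbump_eq_0)

lemma partials_eq_0:
 assumes "closed K" "\<And>x. x \<notin> K \<Longrightarrow> \<phi> x = 0" "x \<notin> K"
 shows "partials js \<phi> x = 0"
 using assms(3)
proof (induction js arbitrary: x)
 case Nil
 then show ?case using assms by simp
next
 case (Cons j js)
 have "(partials js \<phi> has_derivative (\<lambda>h. 0)) (at x)"
  by (rule has_derivative_transform_within_open[where f="\<lambda>x. 0" and s="- K"])
   (use Cons assms(1) in \<open>auto simp: open_Compl\<close>)
 then show ?case by (simp add: partial_eqI)
qed

lemma test_function_partials:
 assumes "test_function \<Omega> \<phi>"
 shows "test_function \<Omega> (partials js \<phi>)"
 using assms compact_imp_closed partials_eq_0 unfolding test_function_def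
 by (metis smooth_partials)

lemma test_function_lincomb:
 assumes "test_function \<Omega> f" "test_function \<Omega> g"
 shows "test_function \<Omega> (\<lambda>x. a * f x + b * g x)"
proof -
 obtain K L where "compact K" "K \<subseteq> \<Omega>" "\<forall>x. x \<notin> K \<longrightarrow> f x = 0"
  and "compact L" "L \<subseteq> \<Omega>" "\<forall>x. x \<notin> L \<longrightarrow> g x = 0"
  using assms by (auto simp: test_function_def)
 then show ?thesis unfolding test_function_def
  using assms by (intro conjI exI[of _ "K \<union> L"] smooth_lincomb)
   (auto simp: test_function_def compact_Un)
qed

lemma smooth_borel_measurable: "smooth f \<Longrightarrow> f \<in> borel_measurable borel"
 by (rule borel_measurable_continuous_onI) (rule smooth_continuous_on)

lemma borel_measurable_lebesgue_on:
 "f \<in> borel_measurable borel \<Longrightarrow> f \<in> borel_measurable (lebesgue_on A)"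
 by (simp add: measurable_completion measurable_restrict_space1)

lemma finite_measure_lebesgue_on:
 assumes "bounded A" "A \<in> sets lebesgue"
 shows "finite_measure (lebesgue_on A)"
proof
 have "A \<in> lmeasurable" using assms bounded_set_imp_lmeasurable by blast
 then show "emeasure (lebesgue_on A) (space (lebesgue_on A)) \<noteq> \<infinity>"
  using assms by (auto simp: emeasure_restrict_space fmeasurable_def less_top)
qed

lemma test_function_bounded:
 assumes "test_function \<Omega> \<phi>"
 obtains B where "\<And>x. \<bar>\<phi> x\<bar> \<le> B" "B \<ge> 0"
proof -
 obtain K where K: "compact K" "\<forall>x. x \<notin> K \<longrightarrow> \<phi> x = 0" and s: "smooth \<phi>"
  using assms by (auto simp: test_function_def)
 have "compact (\<phi> ` K)" using K s smooth_continuous_on compact_continuous_image by blast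
 then obtain B where B: "\<forall>y\<in>\<phi> ` K. \<bar>y\<bar> \<le> B" using compact_imp_bounded bounded_iff by (metis real_norm_def)
 have "\<bar>\<phi> x\<bar> \<le> max B 0" for x using B K by (cases "x \<in> K") force+
 then show ?thesis by (intro that[of "max B 0"]) auto
qed

text \<open>Boxes are stable under intersection and generate the Borel sets, so Dynkin's lemma
  reduces unions to disjoint ones. This matters because the properties it is used for are additive
  and nothing more.\<close>

lemma borel_induct_box [consumes 1, case_names box compl union]:
 fixes A :: "'a::euclidean_space set"
 assumes "A \<in> sets borel"
  and box: "\<And>l u. P (box l u)"
  and compl: "\<And>A. A \<in> sets borel \<Longrightarrow> P A \<Longrightarrow> P (- A)"
  and union: "\<And>A::nat \<Rightarrow> 'a set. disjoint_family A \<Longrightarrow> (\<And>i. A i \<in> sets borel) \<Longrightarrow> (\<And>i. P (A i)) \<Longrightarrow> P (\<Union>i. A i)"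
 shows "P A"
proof -
 let ?G = "range (\<lambda>(l, u). box l u :: 'a set)"
 have s: "sets borel = sigma_sets UNIV ?G"
  by (subst borel_eq_box) (simp add: sets_measure_of)
 have "Int_stable ?G"
  unfolding Int_stable_def using box_Int_box by (clarsimp, blast)
 moreover have "?G \<subseteq> Pow UNIV" by simp
 moreover have "A \<in> sigma_sets UNIV ?G" using assms(1) s by simp
 ultimately show ?thesis
 proof (induction rule: sigma_sets_induct_disjoint[consumes 3])
  show "P B" if "B \<in> ?G" for B using that box by auto
  show "P {}" using box[of 0 0] by simp
  show "P (UNIV - B)" if "B \<in> sigma_sets UNIV ?G" "P B" for B
   using compl[of B] that s by (simp add: Compl_eq_Diff_UNIV)
  show "P (\<Union>i. B i)" if "disjoint_family B" "range B \<subseteq> sigma_sets UNIV ?G" "\<And>i::nat. P (B i)" for B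
   using union[of B] that s by auto
 qed
qed

section \<open>Density of test functions and uniqueness of weak derivatives\<close>

lemma L2_dominated_convergence:
 assumes "\<And>k. f k \<in> borel_measurable M" "f' \<in> borel_measurable M" "G \<in> L2 M"
  and "AE x in M. (\<lambda>k. f k x) \<longlonglongrightarrow> f' x" "\<And>k. AE x in M. \<bar>f k x\<bar> \<le> G x"
 shows "(\<lambda>k. nrm M (\<lambda>x. f k x - f' x)) \<longlonglongrightarrow> 0"
proof -
 have bd: "AE x in M. \<forall>k. \<bar>f k x\<bar> \<le> G x" using assms(5) by (simp add: AE_all_countable)
 have "(\<lambda>k. LINT x|M. (f k x - f' x)\<^sup>2) \<longlonglongrightarrow> (LINT x|M. 0)"
 proof (rule integral_dominated_convergence)
  \<comment> \<open>The limit is dominated by G as well, so the difference is at most 2 G and its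
    square at most 4 G^2.\<close>
  show "integrable M (\<lambda>x. 4 * (G x)\<^sup>2)" using assms(3) by (simp add: L2_def)
  show "AE x in M. (\<lambda>k. (f k x - f' x)\<^sup>2) \<longlonglongrightarrow> 0"
   using assms(4)
  proof eventually_elim
   case (elim x)
   then have "(\<lambda>k. (f k x - f' x)\<^sup>2) \<longlonglongrightarrow> (f' x - f' x)\<^sup>2" by (intro tendsto_intros)
   then show ?case by simp
  qed
  fix k
  show "AE x in M. norm ((f k x - f' x)\<^sup>2) \<le> 4 * (G x)\<^sup>2"
   using assms(4) bd
  proof eventually_elim
   case (elim x)
   have "\<bar>f' x\<bar> \<le> G x"
    by (rule LIMSEQ_le_const2[OF tendsto_rabs[OF elim(1)]]) (use elim in auto)
   then have "\<bar>f k x - f' x\<bar> \<le> \<bar>2 * G x\<bar>" using elim(2)[rule_format, of k] by linarith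
   then have "(f k x - f' x)\<^sup>2 \<le> (2 * G x)\<^sup>2" by (simp add: abs_le_square_iff)
   then show ?case by (simp add: power_mult_distrib)
  qed
 qed (use assms in auto)
 then show ?thesis
  unfolding nrm_def using tendsto_real_sqrt[of _ 0] by simp
qed

text \<open>Boxes whose closures stay inside the set cover it, and Lindelof's theorem leaves
  countably many. The closed boxes are recorded because bump functions supported in them are test
  functions.\<close>

lemma open_Union_cbox:
 fixes \<Omega> :: "'a::euclidean_space set"
 assumes "open \<Omega>"
 obtains l u :: "nat \<Rightarrow> 'a" where "\<And>i. cbox (l i) (u i) \<subseteq> \<Omega>" "\<Omega> = (\<Union>i. box (l i) (u i))"
proof (cases "\<Omega> = {}")
 case True
 \<comment> \<open>The sequence needs members even for the empty set; a box from a basis vector b to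
   0 is empty in direction b.\<close>
 obtain b :: 'a where "b \<in> Basis" using nonempty_Basis by blast
 then have e: "cbox b (0::'a) = {}" "box b (0::'a) = {}"
  by (auto simp: box_eq_empty intro!: bexI[of _ b])
 show ?thesis by (rule that[of "\<lambda>_. b" "\<lambda>_. 0"]) (auto simp: True e)
next
 case False
 have "\<exists>F. countable F \<and> (\<forall>(l,u)\<in>F. cbox l u \<subseteq> \<Omega>) \<and> \<Omega> = (\<Union>(l,u)\<in>F. box l u)"
 proof -
  let ?B = "{box l u | l u. cbox l u \<subseteq> \<Omega>}"
  have op: "S \<in> ?B \<Longrightarrow> open S" for S by (auto simp: open_box)
  obtain B' where B': "B' \<subseteq> ?B" "countable B'" "\<Union>B' = \<Union>?B"
   using Lindelof[OF op] by blast
  have U: "\<Union>?B = \<Omega>"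
  proof (intro equalityI subsetI)
   fix x assume "x \<in> \<Omega>"
   then obtain a b where "x \<in> box a b" "cbox a b \<subseteq> \<Omega>"
    using open_contains_cbox[of \<Omega>] assms by (metis subsetD)
   then show "x \<in> \<Union>?B" by blast
  qed (use box_subset_cbox in blast)
  have "\<forall>X\<in>B'. \<exists>p. X = box (fst p) (snd p) \<and> cbox (fst p) (snd p) \<subseteq> \<Omega>"
   using B'(1) by fastforce
  then obtain p where p: "\<forall>X\<in>B'. X = box (fst (p X)) (snd (p X)) \<and> cbox (fst (p X)) (snd (p X)) \<subseteq> \<Omega>"
   by metis
  show ?thesis
  proof (intro exI[of _ "p ` B'"] conjI)
   show "countable (p ` B')" using B' by simp
   show "\<forall>(l, u)\<in>p ` B'. cbox l u \<subseteq> \<Omega>" using p by (auto simp: case_prod_beta)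
   have "\<Omega> = (\<Union>X\<in>B'. X)" using U B'(3) by simp
   also have "\<dots> = (\<Union>X\<in>B'. box (fst (p X)) (snd (p X)))" using p by (intro SUP_cong) auto
   finally show "\<Omega> = (\<Union>(l, u)\<in>p ` B'. box l u)" by (simp add: case_prod_beta)
  qed
 qed
 then obtain F where F: "countable F" "\<forall>(l,u)\<in>F. cbox l u \<subseteq> \<Omega>" "\<Omega> = (\<Union>(l,u)\<in>F. box l u)"
  by blast
 have "F \<noteq> {}" using F(3) False by auto
 then have r: "range (from_nat_into F) = F" using F(1) by (rule range_from_nat_into)
 show ?thesis
 proof (rule that[of "\<lambda>i. fst (from_nat_into F i)" "\<lambda>i. snd (from_nat_into F i)"])
  show "cbox (fst (from_nat_into F i)) (snd (from_nat_into F i)) \<subseteq> \<Omega>" for i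
   using F(2) r by (metis (mono_tags, lifting) case_prod_beta rangeI)
  have "\<Omega> = (\<Union>p\<in>range (from_nat_into F). box (fst p) (snd p))"
   using F(3) r by (simp add: case_prod_beta)
  then show "\<Omega> = (\<Union>i. box (fst (from_nat_into F i)) (snd (from_nat_into F i)))"
   by simp
 qed
qed

text \<open>Vanishing integrals extend from boxes to all Borel sets; the integrals over the sets of
  positive and of negative values then leave no room for a nonzero function.\<close>

lemma AE_zero_if_integral_box_zero:
 fixes f :: "'a::euclidean_space \<Rightarrow> real"
 assumes int: "integrable lebesgue f"
  and box: "\<And>l u. (LINT x:box l u|lebesgue. f x) = 0"
 shows "AE x in lebesgue. f x = 0"
proof -
 have si: "set_integrable lebesgue A f" if "A \<in> sets borel" for A
  unfolding set_integrable_def using int that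
  by (intro integrable_mult_indicator) auto
 \<comment> \<open>The integral over the whole space, a limit over growing boxes, is what the
   complement step of the induction subtracts from.\<close>
 have tot: "(LINT x|lebesgue. f x) = 0"
 proof -
  let ?B = "\<lambda>n::nat. box (- (real n *\<^sub>R One)) (real n *\<^sub>R One) :: 'a set"
  have "(\<lambda>n. LINT x|lebesgue. indicator (?B n) x *\<^sub>R f x) \<longlonglongrightarrow> (LINT x|lebesgue. f x)"
  proof (rule integral_dominated_convergence)
   show "integrable lebesgue (\<lambda>x. norm (f x))" using int by simp
   show "AE x in lebesgue. (\<lambda>n. indicator (?B n) x *\<^sub>R f x) \<longlonglongrightarrow> f x"
   proof (intro always_eventually allI)
    fix x :: 'a
    obtain N :: nat where N: "norm x < real N" using reals_Archimedean2 by blast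
    have "x \<in> ?B n" if "n \<ge> N" for n
    proof -
     have "\<bar>x \<bullet> i\<bar> < real n" if "i \<in> Basis" for i
      using Basis_le_norm[OF that, of x] N \<open>n \<ge> N\<close> by linarith
     then show ?thesis by (auto simp: mem_box abs_less_iff) (smt (verit))
    qed
    then have "\<forall>\<^sub>F n in sequentially. indicator (?B n) x *\<^sub>R f x = f x"
     by (auto simp: eventually_sequentially intro!: exI[of _ N])
    then show "(\<lambda>n. indicator (?B n) x *\<^sub>R f x) \<longlonglongrightarrow> f x" by (rule tendsto_eventually)
   qed
   show "AE x in lebesgue. norm (indicator (?B n) x *\<^sub>R f x) \<le> norm (f x)" for n
    by (auto simp: indicator_def)
   show "(\<lambda>x. indicator (?B n) x *\<^sub>R f x) \<in> borel_measurable lebesgue" for n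
    using int by (intro borel_measurable_scaleR borel_measurable_indicator) auto
  qed (use int in auto)
  moreover have "(LINT x|lebesgue. indicator (?B n) x *\<^sub>R f x) = 0" for n
   using box unfolding set_lebesgue_integral_def by blast
  ultimately show ?thesis by (simp add: LIMSEQ_const_iff)
 qed
 have zero: "(LINT x:A|lebesgue. f x) = 0" if "A \<in> sets borel" for A
  using that
 proof (induction rule: borel_induct_box)
  case (compl A)
  have "(LINT x:A \<union> - A|lebesgue. f x) = (LINT x:A|lebesgue. f x) + (LINT x:-A|lebesgue. f x)"
   using compl by (intro set_integral_Un si) (auto simp: Compl_eq_Diff_UNIV)
  then show ?case using compl tot by (simp add: set_lebesgue_integral_def)
 next
  case (union A)
  have "(LINT x:(\<Union>i. A i)|lebesgue. f x) = (\<Sum>i. (LINT x:(A i)|lebesgue. f x))"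
   using union by (intro lebesgue_integral_countable_add si) (auto simp: disjoint_family_on_def)
  then show ?case using union by simp
 qed (rule box)
 have fm: "f \<in> borel_measurable lebesgue" using int by auto
 \<comment> \<open>f is only Lebesgue measurable. A Borel representative has Borel sign sets, and on
   those the integral is known to vanish.\<close>
 then obtain g where g: "g \<in> borel_measurable lborel" "AE x in lborel. f x = g x"
  using completion_ex_borel_measurable_real by blast
 have gb: "g \<in> borel_measurable borel" using g(1) by simp
 have fg: "AE x in lebesgue. f x = g x" using g(2) by (rule AE_completion)
 have gl: "g \<in> borel_measurable lebesgue" using g(1) by (rule measurable_completion)
 have gi: "integrable lebesgue g"
  using int fm gl fg integrable_cong_AE by blast
 have main: "AE x in lebesgue. s * g x \<le> 0" if "s = 1 \<or> s = -1" for s :: real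
 proof -
  let ?A = "{x. s * g x > 0}"
  have A: "?A \<in> sets borel" using gb by measurable
  have "(LINT x|lebesgue. indicator ?A x *\<^sub>R (s * g x)) = s * (LINT x:?A|lebesgue. g x)"
   unfolding set_lebesgue_integral_def by (subst integral_mult_right_zero[symmetric])
    (intro Bochner_Integration.integral_cong, auto)
  also have "(LINT x:?A|lebesgue. g x) = (LINT x:?A|lebesgue. f x)"
   unfolding set_lebesgue_integral_def using A fg
   by (intro integral_cong_AE) (use fm gl in \<open>auto intro!: borel_measurable_times borel_measurable_indicator\<close>)
  also have "\<dots> = 0" by (rule zero[OF A])
  finally have z: "(LINT x|lebesgue. indicator ?A x *\<^sub>R (s * g x)) = 0" by simp
  have i: "integrable lebesgue (\<lambda>x. indicator ?A x *\<^sub>R (s * g x))"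
   using gi A by (intro integrable_mult_indicator) auto
  have nn: "AE x in lebesgue. 0 \<le> indicator ?A x *\<^sub>R (s * g x)"
   by (intro always_eventually allI) (simp add: indicator_def)
  have "AE x in lebesgue. indicator ?A x *\<^sub>R (s * g x) = 0"
   using iffD1[OF integral_nonneg_eq_0_iff_AE[OF i nn] z] .
  then show ?thesis by eventually_elim (auto simp: indicator_def split: if_splits)
 qed
 have "AE x in lebesgue. 1 * g x \<le> 0" "AE x in lebesgue. (-1) * g x \<le> 0"
  by (rule main; simp)+
 with fg show ?thesis by eventually_elim auto
qed

lemma cbox_subset_if_box_subset:
 fixes c d l u :: "'a::euclidean_space"
 assumes "box c d \<subseteq> box l u" "box c d \<noteq> {}"
 shows "cbox c d \<subseteq> cbox l u"
proof -
 have "box l u \<noteq> {}" using assms by blast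
 then show ?thesis using closure_mono[OF assms(1)] assms(2) by (simp add: closure_box)
qed

lemma AE_lebesgue_on_iff:
 "S \<in> sets lebesgue \<Longrightarrow> (AE x in lebesgue_on S. P x) \<longleftrightarrow> (AE x in lebesgue. x \<in> S \<longrightarrow> P x)"
 by (rule AE_restrict_space_iff) auto

lemma integrable_lebesgue_on_iff:
 fixes f :: "'a::euclidean_space \<Rightarrow> real"
 shows "S \<in> sets lebesgue \<Longrightarrow> integrable (lebesgue_on S) f \<longleftrightarrow> integrable lebesgue (\<lambda>x. indicator S x * f x)"
 by (subst integrable_restrict_space) auto

lemma integral_lebesgue_on_eq:
 fixes f :: "'a::euclidean_space \<Rightarrow> real"
 shows "S \<in> sets lebesgue \<Longrightarrow> (LINT x|lebesgue_on S. f x) = (LINT x|lebesgue. indicator S x * f x)"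
 by (subst integral_restrict_space) auto

locale bounded_open =
 fixes \<Omega> :: "(real^'n::finite) set"
 assumes open_dom: "open \<Omega>" and bounded_dom: "bounded \<Omega>"
begin

abbreviation "\<mu> \<equiv> lebesgue_on \<Omega>"

lemma dom_sets: "\<Omega> \<in> sets lebesgue"
 using open_dom borel_open by (metis sets_completionI_sets sets_lborel)

lemma finite_mu: "finite_measure \<mu>"
 using finite_measure_lebesgue_on bounded_dom dom_sets by blast

lemma L2_space_eq: "L2_space \<Omega> = L2 \<mu>"
 by (simp add: L2_space_def L2_def)

lemma L2_norm_eq: "L2_norm \<Omega> f = nrm \<mu> f" for f :: "real^'n \<Rightarrow> real"
 by (simp add: L2_norm_def L2_inner_def nrm_def power2_eq_square)

lemma L2_inner_eq: "L2_inner \<Omega> f g = (LINT x|\<mu>. f x * g x)" for f :: "real^'n \<Rightarrow> real"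
 by (simp add: L2_inner_def)

lemma measurable_mu: "f \<in> borel_measurable borel \<Longrightarrow> f \<in> borel_measurable \<mu>"
 by (rule borel_measurable_lebesgue_on)

lemma indicator_measurable_mu: "A \<in> sets borel \<Longrightarrow> (indicator A :: real^'n \<Rightarrow> real) \<in> borel_measurable \<mu>"
 by (intro measurable_mu borel_measurable_indicator)

lemma test_function_measurable: "test_function \<Omega> \<phi> \<Longrightarrow> \<phi> \<in> borel_measurable \<mu>"
 by (intro measurable_mu smooth_borel_measurable) (simp add: test_function_def)

lemma test_function_L2: "test_function \<Omega> \<phi> \<Longrightarrow> \<phi> \<in> L2 \<mu>"
 by (meson L2_bounded finite_mu test_function_bounded test_function_measurable)

lemma loc_integrable_integrable:
 assumes "integrable \<mu> f"
 shows "loc_integrable \<Omega> f"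
 unfolding loc_integrable_def
proof (intro allI impI)
 fix K assume K: "compact K \<and> K \<subseteq> \<Omega>"
 then have Ks: "K \<in> sets lebesgue" using lmeasurable_compact fmeasurableD by blast
 have "integrable lebesgue (\<lambda>x. indicator \<Omega> x * f x)"
  using assms integrable_lebesgue_on_iff[OF dom_sets] by blast
 then have "integrable lebesgue (\<lambda>x. indicator K x *\<^sub>R (indicator \<Omega> x * f x))"
  using Ks by (intro integrable_mult_indicator) auto
 also have "(\<lambda>x. indicator K x *\<^sub>R (indicator \<Omega> x * f x)) = (\<lambda>x. indicator K x * f x)"
  using K by (auto simp: indicator_def fun_eq_iff)
 finally show "integrable (lebesgue_on K) f" using integrable_lebesgue_on_iff[OF Ks] by blast
qed

lemma loc_integrable_L2: "f \<in> L2 \<mu> \<Longrightarrow> loc_integrable \<Omega> f"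
 by (intro loc_integrable_integrable L2_integrable[OF finite_mu])

lemma integrable_mult_test:
 assumes f: "loc_integrable \<Omega> f" and \<phi>: "test_function \<Omega> \<phi>"
 shows "integrable \<mu> (\<lambda>x. f x * \<phi> x)"
proof -
 obtain K where K: "compact K" "K \<subseteq> \<Omega>" "\<forall>x. x \<notin> K \<longrightarrow> \<phi> x = 0" and s: "smooth \<phi>"
  using \<phi> by (auto simp: test_function_def)
 have Ks: "K \<in> sets lebesgue" using K lmeasurable_compact fmeasurableD by blast
 obtain B where B: "\<And>x. \<bar>\<phi> x\<bar> \<le> B" "B \<ge> 0" using test_function_bounded[OF \<phi>] by blast
 have "integrable (lebesgue_on K) f" using f K by (auto simp: loc_integrable_def)
 then have i: "integrable lebesgue (\<lambda>x. indicator K x * f x)" using integrable_lebesgue_on_iff[OF Ks] by blast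
 have "\<phi> \<in> borel_measurable lebesgue"
  using smooth_borel_measurable[OF s] by (simp add: measurable_completion)
 then have "integrable lebesgue (\<lambda>x. (indicator K x * f x) * \<phi> x)"
 proof (intro Bochner_Integration.integrable_bound[OF integrable_mult_right[OF i, of B]])
  show "AE x in lebesgue. norm ((indicator K x * f x) * \<phi> x) \<le> norm (B * (indicator K x * f x))"
  proof (intro always_eventually allI)
   fix x
   have "\<bar>indicator K x * f x\<bar> * \<bar>\<phi> x\<bar> \<le> \<bar>indicator K x * f x\<bar> * B"
    by (intro mult_left_mono B) simp
   then show "norm ((indicator K x * f x) * \<phi> x) \<le> norm (B * (indicator K x * f x))"
    using B(2) by (simp add: abs_mult mult_ac)
  qed
 qed (use i in \<open>auto intro!: borel_measurable_times\<close>)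
 also have "(\<lambda>x. (indicator K x * f x) * \<phi> x) = (\<lambda>x. indicator \<Omega> x * (f x * \<phi> x))"
  using K by (auto simp: indicator_def fun_eq_iff)
 finally show ?thesis using integrable_lebesgue_on_iff[OF dom_sets] by blast
qed

text \<open>The fundamental lemma of the calculus of variations: bump functions with slopes tending
  to infinity give zero integrals over all small boxes, hence a null function on each of the
  countably many boxes that cover the domain.\<close>

lemma AE_zero_if_test_zero:
 assumes g: "loc_integrable \<Omega> g"
  and z: "\<And>\<phi>. test_function \<Omega> \<phi> \<Longrightarrow> (LINT x|\<mu>. g x * \<phi> x) = 0"
 shows "AE x in \<mu>. g x = 0"
proof -
 obtain l u :: "nat \<Rightarrow> real^'n" where lu: "\<And>i. cbox (l i) (u i) \<subseteq> \<Omega>" "\<Omega> = (\<Union>i. box (l i) (u i))"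
  using open_Union_cbox[OF open_dom] by metis
 have "AE x in lebesgue. indicator (box (l i) (u i)) x * g x = 0" for i
 proof (rule AE_zero_if_integral_box_zero)
  let ?K = "cbox (l i) (u i)"
  have "integrable (lebesgue_on ?K) g"
   using g lu by (auto simp: loc_integrable_def)
  then have iK: "integrable lebesgue (\<lambda>x. indicator ?K x * g x)"
   by (subst integrable_lebesgue_on_iff[symmetric]) auto
  then have "integrable lebesgue (\<lambda>x. indicator (box (l i) (u i)) x *\<^sub>R (indicator ?K x * g x))"
   by (intro integrable_mult_indicator) auto
  also have "(\<lambda>x. indicator (box (l i) (u i)) x *\<^sub>R (indicator ?K x * g x)) =
    (\<lambda>x. indicator (box (l i) (u i)) x * g x)"
   using box_subset_cbox by (fastforce simp: indicator_def)
  finally show "integrable lebesgue (\<lambda>x. indicator (box (l i) (u i)) x * g x)" .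
  fix a b
  show "(LINT x:box a b|lebesgue. indicator (box (l i) (u i)) x * g x) = 0"
  proof -
   obtain c d where cd: "box a b \<inter> box (l i) (u i) = box c d"
    by (rule that, rule box_Int_box)
   show ?thesis
   proof (cases "box c d = {}")
    case True
    then have "(\<lambda>x. indicator (box a b) x *\<^sub>R (indicator (box (l i) (u i)) x * g x)) = (\<lambda>x. 0)"
     using cd by (auto simp: indicator_def fun_eq_iff)
    then show ?thesis unfolding set_lebesgue_integral_def by (simp only: integral_zero)
   next
    case False
    have "box c d \<subseteq> box (l i) (u i)" using cd by blast
    then have sub: "cbox c d \<subseteq> ?K" using False
     by (rule cbox_subset_if_box_subset)
    have "(\<lambda>k. LINT x|\<mu>. g x * boxbump c d (real k) x) \<longlonglongrightarrow>
     (LINT x|lebesgue. indicator (box a b) x *\<^sub>R (indicator (box (l i) (u i)) x * g x))"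
    proof -
     have "(\<lambda>k. LINT x|lebesgue. (indicator ?K x * g x) * boxbump c d (real k) x) \<longlonglongrightarrow>
      (LINT x|lebesgue. (indicator ?K x * g x) * indicator (box c d) x)"
     proof (rule integral_dominated_convergence)
      show "integrable lebesgue (\<lambda>x. norm (indicator ?K x * g x))" using iK by simp
      show "AE x in lebesgue. (\<lambda>k. (indicator ?K x * g x) * boxbump c d (real k) x)
        \<longlonglongrightarrow> (indicator ?K x * g x) * indicator (box c d) x"
       by (intro always_eventually allI tendsto_intros boxbump_tendsto)
      fix k
      show "AE x in lebesgue. norm ((indicator ?K x * g x) * boxbump c d (real k) x)
        \<le> norm (indicator ?K x * g x)"
       using boxbump_bounds[of c d "real k"]
       by (intro always_eventually allI) (simp add: abs_mult mult_left_le)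
      show "(\<lambda>x. (indicator ?K x * g x) * boxbump c d (real k) x) \<in> borel_measurable lebesgue"
       using smooth_borel_measurable[OF smooth_boxbump, of c d "real k"]
       by (intro borel_measurable_times[OF borel_measurable_integrable[OF iK]])
        (simp add: measurable_completion)
     next
      show "(\<lambda>x. (indicator ?K x * g x) * indicator (box c d) x) \<in> borel_measurable lebesgue"
       by (intro borel_measurable_times[OF borel_measurable_integrable[OF iK]]
         borel_measurable_indicator) simp
     qed
     moreover have "(LINT x|lebesgue. (indicator ?K x * g x) * boxbump c d (real k) x)
       = (LINT x|\<mu>. g x * boxbump c d (real k) x)" for k
      unfolding integral_lebesgue_on_eq[OF dom_sets]
     proof (intro Bochner_Integration.integral_cong refl)
      fix x
      show "indicator ?K x * g x * boxbump c d (real k) x = indicator \<Omega> x * (g x * boxbump c d (real k) x)"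
       using sub lu(1)[of i] boxbump_eq_0[of "real k" x c d] box_subset_cbox[of c d]
       by (auto simp: indicator_def)
     qed
     moreover have "(indicator ?K x * g x) * indicator (box c d) x
       = indicator (box a b) x *\<^sub>R (indicator (box (l i) (u i)) x * g x)" for x
      using box_subset_cbox[of "l i" "u i"] unfolding cd[symmetric] by (auto simp: indicator_def)
     ultimately show ?thesis by simp
    qed
    moreover have "(LINT x|\<mu>. g x * boxbump c d (real k) x) = 0" for k
     using sub lu(1)[of i] by (intro z test_function_boxbump) auto
    ultimately show ?thesis
     by (simp add: LIMSEQ_const_iff set_lebesgue_integral_def)
   qed
  qed
 qed
 then have "AE x in lebesgue. \<forall>i. indicator (box (l i) (u i)) x * g x = 0"
  unfolding AE_all_countable by (rule allI)
 then have "AE x in lebesgue. x \<in> \<Omega> \<longrightarrow> g x = 0"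
 proof eventually_elim
  case (elim x)
  show ?case
  proof
   assume "x \<in> \<Omega>"
   then obtain i where "x \<in> box (l i) (u i)" using lu(2) by auto
   then show "g x = 0" using elim[rule_format, of i] by simp
  qed
 qed
 then show ?thesis using AE_lebesgue_on_iff[OF dom_sets] by blast
qed

text \<open>The L^2 closure of the test functions, which turns out to be all of L^2. It is kept as a
  set of its own so that it can be enlarged by linear combinations and limits.\<close>

definition approx :: "(real^'n \<Rightarrow> real) set" where
 "approx = {v \<in> L2 \<mu>. \<forall>e>0. \<exists>\<phi>. test_function \<Omega> \<phi> \<and> nrm \<mu> (\<lambda>x. v x - \<phi> x) < e}"

lemma approx_limit:
 assumes v: "v \<in> L2 \<mu>" and w: "\<And>k. w k \<in> approx" and lim: "(\<lambda>k. nrm \<mu> (\<lambda>x. w k x - v x)) \<longlonglongrightarrow> 0"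
 shows "v \<in> approx"
 unfolding approx_def
proof (safe intro!: v)
 fix e :: real assume "e > 0"
 then have "\<forall>\<^sub>F k in sequentially. nrm \<mu> (\<lambda>x. w k x - v x) < e / 2"
  using lim by (intro order_tendstoD) auto
 then obtain k where k: "nrm \<mu> (\<lambda>x. w k x - v x) < e / 2"
  by (auto simp: eventually_sequentially)
 obtain \<phi> where \<phi>: "test_function \<Omega> \<phi>" "nrm \<mu> (\<lambda>x. w k x - \<phi> x) < e / 2"
  using w[of k] half_gt_zero[OF \<open>e > 0\<close>] unfolding approx_def by blast
 have wk: "w k \<in> L2 \<mu>" using w by (simp add: approx_def)
 have "nrm \<mu> (\<lambda>x. (v x - w k x) + (w k x - \<phi> x)) \<le> nrm \<mu> (\<lambda>x. v x - w k x) + nrm \<mu> (\<lambda>x. w k x - \<phi> x)"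
  by (intro nrm_triangle L2_diff v wk test_function_L2 \<phi>)
 then have "nrm \<mu> (\<lambda>x. v x - \<phi> x) < e"
  using k \<phi>(2) nrm_minus_commute[of \<mu> v "w k"] by simp
 then show "\<exists>\<phi>. test_function \<Omega> \<phi> \<and> nrm \<mu> (\<lambda>x. v x - \<phi> x) < e" using \<phi>(1) by blast
qed

lemma approx_lincomb:
 assumes "v \<in> approx" "w \<in> approx"
 shows "(\<lambda>x. a * v x + b * w x) \<in> approx"
 unfolding approx_def
proof (safe)
 have vw: "v \<in> L2 \<mu>" "w \<in> L2 \<mu>" using assms by (auto simp: approx_def)
 then show "(\<lambda>x. a * v x + b * w x) \<in> L2 \<mu>" by (intro L2_add L2_cmult)
 fix e :: real assume "e > 0"
 define c where "c = \<bar>a\<bar> + \<bar>b\<bar> + 1"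
 have "c > 0" by (simp add: c_def add_nonneg_pos)
 define d where "d = e / c"
 have "d > 0" using \<open>e > 0\<close> \<open>c > 0\<close> by (simp add: d_def)
 then obtain \<phi> \<psi> where p: "test_function \<Omega> \<phi>" "nrm \<mu> (\<lambda>x. v x - \<phi> x) < d"
   "test_function \<Omega> \<psi>" "nrm \<mu> (\<lambda>x. w x - \<psi> x) < d"
  using assms unfolding approx_def by blast
 have "nrm \<mu> (\<lambda>x. a * (v x - \<phi> x) + b * (w x - \<psi> x)) \<le>
   nrm \<mu> (\<lambda>x. a * (v x - \<phi> x)) + nrm \<mu> (\<lambda>x. b * (w x - \<psi> x))"
  by (intro nrm_triangle L2_diff L2_cmult vw test_function_L2 p)
 also have "\<dots> \<le> \<bar>a\<bar> * d + \<bar>b\<bar> * d"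
  unfolding nrm_cmult using p by (intro add_mono mult_left_mono) auto
 also have "\<dots> = (\<bar>a\<bar> + \<bar>b\<bar>) * d" by (simp add: algebra_simps)
 also have "\<dots> < c * d" using \<open>d > 0\<close> by (intro mult_strict_right_mono) (auto simp: c_def)
 also have "\<dots> = e" using \<open>c > 0\<close> by (simp add: d_def)
 finally have "nrm \<mu> (\<lambda>x. (a * v x + b * w x) - (a * \<phi> x + b * \<psi> x)) < e"
  by (simp add: algebra_simps)
 then show "\<exists>\<phi>. test_function \<Omega> \<phi> \<and> nrm \<mu> (\<lambda>x. (a * v x + b * w x) - \<phi> x) < e"
  using test_function_lincomb[OF p(1,3)] by blast
qed

text \<open>Dominated convergence keeps pointwise limits with a square integrable majorant in the
  closure. The passages from bumps to boxes, to countable unions and from simple functions to L^2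
  are all of this kind.\<close>

lemma approx_bounded_limit:
 assumes w: "\<And>k. w k \<in> approx" and v: "v \<in> borel_measurable \<mu>"
  and lim: "AE x in \<mu>. (\<lambda>k. w k x) \<longlonglongrightarrow> v x" and G: "G \<in> L2 \<mu>" and bd: "\<And>k. AE x in \<mu>. \<bar>w k x\<bar> \<le> G x"
 shows "v \<in> approx"
proof (rule approx_limit[OF _ w])
 have m: "w k \<in> borel_measurable \<mu>" for k using w by (simp add: approx_def L2_def)
 have "AE x in \<mu>. \<forall>k. \<bar>w k x\<bar> \<le> G x" using bd by (simp add: AE_all_countable)
 with lim have vG: "AE x in \<mu>. \<bar>v x\<bar> \<le> G x"
 proof eventually_elim
  case (elim x)
  show ?case by (rule LIMSEQ_le_const2[OF tendsto_rabs[OF elim(1)]]) (use elim in auto)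
 qed
 show "v \<in> L2 \<mu>"
 proof (rule L2I[OF v], rule Bochner_Integration.integrable_bound[OF L2_integrable_power2[OF G]])
  show "AE x in \<mu>. norm ((v x)\<^sup>2) \<le> norm ((G x)\<^sup>2)"
   using vG by eventually_elim (simp add: abs_le_square_iff[symmetric])
 qed (use v in auto)
 show "(\<lambda>k. nrm \<mu> (\<lambda>x. w k x - v x)) \<longlonglongrightarrow> 0"
  by (rule L2_dominated_convergence[OF m v G lim bd])
qed

lemma approx_test: "test_function \<Omega> \<phi> \<Longrightarrow> \<phi> \<in> approx"
 unfolding approx_def using test_function_L2 by (auto simp: nrm_def intro!: exI[of _ \<phi>])

lemma const_L2: "(\<lambda>x. c) \<in> L2 \<mu>"
 by (rule L2_bounded[OF finite_mu, of _ "\<bar>c\<bar>"]) auto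

lemma approx_box:
 assumes "cbox l u \<subseteq> \<Omega>"
 shows "indicator (box l u) \<in> approx"
proof (rule approx_bounded_limit)
 show "boxbump l u (real k) \<in> approx" for k
  by (intro approx_test test_function_boxbump assms) simp
 show "AE x in \<mu>. (\<lambda>k. boxbump l u (real k) x) \<longlonglongrightarrow> indicator (box l u) x"
  by (intro always_eventually allI boxbump_tendsto)
 show "AE x in \<mu>. \<bar>boxbump l u (real k) x\<bar> \<le> 1" for k
  using boxbump_bounds[of l u "real k"] by simp
qed (auto intro: const_L2 indicator_measurable_mu)

lemma approx_zero: "(\<lambda>x. 0) \<in> approx"
 by (rule approx_test) (auto simp: test_function_def smooth_const intro!: exI[of _ "{}"])

text \<open>Localised to one box so that complements can be taken relative to it: the indicator of
  the box is already in the closure, while that of the whole domain is not yet known to be.\<close>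

lemma approx_borel_in_box:
 assumes "cbox l u \<subseteq> \<Omega>" "A \<in> sets borel"
 shows "indicator (A \<inter> box l u) \<in> approx"
 using assms(2)
proof (induction rule: borel_induct_box)
 case (box a b)
 obtain c d where cd: "box a b \<inter> box l u = box c d" by (rule that, rule box_Int_box)
 show ?case
 proof (cases "box c d = {}")
  case True
  then show ?thesis using approx_zero by (simp add: cd indicator_def)
 next
  case False
  have "box c d \<subseteq> box l u" using cd by blast
  then have "cbox c d \<subseteq> cbox l u" using False
   by (rule cbox_subset_if_box_subset)
  then show ?thesis unfolding cd using assms by (intro approx_box) auto
 qed
next
 case (compl A)
 have "(\<lambda>x. 1 * indicator (box l u) x + (-1) * indicator (A \<inter> box l u) x) \<in> approx"
  by (intro approx_lincomb approx_box assms compl)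
 also have "(\<lambda>x. 1 * indicator (box l u) x + (-1) * indicator (A \<inter> box l u) x :: real) =
   indicator (- A \<inter> box l u)" by (auto simp: indicator_def)
 finally show ?case .
next
 case (union A)
 show ?case
 proof (rule approx_bounded_limit)
  fix n :: nat
  show "(indicator ((\<Union>i<n. A i) \<inter> box l u) :: real^'n \<Rightarrow> real) \<in> approx"
  proof (induction n)
   case 0
   then show ?case using approx_zero by (simp add: indicator_def)
  next
   case (Suc n)
   have "A n \<inter> A i = {}" if "i < n" for i
    using union(1) that by (intro disjoint_family_onD) auto
   then have "A n \<inter> (\<Union>i<n. A i) = {}" by blast
   then have "(indicator ((\<Union>i<Suc n. A i) \<inter> box l u) :: real^'n \<Rightarrow> real) =
     (\<lambda>x. 1 * indicator ((\<Union>i<n. A i) \<inter> box l u) x + 1 * indicator (A n \<inter> box l u) x)"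
    by (auto simp: indicator_def fun_eq_iff less_Suc_eq)
   then show ?case using Suc union(3) approx_lincomb by presburger
  qed
  show "AE x in \<mu>. \<bar>indicator ((\<Union>i<n. A i) \<inter> box l u) x :: real\<bar> \<le> 1"
   by (auto simp: indicator_def)
 next
  show "AE x in \<mu>. (\<lambda>n. indicator ((\<Union>i<n. A i) \<inter> box l u) x :: real) \<longlonglongrightarrow> indicator ((\<Union>i. A i) \<inter> box l u) x"
  proof (intro always_eventually allI)
   fix x
   show "(\<lambda>n. indicator ((\<Union>i<n. A i) \<inter> box l u) x :: real) \<longlonglongrightarrow> indicator ((\<Union>i. A i) \<inter> box l u) x"
   proof (cases "\<exists>i. x \<in> A i")
    case True
    then obtain i where "x \<in> A i" by blast
    then have "\<forall>\<^sub>F n in sequentially. (indicator ((\<Union>i<n. A i) \<inter> box l u) x :: real) = indicator ((\<Union>i. A i) \<inter> box l u) x"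
     unfolding eventually_sequentially by (intro exI[of _ "Suc i"]) (auto simp: indicator_def)
    then show ?thesis by (rule tendsto_eventually)
   next
    case False
    then show ?thesis by (simp add: indicator_def)
   qed
  qed
 qed (use union in \<open>auto intro!: const_L2 indicator_measurable_mu\<close>)
qed

text \<open>The domain is exhausted by finite unions of boxes; subtracting the boxes already used
  makes the indicators add up.\<close>

lemma approx_borel:
 assumes "A \<in> sets borel"
 shows "indicator A \<in> approx"
proof -
 obtain l u :: "nat \<Rightarrow> real^'n" where lu: "\<And>i. cbox (l i) (u i) \<subseteq> \<Omega>" "\<Omega> = (\<Union>i. box (l i) (u i))"
  using open_Union_cbox[OF open_dom] by metis
 have Un: "indicator (B \<inter> (\<Union>i<n. box (l i) (u i))) \<in> approx" if "B \<in> sets borel" for n :: nat and B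
  using that
 proof (induction n arbitrary: B)
  case 0
  then show ?case using approx_zero by (simp add: indicator_def)
 next
  case (Suc n)
  let ?U = "\<Union>i<n. box (l i) (u i)"
  have "indicator ((B - ?U) \<inter> box (l n) (u n)) \<in> approx"
   by (intro approx_borel_in_box lu sets.Diff Suc sets.finite_UN) auto
  then have "(\<lambda>x. 1 * indicator (B \<inter> ?U) x + 1 * indicator ((B - ?U) \<inter> box (l n) (u n)) x) \<in> approx"
   using Suc by (intro approx_lincomb)
  also have "(\<lambda>x. 1 * indicator (B \<inter> ?U) x + 1 * indicator ((B - ?U) \<inter> box (l n) (u n)) x :: real)
    = indicator (B \<inter> (\<Union>i<Suc n. box (l i) (u i)))"
   by (auto simp: indicator_def fun_eq_iff less_Suc_eq)
  finally show ?case .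
 qed
 show ?thesis
 proof (rule approx_bounded_limit[OF Un[OF assms]])
  show "AE x in \<mu>. (\<lambda>n. indicator (A \<inter> (\<Union>i<n. box (l i) (u i))) x :: real) \<longlonglongrightarrow> indicator A x"
  proof (rule AE_I2)
   fix x assume "x \<in> space \<mu>"
   then obtain i where "x \<in> box (l i) (u i)" using lu(2) by auto
   then have "\<forall>\<^sub>F n in sequentially. indicator (A \<inter> (\<Union>i<n. box (l i) (u i))) x = (indicator A x :: real)"
    unfolding eventually_sequentially by (intro exI[of _ "Suc i"]) (auto simp: indicator_def)
   then show "(\<lambda>n. indicator (A \<inter> (\<Union>i<n. box (l i) (u i))) x :: real) \<longlonglongrightarrow> indicator A x"
    by (rule tendsto_eventually)
  qed
  show "AE x in \<mu>. \<bar>indicator (A \<inter> (\<Union>i<n. box (l i) (u i))) x :: real\<bar> \<le> 1" for n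
   by (auto simp: indicator_def)
 qed (use assms in \<open>auto intro!: const_L2 indicator_measurable_mu\<close>)
qed

lemma approx_cong_AE:
 assumes v: "v \<in> approx" and w: "w \<in> borel_measurable \<mu>" and eq: "AE x in \<mu>. v x = w x"
 shows "w \<in> approx"
proof (rule approx_limit[of w "\<lambda>_. v"])
 have vL: "v \<in> L2 \<mu>" using v by (simp add: approx_def)
 show "w \<in> L2 \<mu>" by (rule L2_cong_AE[OF vL w eq])
 have "nrm \<mu> (\<lambda>x. v x - w x) = nrm \<mu> (\<lambda>x. 0)"
  using vL w eq by (intro nrm_cong_AE) (auto simp: L2_def)
 then show "(\<lambda>k. nrm \<mu> (\<lambda>x. v x - w x)) \<longlonglongrightarrow> 0" by (simp add: nrm_def)
qed (rule v)

lemma approx_simple: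
 assumes "simple_function \<mu> s"
 shows "s \<in> approx"
proof -
 have ind: "indicator A \<in> approx" if "A \<in> sets \<mu>" for A
 proof -
  have Al: "A \<in> sets lebesgue" "A \<subseteq> \<Omega>"
   using that dom_sets sets_restrict_space_iff[of \<Omega> lebesgue A] by auto
  then have im: "(indicator A :: _ \<Rightarrow> real) \<in> borel_measurable lebesgue" by simp
  from Al obtain g where g: "g \<in> borel_measurable lborel" "AE x in lborel. indicator A x = (g x :: real)"
   using completion_ex_borel_measurable_real[OF im] by blast
  \<comment> \<open>A Lebesgue set differs by a null set from the Borel set on which a Borel version
    of its indicator equals 1.\<close>
  let ?B = "{x. g x = 1}"
  have gb: "g \<in> borel_measurable borel" using g by simp
  have B: "?B \<in> sets borel" using gb by measurable
  have "AE x in lebesgue. indicator A x = g x" using g(2) by (rule AE_completion)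
  then have "AE x in lebesgue. x \<in> \<Omega> \<longrightarrow> indicator ?B x = (indicator A x :: real)"
  proof eventually_elim
   case (elim x)
   then show ?case by (cases "x \<in> A") (auto simp: indicator_def)
  qed
  then have "AE x in \<mu>. indicator ?B x = (indicator A x :: real)"
   using AE_lebesgue_on_iff[OF dom_sets] by blast
  then show ?thesis using that by (intro approx_cong_AE[OF approx_borel[OF B]]) auto
 qed
 have fin: "finite (s ` space \<mu>)" using assms by (rule simple_functionD)
 have sum: "(\<lambda>x. \<Sum>y\<in>Y. y * indicator (s -` {y} \<inter> space \<mu>) x) \<in> approx" if "finite Y" for Y
  using that
 proof (induction Y rule: finite_induct)
  case empty
  then show ?case using approx_zero by simp
 next
  case (insert y Y)
  have "(\<lambda>x. y * indicator (s -` {y} \<inter> space \<mu>) x + 1 * (\<Sum>y\<in>Y. y * indicator (s -` {y} \<inter> space \<mu>) x)) \<in> approx"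
   using assms by (intro approx_lincomb insert ind simple_functionD)
  then show ?case by (simp only: sum.insert[OF insert.hyps] mult_1)
 qed
 have "s x = (\<Sum>y\<in>s ` space \<mu>. y * indicator (s -` {y} \<inter> space \<mu>) x)" if "x \<in> space \<mu>" for x
 proof -
  have "(\<Sum>y\<in>s ` space \<mu>. y * indicator (s -` {y} \<inter> space \<mu>) x) = (\<Sum>y\<in>s ` space \<mu>. if y = s x then y else 0)"
   using that by (intro sum.cong) (auto simp: indicator_def)
  then show ?thesis using fin that by simp
 qed
 then have "AE x in \<mu>. (\<Sum>y\<in>s ` space \<mu>. y * indicator (s -` {y} \<inter> space \<mu>) x) = s x"
  by (intro AE_I2) (rule sym)
 then show ?thesis
  by (rule approx_cong_AE[OF sum[OF fin] borel_measurable_simple_function[OF assms]])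
qed

text \<open>Simple functions bounded by 2 |v| converge to v pointwise, so v is a dominated limit of
  members of \<open>approx\<close>.\<close>

theorem test_functions_dense:
 assumes "v \<in> L2 \<mu>"
 obtains \<phi> where "\<And>k::nat. test_function \<Omega> (\<phi> k)" "(\<lambda>k. nrm \<mu> (\<lambda>x. \<phi> k x - v x)) \<longlonglongrightarrow> 0"
proof -
 have vm: "v \<in> borel_measurable \<mu>" using assms by (simp add: L2_def)
 obtain F where F: "\<And>i. simple_function \<mu> (F i)" "\<And>x. x \<in> space \<mu> \<Longrightarrow> (\<lambda>i. F i x) \<longlonglongrightarrow> v x"
   "\<And>i x. x \<in> space \<mu> \<Longrightarrow> dist (F i x) 0 \<le> 2 * dist (v x) 0"
  using borel_measurable_implies_sequence_metric[OF vm, of 0] by metis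
 have "(\<lambda>x. 2 * \<bar>v x\<bar>) \<in> L2 \<mu>" using assms by (auto simp: L2_def power_mult_distrib)
 then have "v \<in> approx"
 proof (rule approx_bounded_limit[OF approx_simple[OF F(1)] vm, rotated])
  show "AE x in \<mu>. (\<lambda>i. F i x) \<longlonglongrightarrow> v x" using F(2) by (rule AE_I2)
  show "AE x in \<mu>. \<bar>F i x\<bar> \<le> 2 * \<bar>v x\<bar>" for i using F(3) by (intro AE_I2) simp
 qed
 then have "\<exists>\<phi>. test_function \<Omega> \<phi> \<and> nrm \<mu> (\<lambda>x. v x - \<phi> x) < 1 / real (Suc k)" for k
  by (auto simp: approx_def)
 then obtain \<phi> where \<phi>: "\<And>k. test_function \<Omega> (\<phi> k)" "\<And>k. nrm \<mu> (\<lambda>x. v x - \<phi> k x) < 1 / real (Suc k)"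
  by metis
 have "(\<lambda>k. nrm \<mu> (\<lambda>x. \<phi> k x - v x)) \<longlonglongrightarrow> 0"
 proof (rule Lim_null_comparison[OF always_eventually LIMSEQ_inverse_real_of_nat], rule allI)
  fix k
  show "norm (nrm \<mu> (\<lambda>x. \<phi> k x - v x)) \<le> inverse (real (Suc k))"
   using \<phi>(2)[of k] by (subst nrm_minus_commute) (simp add: nrm_nonneg inverse_eq_divide)
 qed
 with \<phi>(1) show ?thesis by (rule that)
qed

end

section \<open>Weak derivatives, Sobolev spaces of integer order and the bilinear forms\<close>

context bounded_open
begin

text \<open>Rests on the completeness of Lebesgue measure. It is what makes the arbitrary
  representative chosen by \<open>wderiv\<close> measurable.\<close>

lemma borel_measurable_AE_mu:
 fixes f g :: "real^'n \<Rightarrow> real"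
 assumes "f \<in> borel_measurable \<mu>" "AE x in \<mu>. f x = g x"
 shows "g \<in> borel_measurable \<mu>"
proof -
 have "(\<lambda>x. f x * indicator \<Omega> x) \<in> borel_measurable lebesgue"
  using assms(1) dom_sets by (simp add: borel_measurable_restrict_space_iff mult.commute)
 moreover have "AE x in lebesgue. f x * indicator \<Omega> x = g x * indicator \<Omega> x"
  using assms(2) unfolding AE_lebesgue_on_iff[OF dom_sets] by eventually_elim (auto simp: indicator_def)
 ultimately have "(\<lambda>x. g x * indicator \<Omega> x) \<in> borel_measurable lebesgue"
  by (rule borel_measurable_AE)
 then show ?thesis using dom_sets by (simp add: borel_measurable_restrict_space_iff mult.commute)
qed

lemma L2_AE:
 fixes f g :: "real^'n \<Rightarrow> real"
 assumes "f \<in> L2 \<mu>" "AE x in \<mu>. f x = g x"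
 shows "g \<in> L2 \<mu>"
 using L2_cong_AE[OF assms(1) borel_measurable_AE_mu[OF L2_measurable[OF assms(1)] assms(2)] assms(2)] .

lemma loc_integrable_lincomb:
 "loc_integrable \<Omega> f \<Longrightarrow> loc_integrable \<Omega> g \<Longrightarrow> loc_integrable \<Omega> (\<lambda>x. a * f x + b * g x)"
 unfolding loc_integrable_def by auto

lemma is_weak_deriv_lincomb:
 assumes f: "is_weak_deriv \<Omega> js f g" and f': "is_weak_deriv \<Omega> js f' g'"
 shows "is_weak_deriv \<Omega> js (\<lambda>x. a * f x + b * f' x) (\<lambda>x. a * g x + b * g' x)"
 unfolding is_weak_deriv_def
proof (intro conjI allI impI)
 have l: "loc_integrable \<Omega> f" "loc_integrable \<Omega> f'" "loc_integrable \<Omega> g" "loc_integrable \<Omega> g'"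
  using f f' by (auto simp: is_weak_deriv_def)
 then show "loc_integrable \<Omega> (\<lambda>x. a * f x + b * f' x)" "loc_integrable \<Omega> (\<lambda>x. a * g x + b * g' x)"
  by (auto intro: loc_integrable_lincomb)
 fix \<phi> assume \<phi>: "test_function \<Omega> \<phi>"
 have lin: "L2_inner \<Omega> (\<lambda>x. a * p x + b * q x) \<psi> = a * L2_inner \<Omega> p \<psi> + b * L2_inner \<Omega> q \<psi>"
  if "loc_integrable \<Omega> p" "loc_integrable \<Omega> q" "test_function \<Omega> \<psi>" for p q \<psi>
  using integrable_mult_test[OF that(1,3)] integrable_mult_test[OF that(2,3)]
  by (simp add: L2_inner_eq distrib_right mult.assoc)
 show "L2_inner \<Omega> (\<lambda>x. a * f x + b * f' x) (partials js \<phi>) =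
   (- 1) ^ length js * L2_inner \<Omega> (\<lambda>x. a * g x + b * g' x) \<phi>"
  using f f' \<phi> test_function_partials[OF \<phi>, of js] l
  by (simp add: lin is_weak_deriv_def algebra_simps)
qed

lemma is_weak_deriv_unique:
 assumes "is_weak_deriv \<Omega> js f g" "is_weak_deriv \<Omega> js f g'"
 shows "AE x in \<mu>. g x = g' x"
proof -
 have "is_weak_deriv \<Omega> js (\<lambda>x. 1 * f x + (-1) * f x) (\<lambda>x. 1 * g x + (-1) * g' x)"
  using assms by (rule is_weak_deriv_lincomb)
 then have "AE x in \<mu>. 1 * g x + (-1) * g' x = 0"
  by (intro AE_zero_if_test_zero) (auto simp: is_weak_deriv_def L2_inner_eq)
 then show ?thesis by eventually_elim simp
qed

lemma is_weak_deriv_cong_AE: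
 assumes "is_weak_deriv \<Omega> js f g" "AE x in \<mu>. f x = f' x" "loc_integrable \<Omega> f'"
 shows "is_weak_deriv \<Omega> js f' g"
proof -
 have "L2_inner \<Omega> f' \<phi> = L2_inner \<Omega> f \<phi>" if "test_function \<Omega> \<phi>" for \<phi>
  unfolding L2_inner_eq
 proof (rule integral_cong_AE)
  have "loc_integrable \<Omega> f" using assms(1) by (simp add: is_weak_deriv_def)
  then show "(\<lambda>x. f x * \<phi> x) \<in> borel_measurable \<mu>" "(\<lambda>x. f' x * \<phi> x) \<in> borel_measurable \<mu>"
   using integrable_mult_test assms(3) that by blast+
  show "AE x in \<mu>. f' x * \<phi> x = f x * \<phi> x" using assms(2) by eventually_elim simp
 qed
 then show ?thesis using assms(1,3) test_function_partials unfolding is_weak_deriv_def by metis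
qed

lemma wderiv_is_weak_deriv: "is_weak_deriv \<Omega> js f g \<Longrightarrow> is_weak_deriv \<Omega> js f (wderiv \<Omega> js f)"
 unfolding wderiv_def by (rule someI[where P="is_weak_deriv \<Omega> js f"])

lemma wderiv_AE: "is_weak_deriv \<Omega> js f g \<Longrightarrow> AE x in \<mu>. wderiv \<Omega> js f x = g x"
 using is_weak_deriv_unique wderiv_is_weak_deriv by blast

text \<open>The Sobolev space H^k. Derivatives are indexed by lists of directions, as in
  \<open>sobolev_space\<close>, so that the spaces for r = 1 and r = 2 are literally
  \<open>W 1\<close> and \<open>W 2\<close>.\<close>

definition W :: "nat \<Rightarrow> (real^'n \<Rightarrow> real) set" where
 "W k = {v. \<forall>js. length js \<le> k \<longrightarrow> (\<exists>g\<in>L2 \<mu>. is_weak_deriv \<Omega> js v g)}"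

lemma sobolev_space_1: "sobolev_space 1 \<Omega> = W 1" and sobolev_space_2: "sobolev_space 2 \<Omega> = W 2"
 by (simp_all add: sobolev_space_def W_def L2_space_eq)

lemma sobolev_space_subset_W: "k \<le> nat \<lfloor>r\<rfloor> \<Longrightarrow> sobolev_space r \<Omega> \<subseteq> W k"
 by (auto simp: sobolev_space_def W_def L2_space_eq)

lemma W_mono: "k \<le> l \<Longrightarrow> W l \<subseteq> W k"
 by (auto simp: W_def)

lemma W_is_weak_deriv:
 assumes "v \<in> W k" "length js \<le> k"
 shows "is_weak_deriv \<Omega> js v (wderiv \<Omega> js v)"
proof -
 obtain g where "is_weak_deriv \<Omega> js v g" using assms unfolding W_def by blast
 then show ?thesis by (rule wderiv_is_weak_deriv)
qed

lemma W_wderiv_L2: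
 assumes "v \<in> W k" "length js \<le> k"
 shows "wderiv \<Omega> js v \<in> L2 \<mu>"
proof -
 obtain g where g: "g \<in> L2 \<mu>" "is_weak_deriv \<Omega> js v g" using assms unfolding W_def by blast
 have "AE x in \<mu>. g x = wderiv \<Omega> js v x"
  using wderiv_AE[OF g(2)] by eventually_elim simp
 then show ?thesis by (rule L2_AE[OF g(1)])
qed

lemma W_I:
 assumes "\<And>js. length js \<le> k \<Longrightarrow> is_weak_deriv \<Omega> js v (d js) \<and> d js \<in> L2 \<mu>"
 shows "v \<in> W k"
 using assms unfolding W_def by blast

lemma wderiv_Nil_AE:
 assumes "v \<in> W k"
 shows "AE x in \<mu>. wderiv \<Omega> [] v x = v x"
proof -
 have "loc_integrable \<Omega> v" using W_is_weak_deriv[OF assms, of "[]"] by (simp add: is_weak_deriv_def)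
 then show ?thesis by (intro wderiv_AE) (simp add: is_weak_deriv_def)
qed

lemma W_L2: "v \<in> W k \<Longrightarrow> v \<in> L2 \<mu>"
 using L2_AE[OF W_wderiv_L2[of v k "[]"] wderiv_Nil_AE] by simp

lemma W_lincomb:
 assumes "v \<in> W k" "w \<in> W k"
 shows "(\<lambda>x. a * v x + b * w x) \<in> W k"
 by (rule W_I[where d="\<lambda>js x. a * wderiv \<Omega> js v x + b * wderiv \<Omega> js w x"])
  (intro conjI is_weak_deriv_lincomb L2_add L2_cmult W_wderiv_L2[OF assms(1)] W_wderiv_L2[OF assms(2)]
   W_is_weak_deriv[OF assms(1)] W_is_weak_deriv[OF assms(2)])

lemma wderiv_lincomb:
 assumes "v \<in> W k" "w \<in> W k" "length js \<le> k"
 shows "AE x in \<mu>. wderiv \<Omega> js (\<lambda>x. a * v x + b * w x) x = a * wderiv \<Omega> js v x + b * wderiv \<Omega> js w x"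
 by (rule wderiv_AE) (use assms in \<open>auto intro!: is_weak_deriv_lincomb W_is_weak_deriv\<close>)

lemma wderiv_zero:
 assumes "v \<in> W k" "length js \<le> k" "AE x in \<mu>. v x = 0"
 shows "AE x in \<mu>. wderiv \<Omega> js v x = 0"
proof (rule wderiv_AE)
 have z: "is_weak_deriv \<Omega> js (\<lambda>x. 0) (\<lambda>x. 0)"
  using loc_integrable_L2[OF L2_zero] by (simp add: is_weak_deriv_def L2_inner_eq)
 have "AE x in \<mu>. 0 = v x" using assms(3) by eventually_elim simp
 then show "is_weak_deriv \<Omega> js v (\<lambda>x. 0)"
  by (rule is_weak_deriv_cong_AE[OF z]) (rule loc_integrable_L2[OF W_L2[OF assms(1)]])
qed

text \<open>Inserting the test function \<open>partial i \<phi>\<close> into the identity for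
  direction j makes the derivatives fall on \<open>\<phi>\<close> in the order of the list
  \<open>[j, i]\<close>.\<close>

lemma is_weak_deriv_wderiv:
 assumes "v \<in> W 2"
 shows "is_weak_deriv \<Omega> [i] (wderiv \<Omega> [j] v) (wderiv \<Omega> [j, i] v)"
 unfolding is_weak_deriv_def
proof (intro conjI allI impI)
 have w: "is_weak_deriv \<Omega> [j] v (wderiv \<Omega> [j] v)" "is_weak_deriv \<Omega> [j, i] v (wderiv \<Omega> [j, i] v)"
  using assms by (auto intro: W_is_weak_deriv)
 then show "loc_integrable \<Omega> (wderiv \<Omega> [j] v)" "loc_integrable \<Omega> (wderiv \<Omega> [j, i] v)"
  by (auto simp: is_weak_deriv_def)
 fix \<phi> assume \<phi>: "test_function \<Omega> \<phi>"
 have "test_function \<Omega> (partials [i] \<phi>)" using test_function_partials[OF \<phi>] .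
 then have "L2_inner \<Omega> v (partials [j] (partials [i] \<phi>)) = - L2_inner \<Omega> (wderiv \<Omega> [j] v) (partials [i] \<phi>)"
  using w(1) unfolding is_weak_deriv_def by force
 moreover have "L2_inner \<Omega> v (partials [j, i] \<phi>) = L2_inner \<Omega> (wderiv \<Omega> [j, i] v) \<phi>"
  using w(2) \<phi> unfolding is_weak_deriv_def by force
 ultimately show "L2_inner \<Omega> (wderiv \<Omega> [j] v) (partials [i] \<phi>)
   = (- 1) ^ length [i] * L2_inner \<Omega> (wderiv \<Omega> [j, i] v) \<phi>"
  by simp
qed

lemma wderiv_wderiv_AE:
 "v \<in> W 2 \<Longrightarrow> AE x in \<mu>. wderiv \<Omega> [i] (wderiv \<Omega> [j] v) x = wderiv \<Omega> [j, i] v x"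
 by (rule wderiv_AE) (rule is_weak_deriv_wderiv)

lemma lists_le_1: "length js \<le> 1 \<longleftrightarrow> js = [] \<or> (\<exists>j. js = [j])"
 by (cases js) (auto simp: length_Suc_conv)

lemma W1_I:
 assumes "v \<in> L2 \<mu>" "\<And>j. is_weak_deriv \<Omega> [j] v (d j)" "\<And>j. d j \<in> L2 \<mu>"
 shows "v \<in> W 1"
proof (rule W_I)
 fix js :: "'n list" assume "length js \<le> 1"
 then consider "js = []" | j where "js = [j]" using lists_le_1 by blast
 then show "is_weak_deriv \<Omega> js v (if js = [] then v else d (hd js)) \<and> (if js = [] then v else d (hd js)) \<in> L2 \<mu>"
  by cases (use assms loc_integrable_L2[OF assms(1)] in \<open>auto simp: is_weak_deriv_def\<close>)
qed

lemma W2_wderiv_W1: "v \<in> W 2 \<Longrightarrow> wderiv \<Omega> [j] v \<in> W 1"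
 by (rule W1_I[where d="\<lambda>i. wderiv \<Omega> [j, i] v"]) (auto intro: W_wderiv_L2 is_weak_deriv_wderiv)

lemma wlaplace_L2: "v \<in> W 2 \<Longrightarrow> wlaplace \<Omega> v \<in> L2 \<mu>"
 unfolding wlaplace_def[abs_def] by (intro L2_sum W_wderiv_L2) auto

lemma wlaplace_lincomb:
 assumes "v \<in> W 2" "w \<in> W 2"
 shows "AE x in \<mu>. wlaplace \<Omega> (\<lambda>x. a * v x + b * w x) x = a * wlaplace \<Omega> v x + b * wlaplace \<Omega> w x"
proof -
 have "AE x in \<mu>. \<forall>j\<in>UNIV. wderiv \<Omega> [j, j] (\<lambda>x. a * v x + b * w x) x
    = a * wderiv \<Omega> [j, j] v x + b * wderiv \<Omega> [j, j] w x"
  by (intro AE_finite_allI) (auto intro: wderiv_lincomb[OF assms])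
 then show ?thesis
  by eventually_elim (simp add: wlaplace_def sum.distrib sum_distrib_left)
qed

lemma wgrad_inner:
 assumes "v \<in> W 1" "w \<in> W 1"
 shows "L2_inner \<Omega> (wgrad \<Omega> v) (wgrad \<Omega> w) = (\<Sum>j\<in>UNIV. LINT x|\<mu>. wderiv \<Omega> [j] v x * wderiv \<Omega> [j] w x)"
proof -
 have "L2_inner \<Omega> (wgrad \<Omega> v) (wgrad \<Omega> w) = (LINT x|\<mu>. (\<Sum>j\<in>UNIV. wderiv \<Omega> [j] v x * wderiv \<Omega> [j] w x))"
  by (simp add: L2_inner_def inner_vec_def wgrad_def)
 also have "\<dots> = (\<Sum>j\<in>UNIV. LINT x|\<mu>. wderiv \<Omega> [j] v x * wderiv \<Omega> [j] w x)"
  using assms by (intro Bochner_Integration.integral_sum L2_mult_integrable W_wderiv_L2) auto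
 finally show ?thesis .
qed

definition ip :: "(real^'n \<Rightarrow> real) \<Rightarrow> (real^'n \<Rightarrow> real) \<Rightarrow> real" where
 "ip v w = (LINT x|\<mu>. v x * w x)"

lemma ip_L2_inner: "L2_inner \<Omega> v w = ip v w"
 by (simp add: ip_def L2_inner_eq)

lemma ip_commute: "ip v w = ip w v"
 by (simp add: ip_def mult.commute)

lemma ip_self: "ip v v = (nrm \<mu> v)\<^sup>2"
 unfolding ip_def nrm_power2 by (simp only: power2_eq_square)

lemma ip_lincomb:
 assumes "v \<in> L2 \<mu>" "v' \<in> L2 \<mu>" "w \<in> L2 \<mu>"
 shows "ip (\<lambda>x. a * v x + b * v' x) w = a * ip v w + b * ip v' w"
 using assms L2_mult_integrable[of v \<mu> w] L2_mult_integrable[of v' \<mu> w]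
 by (simp add: ip_def distrib_right mult.assoc)

lemma ip_cong_AE:
 assumes "AE x in \<mu>. v x = v' x" "AE x in \<mu>. w x = w' x" "v \<in> L2 \<mu>" "w \<in> L2 \<mu>"
 shows "ip v w = ip v' w'"
proof -
 have "v' \<in> borel_measurable \<mu>" "w' \<in> borel_measurable \<mu>"
  using assms borel_measurable_AE_mu L2_measurable by blast+
 moreover have "AE x in \<mu>. v x * w x = v' x * w' x"
  using assms(1,2) by eventually_elim simp
 ultimately show ?thesis unfolding ip_def using assms(3,4)
  by (intro integral_cong_AE) (auto simp: L2_def)
qed

lemma ip_CS: "v \<in> L2 \<mu> \<Longrightarrow> w \<in> L2 \<mu> \<Longrightarrow> \<bar>ip v w\<bar> \<le> nrm \<mu> v * nrm \<mu> w"
 unfolding ip_def by (rule L2_Cauchy_Schwarz)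

definition gip :: "(real^'n \<Rightarrow> real) \<Rightarrow> (real^'n \<Rightarrow> real) \<Rightarrow> real" where
 "gip v w = (\<Sum>j\<in>UNIV. ip (wderiv \<Omega> [j] v) (wderiv \<Omega> [j] w))"

text \<open>The form a that is applied to the time derivative in both problems. On functions it is
  only semidefinite, since functions vanishing almost everywhere have zero energy.\<close>

definition aip :: "(real^'n \<Rightarrow> real) \<Rightarrow> (real^'n \<Rightarrow> real) \<Rightarrow> real" where
 "aip v w = ip v w + ip (wlaplace \<Omega> v) (wlaplace \<Omega> w)"

lemma gip_eq: "v \<in> W 1 \<Longrightarrow> w \<in> W 1 \<Longrightarrow> L2_inner \<Omega> (wgrad \<Omega> v) (wgrad \<Omega> w) = gip v w"
 by (simp add: wgrad_inner gip_def ip_def)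

lemma gip_commute: "gip v w = gip w v"
 unfolding gip_def using ip_commute by metis

lemma aip_commute: "aip v w = aip w v"
 unfolding aip_def by (metis ip_commute)

lemma gip_nonneg: "gip v v \<ge> 0" and aip_nonneg: "aip v v \<ge> 0"
 by (auto simp: gip_def aip_def ip_self intro: sum_nonneg)

lemma gip_lincomb:
 assumes "v \<in> W 1" "v' \<in> W 1" "w \<in> W 1"
 shows "gip (\<lambda>x. a * v x + b * v' x) w = a * gip v w + b * gip v' w"
proof -
 have "ip (wderiv \<Omega> [j] (\<lambda>x. a * v x + b * v' x)) (wderiv \<Omega> [j] w)
   = a * ip (wderiv \<Omega> [j] v) (wderiv \<Omega> [j] w) + b * ip (wderiv \<Omega> [j] v') (wderiv \<Omega> [j] w)" for j
 proof -
  have "ip (wderiv \<Omega> [j] (\<lambda>x. a * v x + b * v' x)) (wderiv \<Omega> [j] w)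
   = ip (\<lambda>x. a * wderiv \<Omega> [j] v x + b * wderiv \<Omega> [j] v' x) (wderiv \<Omega> [j] w)"
   using assms by (intro ip_cong_AE wderiv_lincomb W_wderiv_L2[OF W_lincomb] W_wderiv_L2) auto
  then show ?thesis using assms by (simp add: ip_lincomb W_wderiv_L2)
 qed
 then show ?thesis by (simp add: gip_def sum.distrib sum_distrib_left)
qed

lemma aip_lincomb:
 assumes "v \<in> W 2" "v' \<in> W 2" "w \<in> W 2"
 shows "aip (\<lambda>x. a * v x + b * v' x) w = a * aip v w + b * aip v' w"
proof -
 have "ip (wlaplace \<Omega> (\<lambda>x. a * v x + b * v' x)) (wlaplace \<Omega> w)
  = ip (\<lambda>x. a * wlaplace \<Omega> v x + b * wlaplace \<Omega> v' x) (wlaplace \<Omega> w)"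
  using assms by (intro ip_cong_AE wlaplace_lincomb wlaplace_L2 W_lincomb) auto
 then show ?thesis
  using assms by (simp add: aip_def ip_lincomb wlaplace_L2 W_L2 algebra_simps)
qed

text \<open>Null functions do not affect the form; this is what permits arguing with elements of S_h
  that agree only almost everywhere.\<close>

lemma aip_zero:
 assumes "v \<in> W 2" "w \<in> W 2" "AE x in \<mu>. v x = 0"
 shows "aip v w = 0"
proof -
 have "AE x in \<mu>. \<forall>j\<in>UNIV. wderiv \<Omega> [j, j] v x = 0"
  by (intro AE_finite_allI wderiv_zero[OF assms(1) _ assms(3)]) auto
 then have "AE x in \<mu>. wlaplace \<Omega> v x = 0" by eventually_elim (simp add: wlaplace_def)
 then have "ip (wlaplace \<Omega> v) (wlaplace \<Omega> w) = ip (\<lambda>x. 0) (wlaplace \<Omega> w)"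
  using assms by (intro ip_cong_AE wlaplace_L2) auto
 moreover have "ip v w = ip (\<lambda>x. 0) w" using assms by (intro ip_cong_AE W_L2) auto
 ultimately show ?thesis by (simp add: aip_def ip_def)
qed

lemma norm1_eq: "v \<in> W 1 \<Longrightarrow> norm1 \<Omega> v = sqrt (ip v v + gip v v)"
 by (simp add: norm1_def L2_norm_def[where 'b="real^'n"] gip_eq gip_nonneg L2_norm_eq ip_self)

lemma norm2_eq: "v \<in> W 2 \<Longrightarrow> norm2 \<Omega> v = sqrt (aip v v + gip v v)"
 using W_mono[of 1 2]
 by (simp add: norm2_def aip_def L2_norm_def[where 'b="real^'n"] gip_eq gip_nonneg L2_norm_eq ip_self subset_iff algebra_simps)

end

section \<open>Hausdorff measure\<close>

definition hterm :: "nat \<Rightarrow> 'a::metric_space set \<Rightarrow> ennreal" where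
 "hterm d C = (if C = {} then 0 else ennreal (diameter C ^ d))"

definition hcover :: "real \<Rightarrow> 'a::metric_space set \<Rightarrow> (nat \<Rightarrow> 'a set) set" where
 "hcover \<delta> A = {C. A \<subseteq> (\<Union>i. C i) \<and> (\<forall>i. bounded (C i) \<and> diameter (C i) \<le> \<delta>)}"

text \<open>The outer measure behind \<open>hausdorff_measure\<close>, taken on all sets so that
  Caratheodory's construction can be applied to it.\<close>

definition houter :: "nat \<Rightarrow> 'a::metric_space set \<Rightarrow> ennreal" where
 "houter d A = (SUP \<delta>\<in>{0<..}. hausdorff_pre d \<delta> A)"

lemma hausdorff_pre_eq: "hausdorff_pre d \<delta> A = (INF C\<in>hcover \<delta> A. \<Sum>i. hterm d (C i))"
 by (simp add: hausdorff_pre_def hterm_def hcover_def)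

lemma hausdorff_pre_mono: "A \<subseteq> B \<Longrightarrow> hausdorff_pre d \<delta> A \<le> hausdorff_pre d \<delta> B"
 unfolding hausdorff_pre_eq by (rule INF_superset_mono) (auto simp: hcover_def)

lemma hausdorff_pre_antimono:
 assumes "\<delta> \<le> \<delta>'"
 shows "hausdorff_pre d \<delta>' A \<le> hausdorff_pre d \<delta> A"
 unfolding hausdorff_pre_eq
proof (rule INF_superset_mono)
 show "hcover \<delta> A \<subseteq> hcover \<delta>' A" using assms order_trans unfolding hcover_def by blast
qed simp

lemma hausdorff_pre_empty: "\<delta> > 0 \<Longrightarrow> hausdorff_pre d \<delta> {} = 0"
proof -
 assume "\<delta> > 0"
 then have "(\<lambda>_. {}) \<in> hcover \<delta> ({} :: 'a set)" by (auto simp: hcover_def)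
 then have "hausdorff_pre d \<delta> ({} :: 'a set) \<le> (\<Sum>i. hterm d ({} :: 'a set))"
  unfolding hausdorff_pre_eq by (rule INF_lower2) simp
 then show ?thesis by (simp add: hterm_def)
qed

text \<open>The n-th set is covered up to e / 2^(n+1), and the double sequence of covering sets is
  arranged in a single one by the pairing function.\<close>

lemma hausdorff_pre_UN:
 "hausdorff_pre d \<delta> (\<Union>n. A n) \<le> (\<Sum>n. hausdorff_pre d \<delta> (A n))"
proof (rule ennreal_le_epsilon)
 fix e :: real assume e: "0 < e" and fin: "(\<Sum>n. hausdorff_pre d \<delta> (A n)) < top"
 have "\<exists>C\<in>hcover \<delta> (A n). (\<Sum>i. hterm d (C i)) < hausdorff_pre d \<delta> (A n) + e * (1/2)^Suc n" for n
 proof -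
  have "hausdorff_pre d \<delta> (A n) < top" using fin by (auto dest!: ennreal_suminf_lessD)
  then have "hausdorff_pre d \<delta> (A n) < hausdorff_pre d \<delta> (A n) + e * (1/2)^Suc n"
   using e by (auto simp: less_top)
  then show ?thesis by (subst (asm) hausdorff_pre_eq) (simp only: INF_less_iff)
 qed
 then obtain B where B: "\<And>n. B n \<in> hcover \<delta> (A n)"
  and Ble: "\<And>n. (\<Sum>i. hterm d (B n i)) < hausdorff_pre d \<delta> (A n) + e * (1/2)^Suc n"
  by metis
 define C where "C = case_prod B o prod_decode"
 have "C \<in> hcover \<delta> (\<Union>n. A n)"
  unfolding hcover_def
 proof (intro CollectI conjI allI subsetI)
  fix x assume "x \<in> (\<Union>n. A n)"
  then obtain n i where "x \<in> B n i" using B by (fastforce simp: hcover_def)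
  then have "x \<in> C (prod_encode (n, i))" by (simp add: C_def)
  then show "x \<in> (\<Union>i. C i)" by blast
 qed (use B in \<open>auto simp: hcover_def C_def split_beta\<close>)
 then have "hausdorff_pre d \<delta> (\<Union>n. A n) \<le> (\<Sum>i. hterm d (C i))"
  unfolding hausdorff_pre_eq by (rule INF_lower)
 also have "\<dots> = (\<Sum>i. (case_prod (\<lambda>n i. hterm d (B n i))) (prod_decode i))"
  by (simp add: C_def split_beta)
 also have "\<dots> = (\<Sum>n. \<Sum>i. hterm d (B n i))"
  by (intro suminf_ennreal_2dimen) auto
 also have "\<dots> \<le> (\<Sum>n. hausdorff_pre d \<delta> (A n) + e * (1/2) ^ Suc n)"
  using Ble by (intro suminf_le allI less_imp_le) auto
 also have "\<dots> = (\<Sum>n. hausdorff_pre d \<delta> (A n)) + (\<Sum>n. ennreal e * ennreal ((1/2) ^ Suc n))"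
  using \<open>0 < e\<close> by (subst suminf_add[symmetric])
   (auto simp del: ennreal_suminf_cmult simp add: ennreal_mult[symmetric])
 also have "\<dots> = (\<Sum>n. hausdorff_pre d \<delta> (A n)) + e"
  unfolding ennreal_suminf_cmult
  by (subst suminf_ennreal_eq[OF zero_le_power power_half_series]) auto
 finally show "hausdorff_pre d \<delta> (\<Union>n. A n) \<le> (\<Sum>n. hausdorff_pre d \<delta> (A n)) + e" .
qed

lemma houter_empty: "houter d {} = 0"
proof -
 have "houter d {} \<le> 0" unfolding houter_def by (rule SUP_least) (simp add: hausdorff_pre_empty)
 then show ?thesis by simp
qed

lemma houter_mono: "A \<subseteq> B \<Longrightarrow> houter d A \<le> houter d B"
 unfolding houter_def by (intro SUP_mono) (auto intro: hausdorff_pre_mono)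

lemma houter_UN: "houter d (\<Union>n. A n) \<le> (\<Sum>n. houter d (A n))"
 unfolding houter_def
proof (rule SUP_least)
 fix \<delta> :: real assume \<delta>: "\<delta> \<in> {0<..}"
 have "(\<Sum>n. hausdorff_pre d \<delta> (A n)) \<le> (\<Sum>n. SUP \<delta>\<in>{0<..}. hausdorff_pre d \<delta> (A n))"
  using \<delta> by (intro suminf_le SUP_upper) auto
 then show "hausdorff_pre d \<delta> (\<Union>n. A n) \<le> (\<Sum>n. SUP \<delta>\<in>{0<..}. hausdorff_pre d \<delta> (A n))"
  using hausdorff_pre_UN order_trans by blast
qed

lemma houter_Un: "houter d (A \<union> B) \<le> houter d A + houter d B"
proof -
 define C where "C n = (if n = 0 then A else if n = 1 then B else {})" for n :: nat
 have "houter d (\<Union>n. C n) \<le> (\<Sum>n. houter d (C n))"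
  by (rule houter_UN)
 also have "\<dots> = (\<Sum>n<2. houter d (C n))"
  by (rule suminf_finite) (auto simp: houter_empty C_def)
 also have "\<dots> = houter d A + houter d B" by (simp add: numeral_2_eq_2 C_def)
 also have "(\<Union>n. C n) = A \<union> B"
 proof -
  have "C 0 = A" "C 1 = B" by (simp_all add: C_def)
  moreover have "C n \<subseteq> A \<union> B" for n by (simp add: C_def)
  ultimately show ?thesis by blast
 qed
 finally show ?thesis .
qed

text \<open>Covering sets of diameter below the distance e cannot meet both sets, so every fine
  cover of the union splits into a cover of each.\<close>

lemma houter_separated:
 fixes A B :: "'a::metric_space set"
 assumes e: "e > 0" and sep: "\<And>x y. x \<in> A \<Longrightarrow> y \<in> B \<Longrightarrow> dist x y \<ge> e"
 shows "houter d A + houter d B \<le> houter d (A \<union> B)"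
proof -
 have *: "hausdorff_pre d \<delta> A + hausdorff_pre d \<delta> B \<le> hausdorff_pre d \<delta> (A \<union> B)" if \<delta>: "\<delta> > 0" "\<delta> < e" for \<delta>
 proof -
  have "hausdorff_pre d \<delta> A + hausdorff_pre d \<delta> B \<le> (\<Sum>i. hterm d (C i))"
   if C: "C \<in> hcover \<delta> (A \<union> B)" for C
  proof -
   define CA where "CA i = (if C i \<inter> A = {} then {} else C i)" for i
   define CB where "CB i = (if C i \<inter> B = {} then {} else C i)" for i
   have "CA \<in> hcover \<delta> A" "CB \<in> hcover \<delta> B"
    using C \<delta> by (auto simp: hcover_def CA_def CB_def) (blast+)
   then have "hausdorff_pre d \<delta> A \<le> (\<Sum>i. hterm d (CA i))" "hausdorff_pre d \<delta> B \<le> (\<Sum>i. hterm d (CB i))"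
    unfolding hausdorff_pre_eq by (auto intro: INF_lower)
   then have "hausdorff_pre d \<delta> A + hausdorff_pre d \<delta> B \<le> (\<Sum>i. hterm d (CA i) + hterm d (CB i))"
    by (subst suminf_add[symmetric]) (auto intro: add_mono)
   also have "\<dots> \<le> (\<Sum>i. hterm d (C i))"
   proof (rule suminf_le)
    fix i
    have "C i \<inter> A = {} \<or> C i \<inter> B = {}"
    proof (rule ccontr)
     assume "\<not> ?thesis"
     then obtain x y where xy: "x \<in> C i" "x \<in> A" "y \<in> C i" "y \<in> B" by blast
     have "dist x y \<le> diameter (C i)"
      using C xy by (intro diameter_bounded_bound) (auto simp: hcover_def)
     also have "\<dots> \<le> \<delta>" using C by (auto simp: hcover_def)
     finally show False using sep[OF xy(2,4)] \<delta> by simp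
    qed
    then show "hterm d (CA i) + hterm d (CB i) \<le> hterm d (C i)"
     by (auto simp: CA_def CB_def hterm_def)
   qed auto
   finally show ?thesis .
  qed
  then show ?thesis by (subst (3) hausdorff_pre_eq) (rule INF_greatest)
 qed
 have "houter d A + houter d B = (SUP \<delta>\<in>{0<..}. hausdorff_pre d \<delta> A + hausdorff_pre d \<delta> B)"
  unfolding houter_def
 proof (rule SUP_add_directed_ennreal[symmetric])
  fix i j :: real assume "i \<in> {0<..}" "j \<in> {0<..}"
  then show "\<exists>k\<in>{0<..}. hausdorff_pre d i A + hausdorff_pre d j B \<le> hausdorff_pre d k A + hausdorff_pre d k B"
   by (intro bexI[of _ "min i j"] add_mono hausdorff_pre_antimono) auto
 qed
 also have "\<dots> \<le> houter d (A \<union> B)"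
 proof (rule SUP_least)
  fix \<delta> :: real assume \<delta>: "\<delta> \<in> {0<..}"
  let ?\<delta> = "min \<delta> (e / 2)"
  have "hausdorff_pre d \<delta> A + hausdorff_pre d \<delta> B \<le> hausdorff_pre d ?\<delta> A + hausdorff_pre d ?\<delta> B"
   by (intro add_mono hausdorff_pre_antimono) auto
  also have "\<dots> \<le> hausdorff_pre d ?\<delta> (A \<union> B)" using \<delta> e by (intro *) auto
  also have "\<dots> \<le> houter d (A \<union> B)" unfolding houter_def using \<delta> e by (intro SUP_upper) auto
  finally show "hausdorff_pre d \<delta> A + hausdorff_pre d \<delta> B \<le> houter d (A \<union> B)" .
 qed
 finally show ?thesis .
qed

text \<open>The annuli around a closed set of alternate indices have positive distance, so the sums of
 their outer measures converge and the outer tails vanish in the limit.\<close>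

lemma houter_closed:
 fixes F :: "'a::metric_space set"
 assumes F: "closed F"
 shows "houter d (A \<inter> F) + houter d (A - F) \<le> houter d A"
proof (cases "F = {} \<or> houter d A = \<infinity>")
 case True
 then show ?thesis by (auto simp: houter_empty)
next
 case False
 then have F0: "F \<noteq> {}" and fin: "houter d A < \<infinity>" by (auto simp: less_top)
 have pos: "infdist x F > 0" if "x \<notin> F" for x
  by (rule infdist_pos_not_in_closed[OF F F0 that])
 have lip: "infdist x F \<le> infdist y F + dist x y" for x y by (rule infdist_triangle)
 define An where "An n = {x \<in> A. 1 / real (Suc n) \<le> infdist x F}" for n
 define R where "R n = {x \<in> A. 1 / real (Suc (Suc n)) \<le> infdist x F \<and> infdist x F < 1 / real (Suc n)}" for n
 have sums: "(\<Sum>k<n. houter d (R (2 * k + p))) \<le> houter d A" for n p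
 proof -
  have "(\<Sum>k<n. houter d (R (2 * k + p))) \<le> houter d (\<Union>k<n. R (2 * k + p))"
  proof (induction n)
   case (Suc n)
   let ?U = "\<Union>k<n. R (2 * k + p)"
   have "houter d ?U + houter d (R (2 * n + p)) \<le> houter d (?U \<union> R (2 * n + p))"
   proof (cases n)
    case 0
    then show ?thesis by (simp add: houter_empty)
   next
    case (Suc m)
    show ?thesis
    proof (rule houter_separated)
     \<comment> \<open>Points of an earlier annulus of the same parity have distance at least
       1/(2n+p) from F, those of the present one less than 1/(2n+p+1); the difference is a positive
       gap.\<close>
     show "0 < 1 / real (2 * n + p) - 1 / real (Suc (2 * n + p))"
      using Suc by (simp add: divide_strict_left_mono)
     fix x y assume x: "x \<in> ?U" and y: "y \<in> R (2 * n + p)"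
     then obtain k where k: "k < n" "x \<in> R (2 * k + p)" by blast
     have "1 / real (2 * n + p) \<le> 1 / real (Suc (Suc (2 * k + p)))"
      using k(1) by (intro divide_left_mono) auto
     also have "\<dots> \<le> infdist x F" using k(2) by (auto simp: R_def)
     finally have "1 / real (2 * n + p) \<le> infdist x F" .
     moreover have "infdist y F < 1 / real (Suc (2 * n + p))" using y by (auto simp: R_def)
     ultimately show "1 / real (2 * n + p) - 1 / real (Suc (2 * n + p)) \<le> dist x y"
      using lip[of x y] by linarith
    qed
   qed
   moreover have "(\<Union>k<Suc n. R (2 * k + p)) = ?U \<union> R (2 * n + p)" by (auto simp: less_Suc_eq)
   ultimately have "houter d ?U + houter d (R (2 * n + p)) \<le> houter d (\<Union>k<Suc n. R (2 * k + p))"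
    by simp
   then show ?case unfolding sum.lessThan_Suc by (rule order_trans[OF add_right_mono[OF Suc]])
  qed (simp add: houter_empty)
  also have "\<dots> \<le> houter d A" by (intro houter_mono) (auto simp: R_def)
  finally show ?thesis .
 qed
 have total: "(\<Sum>k<n. houter d (R k)) \<le> 2 * houter d A" for n
 proof -
  have "(\<Sum>k<n. houter d (R k)) \<le> (\<Sum>k<2*n. houter d (R k))"
   by (intro sum_mono2) auto
  also have "\<dots> = (\<Sum>k<n. houter d (R (2 * k + 0))) + (\<Sum>k<n. houter d (R (2 * k + 1)))"
  proof (induction n)
   case (Suc n)
   have "2 * Suc n = Suc (Suc (2 * n))" by simp
   then show ?case by (simp only: sum.lessThan_Suc Suc) (simp add: ac_simps)
  qed simp
  also have "\<dots> \<le> houter d A + houter d A" by (intro add_mono sums)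
  finally show ?thesis by (simp add: mult_2)
 qed
 have "houter d (R k) \<le> houter d A" for k by (intro houter_mono) (auto simp: R_def)
 then have finR: "houter d (R k) < top" for k using fin by (auto intro: le_less_trans)
 define f where "f k = enn2real (houter d (R k))" for k
 have f: "houter d (R k) = ennreal (f k)" "f k \<ge> 0" for k
  using finR[of k] by (auto simp: f_def)
 obtain a where a: "houter d A = ennreal a" "a \<ge> 0" using fin by (cases "houter d A") auto
 have bnd: "(\<Sum>k<n. f k) \<le> 2 * a" for n
 proof -
  have "ennreal (\<Sum>k<n. f k) \<le> ennreal (2 * a)"
   using total[of n] a f by (simp add: sum_ennreal ennreal_mult)
  then show ?thesis using a by (simp add: ennreal_le_iff)
 qed
 have sm: "summable f"
  by (rule bounded_imp_summable[of f "2 * a"]) (auto simp only: lessThan_Suc_atMost[symmetric] bnd f(2))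
 have cover: "A - F \<subseteq> An n \<union> (\<Union>k. R (k + n))" for n
 proof
  fix x assume x: "x \<in> A - F"
  then have "infdist x F > 0" using pos by blast
  then obtain m0 where "inverse (real (Suc m0)) < infdist x F" using reals_Archimedean by blast
  then have ex: "\<exists>m. 1 / real (Suc m) \<le> infdist x F"
   unfolding inverse_eq_divide by (intro exI[of _ m0]) (rule less_imp_le)
  \<comment> \<open>The annulus containing x is found from the least m for which 1/(m+1) does not
    exceed the distance to F; its index is m - 1.\<close>
  define m where "m = (LEAST m. 1 / real (Suc m) \<le> infdist x F)"
  have m: "1 / real (Suc m) \<le> infdist x F" unfolding m_def using ex by (rule LeastI_ex)
  show "x \<in> An n \<union> (\<Union>k. R (k + n))"
  proof (cases "1 / real (Suc n) \<le> infdist x F")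
   case True
   then show ?thesis using x by (auto simp: An_def)
  next
   case False
   have "n < m"
   proof (rule ccontr)
    assume "\<not> n < m"
    then have "1 / real (Suc n) \<le> 1 / real (Suc m)" by (intro divide_left_mono) auto
    then show False using m False by linarith
   qed
   then obtain m' where m': "m = Suc m'" "n \<le> m'" by (cases m) auto
   have "\<not> 1 / real (Suc m') \<le> infdist x F"
    by (rule not_less_Least) (use m' in \<open>simp add: m_def\<close>)
   then have "x \<in> R m'" using m m' x by (auto simp: R_def)
   moreover have "m' = (m' - n) + n" using m' by simp
   ultimately show ?thesis by (metis UN_I UNIV_I UnI2)
  qed
 qed
 show ?thesis
 proof (rule ennreal_le_epsilon)
  fix e :: real assume "e > 0"
  then obtain n where n: "norm (\<Sum>i. f (i + n)) < e" using suminf_exist_split[OF _ sm] by blast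
  have "(\<Sum>k. houter d (R (k + n))) = ennreal (\<Sum>k. f (k + n))"
   unfolding f(1) using sm f(2) by (intro suminf_ennreal2) (auto simp: summable_iff_shift)
  also have "\<dots> \<le> ennreal e" using n by (intro ennreal_leI) simp
  finally have tail: "(\<Sum>k. houter d (R (k + n))) \<le> ennreal e" .
  have "houter d (A - F) \<le> houter d (An n \<union> (\<Union>k. R (k + n)))" by (rule houter_mono[OF cover])
  also have "\<dots> \<le> houter d (An n) + houter d (\<Union>k. R (k + n))" by (rule houter_Un)
  also have "\<dots> \<le> houter d (An n) + (\<Sum>k. houter d (R (k + n)))" by (intro add_left_mono houter_UN)
  also have "\<dots> \<le> houter d (An n) + ennreal e" by (intro add_left_mono tail)
  finally have 1: "houter d (A - F) \<le> houter d (An n) + ennreal e" .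
  have "houter d (A \<inter> F) + houter d (An n) \<le> houter d ((A \<inter> F) \<union> An n)"
  proof (rule houter_separated)
   fix x y assume "x \<in> A \<inter> F" "y \<in> An n"
   then show "1 / real (Suc n) \<le> dist x y" using lip[of y x] by (simp add: An_def dist_commute)
  qed simp
  also have "\<dots> \<le> houter d A" by (intro houter_mono) (auto simp: An_def)
  finally have 2: "houter d (A \<inter> F) + houter d (An n) \<le> houter d A" .
  have "houter d (A \<inter> F) + houter d (A - F) \<le> houter d (A \<inter> F) + (houter d (An n) + ennreal e)"
   by (intro add_left_mono 1)
  also have "\<dots> \<le> houter d A + ennreal e" using add_right_mono[OF 2, of "ennreal e"] by (simp only: add.assoc)
  finally show "houter d (A \<inter> F) + houter d (A - F) \<le> houter d A + ennreal e" .
 qed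
qed

text \<open>A metric outer measure is countably additive on Borel sets by Caratheodory's theorem, as
  closed sets are measurable. Without this \<open>measure_of\<close> would yield the zero measure,
  and every surface integral would vanish.\<close>

lemma measure_space_houter:
 "measure_space UNIV (sets borel) (houter d :: 'a::metric_space set \<Rightarrow> ennreal)"
proof -
 interpret P: sigma_algebra UNIV "Pow (UNIV :: 'a set)" by (rule sigma_algebra_Pow)
 let ?L = "lambda_system UNIV (Pow UNIV) (houter d :: 'a set \<Rightarrow> ennreal)"
 have "outer_measure_space (Pow UNIV) (houter d :: 'a set \<Rightarrow> ennreal)"
  by (auto simp: outer_measure_space_def positive_def houter_empty increasing_def houter_mono
    countably_subadditive_def houter_UN)
 then have ms: "measure_space UNIV ?L (houter d)" by (rule P.caratheodory_lemma)
 then interpret L: sigma_algebra UNIV ?L by (simp add: measure_space_def)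
 have "F \<in> ?L" if "closed F" for F
  unfolding P.lambda_system_eq
 proof (intro CollectI conjI ballI)
  fix A :: "'a set"
  have "houter d A \<le> houter d (A \<inter> F) + houter d (A - F)"
   using houter_Un[of d "A \<inter> F" "A - F"] by (simp add: Un_Diff_Int sup_commute)
  then show "houter d (A \<inter> F) + houter d (A - F) = houter d A"
   using houter_closed[OF that] by (intro antisym)
 qed simp
 then have "sigma_sets UNIV (Collect closed) \<subseteq> ?L"
  by (intro L.sigma_sets_subset) auto
 then have "sets borel \<subseteq> ?L" by (simp add: borel_eq_closed)
 moreover have "sigma_algebra UNIV (sets borel :: 'a set set)"
  using sets.sigma_algebra_axioms[of "borel :: 'a measure"] by simp
 ultimately have sub: "sets borel \<subseteq> ?L" and sa: "sigma_algebra UNIV (sets borel :: 'a set set)" .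
 have pos: "positive ?L (houter d)" and ca: "countably_additive ?L (houter d)"
  using ms by (auto simp: measure_space_def)
 have "countably_additive (sets borel) (houter d :: 'a set \<Rightarrow> ennreal)"
  unfolding countably_additive_def
 proof (intro allI impI)
  fix A :: "nat \<Rightarrow> 'a set"
  assume "range A \<subseteq> sets borel" "disjoint_family A" "\<Union> (range A) \<in> sets borel"
  then show "(\<Sum>i. houter d (A i)) = houter d (\<Union> (range A))"
   using ca[unfolded countably_additive_def, rule_format, of A] sub by blast
 qed
 then show ?thesis using sa pos by (simp add: measure_space_def positive_def)
qed

lemma hausdorff_measure_eq: "hausdorff_measure d = measure_of UNIV (sets borel) (houter d)"
proof -
 have "(\<lambda>A::'a set. SUP \<delta>\<in>{0<..}. hausdorff_pre d \<delta> A) = houter d"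
  by (rule ext) (simp add: houter_def)
 then show ?thesis by (simp only: hausdorff_measure_def)
qed

lemma emeasure_hausdorff_measure:
 assumes "A \<in> sets borel"
 shows "emeasure (hausdorff_measure d) A = houter d A"
 unfolding hausdorff_measure_eq
 by (rule emeasure_measure_of_sigma) (use measure_space_houter assms in \<open>auto simp only: measure_space_def\<close>)

lemma sets_hausdorff_measure [simp]: "sets (hausdorff_measure d :: 'a::metric_space measure) = sets borel"
 unfolding hausdorff_measure_eq using sets.sets_measure_of_eq[of "borel :: 'a measure"]
 by (simp add: sets_measure_of_conv)

lemma space_hausdorff_measure [simp]: "space (hausdorff_measure d) = UNIV"
 unfolding hausdorff_measure_def by (rule space_measure_of_conv)

section \<open>Slices of a bounded open set\<close>

text \<open>A component is convex and open, hence an open interval; its end points lie on the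
  frontier because the frontier of a component is part of that of the set.\<close>

lemma open_component_real:
 fixes U :: "real set"
 assumes "open U" "bounded U" "C \<in> components U"
 obtains a b where "a < b" "C = {a<..<b}" "a \<in> frontier U" "b \<in> frontier U"
proof -
 have C: "open C" "connected C" "C \<noteq> {}" "C \<subseteq> U"
  using assms open_components in_components_connected in_components_nonempty in_components_subset by blast+
 have bC: "bounded C" using C(4) assms(2) bounded_subset by blast
 have ivl: "x \<in> C" if "a \<in> C" "b \<in> C" "a \<le> x" "x \<le> b" for a b x
  using C(2) that by (metis connected_contains_Icc subsetD atLeastAtMost_iff)
 define a b where "a = Inf C" and "b = Sup C"
 have ba: "bdd_below C" "bdd_above C" using bC bounded_imp_bdd_below bounded_imp_bdd_above by auto
 have eq: "C = {a<..<b}"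
 proof (intro equalityI subsetI)
  fix x assume x: "x \<in> C"
  then obtain e where e: "e > 0" "ball x e \<subseteq> C" using C(1) openE by blast
  then have "x - e / 2 \<in> C" "x + e / 2 \<in> C" by (auto simp: dist_real_def subset_eq)
  then have "a \<le> x - e / 2" "x + e / 2 \<le> b" using ba by (auto simp: a_def b_def intro: cInf_lower cSup_upper)
  then show "x \<in> {a<..<b}" using e by auto
 next
  fix x assume x: "x \<in> {a<..<b}"
  then obtain y z where "y \<in> C" "y < x" "z \<in> C" "x < z"
   using cInf_less_iff[OF C(3) ba(1)] less_cSup_iff[OF C(3) ba(2)] by (auto simp: a_def b_def)
  then show "x \<in> C" using ivl less_imp_le by blast
 qed
 have ab: "a < b" using eq C(3) by auto
 have "frontier C \<subseteq> frontier U" using assms(3) by (rule frontier_of_components_subset)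
 moreover have "frontier C = {a, b}"
  unfolding eq frontier_def using ab by (auto simp: interior_open)
 ultimately show ?thesis using that[OF ab eq] by blast
qed

lemma set_integrable_bounded_continuous:
 fixes f :: "real \<Rightarrow> real"
 assumes "bounded A" "A \<in> sets borel" "continuous_on UNIV f"
 shows "set_integrable lborel A f"
proof -
 obtain c where c: "A \<subseteq> cbox (-c) c" using bounded_subset_cbox_symmetric[OF assms(1)] by blast
 have "set_integrable lborel (cbox (-c) c) f"
  by (rule borel_integrable_compact[folded set_integrable_def])
   (use assms(3) continuous_on_subset in auto)
 then show ?thesis by (rule set_integrable_subset) (use c assms in auto)
qed

lemma set_integral_FTC_open:
 fixes g :: "real \<Rightarrow> real"
 assumes "a \<le> b" "\<And>x. (g has_real_derivative g' x) (at x)" "continuous_on UNIV g'"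
 shows "(LINT x:{a<..<b}|lborel. g' x) = g b - g a"
proof -
 have "(LINT x|lborel. g' x * indicator {a..b} x) = g b - g a"
 proof (rule integral_FTC_Icc_real)
  show "isCont g' x" for x using assms(3) by (simp add: continuous_on_eq_continuous_at)
 qed (use assms in auto)
 moreover have "(LINT x:{a<..<b}|lborel. g' x) = (LINT x|lborel. g' x * indicator {a..b} x)"
  unfolding set_lebesgue_integral_def
 proof (rule integral_cong_AE)
  have m: "g' \<in> borel_measurable borel" using assms(3) by (rule borel_measurable_continuous_onI)
  then show "(\<lambda>x. indicator {a<..<b} x *\<^sub>R g' x) \<in> borel_measurable lborel"
   "(\<lambda>x. g' x * indicator {a..b} x) \<in> borel_measurable lborel" by measurable
  have "AE x in lborel. x \<noteq> a" "AE x in lborel. x \<noteq> b" by (auto intro: AE_lborel_singleton)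
  then show "AE x in lborel. indicator {a<..<b} x *\<^sub>R g' x = g' x * indicator {a..b} x"
   by eventually_elim (auto simp: indicator_def)
 qed
 ultimately show ?thesis by simp
qed

text \<open>On each component the integral is a difference of two end point values. A frontier point
  is the left end of at most one component and the right end of at most one, hence the factor
  2.\<close>

lemma integral_deriv_le_boundary:
 fixes g :: "real \<Rightarrow> real"
 assumes U: "open U" "bounded U" and fin: "finite (frontier U)"
  and g: "\<And>x. (g has_real_derivative g' x) (at x)" "continuous_on UNIV g'"
 shows "\<bar>LINT x:U|lborel. g' x\<bar> \<le> 2 * (\<Sum>z\<in>frontier U. \<bar>g z\<bar>)"
proof -
 have "\<forall>C\<in>components U. \<exists>a b. a < b \<and> C = {a<..<b} \<and> a \<in> frontier U \<and> b \<in> frontier U"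
  using open_component_real[OF U] by metis
 then obtain a b where ab: "\<And>C. C \<in> components U \<Longrightarrow> a C < b C \<and> C = {a C<..<b C} \<and> a C \<in> frontier U \<and> b C \<in> frontier U"
  by metis
 have disj: "C = D" if CD: "C \<in> components U" "D \<in> components U" "C \<inter> D \<noteq> {}" for C D
  using pairwise_disjoint_components[of U] CD by (auto simp: pairwise_def)
 have injb: "inj_on b (components U)"
 proof (rule inj_onI)
  fix C D assume CD: "C \<in> components U" "D \<in> components U" "b C = b D"
  have lt: "max (a C) (a D) < b C" using ab[OF CD(1)] ab[OF CD(2)] CD(3) by auto
  obtain x where "max (a C) (a D) < x" "x < b C" using dense[OF lt] by blast
  then have "x \<in> C \<inter> D" using ab[OF CD(1)] ab[OF CD(2)] CD(3) by auto
  then show "C = D" using disj CD by blast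
 qed
 have inja: "inj_on a (components U)"
 proof (rule inj_onI)
  fix C D assume CD: "C \<in> components U" "D \<in> components U" "a C = a D"
  have lt: "a C < min (b C) (b D)" using ab[OF CD(1)] ab[OF CD(2)] CD(3) by auto
  obtain x where "a C < x" "x < min (b C) (b D)" using dense[OF lt] by blast
  then have "x \<in> C \<inter> D" using ab[OF CD(1)] ab[OF CD(2)] CD(3) by auto
  then show "C = D" using disj CD by blast
 qed
 have finC: "finite (components U)"
  by (rule finite_imageD[OF finite_subset[OF _ fin] injb]) (use ab in auto)
 have "(LINT x:(\<Union>C\<in>components U. C)|lborel. g' x) = (\<Sum>C\<in>components U. LINT x:C|lborel. g' x)"
 proof (rule set_integral_finite_Union[OF finC])
  show "disjoint_family_on (\<lambda>C. C) (components U)" using disj by (auto simp: disjoint_family_on_def)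
  fix C assume C: "C \<in> components U"
  then have "open C" using U(1) open_components by blast
  then show "C \<in> sets lborel" by simp
  moreover have "bounded C" using U(2) C in_components_subset bounded_subset by blast
  ultimately show "set_integrable lborel C g'"
   using g(2) by (intro set_integrable_bounded_continuous) auto
 qed
 also have "\<dots> = (\<Sum>C\<in>components U. g (b C) - g (a C))"
 proof (rule sum.cong)
  fix C assume "C \<in> components U"
  from ab[OF this] have "C = {a C<..<b C}" "a C \<le> b C" by auto
  then show "(LINT x:C|lborel. g' x) = g (b C) - g (a C)"
   using set_integral_FTC_open[OF \<open>a C \<le> b C\<close> g] by simp
 qed simp
 finally have "\<bar>LINT x:U|lborel. g' x\<bar> \<le> (\<Sum>C\<in>components U. \<bar>g (b C)\<bar> + \<bar>g (a C)\<bar>)"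
  by (auto intro!: order_trans[OF sum_abs] sum_mono)
 also have "\<dots> = (\<Sum>z\<in>b ` components U. \<bar>g z\<bar>) + (\<Sum>z\<in>a ` components U. \<bar>g z\<bar>)"
  by (simp add: sum.reindex injb inja sum.distrib)
 also have "\<dots> \<le> (\<Sum>z\<in>frontier U. \<bar>g z\<bar>) + (\<Sum>z\<in>frontier U. \<bar>g z\<bar>)"
  by (intro add_mono sum_mono2 fin) (use ab in auto)
 finally show ?thesis by simp
qed

text \<open>From s one integrates back to the left end point of its component, which lies on the
  frontier.\<close>

lemma sup_le_boundary_plus_integral:
 fixes g :: "real \<Rightarrow> real"
 assumes U: "open U" "bounded U" and fin: "finite (frontier U)"
  and g: "\<And>x. (g has_real_derivative g' x) (at x)" "continuous_on UNIV g'" and s: "s \<in> U"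
 shows "\<bar>g s\<bar> \<le> (\<Sum>z\<in>frontier U. \<bar>g z\<bar>) + (LINT x:U|lborel. \<bar>g' x\<bar>)"
proof -
 let ?C = "connected_component_set U s"
 have C: "?C \<in> components U" using s by (auto simp: components_def)
 obtain a b where ab: "a < b" "?C = {a<..<b}" "a \<in> frontier U" "b \<in> frontier U"
  using open_component_real[OF U C] by blast
 have "s \<in> {a<..<b}" using s ab(2) connected_component_refl by blast
 then have as: "a < s" "s < b" by auto
 have sub: "{a<..<s} \<subseteq> U" using ab(2) as connected_component_subset[of U s] by auto
 have cont: "continuous_on UNIV (\<lambda>x. \<bar>g' x\<bar>)" using g(2) by (intro continuous_intros)
 have ai: "set_integrable lborel U (\<lambda>x. \<bar>g' x\<bar>)"
  using U cont by (intro set_integrable_bounded_continuous) auto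
 have "g s = g a + (LINT x:{a<..<s}|lborel. g' x)"
  using set_integral_FTC_open[OF _ g, of a s] as by simp
 then have "\<bar>g s\<bar> \<le> \<bar>g a\<bar> + \<bar>LINT x:{a<..<s}|lborel. g' x\<bar>" by simp
 also have "\<bar>LINT x:{a<..<s}|lborel. g' x\<bar> \<le> (LINT x:{a<..<s}|lborel. \<bar>g' x\<bar>)"
  unfolding set_lebesgue_integral_def by (rule order_trans[OF integral_abs_bound]) (simp add: abs_mult)
 also have "\<dots> \<le> (LINT x:U|lborel. \<bar>g' x\<bar>)"
  unfolding set_lebesgue_integral_def
 proof (rule integral_mono)
  show "integrable lborel (\<lambda>x. indicator {a<..<s} x *\<^sub>R \<bar>g' x\<bar>)"
   using set_integrable_bounded_continuous[of "{a<..<s}" "\<lambda>x. \<bar>g' x\<bar>"] cont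
   by (simp add: set_integrable_def)
  show "integrable lborel (\<lambda>x. indicator U x *\<^sub>R \<bar>g' x\<bar>)" using ai by (simp add: set_integrable_def)
  show "indicator {a<..<s} x *\<^sub>R \<bar>g' x\<bar> \<le> indicator U x *\<^sub>R \<bar>g' x\<bar>" for x
   using sub by (auto simp: indicator_def)
 qed
 also have "\<bar>g a\<bar> \<le> (\<Sum>z\<in>frontier U. \<bar>g z\<bar>)"
  using fin ab(3) by (intro member_le_sum) auto
 finally show ?thesis by simp
qed

section \<open>Cartesian coordinates\<close>

text \<open>Product Lebesgue measure on functions of a set of coordinates; in contrast to vectors,
  these allow splitting off one coordinate at a time.\<close>

abbreviation PiR :: "'n set \<Rightarrow> ('n \<Rightarrow> real) measure" where
 "PiR I \<equiv> Pi\<^sub>M I (\<lambda>_. lborel)"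

interpretation PR: product_sigma_finite "\<lambda>_::'n. lborel :: real measure"
 by standard

lemma measurable_vec_lambda:
 assumes "\<And>i. (\<lambda>x. f x i) \<in> borel_measurable M"
 shows "(\<lambda>x. vec_lambda (f x) :: real^'n::finite) \<in> borel_measurable M"
proof (rule borel_measurable_euclidean_space[THEN iffD2], rule ballI)
 fix i :: "real^'n" assume "i \<in> Basis"
 then obtain k where k: "i = axis k 1" by (auto simp: Basis_vec_def)
 show "(\<lambda>x. vec_lambda (f x) \<bullet> i) \<in> borel_measurable M"
  unfolding k inner_axis vec_lambda_beta using assms[of k] by simp
qed

lemma measurable_component_PiR: "i \<in> I \<Longrightarrow> (\<lambda>f. f i) \<in> borel_measurable (PiR I)"
 using measurable_component_singleton[of i I "\<lambda>_. lborel :: real measure"] by simp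

lemma measurable_vec_lambda_PiR: "vec_lambda \<in> PiR UNIV \<rightarrow>\<^sub>M (borel :: (real^'n::finite) measure)"
 by (rule measurable_vec_lambda) (rule measurable_component_PiR, simp)

text \<open>Both measures give a box the product of its side lengths, which determines Lebesgue
  measure.\<close>

lemma lborel_vec:
 "(lborel :: (real^'n::finite) measure) = distr (PiR UNIV) borel vec_lambda"
proof (rule lborel_eqI)
 fix l u :: "real^'n" assume lu: "\<And>b. b \<in> Basis \<Longrightarrow> l \<bullet> b \<le> u \<bullet> b"
 then have le: "l $ i \<le> u $ i" for i by (force simp: Basis_vec_def inner_axis)
 have "emeasure (distr (PiR UNIV) borel vec_lambda) (box l u) =
   emeasure (PiR UNIV) (vec_lambda -` box l u \<inter> space (PiR UNIV))"
  by (rule emeasure_distr[OF measurable_vec_lambda_PiR]) simp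
 also have "vec_lambda -` box l u \<inter> space (PiR UNIV) = Pi\<^sub>E UNIV (\<lambda>i. {l $ i<..<u $ i})"
  by (auto simp: space_PiM mem_box_cart PiE_def Pi_iff)
 also have "emeasure (PiR UNIV) \<dots> = (\<Prod>i\<in>UNIV. emeasure lborel {l $ i<..<u $ i})"
  by (rule PR.emeasure_PiM) auto
 also have "\<dots> = (\<Prod>i\<in>UNIV. ennreal (u $ i - l $ i))"
  using le by simp
 also have "\<dots> = ennreal (\<Prod>i\<in>UNIV. u $ i - l $ i)"
  using le by (intro prod_ennreal) simp
 also have "(\<Prod>i\<in>UNIV. u $ i - l $ i) = (\<Prod>b\<in>Basis. (u - l) \<bullet> b)"
 proof -
  have B: "Basis = (\<lambda>i. axis i 1 :: real^'n) ` UNIV" by (auto simp: Basis_vec_def)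
  have inj: "inj (\<lambda>i. axis i 1 :: real^'n)" by (auto simp: inj_def axis_eq_axis)
  show ?thesis unfolding B prod.reindex[OF inj] o_def by (simp add: inner_axis)
 qed
 finally show "emeasure (distr (PiR UNIV) borel vec_lambda) (box l u) = ennreal (\<Prod>b\<in>Basis. (u - l) \<bullet> b)" .
qed simp

definition slice :: "'n \<Rightarrow> ('n \<Rightarrow> real) \<Rightarrow> real \<Rightarrow> real^'n::finite" where
 "slice j f s = vec_lambda (f(j := s))"

lemma slice_nth: "slice j f s $ i = (if i = j then s else f i)"
 by (simp add: slice_def)

lemma slice_eq: "slice j f s = slice j f 0 + s *\<^sub>R axis j 1"
proof -
 have "slice j f s $ i = (slice j f 0 + s *\<^sub>R axis j 1) $ i" for i
  by (cases "i = j") (simp_all add: slice_nth axis_def)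
 then show ?thesis unfolding vec_eq_iff by blast
qed

lemma measurable_slice_pair:
 "(\<lambda>(f, s). slice j f s) \<in> PiR (UNIV - {j}) \<Otimes>\<^sub>M lborel \<rightarrow>\<^sub>M (borel :: (real^'n::finite) measure)"
proof -
 have "(\<lambda>p. vec_lambda ((fst p)(j := snd p)) :: real^'n) \<in> borel_measurable (PiR (UNIV - {j}) \<Otimes>\<^sub>M lborel)"
 proof (rule measurable_vec_lambda)
  fix i
  show "(\<lambda>p. ((fst p)(j := snd p)) i) \<in> borel_measurable (PiR (UNIV - {j}) \<Otimes>\<^sub>M lborel)"
  proof (cases "i = j")
   case False
   then have "(\<lambda>f. f i) \<in> borel_measurable (PiR (UNIV - {j}))" by (intro measurable_component_PiR) simp
   from measurable_compose[OF measurable_fst this]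
   have "(\<lambda>p. fst p i) \<in> borel_measurable (PiR (UNIV - {j}) \<Otimes>\<^sub>M lborel)" .
   then show ?thesis using False by simp
  qed simp
 qed
 then show ?thesis by (simp add: slice_def split_beta')
qed

lemma nn_integral_slice:
 fixes F :: "real^'n::finite \<Rightarrow> ennreal"
 assumes "F \<in> borel_measurable borel"
 shows "(\<integral>\<^sup>+x. F x \<partial>lborel) = (\<integral>\<^sup>+f. (\<integral>\<^sup>+s. F (slice j f s) \<partial>lborel) \<partial>PiR (UNIV - {j}))"
proof -
 have i: "insert j (UNIV - {j}) = UNIV" by auto
 have "(\<integral>\<^sup>+x. F x \<partial>lborel) = (\<integral>\<^sup>+f. F (vec_lambda f) \<partial>PiR UNIV)"
  using nn_integral_distr[OF measurable_vec_lambda_PiR, of F] assms by (simp flip: lborel_vec)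
 also have "\<dots> = (\<integral>\<^sup>+f. (\<integral>\<^sup>+s. F (vec_lambda (f(j := s))) \<partial>lborel) \<partial>PiR (UNIV - {j}))"
  using PR.product_nn_integral_insert[of "UNIV - {j}" j "\<lambda>f. F (vec_lambda f)"]
   measurable_compose[OF measurable_vec_lambda_PiR assms] by (simp add: i)
 finally show ?thesis by (simp add: slice_def)
qed

lemma integral_slice:
 fixes F :: "real^'n::finite \<Rightarrow> real"
 assumes "integrable lborel F"
 shows "(LINT x|lborel. F x) = (LINT f|PiR (UNIV - {j}). (LINT s|lborel. F (slice j f s)))"
proof -
 have i: "insert j (UNIV - {j}) = UNIV" by auto
 have Fm: "F \<in> borel_measurable borel" using assms by auto
 have "integrable (PiR UNIV) (\<lambda>f. F (vec_lambda f))"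
  using integrable_distr_eq[OF measurable_vec_lambda_PiR Fm] assms by (simp flip: lborel_vec)
 moreover have "(LINT x|lborel. F x) = (LINT f|PiR UNIV. F (vec_lambda f))"
  using integral_distr[OF measurable_vec_lambda_PiR Fm] by (simp flip: lborel_vec)
 ultimately show ?thesis
  using PR.product_integral_insert[of "UNIV - {j}" j "\<lambda>f. F (vec_lambda f)"] by (simp add: i slice_def)
qed

section \<open>The boundary of a polyhedral domain\<close>

lemma interior_Inter_finite: "finite F \<Longrightarrow> interior (\<Inter>F) = \<Inter>(interior ` F)"
 by (induction F rule: finite_induct) simp_all

text \<open>A frontier point of a finite intersection of half-spaces fails to be interior to one of
  them, hence lies on its bounding hyperplane.\<close>

lemma polytope_frontier_hyperplanes:
 fixes P :: "'a::euclidean_space set"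
 assumes "polytope P"
 shows "\<exists>H. finite H \<and> (\<forall>(a, b)\<in>H. a \<noteq> (0::'a)) \<and> frontier P \<subseteq> (\<Union>(a, b)\<in>H. {x. a \<bullet> x = b})"
proof -
 obtain F where F: "finite F" "P = \<Inter>F" "\<And>h. h \<in> F \<Longrightarrow> \<exists>a b. a \<noteq> 0 \<and> h = {x. a \<bullet> x \<le> b}"
  using polytope_imp_polyhedron[OF assms] unfolding polyhedron_def by blast
 then obtain a b where ab: "\<And>h. h \<in> F \<Longrightarrow> a h \<noteq> 0 \<and> h = {x. a h \<bullet> x \<le> b h}" by metis
 have "frontier P \<subseteq> (\<Union>h\<in>F. {x. a h \<bullet> x = b h})"
 proof
  fix x assume x: "x \<in> frontier P"
  have "closed P" using assms polytope_imp_closed by blast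
  then have "x \<in> P" "x \<notin> interior P" using x by (auto simp: frontier_def)
  then obtain h where h: "h \<in> F" "x \<notin> interior h"
   using interior_Inter_finite[OF F(1)] F(2) by auto
  have "x \<in> h" using \<open>x \<in> P\<close> F(2) h(1) by blast
  have "interior {x. a h \<bullet> x \<le> b h} = {x. a h \<bullet> x < b h}"
   using ab[OF h(1)] by (intro interior_halfspace_le) auto
  then have "interior h = {x. a h \<bullet> x < b h}" using ab[OF h(1)] by simp
  moreover have "a h \<bullet> x \<le> b h" using \<open>x \<in> h\<close> ab[OF h(1)] by auto
  ultimately have "a h \<bullet> x = b h" using h(2) by auto
  then show "x \<in> (\<Union>h\<in>F. {x. a h \<bullet> x = b h})" using h(1) by blast
 qed
 then show ?thesis using ab F(1) by (intro exI[of _ "(\<lambda>h. (a h, b h)) ` F"]) auto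
qed

text \<open>Excludes slits, which would belong to the frontier but be interior to the union of the
  polytopes: on the far side of the Lipschitz graph there are open sets disjoint from
  \<open>\<Omega>\<close> arbitrarily close to x.\<close>

lemma lipschitz_boundary_frontier:
 fixes \<Omega> :: "'a::euclidean_space set"
 assumes "open \<Omega>" "lipschitz_boundary \<Omega>" "x \<in> frontier \<Omega>"
 shows "x \<notin> interior (closure \<Omega>)"
proof
 assume "x \<in> interior (closure \<Omega>)"
 then obtain \<epsilon> where \<epsilon>: "\<epsilon> > 0" "ball x \<epsilon> \<subseteq> closure \<Omega>" by (meson mem_interior)
 obtain \<rho> L e and f :: "'a \<Rightarrow> real" where loc: "\<rho> > 0" "norm e = 1" "lipschitz_on L UNIV f"
  "\<And>y. y \<in> ball x \<rho> \<Longrightarrow> y \<in> \<Omega> \<longleftrightarrow> f (y - (y \<bullet> e) *\<^sub>R e) < y \<bullet> e"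
  using assms(2,3) unfolding lipschitz_boundary_def by blast
 have "x \<notin> \<Omega>" using assms by (simp add: frontier_def interior_open)
 then have fx: "f (x - (x \<bullet> e) *\<^sub>R e) \<ge> x \<bullet> e" using loc(4)[of x] loc(1) by auto
 define d where "d = min \<epsilon> \<rho> / 2"
 have d: "d > 0" "d < \<epsilon>" "d < \<rho>" using \<epsilon> loc by (auto simp: d_def)
 define y where "y = x - d *\<^sub>R e"
 have ee: "e \<bullet> e = 1" using loc(2) by (simp add: norm_eq_1)
 have dy: "dist x y = d" using d loc(2) by (simp add: y_def dist_norm)
 have ye: "y \<bullet> e = x \<bullet> e - d" by (simp add: y_def inner_diff_left ee)
 have "y - (y \<bullet> e) *\<^sub>R e = x - (x \<bullet> e) *\<^sub>R e" unfolding ye by (simp add: y_def algebra_simps)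
 then have fy: "f (y - (y \<bullet> e) *\<^sub>R e) > y \<bullet> e" using fx ye d by simp
 have cf: "continuous_on UNIV f" using loc(3) by (rule lipschitz_on_continuous_on)
 have "continuous_on UNIV (\<lambda>z. f (z - (z \<bullet> e) *\<^sub>R e) - z \<bullet> e)"
  by (intro continuous_intros continuous_on_compose2[OF cf]) auto
 then have op: "open {z. 0 < f (z - (z \<bullet> e) *\<^sub>R e) - z \<bullet> e}"
  by (intro open_Collect_less) (auto intro: continuous_intros)
 let ?W = "{z. 0 < f (z - (z \<bullet> e) *\<^sub>R e) - z \<bullet> e} \<inter> ball x \<rho>"
 have "open ?W" "y \<in> ?W" using op fy dy d by auto
 moreover have "?W \<inter> \<Omega> = {}" using loc(4) by fastforce
 ultimately have "y \<notin> closure \<Omega>" using open_Int_closure_eq_empty[of ?W \<Omega>] by blast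
 then show False using \<epsilon>(2) dy d by auto
qed

text \<open>A frontier point is not interior to the union of the polytopes, so it is not interior to
  the polytope that contains it and lies on the frontier of that polytope.\<close>

lemma polyhedral_frontier_hyperplanes:
 fixes \<Omega> :: "'a::euclidean_space set"
 assumes "polyhedral_lipschitz_domain \<Omega>"
 shows "\<exists>H. finite H \<and> (\<forall>(a, b)\<in>H. a \<noteq> (0::'a)) \<and> frontier \<Omega> \<subseteq> (\<Union>(a, b)\<in>H. {x. a \<bullet> x = b})"
proof -
 obtain \<P> where \<P>: "finite \<P>" "\<And>P. P \<in> \<P> \<Longrightarrow> polytope P" "closure \<Omega> = \<Union>\<P>"
  using assms unfolding polyhedral_lipschitz_domain_def by blast
 have "\<forall>P\<in>\<P>. \<exists>H. finite H \<and> (\<forall>(a, b)\<in>H. a \<noteq> (0::'a)) \<and> frontier P \<subseteq> (\<Union>(a, b)\<in>H. {x. a \<bullet> x = b})"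
  by (intro ballI polytope_frontier_hyperplanes \<P>(2))
 then obtain H where H: "\<And>P. P \<in> \<P> \<Longrightarrow> finite (H P) \<and> (\<forall>(a, b)\<in>H P. a \<noteq> (0::'a)) \<and>
   frontier P \<subseteq> (\<Union>(a, b)\<in>H P. {x. a \<bullet> x = b})" by metis
 have "frontier \<Omega> \<subseteq> (\<Union>P\<in>\<P>. frontier P)"
 proof
  fix x assume x: "x \<in> frontier \<Omega>"
  then have "x \<notin> interior (closure \<Omega>)"
   using assms by (intro lipschitz_boundary_frontier) (simp_all add: polyhedral_lipschitz_domain_def)
  moreover have "x \<in> closure \<Omega>" using x by (simp add: frontier_def)
  ultimately obtain P where P: "P \<in> \<P>" "x \<in> P" "x \<notin> interior (\<Union>\<P>)"
   unfolding \<P>(3) by blast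
  then have "x \<notin> interior P" using interior_mono[of P "\<Union>\<P>"] by blast
  then have "x \<in> frontier P" using P closure_subset by (auto simp: frontier_def)
  then show "x \<in> (\<Union>P\<in>\<P>. frontier P)" using P by blast
 qed
 also have "\<dots> \<subseteq> (\<Union>P\<in>\<P>. (\<Union>(a, b)\<in>H P. {x. a \<bullet> x = b}))"
  using H by (intro UN_mono order_refl) blast
 also have "\<dots> = (\<Union>(a, b)\<in>(\<Union>P\<in>\<P>. H P). {x. a \<bullet> x = b})"
  by (rule UN_UN_flatten[symmetric])
 finally show ?thesis using \<P>(1) H by (intro exI[of _ "\<Union>P\<in>\<P>. H P"]) auto
qed

lemma coordinates_in_small_box:
 fixes C :: "(real^'n::finite) set"
 assumes "bounded C" "C \<noteq> {}"
 obtains l u where "\<And>x k. x \<in> C \<Longrightarrow> x $ k \<in> {l k..u k}" "\<And>k. 0 \<le> u k - l k" "\<And>k. u k - l k \<le> diameter C"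
proof -
 let ?S = "\<lambda>k. (\<lambda>x. x $ k) ` C"
 have b: "bounded (?S k)" for k using assms(1) bounded_linear_image bounded_linear_vec_nth by blast
 have bd: "bdd_below (?S k)" "bdd_above (?S k)" for k
  using b bounded_imp_bdd_below bounded_imp_bdd_above by auto
 have ne: "?S k \<noteq> {}" for k using assms(2) by simp
 have close: "x $ k - y $ k \<le> diameter C" if "x \<in> C" "y \<in> C" for x y k
 proof -
  have "\<bar>(x - y) $ k\<bar> \<le> norm (x - y)" by (rule component_le_norm_cart)
  also have "\<dots> \<le> diameter C" using diameter_bounded_bound[OF assms(1) that] by (simp add: dist_norm)
  finally show ?thesis by simp
 qed
 show ?thesis
 proof (rule that[of "\<lambda>k. Inf (?S k)" "\<lambda>k. Sup (?S k)"])
  show in_S: "x $ k \<in> {Inf (?S k)..Sup (?S k)}" if "x \<in> C" for x k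
   using bd that by (auto intro: cInf_lower cSup_upper)
  show "0 \<le> Sup (?S k) - Inf (?S k)" for k
  proof -
   obtain x where "x \<in> C" using assms(2) by blast
   from in_S[OF this, of k] show ?thesis by auto
  qed
  show "Sup (?S k) - Inf (?S k) \<le> diameter C" for k
  proof -
   have "Sup (?S k) - diameter C \<le> y $ k" if y: "y \<in> C" for y
   proof -
    have "Sup (?S k) \<le> y $ k + diameter C"
     using close[OF _ y, of _ k] by (intro cSup_least[OF ne]) force
    then show ?thesis by simp
   qed
   then have "Sup (?S k) - diameter C \<le> Inf (?S k)" by (intro cInf_greatest[OF ne]) auto
   then show ?thesis by simp
  qed
 qed
qed

text \<open>Projection along a coordinate axis does not increase the diameter, so Hausdorff measure
 dominates the Lebesgue measure of the parameters of a graph.\<close>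

lemma graph_measure_le_houter:
 fixes \<gamma> :: "('n::finite \<Rightarrow> real) \<Rightarrow> real^'n"
 assumes \<gamma>: "\<gamma> \<in> PiR (UNIV - {j}) \<rightarrow>\<^sub>M borel" and nth: "\<And>f k. k \<noteq> j \<Longrightarrow> \<gamma> f $ k = f k"
  and A: "A \<in> sets borel"
 shows "emeasure (distr (PiR (UNIV - {j})) borel \<gamma>) A \<le> houter (CARD('n) - 1) A"
proof -
 let ?R = "UNIV - {j}" and ?d = "CARD('n) - 1"
 have cR: "card ?R = ?d" by (simp add: card_Diff_subset)
 have "emeasure (PiR ?R) (\<gamma> -` A \<inter> space (PiR ?R)) \<le> (\<Sum>i. hterm ?d (C i))"
  if C: "C \<in> hcover 1 A" for C
 proof -
  have "\<forall>i. \<exists>B\<in>sets (PiR ?R). \<gamma> -` C i \<inter> space (PiR ?R) \<subseteq> B \<and> emeasure (PiR ?R) B \<le> hterm ?d (C i)"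
  proof
   fix i
   show "\<exists>B\<in>sets (PiR ?R). \<gamma> -` C i \<inter> space (PiR ?R) \<subseteq> B \<and> emeasure (PiR ?R) B \<le> hterm ?d (C i)"
   proof (cases "C i = {}")
    case True
    then show ?thesis by (intro bexI[of _ "{}"]) auto
   next
    case False
    have bC: "bounded (C i)" using C by (auto simp: hcover_def)
    obtain l u where lu: "\<And>x k. x \<in> C i \<Longrightarrow> x $ k \<in> {l k..u k}" "\<And>k. 0 \<le> u k - l k"
      "\<And>k. u k - l k \<le> diameter (C i)"
     using coordinates_in_small_box[OF bC False] by metis
    let ?B = "Pi\<^sub>E ?R (\<lambda>k. {l k..u k})"
    have "emeasure (PiR ?R) ?B = (\<Prod>k\<in>?R. emeasure lborel {l k..u k})"
     by (rule PR.emeasure_PiM) auto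
    also have "\<dots> = (\<Prod>k\<in>?R. ennreal (u k - l k))" using lu(2) by (intro prod.cong) auto
    also have "\<dots> = ennreal (\<Prod>k\<in>?R. u k - l k)" using lu(2) by (intro prod_ennreal)
    also have "\<dots> \<le> ennreal (\<Prod>k\<in>?R. diameter (C i))"
     by (intro ennreal_leI prod_mono conjI lu(2,3))
    also have "\<dots> = ennreal (diameter (C i) ^ ?d)" by (simp only: prod_constant cR)
    finally have "emeasure (PiR ?R) ?B \<le> hterm ?d (C i)" using False by (simp add: hterm_def)
    moreover have "\<gamma> -` C i \<inter> space (PiR ?R) \<subseteq> ?B"
    proof
     fix f assume f: "f \<in> \<gamma> -` C i \<inter> space (PiR ?R)"
     then have "f k \<in> {l k..u k}" if "k \<noteq> j" for k using lu(1)[of "\<gamma> f" k] nth[OF that, of f] by simp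
     then show "f \<in> ?B" using f by (auto simp: space_PiM PiE_def)
    qed
    moreover have "?B \<in> sets (PiR ?R)" by (intro sets_PiM_I_finite) auto
    ultimately show ?thesis by blast
   qed
  qed
  then obtain B where B: "\<And>i. B i \<in> sets (PiR ?R)" "\<And>i. \<gamma> -` C i \<inter> space (PiR ?R) \<subseteq> B i"
   "\<And>i. emeasure (PiR ?R) (B i) \<le> hterm ?d (C i)" by metis
  have "emeasure (PiR ?R) (\<gamma> -` A \<inter> space (PiR ?R)) \<le> emeasure (PiR ?R) (\<Union>i. B i)"
  proof (rule emeasure_mono)
   have "A \<subseteq> (\<Union>i. C i)" using C by (simp add: hcover_def)
   then show "\<gamma> -` A \<inter> space (PiR ?R) \<subseteq> (\<Union>i. B i)" using B(2) by blast
  qed (use B(1) in auto)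
  also have "\<dots> \<le> (\<Sum>i. emeasure (PiR ?R) (B i))" using B(1) by (intro emeasure_subadditive_countably) auto
  also have "\<dots> \<le> (\<Sum>i. hterm ?d (C i))" using B(3) by (intro suminf_le) auto
  finally show ?thesis .
 qed
 then have "emeasure (PiR ?R) (\<gamma> -` A \<inter> space (PiR ?R)) \<le> hausdorff_pre ?d 1 A"
  unfolding hausdorff_pre_eq by (rule INF_greatest)
 \<comment> \<open>The outer measure is the supremum over all mesh sizes, so covers of mesh size 1
   already give a lower bound for it.\<close>
 also have "\<dots> \<le> houter ?d A" unfolding houter_def by (rule SUP_upper) simp
 finally show ?thesis using emeasure_distr[OF \<gamma> A] by simp
qed

lemma surface_nn_integral:
 fixes \<Omega> :: "(real^'n::finite) set"
 assumes "F \<in> borel_measurable borel"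
 shows "(\<integral>\<^sup>+x. F x \<partial>surface_measure \<Omega>) = (\<integral>\<^sup>+x. F x * indicator (frontier \<Omega>) x \<partial>hausdorff_measure (CARD('n) - 1))"
proof -
 have "frontier \<Omega> \<inter> space (hausdorff_measure (CARD('n) - 1)) \<in> sets (hausdorff_measure (CARD('n) - 1))"
  by (simp only: space_hausdorff_measure sets_hausdorff_measure Int_UNIV_right borel_closed frontier_closed)
 then show ?thesis unfolding surface_measure_def by (rule nn_integral_restrict_space)
qed

lemma graph_nn_integral_le_surface:
 fixes \<gamma> :: "('n::finite \<Rightarrow> real) \<Rightarrow> real^'n"
 assumes \<gamma>: "\<gamma> \<in> PiR (UNIV - {j}) \<rightarrow>\<^sub>M borel" and nth: "\<And>f k. k \<noteq> j \<Longrightarrow> \<gamma> f $ k = f k"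
  and F: "F \<in> borel_measurable borel"
 shows "(\<integral>\<^sup>+f. F (\<gamma> f) * indicator (frontier \<Omega>) (\<gamma> f) \<partial>PiR (UNIV - {j})) \<le> (\<integral>\<^sup>+x. F x \<partial>surface_measure \<Omega>)"
proof -
 let ?G = "\<lambda>x. F x * indicator (frontier \<Omega>) x"
 have fr: "frontier \<Omega> \<in> sets borel" by (rule borel_closed[OF frontier_closed])
 have G: "?G \<in> borel_measurable borel" using F fr by measurable
 have "(\<integral>\<^sup>+f. ?G (\<gamma> f) \<partial>PiR (UNIV - {j})) = (\<integral>\<^sup>+x. ?G x \<partial>distr (PiR (UNIV - {j})) borel \<gamma>)"
  by (rule nn_integral_distr[symmetric, OF \<gamma>]) (use G in simp)
 also have "\<dots> \<le> (\<integral>\<^sup>+x. ?G x \<partial>hausdorff_measure (CARD('n) - 1))"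
 proof (rule nn_integral_mono_measure)
  show "distr (PiR (UNIV - {j})) borel \<gamma> \<le> hausdorff_measure (CARD('n) - 1)"
  proof (subst le_measure)
   show "\<forall>A\<in>sets (distr (PiR (UNIV - {j})) borel \<gamma>).
     emeasure (distr (PiR (UNIV - {j})) borel \<gamma>) A \<le> emeasure (hausdorff_measure (CARD('n) - 1)) A"
    using graph_measure_le_houter[OF \<gamma> nth] by (simp add: emeasure_hausdorff_measure)
  qed simp
 qed simp
 also have "\<dots> = (\<integral>\<^sup>+x. F x \<partial>surface_measure \<Omega>)" by (rule surface_nn_integral[symmetric, OF F])
 finally show ?thesis .
qed

text \<open>Records only the derivative along direction j, since integration runs along lines in
  that direction; D is the j-th partial derivative. Products stay in the class, which is how squares
  and weighted products are treated.\<close>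

definition c1 :: "'n \<Rightarrow> (real^'n::finite \<Rightarrow> real) \<Rightarrow> (real^'n \<Rightarrow> real) \<Rightarrow> bool" where
 "c1 j G D \<longleftrightarrow> continuous_on UNIV G \<and> continuous_on UNIV D \<and>
   (\<forall>f s. ((\<lambda>s. G (slice j f s)) has_real_derivative D (slice j f s)) (at s))"

lemma c1_smooth:
 assumes "smooth \<phi>"
 shows "c1 j \<phi> (partial j \<phi>)"
 unfolding c1_def
proof (intro conjI allI)
 show "continuous_on UNIV \<phi>" "continuous_on UNIV (partial j \<phi>)"
  using assms smooth_continuous_on smooth_partial by blast+
 fix f s
 have d: "(\<phi> has_derivative frechet_derivative \<phi> (at (slice j f s))) (at (slice j f s))"
  using smooth_differentiable[OF assms] frechet_derivative_works by blast
 have "((\<lambda>s. slice j f 0 + s *\<^sub>R axis j 1) has_derivative (\<lambda>h. h *\<^sub>R axis j 1)) (at s)"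
  by (auto intro!: derivative_eq_intros)
 then have "((\<lambda>s. slice j f s) has_derivative (\<lambda>h. h *\<^sub>R axis j 1)) (at s)"
  by (simp flip: slice_eq)
 from has_derivative_compose[OF this d]
 have "((\<lambda>s. \<phi> (slice j f s)) has_derivative (\<lambda>h. frechet_derivative \<phi> (at (slice j f s)) (h *\<^sub>R axis j 1))) (at s)" .
 moreover have "frechet_derivative \<phi> (at (slice j f s)) (h *\<^sub>R axis j 1) = partial j \<phi> (slice j f s) * h" for h
  using linear_scale[OF has_derivative_linear[OF d], of h "axis j 1"] by (simp add: partial_def mult.commute)
 ultimately show "((\<lambda>s. \<phi> (slice j f s)) has_real_derivative partial j \<phi> (slice j f s)) (at s)"
  by (simp add: has_field_derivative_def)
qed

lemma c1_mult:
 assumes "c1 j F D" "c1 j G E"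
 shows "c1 j (\<lambda>x. F x * G x) (\<lambda>x. F x * E x + D x * G x)"
 using assms unfolding c1_def
 by (auto intro!: continuous_intros DERIV_mult')

section \<open>Slicing a domain whose frontier lies in finitely many hyperplanes\<close>

locale cut_domain = bounded_open \<Omega> for \<Omega> :: "(real^'n::finite) set" +
 fixes HP :: "((real^'n) \<times> real) set"
 assumes finite_HP: "finite HP" and HP_nonzero: "\<And>a b. (a, b) \<in> HP \<Longrightarrow> a \<noteq> 0"
  and frontier_HP: "frontier \<Omega> \<subseteq> (\<Union>(a, b)\<in>HP. {x. a \<bullet> x = b})"
begin

definition rdot :: "'n \<Rightarrow> real^'n \<Rightarrow> ('n \<Rightarrow> real) \<Rightarrow> real" where
 "rdot j a f = (\<Sum>i\<in>UNIV - {j}. a $ i * f i)"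

definition HPj :: "'n \<Rightarrow> ((real^'n) \<times> real) set" where
 "HPj j = {(a, b) \<in> HP. a $ j \<noteq> 0}"

definition cutpt :: "'n \<Rightarrow> (real^'n) \<times> real \<Rightarrow> ('n \<Rightarrow> real) \<Rightarrow> real" where
 "cutpt j = (\<lambda>(a, b) f. (b - rdot j a f) / a $ j)"

text \<open>A hyperplane parallel to direction j contains the whole line as soon as it meets it.
  Good lines avoid all of these, so the frontier can meet them only at the finitely many points
  given by \<open>cutpt\<close>.\<close>

definition good :: "'n \<Rightarrow> ('n \<Rightarrow> real) \<Rightarrow> bool" where
 "good j f \<longleftrightarrow> (\<forall>(a, b)\<in>HP. a $ j = 0 \<longrightarrow> rdot j a f \<noteq> b)"

definition U :: "'n \<Rightarrow> ('n \<Rightarrow> real) \<Rightarrow> real set" where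
 "U j f = {s. slice j f s \<in> \<Omega>}"

text \<open>The sum runs over hyperplanes instead of frontier points of the slice, which makes it
  measurable in f. It may count a point several times and serves as an upper bound.\<close>

definition bd :: "'n \<Rightarrow> (real^'n \<Rightarrow> real) \<Rightarrow> ('n \<Rightarrow> real) \<Rightarrow> real" where
 "bd j G f = (\<Sum>h\<in>HPj j. \<bar>G (slice j f (cutpt j h f))\<bar> * indicator (frontier \<Omega>) (slice j f (cutpt j h f)))"

lemma finite_HPj: "finite (HPj j)"
 unfolding HPj_def using finite_HP by (rule finite_subset[rotated]) auto

lemma inner_slice: "a \<bullet> slice j f s = a $ j * s + rdot j a f"
 unfolding inner_vec_def rdot_def by (subst sum.remove[of UNIV j]) (auto simp: slice_nth)

lemma continuous_slice: "continuous_on UNIV (slice j f)"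
proof -
 have "continuous_on UNIV (\<lambda>s. slice j f 0 + s *\<^sub>R axis j 1)" by (intro continuous_intros)
 then show ?thesis by (simp flip: slice_eq)
qed

lemma open_U: "open (U j f)"
 unfolding U_def using open_vimage[OF open_dom continuous_slice[of j f]]
 by (simp add: vimage_def)

lemma bounded_U: "bounded (U j f)"
proof -
 have "U j f \<subseteq> (\<lambda>x. x $ j) ` \<Omega>" unfolding U_def by (force simp: slice_nth)
 moreover have "bounded ((\<lambda>x. x $ j) ` \<Omega>)"
  using bounded_dom bounded_linear_image bounded_linear_vec_nth by blast
 ultimately show ?thesis using bounded_subset by blast
qed

lemma frontier_U: "s \<in> frontier (U j f) \<Longrightarrow> slice j f s \<in> frontier \<Omega>"
proof -
 assume s: "s \<in> frontier (U j f)"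
 have "slice j f ` closure (U j f) \<subseteq> closure \<Omega>"
 proof (rule image_closure_subset)
  show "continuous_on (closure (U j f)) (slice j f)" using continuous_slice continuous_on_subset by blast
  show "slice j f ` U j f \<subseteq> closure \<Omega>" using closure_subset by (auto simp: U_def)
 qed simp
 moreover have "s \<notin> U j f" "s \<in> closure (U j f)" using s open_U by (auto simp: frontier_def interior_open)
 ultimately show ?thesis using open_dom by (auto simp: frontier_def interior_open U_def)
qed

lemma frontier_U_cut:
 assumes "good j f"
 shows "frontier (U j f) \<subseteq> (\<lambda>h. cutpt j h f) ` {h \<in> HPj j. slice j f (cutpt j h f) \<in> frontier \<Omega>}"
proof
 fix s assume s: "s \<in> frontier (U j f)"
 then have fr: "slice j f s \<in> frontier \<Omega>" by (rule frontier_U)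
 then obtain a b where ab: "(a, b) \<in> HP" "a \<bullet> slice j f s = b" using frontier_HP by blast
 have "a $ j \<noteq> 0" using assms ab unfolding good_def by (auto simp: inner_slice)
 then have "cutpt j (a, b) f = s" using ab(2) by (simp add: cutpt_def inner_slice field_simps)
 then show "s \<in> (\<lambda>h. cutpt j h f) ` {h \<in> HPj j. slice j f (cutpt j h f) \<in> frontier \<Omega>}"
  using ab(1) \<open>a $ j \<noteq> 0\<close> fr by (force simp: HPj_def)
qed

lemma finite_frontier_U: "good j f \<Longrightarrow> finite (frontier (U j f))"
 by (rule finite_subset[OF frontier_U_cut]) (use finite_HPj in auto)

lemma sum_frontier_U_le:
 assumes "good j f"
 shows "(\<Sum>z\<in>frontier (U j f). \<bar>G (slice j f z)\<bar>) \<le> bd j G f"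
proof -
 let ?I = "{h \<in> HPj j. slice j f (cutpt j h f) \<in> frontier \<Omega>}"
 have fin: "finite ?I" using finite_HPj by simp
 have "(\<Sum>z\<in>frontier (U j f). \<bar>G (slice j f z)\<bar>) \<le> (\<Sum>z\<in>(\<lambda>h. cutpt j h f) ` ?I. \<bar>G (slice j f z)\<bar>)"
  using fin frontier_U_cut[OF assms] by (intro sum_mono2) auto
 also have "\<dots> \<le> (\<Sum>h\<in>?I. \<bar>G (slice j f (cutpt j h f))\<bar>)"
  using sum_image_le[OF fin, of "\<lambda>z. \<bar>G (slice j f z)\<bar>" "\<lambda>h. cutpt j h f"] by (simp add: o_def)
 also have "\<dots> = (\<Sum>h\<in>?I. \<bar>G (slice j f (cutpt j h f))\<bar> * indicator (frontier \<Omega>) (slice j f (cutpt j h f)))"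
  by (intro sum.cong) auto
 also have "\<dots> \<le> bd j G f" unfolding bd_def using finite_HPj by (intro sum_mono2) auto
 finally show ?thesis .
qed

lemma measurable_rdot: "rdot j a \<in> borel_measurable (PiR (UNIV - {j}))"
 unfolding rdot_def[abs_def]
 by (intro borel_measurable_sum borel_measurable_times measurable_component_PiR borel_measurable_const)

lemma measurable_cut: "cutpt j h \<in> borel_measurable (PiR (UNIV - {j}))"
 unfolding cutpt_def split_beta
 by (intro borel_measurable_divide borel_measurable_diff measurable_rdot borel_measurable_const)

lemma measurable_slice_cut: "(\<lambda>f. slice j f (cutpt j h f)) \<in> PiR (UNIV - {j}) \<rightarrow>\<^sub>M borel"
proof -
 have "(\<lambda>f. (f, cutpt j h f)) \<in> PiR (UNIV - {j}) \<rightarrow>\<^sub>M PiR (UNIV - {j}) \<Otimes>\<^sub>M lborel"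
  using measurable_cut[of j h] by (intro measurable_Pair) auto
 from measurable_compose[OF this measurable_slice_pair] show ?thesis by simp
qed

lemma measurable_slice_integral:
 assumes "F \<in> borel_measurable borel"
 shows "(\<lambda>f. \<integral>\<^sup>+s. F (slice j f s) \<partial>lborel) \<in> borel_measurable (PiR (UNIV - {j}))"
proof (rule lborel.borel_measurable_nn_integral)
 show "(\<lambda>(f, s). F (slice j f s)) \<in> borel_measurable (PiR (UNIV - {j}) \<Otimes>\<^sub>M lborel)"
  using measurable_compose[OF measurable_slice_pair assms, of j] by (simp add: split_beta)
qed

lemma measurable_bd:
 assumes "G \<in> borel_measurable borel"
 shows "bd j G \<in> borel_measurable (PiR (UNIV - {j}))"
proof -
 have "(\<lambda>x. \<bar>G x\<bar> * indicator (frontier \<Omega>) x) \<in> borel_measurable borel"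
  by (intro borel_measurable_times borel_measurable_abs borel_measurable_indicator assms borel_closed[OF frontier_closed])
 then show ?thesis unfolding bd_def[abs_def]
  by (intro borel_measurable_sum measurable_compose[OF measurable_slice_cut, of "\<lambda>x. \<bar>G x\<bar> * indicator (frontier \<Omega>) x"])
qed

lemma bd_nonneg: "bd j G f \<ge> 0"
 unfolding bd_def by (intro sum_nonneg) auto

text \<open>A hyperplane transversal to direction j is a graph over the remaining coordinates, so
  each summand integrates to at most the surface integral, and there are at most
  \<open>card HP\<close> summands.\<close>

lemma nn_integral_bd:
 assumes "G \<in> borel_measurable borel"
 shows "(\<integral>\<^sup>+f. ennreal (bd j G f) \<partial>PiR (UNIV - {j})) \<le> of_nat (card HP) * (\<integral>\<^sup>+x. ennreal \<bar>G x\<bar> \<partial>surface_measure \<Omega>)"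
proof -
 let ?H = "\<lambda>x. ennreal \<bar>G x\<bar> * indicator (frontier \<Omega>) x"
 have Gm: "(\<lambda>x. ennreal \<bar>G x\<bar>) \<in> borel_measurable borel" using assms by measurable
 have Hm: "?H \<in> borel_measurable borel" using Gm borel_closed[OF frontier_closed] by measurable
 have "(\<integral>\<^sup>+f. ennreal (bd j G f) \<partial>PiR (UNIV - {j})) =
   (\<integral>\<^sup>+f. (\<Sum>h\<in>HPj j. ?H (slice j f (cutpt j h f))) \<partial>PiR (UNIV - {j}))"
 proof (intro nn_integral_cong)
  fix f
  have t: "ennreal (\<bar>G x\<bar> * indicator (frontier \<Omega>) x) = ?H x" for x
   by (cases "x \<in> frontier \<Omega>") auto
  show "ennreal (bd j G f) = (\<Sum>h\<in>HPj j. ?H (slice j f (cutpt j h f)))"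
   unfolding bd_def t[symmetric] by (rule sum_ennreal[symmetric]) simp
 qed
 also have "\<dots> = (\<Sum>h\<in>HPj j. \<integral>\<^sup>+f. ?H (slice j f (cutpt j h f)) \<partial>PiR (UNIV - {j}))"
  by (intro nn_integral_sum measurable_compose[OF measurable_slice_cut Hm])
 also have "\<dots> \<le> (\<Sum>h\<in>HPj j. \<integral>\<^sup>+x. ennreal \<bar>G x\<bar> \<partial>surface_measure \<Omega>)"
  by (intro sum_mono graph_nn_integral_le_surface[OF measurable_slice_cut _ Gm]) (auto simp: slice_nth)
 also have "\<dots> = of_nat (card (HPj j)) * (\<integral>\<^sup>+x. ennreal \<bar>G x\<bar> \<partial>surface_measure \<Omega>)" by simp
 also have "\<dots> \<le> of_nat (card HP) * (\<integral>\<^sup>+x. ennreal \<bar>G x\<bar> \<partial>surface_measure \<Omega>)"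
 proof (rule mult_right_mono)
  have "card (HPj j) \<le> card HP" by (intro card_mono finite_HP) (auto simp: HPj_def)
  then show "of_nat (card (HPj j)) \<le> (of_nat (card HP) :: ennreal)" by simp
 qed simp
 finally show ?thesis .
qed

text \<open>A hyperplane parallel to direction j is a null set, while each line inside it
  contributes an infinite integral; by Fubini such lines form a null set.\<close>

lemma AE_good: "AE f in PiR (UNIV - {j}). good j f"
proof -
 have "AE f in PiR (UNIV - {j}). \<forall>h\<in>HP. fst h $ j = 0 \<longrightarrow> rdot j (fst h) f \<noteq> snd h"
 proof (rule AE_finite_allI[OF finite_HP])
  fix h assume h: "h \<in> HP"
  obtain a b where ab: "h = (a, b)" by (cases h)
  show "AE f in PiR (UNIV - {j}). fst h $ j = 0 \<longrightarrow> rdot j (fst h) f \<noteq> snd h"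
  proof (cases "a $ j = 0")
   case True
   let ?P = "{x. a \<bullet> x = b}"
   have Pb: "?P \<in> sets borel" by (intro borel_closed closed_hyperplane)
   have "negligible ?P" using HP_nonzero h ab by (intro negligible_hyperplane) auto
   then have "emeasure lborel ?P = 0"
    using Pb by (simp add: negligible_iff_null_sets null_sets_def emeasure_completion)
   then have "(\<integral>\<^sup>+x. indicator ?P x \<partial>lborel) = 0" using Pb by simp
   then have "(\<integral>\<^sup>+f. (\<integral>\<^sup>+s. indicator ?P (slice j f s) \<partial>lborel) \<partial>PiR (UNIV - {j})) = 0"
    using nn_integral_slice[of "indicator ?P" j] Pb by simp
   then have "AE f in PiR (UNIV - {j}). (\<integral>\<^sup>+s. indicator ?P (slice j f s) \<partial>lborel) = 0"
    using measurable_slice_integral[of "indicator ?P" j] Pb by (subst (asm) nn_integral_0_iff_AE) auto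
   then show ?thesis
   proof eventually_elim
    case (elim f)
    show ?case
    proof (intro impI notI)
     assume "rdot j (fst h) f = snd h"
     then have "indicator ?P (slice j f s) = (1 :: ennreal)" for s
      using True ab by (simp add: inner_slice)
     then show False using elim by simp
    qed
   qed
  qed (simp add: ab)
 qed
 then show ?thesis by eventually_elim (auto simp: good_def)
qed

lemma continuous_bounded_dom:
 fixes D :: "real^'n \<Rightarrow> real"
 assumes "continuous_on UNIV D"
 obtains B where "\<And>x. x \<in> \<Omega> \<Longrightarrow> \<bar>D x\<bar> \<le> B" "B \<ge> 0"
proof -
 have "compact (closure \<Omega>)" using bounded_dom by simp
 then have "compact (D ` closure \<Omega>)" using assms by (intro compact_continuous_image) (auto intro: continuous_on_subset)
 then have "bounded (D ` closure \<Omega>)" by (rule compact_imp_bounded)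
 then obtain B where B: "\<forall>y\<in>D ` closure \<Omega>. \<bar>y\<bar> \<le> B" by (auto simp: bounded_iff)
 show ?thesis
 proof (rule that[of "max B 0"])
  fix x assume "x \<in> \<Omega>"
  then have "\<bar>D x\<bar> \<le> B" using B closure_subset by blast
  then show "\<bar>D x\<bar> \<le> max B 0" by simp
 qed simp
qed

lemma continuous_L2: "continuous_on UNIV D \<Longrightarrow> D \<in> L2 \<mu>"
proof -
 assume c: "continuous_on UNIV D"
 obtain B where "\<And>x. x \<in> \<Omega> \<Longrightarrow> \<bar>D x\<bar> \<le> B" using continuous_bounded_dom[OF c] by metis
 then show ?thesis
  by (intro L2_bounded[OF finite_mu measurable_mu[OF borel_measurable_continuous_onI[OF c]]]) simp
qed

lemma integrable_indicator_dom:
 fixes D :: "real^'n \<Rightarrow> real"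
 assumes "continuous_on UNIV D"
 shows "integrable lborel (\<lambda>x. indicator \<Omega> x * D x)"
proof -
 have m: "(\<lambda>x. indicator \<Omega> x * D x) \<in> borel_measurable borel"
  by (intro borel_measurable_times borel_measurable_indicator borel_measurable_continuous_onI[OF assms]
    borel_open[OF open_dom])
 have "integrable \<mu> D" by (rule L2_integrable[OF finite_mu continuous_L2[OF assms]])
 then have "integrable lebesgue (\<lambda>x. indicator \<Omega> x * D x)"
  using integrable_lebesgue_on_iff[OF dom_sets] by blast
 then show ?thesis using m by (simp add: integrable_completion)
qed

lemma integral_mu_lborel:
 fixes D :: "real^'n \<Rightarrow> real"
 assumes "D \<in> borel_measurable borel"
 shows "(LINT x|\<mu>. D x) = (LINT x|lborel. indicator \<Omega> x * D x)"
proof -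
 have m: "(\<lambda>x. indicator \<Omega> x * D x) \<in> borel_measurable borel"
  by (intro borel_measurable_times borel_measurable_indicator assms borel_open[OF open_dom])
 show ?thesis unfolding integral_lebesgue_on_eq[OF dom_sets] using m by (simp add: integral_completion)
qed

lemma nn_integral_mu_lborel:
 fixes D :: "real^'n \<Rightarrow> ennreal"
 assumes "D \<in> borel_measurable borel"
 shows "(\<integral>\<^sup>+x. D x \<partial>\<mu>) = (\<integral>\<^sup>+x. D x * indicator \<Omega> x \<partial>lborel)"
 using dom_sets by (subst nn_integral_restrict_space) (auto simp: nn_integral_completion)

lemma c1_borel: "c1 j G D \<Longrightarrow> G \<in> borel_measurable borel" "c1 j G D \<Longrightarrow> D \<in> borel_measurable borel"
 by (auto simp: c1_def borel_measurable_continuous_onI)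

text \<open>Plays the part of the divergence theorem. Being an inequality in absolute values, it is
  applied to products whose boundary values tend to zero, where it turns into an identity in the
  limit.\<close>

theorem integral_partial_le_boundary:
 assumes c: "c1 j G D"
 shows "ennreal \<bar>LINT x|\<mu>. D x\<bar> \<le> 2 * of_nat (card HP) * (\<integral>\<^sup>+x. ennreal \<bar>G x\<bar> \<partial>surface_measure \<Omega>)"
proof -
 let ?R = "PiR (UNIV - {j})"
 let ?\<psi> = "\<lambda>f. LINT s|lborel. indicator \<Omega> (slice j f s) * D (slice j f s)"
 have cD: "continuous_on UNIV D" and der: "\<And>f s. ((\<lambda>s. G (slice j f s)) has_real_derivative D (slice j f s)) (at s)"
  using c by (auto simp: c1_def)
 have "(LINT x|\<mu>. D x) = (LINT f|?R. ?\<psi> f)"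
  unfolding integral_mu_lborel[OF c1_borel(2)[OF c]] by (rule integral_slice[OF integrable_indicator_dom[OF cD]])
 then have "ennreal \<bar>LINT x|\<mu>. D x\<bar> = ennreal \<bar>LINT f|?R. ?\<psi> f\<bar>" by simp
 also have "\<dots> \<le> (\<integral>\<^sup>+f. ennreal \<bar>?\<psi> f\<bar> \<partial>?R)"
 proof (cases "integrable ?R ?\<psi>")
  case True
  from integral_norm_bound_ennreal[OF True] show ?thesis by simp
 next
  case False
  \<comment> \<open>A non-integrable function has integral 0 by convention, so the bound is
    trivial.\<close>
  then show ?thesis by (simp add: not_integrable_integral_eq)
 qed
 also have "\<dots> \<le> (\<integral>\<^sup>+f. 2 * ennreal (bd j G f) \<partial>?R)"
 proof (rule nn_integral_mono_AE)
  show "AE f in ?R. ennreal \<bar>?\<psi> f\<bar> \<le> 2 * ennreal (bd j G f)"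
   using AE_good
  proof eventually_elim
   case (elim f)
   have cDs: "continuous_on UNIV (\<lambda>s. D (slice j f s))"
    by (rule continuous_on_compose2[OF cD continuous_slice]) simp
   have "?\<psi> f = (LINT s:U j f|lborel. D (slice j f s))"
    unfolding set_lebesgue_integral_def U_def
    by (intro Bochner_Integration.integral_cong) (auto simp: indicator_def)
   also have "\<bar>\<dots>\<bar> \<le> 2 * (\<Sum>z\<in>frontier (U j f). \<bar>G (slice j f z)\<bar>)"
    by (rule integral_deriv_le_boundary[OF open_U bounded_U finite_frontier_U[OF elim] der cDs])
   also have "\<dots> \<le> 2 * bd j G f" using sum_frontier_U_le[OF elim, of G] by simp
   finally have "ennreal \<bar>?\<psi> f\<bar> \<le> ennreal (2 * bd j G f)" by (rule ennreal_leI)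
   then show ?case using bd_nonneg[of j G f] by (simp add: ennreal_mult)
  qed
 qed
 also have "\<dots> = 2 * (\<integral>\<^sup>+f. ennreal (bd j G f) \<partial>?R)"
  using measurable_bd[OF c1_borel(1)[OF c]] by (intro nn_integral_cmult) auto
 also have "\<dots> \<le> 2 * (of_nat (card HP) * (\<integral>\<^sup>+x. ennreal \<bar>G x\<bar> \<partial>surface_measure \<Omega>))"
  by (intro mult_left_mono nn_integral_bd[OF c1_borel(1)[OF c]]) simp
 finally show ?thesis by (simp add: mult.assoc)
qed

end

section \<open>Square integrability from first derivatives in at most two dimensions\<close>

context cut_domain
begin

abbreviation "surf \<equiv> surface_measure \<Omega>"

text \<open>Bounds G on an entire good line: values at the cut points plus the integral of the
  derivative. It takes values in \<open>ennreal\<close>, since finiteness becomes visible only after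
  integrating over the lines.\<close>

definition supb :: "'n \<Rightarrow> (real^'n \<Rightarrow> real) \<Rightarrow> (real^'n \<Rightarrow> real) \<Rightarrow> ('n \<Rightarrow> real) \<Rightarrow> ennreal" where
 "supb j G D f = ennreal (bd j G f) + (\<integral>\<^sup>+t. ennreal \<bar>D (slice j f t)\<bar> * indicator \<Omega> (slice j f t) \<partial>lborel)"

lemma slice_le_supb:
 assumes c: "c1 j G D" and "good j f" and s: "slice j f s \<in> \<Omega>"
 shows "ennreal \<bar>G (slice j f s)\<bar> \<le> supb j G D f"
proof -
 have cD: "continuous_on UNIV D" and der: "\<And>f s. ((\<lambda>s. G (slice j f s)) has_real_derivative D (slice j f s)) (at s)"
  using c by (auto simp: c1_def)
 have cDs: "continuous_on UNIV (\<lambda>s. D (slice j f s))"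
  by (rule continuous_on_compose2[OF cD continuous_slice]) simp
 have sU: "s \<in> U j f" using s by (simp add: U_def)
 have "\<bar>G (slice j f s)\<bar> \<le> (\<Sum>z\<in>frontier (U j f). \<bar>G (slice j f z)\<bar>) + (LINT t:U j f|lborel. \<bar>D (slice j f t)\<bar>)"
  by (rule sup_le_boundary_plus_integral[OF open_U bounded_U finite_frontier_U[OF assms(2)] der cDs sU])
 also have "\<dots> \<le> bd j G f + (LINT t:U j f|lborel. \<bar>D (slice j f t)\<bar>)"
  using sum_frontier_U_le[OF assms(2), of G] by simp
 finally have "ennreal \<bar>G (slice j f s)\<bar> \<le> ennreal (bd j G f + (LINT t:U j f|lborel. \<bar>D (slice j f t)\<bar>))"
  by (rule ennreal_leI)
 also have "\<dots> = ennreal (bd j G f) + ennreal (LINT t:U j f|lborel. \<bar>D (slice j f t)\<bar>)"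
  by (intro ennreal_plus bd_nonneg) (auto simp: set_lebesgue_integral_def)
 also have "ennreal (LINT t:U j f|lborel. \<bar>D (slice j f t)\<bar>) =
   (\<integral>\<^sup>+t. ennreal (indicator (U j f) t *\<^sub>R \<bar>D (slice j f t)\<bar>) \<partial>lborel)"
  unfolding set_lebesgue_integral_def
 proof (rule nn_integral_eq_integral[symmetric])
  have "set_integrable lborel (U j f) (\<lambda>t. \<bar>D (slice j f t)\<bar>)"
   using cDs by (intro set_integrable_bounded_continuous bounded_U borel_open open_U continuous_intros)
  then show "integrable lborel (\<lambda>t. indicator (U j f) t *\<^sub>R \<bar>D (slice j f t)\<bar>)"
   by (simp add: set_integrable_def)
 qed simp
 also have "\<dots> = (\<integral>\<^sup>+t. ennreal \<bar>D (slice j f t)\<bar> * indicator \<Omega> (slice j f t) \<partial>lborel)"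
  by (intro nn_integral_cong) (auto simp: U_def indicator_def)
 finally show ?thesis by (simp add: supb_def)
qed

lemma measurable_ind_abs:
 fixes D :: "real^'n \<Rightarrow> real"
 shows "D \<in> borel_measurable borel \<Longrightarrow> (\<lambda>x. ennreal \<bar>D x\<bar> * indicator \<Omega> x) \<in> borel_measurable borel"
 by (intro borel_measurable_times_ennreal borel_measurable_indicator borel_open open_dom
   measurable_compose[OF _ measurable_ennreal] borel_measurable_abs)

lemma measurable_supb:
 assumes "c1 j G D"
 shows "supb j G D \<in> borel_measurable (PiR (UNIV - {j}))"
proof -
 have "(\<lambda>f. ennreal (bd j G f)) \<in> borel_measurable (PiR (UNIV - {j}))"
  by (rule measurable_compose[OF measurable_bd[OF c1_borel(1)[OF assms]] measurable_ennreal])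
 moreover have "(\<lambda>f. \<integral>\<^sup>+t. ennreal \<bar>D (slice j f t)\<bar> * indicator \<Omega> (slice j f t) \<partial>lborel)
   \<in> borel_measurable (PiR (UNIV - {j}))"
  by (rule measurable_slice_integral[OF measurable_ind_abs[OF c1_borel(2)[OF assms]]])
 ultimately show ?thesis unfolding supb_def[abs_def] by (rule borel_measurable_add)
qed

lemma nn_integral_supb:
 assumes c: "c1 j G D"
 shows "(\<integral>\<^sup>+f. supb j G D f \<partial>PiR (UNIV - {j})) \<le>
  of_nat (card HP) * (\<integral>\<^sup>+x. ennreal \<bar>G x\<bar> \<partial>surf) + (\<integral>\<^sup>+x. ennreal \<bar>D x\<bar> \<partial>\<mu>)"
proof -
 have D: "D \<in> borel_measurable borel" and G: "G \<in> borel_measurable borel" using c c1_borel by auto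
 have "(\<integral>\<^sup>+f. supb j G D f \<partial>PiR (UNIV - {j})) = (\<integral>\<^sup>+f. ennreal (bd j G f) \<partial>PiR (UNIV - {j})) +
   (\<integral>\<^sup>+f. (\<integral>\<^sup>+t. ennreal \<bar>D (slice j f t)\<bar> * indicator \<Omega> (slice j f t) \<partial>lborel) \<partial>PiR (UNIV - {j}))"
  unfolding supb_def
  by (intro nn_integral_add measurable_slice_integral[OF measurable_ind_abs[OF D]]
    measurable_compose[OF measurable_bd[OF G] measurable_ennreal])
 also have "(\<integral>\<^sup>+f. (\<integral>\<^sup>+t. ennreal \<bar>D (slice j f t)\<bar> * indicator \<Omega> (slice j f t) \<partial>lborel) \<partial>PiR (UNIV - {j}))
   = (\<integral>\<^sup>+x. ennreal \<bar>D x\<bar> * indicator \<Omega> x \<partial>lborel)"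
  by (rule nn_integral_slice[symmetric, OF measurable_ind_abs[OF D]])
 also have "\<dots> = (\<integral>\<^sup>+x. ennreal \<bar>D x\<bar> \<partial>\<mu>)"
  by (rule nn_integral_mu_lborel[symmetric]) (rule measurable_compose[OF borel_measurable_abs[OF D] measurable_ennreal])
 finally show ?thesis using nn_integral_bd[OF G] by (simp add: add_right_mono)
qed

text \<open>In two dimensions \<open>G\<^sup>2\<close> is at most the product of a function of \<open>x\<^sub>1\<close> and a function of \<open>x\<^sub>2\<close>.\<close>

lemma L2_bound_c1:
 assumes card: "CARD('n) \<le> 2" and c: "\<And>j. c1 j G (D j)"
  and K: "\<And>j. of_nat (card HP) * (\<integral>\<^sup>+x. ennreal \<bar>G x\<bar> \<partial>surf) + (\<integral>\<^sup>+x. ennreal \<bar>D j x\<bar> \<partial>\<mu>) \<le> K"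
  and K': "(\<integral>\<^sup>+x. ennreal \<bar>G x\<bar> \<partial>\<mu>) \<le> K"
 shows "(\<integral>\<^sup>+x. ennreal ((G x)\<^sup>2) \<partial>\<mu>) \<le> K * K"
proof -
 obtain j0 :: 'n where True by simp
 have G: "G \<in> borel_measurable borel" using c1_borel(1)[OF c[of j0]] .
 let ?F = "\<lambda>x. ennreal ((G x)\<^sup>2) * indicator \<Omega> x"
 let ?H = "\<lambda>x. ennreal \<bar>G x\<bar> * indicator \<Omega> x"
 have F: "?F \<in> borel_measurable borel"
  using measurable_ind_abs[of "\<lambda>x. (G x)\<^sup>2"] G by simp
 have H: "?H \<in> borel_measurable borel" by (rule measurable_ind_abs[OF G])
 have sq: "?F x = ?H x * ?H x" for x
  by (cases "x \<in> \<Omega>") (auto simp: ennreal_mult[symmetric] power2_eq_square)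
 have start: "(\<integral>\<^sup>+x. ennreal ((G x)\<^sup>2) \<partial>\<mu>) = (\<integral>\<^sup>+f. (\<integral>\<^sup>+s. ?F (slice j f s) \<partial>lborel) \<partial>PiR (UNIV - {j}))" for j
 proof -
  have "(\<integral>\<^sup>+x. ennreal ((G x)\<^sup>2) \<partial>\<mu>) = (\<integral>\<^sup>+x. ?F x \<partial>lborel)"
   using G by (intro nn_integral_mu_lborel measurable_compose[OF _ measurable_ennreal] borel_measurable_power)
  also have "\<dots> = (\<integral>\<^sup>+f. (\<integral>\<^sup>+s. ?F (slice j f s) \<partial>lborel) \<partial>PiR (UNIV - {j}))"
   by (rule nn_integral_slice[OF F])
  finally show ?thesis .
 qed
 have supK: "(\<integral>\<^sup>+f. supb j G (D j) f \<partial>PiR (UNIV - {j})) \<le> K" for j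
  using order_trans[OF nn_integral_supb[OF c] K] .
 have le: "?H (slice j f s) \<le> supb j G (D j) f" if "good j f" for j f s
  using slice_le_supb[OF c that] by (cases "slice j f s \<in> \<Omega>") auto
 have "CARD('n) > 0" by simp
 with card consider "CARD('n) = 1" | "CARD('n) = 2" by linarith
 then show ?thesis
 proof cases
  case 1
  then obtain j :: 'n where j: "UNIV = {j}" by (rule card_1_singletonE)
  then have e: "UNIV - {j} = {}" by simp
  \<comment> \<open>In dimension one no coordinates remain: the empty product consists of a single
    point, the function that is undefined everywhere.\<close>
  let ?u = "(\<lambda>k. undefined) :: 'n \<Rightarrow> real"
  have emp: "(\<integral>\<^sup>+f. h f \<partial>PiR ({} :: 'n set)) = h ?u" for h
   by (simp add: PiM_empty nn_integral_count_space_finite)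
  have "(\<integral>\<^sup>+x. ennreal ((G x)\<^sup>2) \<partial>\<mu>) = (\<integral>\<^sup>+f. (\<integral>\<^sup>+s. ?F (slice j f s) \<partial>lborel) \<partial>PiR (UNIV - {j}))"
   by (rule start)
  \<comment> \<open>One factor is bounded by its supremum on the line and the other is integrated,
    so the L^1 norm of G stands in for the second direction.\<close>
  also have "\<dots> \<le> (\<integral>\<^sup>+f. supb j G (D j) f * (\<integral>\<^sup>+s. ?H (slice j f s) \<partial>lborel) \<partial>PiR (UNIV - {j}))"
  proof (rule nn_integral_mono_AE)
   show "AE f in PiR (UNIV - {j}). (\<integral>\<^sup>+s. ?F (slice j f s) \<partial>lborel) \<le> supb j G (D j) f * (\<integral>\<^sup>+s. ?H (slice j f s) \<partial>lborel)"
    using AE_good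
   proof eventually_elim
    case (elim f)
    have "(\<integral>\<^sup>+s. ?F (slice j f s) \<partial>lborel) \<le> (\<integral>\<^sup>+s. supb j G (D j) f * ?H (slice j f s) \<partial>lborel)"
     unfolding sq by (intro nn_integral_mono mult_right_mono le[OF elim]) simp
    also have "\<dots> = supb j G (D j) f * (\<integral>\<^sup>+s. ?H (slice j f s) \<partial>lborel)"
    proof (rule nn_integral_cmult)
     have "slice j f \<in> borel_measurable borel"
      by (rule borel_measurable_continuous_onI[OF continuous_slice])
     from measurable_compose[OF this H] show "(\<lambda>s. ?H (slice j f s)) \<in> borel_measurable lborel" by simp
    qed
    finally show ?case .
   qed
  qed
  also have "\<dots> = supb j G (D j) ?u * (\<integral>\<^sup>+s. ?H (slice j ?u s) \<partial>lborel)"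
   unfolding e by (rule emp)
  also have "\<dots> = (\<integral>\<^sup>+f. supb j G (D j) f \<partial>PiR (UNIV - {j})) *
    (\<integral>\<^sup>+f. (\<integral>\<^sup>+s. ?H (slice j f s) \<partial>lborel) \<partial>PiR (UNIV - {j}))"
   unfolding e by (simp only: emp)
  also have "(\<integral>\<^sup>+f. (\<integral>\<^sup>+s. ?H (slice j f s) \<partial>lborel) \<partial>PiR (UNIV - {j})) = (\<integral>\<^sup>+x. ennreal \<bar>G x\<bar> \<partial>\<mu>)"
   using G by (subst nn_integral_slice[symmetric, OF H], subst nn_integral_mu_lborel)
    (auto intro: measurable_compose[OF _ measurable_ennreal])
  also have "(\<integral>\<^sup>+f. supb j G (D j) f \<partial>PiR (UNIV - {j})) * (\<integral>\<^sup>+x. ennreal \<bar>G x\<bar> \<partial>\<mu>) \<le> K * K"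
   by (intro mult_mono supK K') auto
  finally show ?thesis .
 next
  case 2
  then obtain i j :: 'n where ij: "UNIV = {i, j}" "i \<noteq> j" by (auto simp: card_2_iff)
  then have ei: "UNIV - {i} = {j}" and ej: "UNIV - {j} = {i}" by auto
  \<comment> \<open>The line in direction i at height s. With it the same point can be read as lying
    on a line of either direction.\<close>
  let ?u = "\<lambda>s. (\<lambda>k\<in>{j}. s) :: 'n \<Rightarrow> real"
  have swap: "slice j f s = slice i (?u s) (f i)" for f s
  proof -
   have "slice j f s $ k = slice i (?u s) (f i) $ k" for k
   proof -
    have "k = i \<or> k = j" using ij(1) by blast
    then show ?thesis using ij(2) by (auto simp: slice_nth)
   qed
   then show ?thesis by (simp add: vec_eq_iff)
  qed
  \<comment> \<open>A line in direction i is bad only if it lies in a hyperplane where the j-th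
    coordinate is b / a_j, which excludes finitely many heights s.\<close>
  have goods: "AE s in lborel. good i (?u s)"
  proof -
   let ?E = "(\<lambda>(a, b). b / a $ j) ` HP"
   have "AE s in lborel. s \<notin> ?E"
    using finite_HP by (intro AE_not_in) (auto intro: finite_imp_null_set_lborel)
   then show ?thesis
   proof eventually_elim
    case (elim s)
    show ?case unfolding good_def
    proof (intro ballI, unfold split_beta, intro impI notI)
     fix h assume h: "h \<in> HP" "fst h $ i = 0" "rdot i (fst h) (?u s) = snd h"
     define a b where "a = fst h" and "b = snd h"
     have ab: "(a, b) \<in> HP" "a $ i = 0" "rdot i a (?u s) = b" using h by (auto simp: a_def b_def)
     have "a $ j \<noteq> 0"
     proof
      assume "a $ j = 0"
      then have "a $ k = 0" for k using ab(2) ij(1) by (metis UNIV_I insertE singletonD)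
      then have "a = 0" by (simp add: vec_eq_iff)
      then show False using HP_nonzero ab(1) by blast
     qed
     moreover have "b = a $ j * s" using ab(3) by (simp add: rdot_def ei)
     ultimately have "s = b / a $ j" by simp
     then show False using elim ab(1) by force
    qed
   qed
  qed
  have mu: "(\<lambda>s. ?u s) \<in> lborel \<rightarrow>\<^sub>M PiR {j}" by (rule measurable_restrict) auto
  have ms: "(\<lambda>s. supb i G (D i) (?u s)) \<in> borel_measurable lborel"
   using measurable_compose[OF mu, of "supb i G (D i)"] measurable_supb[OF c, of i] by (simp add: ei)
  have isu: "(\<integral>\<^sup>+s. supb i G (D i) (?u s) \<partial>lborel) = (\<integral>\<^sup>+f. supb i G (D i) f \<partial>PiR (UNIV - {i}))"
  proof -
   have "(\<integral>\<^sup>+s. supb i G (D i) (?u s) \<partial>lborel) = (\<integral>\<^sup>+f. supb i G (D i) (?u (f j)) \<partial>PiR {j})"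
    using PR.product_nn_integral_singleton[of "\<lambda>s. supb i G (D i) (?u s)" j, OF ms] by simp
   also have "\<dots> = (\<integral>\<^sup>+f. supb i G (D i) f \<partial>PiR {j})"
   proof (rule nn_integral_cong)
    fix f assume "f \<in> space (PiR {j})"
    then have "?u (f j) = f" by (auto simp: space_PiM PiE_def extensional_def fun_eq_iff)
    then show "supb i G (D i) (?u (f j)) = supb i G (D i) f" by simp
   qed
   finally show ?thesis by (simp only: ei)
  qed
  have "(\<integral>\<^sup>+x. ennreal ((G x)\<^sup>2) \<partial>\<mu>) = (\<integral>\<^sup>+f. (\<integral>\<^sup>+s. ?F (slice j f s) \<partial>lborel) \<partial>PiR (UNIV - {j}))"
   by (rule start)
  also have "\<dots> \<le> (\<integral>\<^sup>+f. supb j G (D j) f * (\<integral>\<^sup>+s. supb i G (D i) (?u s) \<partial>lborel) \<partial>PiR (UNIV - {j}))"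
  proof (rule nn_integral_mono_AE)
   show "AE f in PiR (UNIV - {j}). (\<integral>\<^sup>+s. ?F (slice j f s) \<partial>lborel) \<le>
     supb j G (D j) f * (\<integral>\<^sup>+s. supb i G (D i) (?u s) \<partial>lborel)"
    using AE_good
   proof eventually_elim
    case (elim f)
    have "(\<integral>\<^sup>+s. ?F (slice j f s) \<partial>lborel) \<le> (\<integral>\<^sup>+s. supb j G (D j) f * supb i G (D i) (?u s) \<partial>lborel)"
    proof (rule nn_integral_mono_AE)
     show "AE s in lborel. ?F (slice j f s) \<le> supb j G (D j) f * supb i G (D i) (?u s)"
      using goods
     proof eventually_elim
      case (elim s)
      have "?H (slice j f s) \<le> supb i G (D i) (?u s)"
       using le[OF elim, of "f i"] by (simp only: swap)
      then show ?case unfolding sq using le[OF \<open>good j f\<close>, of s] by (intro mult_mono) auto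
     qed
    qed
    also have "\<dots> = supb j G (D j) f * (\<integral>\<^sup>+s. supb i G (D i) (?u s) \<partial>lborel)"
     by (rule nn_integral_cmult[OF ms])
    finally show ?case .
   qed
  qed
  also have "\<dots> = (\<integral>\<^sup>+f. supb j G (D j) f \<partial>PiR (UNIV - {j})) * (\<integral>\<^sup>+s. supb i G (D i) (?u s) \<partial>lborel)"
   by (rule nn_integral_multc[OF measurable_supb[OF c]])
  also have "\<dots> \<le> K * K" unfolding isu by (intro mult_mono supK) auto
  finally show ?thesis .
 qed
qed

end

section \<open>Traces\<close>

lemma nn_integral_abs_mult_le:
 assumes "f \<in> L2 M" "g \<in> L2 M"
 shows "(\<integral>\<^sup>+x. ennreal \<bar>f x * g x\<bar> \<partial>M) \<le> ennreal (nrm M f * nrm M g)"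
proof -
 have a: "(\<lambda>x. \<bar>f x\<bar>) \<in> L2 M" "(\<lambda>x. \<bar>g x\<bar>) \<in> L2 M" using assms by (auto simp: L2_def)
 have "(\<integral>\<^sup>+x. ennreal \<bar>f x * g x\<bar> \<partial>M) = (\<integral>\<^sup>+x. ennreal (\<bar>f x\<bar> * \<bar>g x\<bar>) \<partial>M)" by (simp add: abs_mult)
 also have "\<dots> = ennreal (LINT x|M. \<bar>f x\<bar> * \<bar>g x\<bar>)"
  by (rule nn_integral_eq_integral[OF L2_mult_integrable[OF a]]) simp
 also have "\<dots> \<le> ennreal (nrm M (\<lambda>x. \<bar>f x\<bar>) * nrm M (\<lambda>x. \<bar>g x\<bar>))"
  using L2_Cauchy_Schwarz[OF a] by (intro ennreal_leI) linarith
 finally show ?thesis by (simp add: nrm_def)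
qed

lemma L2_mult_bounded:
 assumes "f \<in> L2 M" "q \<in> borel_measurable M" "\<And>x. x \<in> space M \<Longrightarrow> \<bar>q x\<bar> \<le> B" "B \<ge> 0"
 shows "(\<lambda>x. f x * q x) \<in> L2 M" "nrm M (\<lambda>x. f x * q x) \<le> B * nrm M f"
proof -
 have fm: "f \<in> borel_measurable M" using assms by (simp add: L2_def)
 have b: "(f x * q x)\<^sup>2 \<le> (B * f x)\<^sup>2" if "x \<in> space M" for x
 proof -
  have "\<bar>f x\<bar> * \<bar>q x\<bar> \<le> \<bar>f x\<bar> * B" using assms(3)[OF that] by (intro mult_left_mono) auto
  then have "\<bar>f x * q x\<bar> \<le> \<bar>B * f x\<bar>" using assms(4) by (simp add: abs_mult mult.commute)
  then show ?thesis by (simp only: abs_le_square_iff)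
 qed
 have BL: "(\<lambda>x. B * f x) \<in> L2 M" using assms(1) by (rule L2_cmult)
 show fL: "(\<lambda>x. f x * q x) \<in> L2 M"
 proof (rule L2I)
  show "(\<lambda>x. f x * q x) \<in> borel_measurable M" using fm assms(2) by (rule borel_measurable_times)
  then show "integrable M (\<lambda>x. (f x * q x)\<^sup>2)"
   using b by (intro Bochner_Integration.integrable_bound[OF L2_integrable_power2[OF BL]] AE_I2) auto
 qed
 have "nrm M (\<lambda>x. f x * q x) \<le> nrm M (\<lambda>x. B * f x)"
  unfolding nrm_def using b L2_integrable_power2[OF BL] L2_integrable_power2[OF fL]
  by (intro real_sqrt_le_mono integral_mono) auto
 then show "nrm M (\<lambda>x. f x * q x) \<le> B * nrm M f" using assms(4) by (simp add: nrm_cmult)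
qed

context cut_domain
begin

lemma space_surf: "space surf = frontier \<Omega>"
 by (simp add: surface_measure_def space_restrict_space)

lemma measurable_surf: "f \<in> borel_measurable borel \<Longrightarrow> f \<in> borel_measurable surf"
 unfolding surface_measure_def
 by (rule measurable_restrict_space1, subst measurable_cong_sets[OF sets_hausdorff_measure refl])

lemma integral_product_le_boundary:
 assumes "c1 j \<phi> D" "c1 j \<psi> E" "\<phi> \<in> L2 surf" "\<psi> \<in> L2 surf"
 shows "\<bar>LINT x|\<mu>. \<phi> x * E x + D x * \<psi> x\<bar> \<le> 2 * real (card HP) * (nrm surf \<phi> * nrm surf \<psi>)"
proof -
 have "ennreal \<bar>LINT x|\<mu>. \<phi> x * E x + D x * \<psi> x\<bar> \<le>
   2 * of_nat (card HP) * (\<integral>\<^sup>+x. ennreal \<bar>\<phi> x * \<psi> x\<bar> \<partial>surf)"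
  by (rule integral_partial_le_boundary[OF c1_mult[OF assms(1,2)]])
 also have "\<dots> \<le> 2 * of_nat (card HP) * ennreal (nrm surf \<phi> * nrm surf \<psi>)"
  by (intro mult_left_mono nn_integral_abs_mult_le assms) simp
 also have "\<dots> = ennreal (2 * real (card HP) * (nrm surf \<phi> * nrm surf \<psi>))"
  by (simp add: ennreal_mult nrm_nonneg ennreal_of_nat_eq_real_of_nat)
 finally show ?thesis by (simp add: ennreal_le_iff nrm_nonneg)
qed

lemma smooth_L2: "smooth \<phi> \<Longrightarrow> \<phi> \<in> L2 \<mu>"
 by (rule continuous_L2) (rule smooth_continuous_on)

text \<open>The boundary term of the product with a test function is zero, because the compact
  support misses the frontier of the open set.\<close>

lemma smooth_is_weak_deriv:
 assumes "smooth \<phi>"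
 shows "is_weak_deriv \<Omega> [j] \<phi> (partial j \<phi>)"
 unfolding is_weak_deriv_def
proof (intro conjI allI impI)
 have L: "\<phi> \<in> L2 \<mu>" "partial j \<phi> \<in> L2 \<mu>" using assms smooth_partial smooth_L2 by blast+
 then show "loc_integrable \<Omega> \<phi>" "loc_integrable \<Omega> (partial j \<phi>)" by (auto intro: loc_integrable_L2)
 fix \<psi> assume \<psi>: "test_function \<Omega> \<psi>"
 then have s: "smooth \<psi>" by (simp add: test_function_def)
 have Lp: "\<psi> \<in> L2 \<mu>" "partial j \<psi> \<in> L2 \<mu>" using s smooth_partial smooth_L2 by blast+
 obtain K where K: "K \<subseteq> \<Omega>" "\<forall>x. x \<notin> K \<longrightarrow> \<psi> x = 0" using \<psi> by (auto simp: test_function_def)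
 have "\<psi> x = 0" if "x \<in> frontier \<Omega>" for x
  using that K open_dom by (auto simp: frontier_def interior_open)
 then have "(\<integral>\<^sup>+x. ennreal \<bar>\<phi> x * \<psi> x\<bar> \<partial>surf) = (\<integral>\<^sup>+x. 0 \<partial>surf)"
  by (intro nn_integral_cong) (simp add: space_surf)
 then have "ennreal \<bar>LINT x|\<mu>. \<phi> x * partial j \<psi> x + partial j \<phi> x * \<psi> x\<bar> \<le> 0"
  using integral_partial_le_boundary[OF c1_mult[OF c1_smooth[OF assms, of j] c1_smooth[OF s, of j]]] by simp
 then have "(LINT x|\<mu>. \<phi> x * partial j \<psi> x + partial j \<phi> x * \<psi> x) = 0" by simp
 then have "(LINT x|\<mu>. \<phi> x * partial j \<psi> x) + (LINT x|\<mu>. partial j \<phi> x * \<psi> x) = 0"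
  using L Lp by (simp add: L2_mult_integrable)
 then show "L2_inner \<Omega> \<phi> (partials [j] \<psi>) = (- 1) ^ length [j] * L2_inner \<Omega> (partial j \<phi>) \<psi>"
  by (simp add: L2_inner_eq)
qed

lemma smooth_W1: "smooth \<phi> \<Longrightarrow> \<phi> \<in> W 1"
 by (rule W1_I[where d="\<lambda>j. partial j \<phi>"]) (auto intro: smooth_L2 smooth_is_weak_deriv smooth_partial)

lemma smooth_wderiv: "smooth \<phi> \<Longrightarrow> AE x in \<mu>. wderiv \<Omega> [j] \<phi> x = partial j \<phi> x"
 by (rule wderiv_AE) (rule smooth_is_weak_deriv)

text \<open>The content of \<open>has_trace\<close> at order 1, split into L^2 convergence of the
  function, of each first derivative and of the boundary values. Every member must also be square
  integrable on the surface, which \<open>has_trace\<close> ensures only from some index on.\<close>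

definition tseq :: "(real^'n \<Rightarrow> real) \<Rightarrow> (real^'n \<Rightarrow> real) \<Rightarrow> (nat \<Rightarrow> real^'n \<Rightarrow> real) \<Rightarrow> bool" where
 "tseq w f \<phi> \<longleftrightarrow> (\<forall>k. smooth (\<phi> k) \<and> \<phi> k \<in> L2 surf) \<and>
   (\<lambda>k. nrm \<mu> (\<lambda>x. \<phi> k x - w x)) \<longlonglongrightarrow> 0 \<and>
   (\<forall>j. (\<lambda>k. nrm \<mu> (\<lambda>x. partial j (\<phi> k) x - wderiv \<Omega> [j] w x)) \<longlonglongrightarrow> 0) \<and>
   (\<lambda>k. nrm surf (\<lambda>x. \<phi> k x - f x)) \<longlonglongrightarrow> 0"

lemma sobolev_norm_1: "sobolev_norm 1 \<Omega> v = sqrt (\<Sum>js | length js \<le> 1. (nrm \<mu> (wderiv \<Omega> js v))\<^sup>2)"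
 by (simp add: sobolev_norm_def L2_norm_eq)

lemma lists_le_1_eq: "{js::'n list. length js \<le> 1} = insert [] ((\<lambda>j. [j]) ` UNIV)"
 using lists_le_1 by auto

lemma finite_lists_le_1: "finite {js::'n list. length js \<le> 1}"
 unfolding lists_le_1_eq by simp

lemma nrm_wderiv_le_sobolev_norm_1:
 assumes "length js \<le> 1"
 shows "nrm \<mu> (wderiv \<Omega> js v) \<le> sobolev_norm 1 \<Omega> v"
proof -
 have "(nrm \<mu> (wderiv \<Omega> js v))\<^sup>2 \<le> (\<Sum>js | length js \<le> 1. (nrm \<mu> (wderiv \<Omega> js v))\<^sup>2)"
  using assms finite_lists_le_1 by (intro member_le_sum) auto
 then show ?thesis unfolding sobolev_norm_1 by (rule real_le_rsqrt)
qed

lemma smooth_diff_wderiv: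
 assumes "w \<in> W 1" "smooth \<phi>"
 shows "nrm \<mu> (wderiv \<Omega> [] (\<lambda>x. w x - \<phi> x)) = nrm \<mu> (\<lambda>x. \<phi> x - w x)"
  and "nrm \<mu> (wderiv \<Omega> [j] (\<lambda>x. w x - \<phi> x)) = nrm \<mu> (\<lambda>x. partial j \<phi> x - wderiv \<Omega> [j] w x)"
proof -
 have W: "(\<lambda>x. 1 * w x + (-1) * \<phi> x) \<in> W 1" by (intro W_lincomb assms smooth_W1)
 then have W': "(\<lambda>x. w x - \<phi> x) \<in> W 1" by simp
 have L: "wderiv \<Omega> js (\<lambda>x. w x - \<phi> x) \<in> L2 \<mu>" if "length js \<le> 1" for js using W_wderiv_L2[OF W' that] .
 have "nrm \<mu> (wderiv \<Omega> [] (\<lambda>x. w x - \<phi> x)) = nrm \<mu> (\<lambda>x. w x - \<phi> x)"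
  using wderiv_Nil_AE[OF W'] L[of "[]"] W_L2[OF W'] by (intro nrm_cong_AE) (auto simp: L2_def)
 then show "nrm \<mu> (wderiv \<Omega> [] (\<lambda>x. w x - \<phi> x)) = nrm \<mu> (\<lambda>x. \<phi> x - w x)"
  using nrm_minus_commute[of \<mu> w \<phi>] by simp
 have "AE x in \<mu>. wderiv \<Omega> [j] (\<lambda>x. w x - \<phi> x) x = wderiv \<Omega> [j] w x - wderiv \<Omega> [j] \<phi> x"
  using wderiv_lincomb[OF assms(1) smooth_W1[OF assms(2)], of "[j]" 1 "-1"] by simp
 with smooth_wderiv[OF assms(2), of j]
 have "AE x in \<mu>. wderiv \<Omega> [j] (\<lambda>x. w x - \<phi> x) x = wderiv \<Omega> [j] w x - partial j \<phi> x"
  by eventually_elim simp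
 moreover have "(\<lambda>x. wderiv \<Omega> [j] w x - partial j \<phi> x) \<in> L2 \<mu>"
  using W_wderiv_L2[OF assms(1), of "[j]"] smooth_L2[OF smooth_partial[OF assms(2)]] by (intro L2_diff) auto
 ultimately have "nrm \<mu> (wderiv \<Omega> [j] (\<lambda>x. w x - \<phi> x)) = nrm \<mu> (\<lambda>x. wderiv \<Omega> [j] w x - partial j \<phi> x)"
  using L[of "[j]"] by (intro nrm_cong_AE) (auto simp: L2_def)
 then show "nrm \<mu> (wderiv \<Omega> [j] (\<lambda>x. w x - \<phi> x)) = nrm \<mu> (\<lambda>x. partial j \<phi> x - wderiv \<Omega> [j] w x)"
  using nrm_minus_commute[of \<mu> "wderiv \<Omega> [j] w" "partial j \<phi>"] by simp
qed

lemma tseq_subseq: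
 assumes "tseq w f \<phi>" "strict_mono s"
 shows "tseq w f (\<lambda>k. \<phi> (s k))"
 using assms unfolding tseq_def
 by (auto intro: LIMSEQ_subseq_LIMSEQ[OF _ assms(2), unfolded o_def])

text \<open>Terms at infinite distance from f on the surface can occur only at the start, as the
  distances tend to 0; they are dropped. Passing to a subsequence adds convergence almost
  everywhere.\<close>

lemma has_traceE:
 assumes "has_trace 1 \<Omega> w f"
 obtains \<phi> where "w \<in> W 1" "f \<in> L2 surf" "tseq w f \<phi>" "AE x in \<mu>. (\<lambda>k. \<phi> k x) \<longlonglongrightarrow> w x"
proof -
 have w: "w \<in> W 1" and f: "f \<in> L2 surf"
  using assms by (auto simp: has_trace_def sobolev_space_1 L2_def)
 obtain \<phi> where sm: "\<And>k::nat. smooth (\<phi> k)"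
  and n: "(\<lambda>k. sobolev_norm 1 \<Omega> (\<lambda>x. w x - \<phi> k x)) \<longlonglongrightarrow> 0"
  and b: "(\<lambda>k. \<integral>\<^sup>+x. ennreal ((\<phi> k x - f x)\<^sup>2) \<partial>surf) \<longlonglongrightarrow> 0"
  using assms by (auto simp: has_trace_def)
 have fm: "f \<in> borel_measurable surf" using f by (simp add: L2_def)
 have \<phi>m: "\<phi> k \<in> borel_measurable surf" for k using sm by (intro measurable_surf smooth_borel_measurable)
 have "\<forall>\<^sub>F k in sequentially. (\<integral>\<^sup>+x. ennreal ((\<phi> k x - f x)\<^sup>2) \<partial>surf) < 1"
  by (rule order_tendstoD(2)[OF b]) simp
 then obtain N where N: "\<And>k. k \<ge> N \<Longrightarrow> (\<integral>\<^sup>+x. ennreal ((\<phi> k x - f x)\<^sup>2) \<partial>surf) < 1"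
  by (auto simp: eventually_sequentially)
 define \<psi> where "\<psi> k = \<phi> (k + N)" for k
 have dL: "(\<lambda>x. \<psi> k x - f x) \<in> L2 surf" for k
 proof -
  have m: "(\<lambda>x. \<psi> k x - f x) \<in> borel_measurable surf" using \<phi>m fm by (simp add: \<psi>_def)
  have "(\<integral>\<^sup>+x. ennreal ((\<psi> k x - f x)\<^sup>2) \<partial>surf) < \<infinity>"
   using N[of "k + N"] by (auto simp: \<psi>_def intro: less_trans)
  then show ?thesis using L2_nn_integral[OF m] by simp
 qed
 have \<psi>L: "\<psi> k \<in> L2 surf" for k using L2_add[OF dL f] by simp
 have "(\<lambda>k. ennreal ((nrm surf (\<lambda>x. \<psi> k x - f x))\<^sup>2)) \<longlonglongrightarrow> ennreal 0"
  unfolding nrm_nn_integral[OF dL, symmetric] using LIMSEQ_ignore_initial_segment[OF b, of N] by (simp add: \<psi>_def)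
 then have "(\<lambda>k. (nrm surf (\<lambda>x. \<psi> k x - f x))\<^sup>2) \<longlonglongrightarrow> 0"
  by (subst (asm) tendsto_ennreal_iff) auto
 then have "(\<lambda>k. sqrt ((nrm surf (\<lambda>x. \<psi> k x - f x))\<^sup>2)) \<longlonglongrightarrow> sqrt 0" by (rule tendsto_real_sqrt)
 then have bs: "(\<lambda>k. nrm surf (\<lambda>x. \<psi> k x - f x)) \<longlonglongrightarrow> 0" by (simp add: nrm_nonneg)
 have n': "(\<lambda>k. sobolev_norm 1 \<Omega> (\<lambda>x. w x - \<psi> k x)) \<longlonglongrightarrow> 0"
  using LIMSEQ_ignore_initial_segment[OF n, of N] by (simp add: \<psi>_def)
 have z: "(\<lambda>k. nrm \<mu> (wderiv \<Omega> js (\<lambda>x. w x - \<psi> k x))) \<longlonglongrightarrow> 0" if "length js \<le> 1" for js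
  by (rule Lim_null_comparison[OF always_eventually n'])
   (use nrm_wderiv_le_sobolev_norm_1[OF that] in \<open>auto simp: nrm_nonneg\<close>)
 have sm': "smooth (\<psi> k)" for k using sm by (simp add: \<psi>_def)
 have t: "tseq w f \<psi>"
  unfolding tseq_def using z[of "[]"] z[of "[_]"] sm' \<psi>L bs smooth_diff_wderiv[OF w sm'] by simp
 have t1: "(\<lambda>k. nrm \<mu> (\<lambda>x. \<psi> k x - w x)) \<longlonglongrightarrow> 0" using t by (simp add: tseq_def)
 obtain s :: "nat \<Rightarrow> nat" where s: "strict_mono s" "AE x in \<mu>. (\<lambda>k. \<psi> (s k) x) \<longlonglongrightarrow> w x"
  by (rule L2_AE_subseq[OF smooth_L2[OF sm'] W_L2[OF w] t1]) blast
 show ?thesis by (rule that[OF w f tseq_subseq[OF t s(1)] s(2)])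
qed

lemma has_traceI:
 assumes w: "w \<in> W 1" and f: "f \<in> L2 surf" and t: "tseq w f \<phi>"
 shows "has_trace 1 \<Omega> w f"
 unfolding has_trace_def
proof (intro conjI exI[of _ \<phi>] allI)
 show "w \<in> sobolev_space 1 \<Omega>" using w by (simp add: sobolev_space_1)
 show "f \<in> borel_measurable surf" "integrable surf (\<lambda>x. (f x)\<^sup>2)" using f by (auto simp: L2_def)
 have sm: "smooth (\<phi> k)" and L: "\<phi> k \<in> L2 surf" for k using t by (auto simp: tseq_def)
 show "smooth (\<phi> k)" for k by (rule sm)
 have "(\<lambda>k. sobolev_norm 1 \<Omega> (\<lambda>x. w x - \<phi> k x)) \<longlonglongrightarrow> sqrt (\<Sum>js\<in>{js::'n list. length js \<le> 1}. 0\<^sup>2)"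
  unfolding sobolev_norm_1
 proof (intro tendsto_real_sqrt tendsto_sum tendsto_power)
  fix js :: "'n list" assume "js \<in> {js. length js \<le> 1}"
  then consider "js = []" | j where "js = [j]" using lists_le_1 by blast
  then show "(\<lambda>k. nrm \<mu> (wderiv \<Omega> js (\<lambda>x. w x - \<phi> k x))) \<longlonglongrightarrow> 0"
   by cases (use t smooth_diff_wderiv[OF w sm] in \<open>auto simp: tseq_def\<close>)
 qed
 then show "(\<lambda>k. sobolev_norm 1 \<Omega> (\<lambda>x. w x - \<phi> k x)) \<longlonglongrightarrow> 0" by simp
 have "(\<lambda>k. ennreal ((nrm surf (\<lambda>x. \<phi> k x - f x))\<^sup>2)) \<longlonglongrightarrow> ennreal (0\<^sup>2)"
  by (intro tendsto_ennrealI tendsto_power) (use t in \<open>simp add: tseq_def\<close>)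
 then show "(\<lambda>k. \<integral>\<^sup>+x. ennreal ((\<phi> k x - f x)\<^sup>2) \<partial>surf) \<longlonglongrightarrow> 0"
  unfolding nrm_nn_integral[OF L2_diff[OF L f]] by simp
qed

lemma smooth_has_trace:
 assumes "smooth \<phi>" "\<phi> \<in> L2 surf"
 shows "has_trace 1 \<Omega> \<phi> \<phi>"
proof (rule has_traceI[OF smooth_W1[OF assms(1)] assms(2), where \<phi>="\<lambda>_. \<phi>"])
 have "nrm \<mu> (\<lambda>x. partial j \<phi> x - wderiv \<Omega> [j] \<phi> x) = nrm \<mu> (\<lambda>x. 0)" for j
 proof (rule nrm_cong_AE)
  show "AE x in \<mu>. partial j \<phi> x - wderiv \<Omega> [j] \<phi> x = 0"
   using smooth_wderiv[OF assms(1), of j] by eventually_elim simp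
  show "(\<lambda>x. partial j \<phi> x - wderiv \<Omega> [j] \<phi> x) \<in> borel_measurable \<mu>"
   using smooth_L2[OF smooth_partial[OF assms(1)]] W_wderiv_L2[OF smooth_W1[OF assms(1)], of "[j]"]
   by (intro borel_measurable_diff) (auto simp: L2_def)
 qed simp
 then show "tseq \<phi> \<phi> (\<lambda>_. \<phi>)" using assms by (simp add: tseq_def nrm_def)
qed

lemma nrm_lincomb_tendsto:
 assumes "\<And>k. f k \<in> L2 M" "\<And>k. g k \<in> L2 M" "f' \<in> L2 M" "g' \<in> L2 M"
  and "(\<lambda>k. nrm M (\<lambda>x. f k x - f' x)) \<longlonglongrightarrow> 0" "(\<lambda>k. nrm M (\<lambda>x. g k x - g' x)) \<longlonglongrightarrow> 0"
 shows "(\<lambda>k. nrm M (\<lambda>x. (a * f k x + b * g k x) - (a * f' x + b * g' x))) \<longlonglongrightarrow> 0"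
proof (rule Lim_null_comparison[OF always_eventually])
 show "(\<lambda>k. \<bar>a\<bar> * nrm M (\<lambda>x. f k x - f' x) + \<bar>b\<bar> * nrm M (\<lambda>x. g k x - g' x)) \<longlonglongrightarrow> 0"
  using assms(5,6) by (auto intro!: tendsto_eq_intros)
 show "\<forall>k. norm (nrm M (\<lambda>x. (a * f k x + b * g k x) - (a * f' x + b * g' x))) \<le>
   \<bar>a\<bar> * nrm M (\<lambda>x. f k x - f' x) + \<bar>b\<bar> * nrm M (\<lambda>x. g k x - g' x)"
 proof
  fix k
  have "(\<lambda>x. (a * f k x + b * g k x) - (a * f' x + b * g' x)) =
    (\<lambda>x. a * (f k x - f' x) + b * (g k x - g' x))" by (auto simp: algebra_simps)
  then show "norm (nrm M (\<lambda>x. (a * f k x + b * g k x) - (a * f' x + b * g' x))) \<le>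
   \<bar>a\<bar> * nrm M (\<lambda>x. f k x - f' x) + \<bar>b\<bar> * nrm M (\<lambda>x. g k x - g' x)"
   using nrm_triangle[OF L2_cmult[OF L2_diff[OF assms(1)[of k] assms(3)], of a] L2_cmult[OF L2_diff[OF assms(2)[of k] assms(4)], of b]]
   by (simp add: nrm_cmult nrm_nonneg)
 qed
qed

lemma has_trace_lincomb:
 assumes "has_trace 1 \<Omega> v f" "has_trace 1 \<Omega> w g"
 shows "has_trace 1 \<Omega> (\<lambda>x. a * v x + b * w x) (\<lambda>x. a * f x + b * g x)"
proof -
 obtain \<phi> where v: "v \<in> W 1" "f \<in> L2 surf" "tseq v f \<phi>" using has_traceE[OF assms(1)] by blast
 obtain \<psi> where w: "w \<in> W 1" "g \<in> L2 surf" "tseq w g \<psi>" using has_traceE[OF assms(2)] by blast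
 have sm: "smooth (\<phi> k)" "smooth (\<psi> k)" "\<phi> k \<in> L2 surf" "\<psi> k \<in> L2 surf" for k
  using v w by (auto simp: tseq_def)
 show ?thesis
 proof (rule has_traceI[where \<phi>="\<lambda>k x. a * \<phi> k x + b * \<psi> k x"])
  show "(\<lambda>x. a * v x + b * w x) \<in> W 1" by (intro W_lincomb v w)
  show "(\<lambda>x. a * f x + b * g x) \<in> L2 surf" by (intro L2_add L2_cmult v w)
  show "tseq (\<lambda>x. a * v x + b * w x) (\<lambda>x. a * f x + b * g x) (\<lambda>k x. a * \<phi> k x + b * \<psi> k x)"
   unfolding tseq_def
  proof (intro conjI allI)
   show "smooth (\<lambda>x. a * \<phi> k x + b * \<psi> k x)" for k by (intro smooth_lincomb sm)
   show "(\<lambda>x. a * \<phi> k x + b * \<psi> k x) \<in> L2 surf" for k by (intro L2_add L2_cmult sm)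
   show "(\<lambda>k. nrm \<mu> (\<lambda>x. (a * \<phi> k x + b * \<psi> k x) - (a * v x + b * w x))) \<longlonglongrightarrow> 0"
    using v w by (intro nrm_lincomb_tendsto smooth_L2 sm W_L2) (auto simp: tseq_def)
   show "(\<lambda>k. nrm surf (\<lambda>x. (a * \<phi> k x + b * \<psi> k x) - (a * f x + b * g x))) \<longlonglongrightarrow> 0"
    using v w by (intro nrm_lincomb_tendsto sm) (auto simp: tseq_def)
   fix j
   have "(\<lambda>k. nrm \<mu> (\<lambda>x. (a * partial j (\<phi> k) x + b * partial j (\<psi> k) x)
     - (a * wderiv \<Omega> [j] v x + b * wderiv \<Omega> [j] w x))) \<longlonglongrightarrow> 0"
    using v w W_wderiv_L2[of v 1 "[j]"] W_wderiv_L2[of w 1 "[j]"]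
    by (intro nrm_lincomb_tendsto smooth_L2[OF smooth_partial] sm) (auto simp: tseq_def)
   moreover have "nrm \<mu> (\<lambda>x. partial j (\<lambda>x. a * \<phi> k x + b * \<psi> k x) x - wderiv \<Omega> [j] (\<lambda>x. a * v x + b * w x) x)
     = nrm \<mu> (\<lambda>x. (a * partial j (\<phi> k) x + b * partial j (\<psi> k) x)
     - (a * wderiv \<Omega> [j] v x + b * wderiv \<Omega> [j] w x))" for k
   proof (rule nrm_cong_AE)
    have p: "partial j (\<lambda>x. a * \<phi> k x + b * \<psi> k x) x = a * partial j (\<phi> k) x + b * partial j (\<psi> k) x" for x
     by (intro partial_lincomb smooth_differentiable sm)
    show "AE x in \<mu>. partial j (\<lambda>x. a * \<phi> k x + b * \<psi> k x) x - wderiv \<Omega> [j] (\<lambda>x. a * v x + b * w x) x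
      = (a * partial j (\<phi> k) x + b * partial j (\<psi> k) x) - (a * wderiv \<Omega> [j] v x + b * wderiv \<Omega> [j] w x)"
    proof -
     have "AE x in \<mu>. wderiv \<Omega> [j] (\<lambda>x. a * v x + b * w x) x = a * wderiv \<Omega> [j] v x + b * wderiv \<Omega> [j] w x"
      by (rule wderiv_lincomb[OF v(1) w(1)]) simp
     then show ?thesis unfolding p by eventually_elim simp
    qed
    have "partial j (\<phi> k) \<in> borel_measurable \<mu>" "partial j (\<psi> k) \<in> borel_measurable \<mu>"
     "wderiv \<Omega> [j] v \<in> borel_measurable \<mu>" "wderiv \<Omega> [j] w \<in> borel_measurable \<mu>"
     "wderiv \<Omega> [j] (\<lambda>x. a * v x + b * w x) \<in> borel_measurable \<mu>"
     using smooth_L2[OF smooth_partial[OF sm(1)]] smooth_L2[OF smooth_partial[OF sm(2)]]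
      W_wderiv_L2[OF v(1), of "[j]"] W_wderiv_L2[OF w(1), of "[j]"]
      W_wderiv_L2[OF W_lincomb[OF v(1) w(1)], of "[j]"] by (simp_all add: L2_def)
    then show "(\<lambda>x. partial j (\<lambda>x. a * \<phi> k x + b * \<psi> k x) x - wderiv \<Omega> [j] (\<lambda>x. a * v x + b * w x) x) \<in> borel_measurable \<mu>"
     "(\<lambda>x. (a * partial j (\<phi> k) x + b * partial j (\<psi> k) x)
     - (a * wderiv \<Omega> [j] v x + b * wderiv \<Omega> [j] w x)) \<in> borel_measurable \<mu>"
     unfolding p by simp_all
   qed
   ultimately show "(\<lambda>k. nrm \<mu> (\<lambda>x. partial j (\<lambda>x. a * \<phi> k x + b * \<psi> k x) x
     - wderiv \<Omega> [j] (\<lambda>x. a * v x + b * w x) x)) \<longlonglongrightarrow> 0" by simp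
  qed
 qed
qed

end

section \<open>The L^4 bound and integration by parts for functions with traces\<close>

context cut_domain
begin

text \<open>Bounds w^2 in the slicing estimate: the surface term of w^2 gives the first summand, and
  twice |w| times a partial derivative is at most the sum of the two squares, which gives the
  second.\<close>

definition tbound :: "(real^'n \<Rightarrow> real) \<Rightarrow> (real^'n \<Rightarrow> real) \<Rightarrow> real" where
 "tbound w f = real (card HP) * (nrm surf f)\<^sup>2 + (ip w w + gip w w)"

lemma tbound_nonneg: "tbound w f \<ge> 0"
 unfolding tbound_def by (intro add_nonneg_nonneg) (auto simp: ip_self gip_nonneg)

lemma gip_smooth:
 assumes "smooth \<phi>"
 shows "gip \<phi> \<phi> = (\<Sum>j\<in>UNIV. (nrm \<mu> (partial j \<phi>))\<^sup>2)"
proof -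
 have "nrm \<mu> (wderiv \<Omega> [j] \<phi>) = nrm \<mu> (partial j \<phi>)" for j
  using smooth_wderiv[OF assms, of j] smooth_L2[OF smooth_partial[OF assms], of j]
   W_wderiv_L2[OF smooth_W1[OF assms], of "[j]"] by (intro nrm_cong_AE) (auto simp: L2_def)
 then show ?thesis by (simp add: gip_def ip_self)
qed

text \<open>This is \<open>L2_bound_c1\<close> for the square of \<open>\<phi>\<close>, with the
  derivative of the square absorbed by Young's inequality.\<close>

lemma smooth_L4:
 assumes card: "CARD('n) \<le> 2" and s: "smooth \<phi>" "\<phi> \<in> L2 surf"
 shows "(\<integral>\<^sup>+x. ennreal (((\<phi> x)\<^sup>2)\<^sup>2) \<partial>\<mu>) \<le> ennreal ((tbound \<phi> \<phi>)\<^sup>2)"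
proof -
 let ?K = "ennreal (tbound \<phi> \<phi>)"
 have L: "\<phi> \<in> L2 \<mu>" and Lj: "partial j \<phi> \<in> L2 \<mu>" for j
  using smooth_L2[OF s(1)] smooth_L2[OF smooth_partial[OF s(1)]] .
 have c: "c1 j (\<lambda>x. (\<phi> x)\<^sup>2) (\<lambda>x. \<phi> x * partial j \<phi> x + partial j \<phi> x * \<phi> x)" for j
  unfolding power2_eq_square by (intro c1_mult c1_smooth s)
 have G: "(\<integral>\<^sup>+x. ennreal \<bar>(\<phi> x)\<^sup>2\<bar> \<partial>\<mu>) = ennreal (ip \<phi> \<phi>)"
  using nrm_nn_integral[OF L] by (simp add: ip_self)
 have S: "(\<integral>\<^sup>+x. ennreal \<bar>(\<phi> x)\<^sup>2\<bar> \<partial>surf) = ennreal ((nrm surf \<phi>)\<^sup>2)"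
  using nrm_nn_integral[OF s(2)] by simp
 have gj: "(nrm \<mu> (partial j \<phi>))\<^sup>2 \<le> gip \<phi> \<phi>" for j
  unfolding gip_smooth[OF s(1)] by (intro member_le_sum) auto
 have D: "(\<integral>\<^sup>+x. ennreal \<bar>\<phi> x * partial j \<phi> x + partial j \<phi> x * \<phi> x\<bar> \<partial>\<mu>) \<le> ennreal (ip \<phi> \<phi> + gip \<phi> \<phi>)" for j
 proof -
  have "\<bar>\<phi> x * partial j \<phi> x + partial j \<phi> x * \<phi> x\<bar> \<le> (\<phi> x)\<^sup>2 + (partial j \<phi> x)\<^sup>2" for x
  proof -
   have "2 * (\<bar>\<phi> x\<bar> * \<bar>partial j \<phi> x\<bar>) \<le> (\<phi> x)\<^sup>2 + (partial j \<phi> x)\<^sup>2"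
    using zero_le_power2[of "\<bar>\<phi> x\<bar> - \<bar>partial j \<phi> x\<bar>"] by (simp add: power2_diff)
   moreover have "\<bar>\<phi> x * partial j \<phi> x + partial j \<phi> x * \<phi> x\<bar> = 2 * (\<bar>\<phi> x\<bar> * \<bar>partial j \<phi> x\<bar>)"
    by (simp add: mult.commute abs_mult flip: mult_2)
   ultimately show ?thesis by simp
  qed
  then have "(\<integral>\<^sup>+x. ennreal \<bar>\<phi> x * partial j \<phi> x + partial j \<phi> x * \<phi> x\<bar> \<partial>\<mu>)
    \<le> (\<integral>\<^sup>+x. ennreal ((\<phi> x)\<^sup>2 + (partial j \<phi> x)\<^sup>2) \<partial>\<mu>)"
   by (intro nn_integral_mono ennreal_leI)
  also have "\<dots> = ennreal (LINT x|\<mu>. (\<phi> x)\<^sup>2 + (partial j \<phi> x)\<^sup>2)"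
   using L Lj by (intro nn_integral_eq_integral) (auto simp: L2_def)
  also have "(LINT x|\<mu>. (\<phi> x)\<^sup>2 + (partial j \<phi> x)\<^sup>2) = ip \<phi> \<phi> + (nrm \<mu> (partial j \<phi>))\<^sup>2"
   using L Lj by (simp add: L2_def ip_self nrm_power2)
  also have "ennreal \<dots> \<le> ennreal (ip \<phi> \<phi> + gip \<phi> \<phi>)" using gj by (intro ennreal_leI) simp
  finally show ?thesis .
 qed
 have "(\<integral>\<^sup>+x. ennreal (((\<phi> x)\<^sup>2)\<^sup>2) \<partial>\<mu>) \<le> ?K * ?K"
 proof (rule L2_bound_c1[OF card c])
  fix j
  have "of_nat (card HP) * (\<integral>\<^sup>+x. ennreal \<bar>(\<phi> x)\<^sup>2\<bar> \<partial>surf)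
    + (\<integral>\<^sup>+x. ennreal \<bar>\<phi> x * partial j \<phi> x + partial j \<phi> x * \<phi> x\<bar> \<partial>\<mu>)
   \<le> of_nat (card HP) * ennreal ((nrm surf \<phi>)\<^sup>2) + ennreal (ip \<phi> \<phi> + gip \<phi> \<phi>)"
   unfolding S by (intro add_left_mono D)
  also have "\<dots> = ?K"
   unfolding tbound_def by (simp add: ennreal_mult ennreal_of_nat_eq_real_of_nat ip_self gip_nonneg)
  finally show "of_nat (card HP) * (\<integral>\<^sup>+x. ennreal \<bar>(\<phi> x)\<^sup>2\<bar> \<partial>surf)
    + (\<integral>\<^sup>+x. ennreal \<bar>\<phi> x * partial j \<phi> x + partial j \<phi> x * \<phi> x\<bar> \<partial>\<mu>) \<le> ?K" .
 next
  show "(\<integral>\<^sup>+x. ennreal \<bar>(\<phi> x)\<^sup>2\<bar> \<partial>\<mu>) \<le> ?K"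
   unfolding G tbound_def using gip_nonneg[of \<phi>] by (intro ennreal_leI) simp
 qed
 then show ?thesis using tbound_nonneg[of \<phi> \<phi>] by (simp add: ennreal_mult power2_eq_square)
qed

lemma tseq_tendsto:
 assumes w: "w \<in> W 1" and f: "f \<in> L2 surf" and t: "tseq w f \<phi>"
 shows "(\<lambda>k. tbound (\<phi> k) (\<phi> k)) \<longlonglongrightarrow> tbound w f"
proof -
 have sm: "smooth (\<phi> k)" "\<phi> k \<in> L2 surf" for k using t by (auto simp: tseq_def)
 have a: "(\<lambda>k. nrm surf (\<phi> k)) \<longlonglongrightarrow> nrm surf f"
  using t by (intro nrm_tendsto sm f) (simp add: tseq_def)
 have b: "(\<lambda>k. nrm \<mu> (\<phi> k)) \<longlonglongrightarrow> nrm \<mu> w"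
  using t by (intro nrm_tendsto smooth_L2 sm W_L2[OF w]) (simp add: tseq_def)
 have c: "(\<lambda>k. nrm \<mu> (partial j (\<phi> k))) \<longlonglongrightarrow> nrm \<mu> (wderiv \<Omega> [j] w)" for j
  using t W_wderiv_L2[OF w, of "[j]"]
  by (intro nrm_tendsto smooth_L2[OF smooth_partial] sm) (auto simp: tseq_def)
 have g: "gip w w = (\<Sum>j\<in>UNIV. (nrm \<mu> (wderiv \<Omega> [j] w))\<^sup>2)" by (simp add: gip_def ip_self)
 show ?thesis unfolding tbound_def gip_smooth[OF sm(1)] ip_self g
  by (intro tendsto_intros a b c)
qed

text \<open>Fatou's lemma along a smooth sequence that converges almost everywhere; the bounds of
  its members converge to that of w.\<close>

lemma trace_L4:
 assumes card: "CARD('n) \<le> 2" and tr: "has_trace 1 \<Omega> w f"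
 shows "(\<lambda>x. (w x)\<^sup>2) \<in> L2 \<mu>" "nrm \<mu> (\<lambda>x. (w x)\<^sup>2) \<le> tbound w f"
proof -
 obtain \<phi> where w: "w \<in> W 1" "f \<in> L2 surf" "tseq w f \<phi>" and ae: "AE x in \<mu>. (\<lambda>k. \<phi> k x) \<longlonglongrightarrow> w x"
  using has_traceE[OF tr] by blast
 have sm: "smooth (\<phi> k)" "\<phi> k \<in> L2 surf" for k using w by (auto simp: tseq_def)
 have wm: "w \<in> borel_measurable \<mu>" using W_L2[OF w(1)] by (simp add: L2_def)
 have \<phi>m: "\<phi> k \<in> borel_measurable \<mu>" for k using smooth_L2[OF sm(1)] by (simp add: L2_def)
 have "(\<integral>\<^sup>+x. ennreal (((w x)\<^sup>2)\<^sup>2) \<partial>\<mu>) = (\<integral>\<^sup>+x. liminf (\<lambda>k. ennreal (((\<phi> k x)\<^sup>2)\<^sup>2)) \<partial>\<mu>)"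
 proof (rule nn_integral_cong_AE)
  show "AE x in \<mu>. ennreal (((w x)\<^sup>2)\<^sup>2) = liminf (\<lambda>k. ennreal (((\<phi> k x)\<^sup>2)\<^sup>2))"
   using ae
  proof eventually_elim
   case (elim x)
   have "(\<lambda>k. ennreal (((\<phi> k x)\<^sup>2)\<^sup>2)) \<longlonglongrightarrow> ennreal (((w x)\<^sup>2)\<^sup>2)"
    by (intro tendsto_ennrealI tendsto_power elim)
   then show ?case by (rule lim_imp_Liminf[symmetric, OF trivial_limit_sequentially])
  qed
 qed
 also have "\<dots> \<le> liminf (\<lambda>k. \<integral>\<^sup>+x. ennreal (((\<phi> k x)\<^sup>2)\<^sup>2) \<partial>\<mu>)"
  by (rule nn_integral_liminf) (intro measurable_compose[OF _ measurable_ennreal] borel_measurable_power \<phi>m)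
 also have "\<dots> \<le> liminf (\<lambda>k. ennreal ((tbound (\<phi> k) (\<phi> k))\<^sup>2))"
  by (intro Liminf_mono always_eventually allI smooth_L4[OF card] sm)
 also have "\<dots> = ennreal ((tbound w f)\<^sup>2)"
  by (intro lim_imp_Liminf tendsto_ennrealI tendsto_power tseq_tendsto w) simp
 finally have b: "(\<integral>\<^sup>+x. ennreal (((w x)\<^sup>2)\<^sup>2) \<partial>\<mu>) \<le> ennreal ((tbound w f)\<^sup>2)" .
 have m: "(\<lambda>x. (w x)\<^sup>2) \<in> borel_measurable \<mu>" using wm by (rule borel_measurable_power)
 show L: "(\<lambda>x. (w x)\<^sup>2) \<in> L2 \<mu>"
  unfolding L2_nn_integral[OF m] using b by (auto intro: le_less_trans)
 have "(nrm \<mu> (\<lambda>x. (w x)\<^sup>2))\<^sup>2 \<le> (tbound w f)\<^sup>2"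
  using b unfolding nrm_nn_integral[OF L] by (simp add: ennreal_le_iff)
 then show "nrm \<mu> (\<lambda>x. (w x)\<^sup>2) \<le> tbound w f" using tbound_nonneg by (rule power2_le_imp_le)
qed

text \<open>For smooth approximants the boundary term is at most a constant times the product of the
  two boundary norms, one of which tends to zero while the other stays bounded.\<close>

lemma trace_ibp:
 assumes "has_trace 1 \<Omega> v (\<lambda>_. 0)" "has_trace 1 \<Omega> w g"
 shows "ip v (wderiv \<Omega> [j] w) + ip (wderiv \<Omega> [j] v) w = 0"
proof -
 obtain \<phi> where v: "v \<in> W 1" "tseq v (\<lambda>_. 0) \<phi>" using has_traceE[OF assms(1)] by blast
 obtain \<psi> where w: "w \<in> W 1" "g \<in> L2 surf" "tseq w g \<psi>" using has_traceE[OF assms(2)] by blast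
 have sm: "smooth (\<phi> k)" "smooth (\<psi> k)" "\<phi> k \<in> L2 surf" "\<psi> k \<in> L2 surf" for k
  using v w by (auto simp: tseq_def)
 have L: "\<phi> k \<in> L2 \<mu>" "\<psi> k \<in> L2 \<mu>" "partial j (\<phi> k) \<in> L2 \<mu>" "partial j (\<psi> k) \<in> L2 \<mu>" for k
  using sm smooth_L2 smooth_partial by blast+
 have Lw: "v \<in> L2 \<mu>" "w \<in> L2 \<mu>" "wderiv \<Omega> [j] v \<in> L2 \<mu>" "wderiv \<Omega> [j] w \<in> L2 \<mu>"
  using v w W_L2 W_wderiv_L2[of _ 1 "[j]"] by auto
 let ?I = "\<lambda>k. (LINT x|\<mu>. \<phi> k x * partial j (\<psi> k) x) + (LINT x|\<mu>. partial j (\<phi> k) x * \<psi> k x)"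
 have "?I \<longlonglongrightarrow> ip v (wderiv \<Omega> [j] w) + ip (wderiv \<Omega> [j] v) w"
  unfolding ip_def using v w by (intro tendsto_add L2_inner_tendsto L Lw) (auto simp: tseq_def)
 moreover have "?I \<longlonglongrightarrow> 0"
 proof (rule Lim_null_comparison[OF always_eventually])
  show "\<forall>k. norm (?I k) \<le> 2 * real (card HP) * (nrm surf (\<phi> k) * nrm surf (\<psi> k))"
  proof
   fix k
   have "?I k = (LINT x|\<mu>. \<phi> k x * partial j (\<psi> k) x + partial j (\<phi> k) x * \<psi> k x)"
    using L by (simp add: L2_mult_integrable)
   then show "norm (?I k) \<le> 2 * real (card HP) * (nrm surf (\<phi> k) * nrm surf (\<psi> k))"
    using integral_product_le_boundary[OF c1_smooth[OF sm(1)[of k], of j]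
      c1_smooth[OF sm(2)[of k], of j] sm(3)[of k] sm(4)[of k]] by simp
  qed
  have "(\<lambda>k. nrm surf (\<phi> k)) \<longlonglongrightarrow> 0" using v(2) by (simp add: tseq_def)
  moreover have "(\<lambda>k. nrm surf (\<psi> k)) \<longlonglongrightarrow> nrm surf g"
   using w by (intro nrm_tendsto sm) (auto simp: tseq_def)
  ultimately have "(\<lambda>k. 2 * real (card HP) * (nrm surf (\<phi> k) * nrm surf (\<psi> k))) \<longlonglongrightarrow> 2 * real (card HP) * (0 * nrm surf g)"
   by (intro tendsto_intros)
  then show "(\<lambda>k. 2 * real (card HP) * (nrm surf (\<phi> k) * nrm surf (\<psi> k))) \<longlonglongrightarrow> 0" by simp
 qed
 ultimately show ?thesis by (rule LIMSEQ_unique)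
qed

text \<open>Integration by parts of v^2 against a smooth weight q. The two factors are taken to be v
  and v q, so that L^2 convergence of the approximants of v is enough to pass to the limit.\<close>

lemma cubic_smooth:
 assumes tr: "has_trace 1 \<Omega> v (\<lambda>_. 0)" and q: "smooth q"
 shows "(LINT x|\<mu>. v x * (v x * partial j q x)) + 2 * (LINT x|\<mu>. wderiv \<Omega> [j] v x * (v x * q x)) = 0"
proof -
 obtain \<phi> where v: "v \<in> W 1" "tseq v (\<lambda>_. 0) \<phi>" using has_traceE[OF tr] by blast
 have sm: "smooth (\<phi> k)" "\<phi> k \<in> L2 surf" for k using v by (auto simp: tseq_def)
 have L: "\<phi> k \<in> L2 \<mu>" "partial j (\<phi> k) \<in> L2 \<mu>" for k using sm smooth_L2 smooth_partial by blast+
 have Lw: "v \<in> L2 \<mu>" "wderiv \<Omega> [j] v \<in> L2 \<mu>" using v W_L2 W_wderiv_L2[of _ 1 "[j]"] by auto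
 have bounded_mult: "(\<lambda>x. f x * q' x) \<in> L2 \<mu>" "(\<lambda>k. nrm \<mu> (\<lambda>x. \<phi> k x * q' x - v x * q' x)) \<longlonglongrightarrow> 0"
  if q': "smooth q'" and f: "f \<in> L2 \<mu>" for f q'
 proof -
  obtain B where B: "\<And>x. x \<in> \<Omega> \<Longrightarrow> \<bar>q' x\<bar> \<le> B" "B \<ge> 0"
   using continuous_bounded_dom[OF smooth_continuous_on[OF q']] by metis
  have qm: "q' \<in> borel_measurable \<mu>" using smooth_L2[OF q'] by (simp add: L2_def)
  show "(\<lambda>x. f x * q' x) \<in> L2 \<mu>" using L2_mult_bounded(1)[OF f qm _ B(2)] B(1) by simp
  show "(\<lambda>k. nrm \<mu> (\<lambda>x. \<phi> k x * q' x - v x * q' x)) \<longlonglongrightarrow> 0"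
  proof (rule Lim_null_comparison[OF always_eventually])
   show "\<forall>k. norm (nrm \<mu> (\<lambda>x. \<phi> k x * q' x - v x * q' x)) \<le> B * nrm \<mu> (\<lambda>x. \<phi> k x - v x)"
    using L2_mult_bounded(2)[OF L2_diff[OF L(1) Lw(1)] qm _ B(2)] B(1)
    by (simp add: nrm_nonneg left_diff_distrib)
   show "(\<lambda>k. B * nrm \<mu> (\<lambda>x. \<phi> k x - v x)) \<longlonglongrightarrow> 0"
    using v(2) by (auto simp: tseq_def intro: tendsto_mult_right_zero)
  qed
 qed
 have qj: "smooth (partial j q)" using q by (rule smooth_partial)
 let ?I = "\<lambda>k. (LINT x|\<mu>. \<phi> k x * (\<phi> k x * partial j q x)) + 2 * (LINT x|\<mu>. partial j (\<phi> k) x * (\<phi> k x * q x))"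
 have "?I \<longlonglongrightarrow> (LINT x|\<mu>. v x * (v x * partial j q x)) + 2 * (LINT x|\<mu>. wderiv \<Omega> [j] v x * (v x * q x))"
  using v by (intro tendsto_add tendsto_mult tendsto_const L2_inner_tendsto L Lw bounded_mult(1)[OF q] bounded_mult(1)[OF qj]
   bounded_mult(2)[OF q Lw(1)] bounded_mult(2)[OF qj Lw(1)])
   (auto simp: tseq_def)
 moreover have "?I \<longlonglongrightarrow> 0"
 proof -
  have "compact (frontier \<Omega>)" using bounded_dom by (intro compact_frontier_bounded)
  then have "compact (q ` frontier \<Omega>)" using smooth_continuous_on[OF q] by (rule compact_continuous_image[rotated])
  then have "bounded (q ` frontier \<Omega>)" by (rule compact_imp_bounded)
  then obtain B0 where B0: "\<forall>y\<in>q ` frontier \<Omega>. \<bar>y\<bar> \<le> B0" by (auto simp: bounded_iff)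
  define B where "B = max B0 0"
  have B: "\<bar>q x\<bar> \<le> B" "B \<ge> 0" if "x \<in> frontier \<Omega>" for x using B0 that by (force simp: B_def)+
  have B0': "B \<ge> 0" by (simp add: B_def)
  have qs: "q \<in> borel_measurable surf" using q by (intro measurable_surf smooth_borel_measurable)
  show ?thesis
  proof (rule Lim_null_comparison[OF always_eventually])
   show "\<forall>k. norm (?I k) \<le> 2 * real (card HP) * (nrm surf (\<phi> k) * (B * nrm surf (\<phi> k)))"
   proof
    fix k
    have Ls: "(\<lambda>x. \<phi> k x * q x) \<in> L2 surf" "nrm surf (\<lambda>x. \<phi> k x * q x) \<le> B * nrm surf (\<phi> k)"
     using L2_mult_bounded[OF sm(2) qs _ B0'] B(1) by (auto simp: space_surf)
    have "?I k = (LINT x|\<mu>. \<phi> k x * (\<phi> k x * partial j q x) + (partial j (\<phi> k) x * (\<phi> k x * q x) + partial j (\<phi> k) x * (\<phi> k x * q x)))"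
    proof -
     have i1: "integrable \<mu> (\<lambda>x. \<phi> k x * (\<phi> k x * partial j q x))"
      by (intro L2_mult_integrable L bounded_mult(1)[OF qj])
     have i2: "integrable \<mu> (\<lambda>x. partial j (\<phi> k) x * (\<phi> k x * q x))"
      by (intro L2_mult_integrable L bounded_mult(1)[OF q])
     show ?thesis
      by (simp only: Bochner_Integration.integral_add[OF i1 Bochner_Integration.integrable_add[OF i2 i2]]
        Bochner_Integration.integral_add[OF i2 i2] mult_2)
    qed
    also have "\<dots> = (LINT x|\<mu>. \<phi> k x * (\<phi> k x * partial j q x + partial j (\<phi> k) x * q x) + partial j (\<phi> k) x * (\<phi> k x * q x))"
     by (intro Bochner_Integration.integral_cong) (auto simp: algebra_simps)
    finally have "\<bar>?I k\<bar> \<le> 2 * real (card HP) * (nrm surf (\<phi> k) * nrm surf (\<lambda>x. \<phi> k x * q x))"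
     using integral_product_le_boundary[OF c1_smooth[OF sm(1)[of k], of j]
      c1_mult[OF c1_smooth[OF sm(1)[of k], of j] c1_smooth[OF q, of j]] sm(2)[of k] Ls(1)]
     by simp
    also have "\<dots> \<le> 2 * real (card HP) * (nrm surf (\<phi> k) * (B * nrm surf (\<phi> k)))"
     by (intro mult_left_mono Ls(2)) (auto simp: nrm_nonneg)
    finally show "norm (?I k) \<le> 2 * real (card HP) * (nrm surf (\<phi> k) * (B * nrm surf (\<phi> k)))" by simp
   qed
   have "(\<lambda>k. nrm surf (\<phi> k)) \<longlonglongrightarrow> 0" using v(2) by (simp add: tseq_def)
   then have "(\<lambda>k. 2 * real (card HP) * (nrm surf (\<phi> k) * (B * nrm surf (\<phi> k)))) \<longlonglongrightarrow> 2 * real (card HP) * (0 * (B * 0))"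
    by (intro tendsto_intros)
   then show "(\<lambda>k. 2 * real (card HP) * (nrm surf (\<phi> k) * (B * nrm surf (\<phi> k)))) \<longlonglongrightarrow> 0" by simp
  qed
 qed
 ultimately show ?thesis by (rule LIMSEQ_unique)
qed

end

lemma L2_mult_L4:
 assumes f: "f \<in> borel_measurable M" "(\<lambda>x. (f x)\<^sup>2) \<in> L2 M"
  and g: "g \<in> borel_measurable M" "(\<lambda>x. (g x)\<^sup>2) \<in> L2 M"
 shows "(\<lambda>x. f x * g x) \<in> L2 M"
  and "(nrm M (\<lambda>x. f x * g x))\<^sup>2 \<le> nrm M (\<lambda>x. (f x)\<^sup>2) * nrm M (\<lambda>x. (g x)\<^sup>2)"
proof -
 have "integrable M (\<lambda>x. (f x)\<^sup>2 * (g x)\<^sup>2)" by (rule L2_mult_integrable[OF f(2) g(2)])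
 then show "(\<lambda>x. f x * g x) \<in> L2 M"
  using f g by (intro L2I borel_measurable_times) (simp_all add: power_mult_distrib)
 show "(nrm M (\<lambda>x. f x * g x))\<^sup>2 \<le> nrm M (\<lambda>x. (f x)\<^sup>2) * nrm M (\<lambda>x. (g x)\<^sup>2)"
  using L2_Cauchy_Schwarz[OF f(2) g(2)] by (simp add: nrm_power2 power_mult_distrib)
qed

section \<open>Squares of functions with zero trace and the nonlinear form\<close>

context cut_domain
begin

text \<open>Replaces the smooth weight by w. The approximants of w converge in L^4 too: the
  difference \<open>\<psi> k - w\<close> has trace \<open>\<psi> k\<close>, so
  \<open>trace_L4\<close> bounds its square by \<open>tbound\<close>, which tends to 0.\<close>

lemma cubic_ibp:
 assumes card: "CARD('n) \<le> 2"
  and trv: "has_trace 1 \<Omega> v (\<lambda>_. 0)" and trw: "has_trace 1 \<Omega> w (\<lambda>_. 0)"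
 shows "ip (\<lambda>x. (v x)\<^sup>2) (wderiv \<Omega> [j] w) + 2 * ip (wderiv \<Omega> [j] v) (\<lambda>x. v x * w x) = 0"
proof -
 obtain \<psi> where w: "w \<in> W 1" "tseq w (\<lambda>_. 0) \<psi>" using has_traceE[OF trw] by blast
 have v: "v \<in> W 1" using has_traceE[OF trv] by blast
 have sm: "smooth (\<psi> k)" "\<psi> k \<in> L2 surf" for k using w by (auto simp: tseq_def)
 have v4: "(\<lambda>x. (v x)\<^sup>2) \<in> L2 \<mu>" using trace_L4(1)[OF card trv] .
 have w4: "(\<lambda>x. (w x)\<^sup>2) \<in> L2 \<mu>" using trace_L4(1)[OF card trw] .
 have vm: "v \<in> borel_measurable \<mu>" and wm: "w \<in> borel_measurable \<mu>" and vj: "wderiv \<Omega> [j] v \<in> L2 \<mu>"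
  using W_L2[OF v] W_L2[OF w(1)] W_wderiv_L2[OF v, of "[j]"] by (auto simp: L2_def)
 have pm: "\<psi> k \<in> borel_measurable \<mu>" for k using smooth_L2[OF sm(1)] by (simp add: L2_def)
 have trk: "has_trace 1 \<Omega> (\<psi> k) (\<psi> k)" for k by (rule smooth_has_trace[OF sm])
 have trd: "has_trace 1 \<Omega> (\<lambda>x. 1 * \<psi> k x + (-1) * w x) (\<lambda>x. 1 * \<psi> k x + (-1) * 0)" for k
  by (rule has_trace_lincomb[OF trk trw])
 then have trd: "has_trace 1 \<Omega> (\<lambda>x. \<psi> k x - w x) (\<psi> k)" for k by simp
 have vp: "(\<lambda>x. v x * \<psi> k x) \<in> L2 \<mu>" for k
  by (rule L2_mult_L4(1)[OF vm v4 pm trace_L4(1)[OF card trk]])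
 have vw: "(\<lambda>x. v x * w x) \<in> L2 \<mu>" by (rule L2_mult_L4(1)[OF vm v4 wm w4])
 have tb: "(\<lambda>k. tbound (\<lambda>x. \<psi> k x - w x) (\<psi> k)) \<longlonglongrightarrow> 0"
 proof -
  have W: "(\<lambda>x. \<psi> k x - w x) \<in> W 1" for k using has_traceE[OF trd] by blast
  have g: "gip (\<lambda>x. \<psi> k x - w x) (\<lambda>x. \<psi> k x - w x) = (\<Sum>j\<in>UNIV. (nrm \<mu> (\<lambda>x. partial j (\<psi> k) x - wderiv \<Omega> [j] w x))\<^sup>2)" for k
  proof -
   have "nrm \<mu> (wderiv \<Omega> [j] (\<lambda>x. \<psi> k x - w x)) = nrm \<mu> (\<lambda>x. partial j (\<psi> k) x - wderiv \<Omega> [j] w x)" for j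
   proof (rule nrm_cong_AE)
    have "AE x in \<mu>. wderiv \<Omega> [j] (\<lambda>x. 1 * \<psi> k x + (-1) * w x) x = 1 * wderiv \<Omega> [j] (\<psi> k) x + (-1) * wderiv \<Omega> [j] w x"
     by (rule wderiv_lincomb[OF smooth_W1[OF sm(1)] w(1)]) simp
    with smooth_wderiv[OF sm(1)[of k], of j]
    show "AE x in \<mu>. wderiv \<Omega> [j] (\<lambda>x. \<psi> k x - w x) x = partial j (\<psi> k) x - wderiv \<Omega> [j] w x"
     by eventually_elim simp
    show "wderiv \<Omega> [j] (\<lambda>x. \<psi> k x - w x) \<in> borel_measurable \<mu>"
     using W_wderiv_L2[OF W, of "[j]"] by (simp add: L2_def)
    show "(\<lambda>x. partial j (\<psi> k) x - wderiv \<Omega> [j] w x) \<in> borel_measurable \<mu>"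
     using smooth_L2[OF smooth_partial[OF sm(1)]] W_wderiv_L2[OF w(1), of "[j]"]
     by (intro borel_measurable_diff) (auto simp: L2_def)
   qed
   then show ?thesis by (simp add: gip_def ip_self)
  qed
  have "(\<lambda>k. tbound (\<lambda>x. \<psi> k x - w x) (\<psi> k)) \<longlonglongrightarrow> real (card HP) * 0\<^sup>2 + (0\<^sup>2 + (\<Sum>j\<in>(UNIV :: 'n set). 0\<^sup>2))"
   unfolding tbound_def g ip_self using w(2)
   by (intro tendsto_add tendsto_mult tendsto_const tendsto_sum tendsto_power) (auto simp: tseq_def)
  then show ?thesis by simp
 qed
 have conv: "(\<lambda>k. nrm \<mu> (\<lambda>x. v x * \<psi> k x - v x * w x)) \<longlonglongrightarrow> 0"
 proof -
  have "(\<lambda>k. (nrm \<mu> (\<lambda>x. v x * \<psi> k x - v x * w x))\<^sup>2) \<longlonglongrightarrow> 0"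
  proof (rule Lim_null_comparison[OF always_eventually])
   show "\<forall>k. norm ((nrm \<mu> (\<lambda>x. v x * \<psi> k x - v x * w x))\<^sup>2) \<le> nrm \<mu> (\<lambda>x. (v x)\<^sup>2) * tbound (\<lambda>x. \<psi> k x - w x) (\<psi> k)"
   proof
    fix k
    have "(nrm \<mu> (\<lambda>x. v x * (\<psi> k x - w x)))\<^sup>2 \<le> nrm \<mu> (\<lambda>x. (v x)\<^sup>2) * nrm \<mu> (\<lambda>x. (\<psi> k x - w x)\<^sup>2)"
     by (rule L2_mult_L4(2)[OF vm v4 borel_measurable_diff[OF pm wm] trace_L4(1)[OF card trd]])
    also have "\<dots> \<le> nrm \<mu> (\<lambda>x. (v x)\<^sup>2) * tbound (\<lambda>x. \<psi> k x - w x) (\<psi> k)"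
     by (intro mult_left_mono trace_L4(2)[OF card trd] nrm_nonneg)
    finally show "norm ((nrm \<mu> (\<lambda>x. v x * \<psi> k x - v x * w x))\<^sup>2) \<le> nrm \<mu> (\<lambda>x. (v x)\<^sup>2) * tbound (\<lambda>x. \<psi> k x - w x) (\<psi> k)"
     by (simp add: right_diff_distrib)
   qed
   show "(\<lambda>k. nrm \<mu> (\<lambda>x. (v x)\<^sup>2) * tbound (\<lambda>x. \<psi> k x - w x) (\<psi> k)) \<longlonglongrightarrow> 0"
    by (rule tendsto_mult_right_zero[OF tb])
  qed
  then have "(\<lambda>k. sqrt ((nrm \<mu> (\<lambda>x. v x * \<psi> k x - v x * w x))\<^sup>2)) \<longlonglongrightarrow> sqrt 0" by (rule tendsto_real_sqrt)
  then show ?thesis by (simp add: nrm_nonneg)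
 qed
 have "(\<lambda>k. (LINT x|\<mu>. partial j (\<psi> k) x * (v x)\<^sup>2) + 2 * (LINT x|\<mu>. (v x * \<psi> k x) * wderiv \<Omega> [j] v x)) \<longlonglongrightarrow>
   (LINT x|\<mu>. wderiv \<Omega> [j] w x * (v x)\<^sup>2) + 2 * (LINT x|\<mu>. (v x * w x) * wderiv \<Omega> [j] v x)"
  using w(2) W_wderiv_L2[OF w(1), of "[j]"]
  by (intro tendsto_add tendsto_mult tendsto_const L2_inner_tendsto_left conv vp vw vj v4 smooth_L2[OF smooth_partial] sm)
   (auto simp: tseq_def)
 moreover have "(LINT x|\<mu>. partial j (\<psi> k) x * (v x)\<^sup>2) + 2 * (LINT x|\<mu>. (v x * \<psi> k x) * wderiv \<Omega> [j] v x) = 0" for k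
  using cubic_smooth[OF trv sm(1)[of k], of j] by (simp add: power2_eq_square mult_ac)
 ultimately have "(LINT x|\<mu>. wderiv \<Omega> [j] w x * (v x)\<^sup>2) + 2 * (LINT x|\<mu>. (v x * w x) * wderiv \<Omega> [j] v x) = 0"
  by (simp add: LIMSEQ_const_iff)
 then show ?thesis by (simp add: ip_def mult_ac)
qed

text \<open>The defining identity is \<open>cubic_smooth\<close> with the test function as
  weight.\<close>

lemma weak_deriv_square:
 assumes card: "CARD('n) \<le> 2" and tr: "has_trace 1 \<Omega> v (\<lambda>_. 0)"
 shows "is_weak_deriv \<Omega> [j] (\<lambda>x. (v x)\<^sup>2) (\<lambda>x. 2 * (v x * wderiv \<Omega> [j] v x))"
 unfolding is_weak_deriv_def
proof (intro conjI allI impI)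
 have v: "v \<in> W 1" using has_traceE[OF tr] by blast
 have L: "v \<in> L2 \<mu>" "wderiv \<Omega> [j] v \<in> L2 \<mu>" using W_L2[OF v] W_wderiv_L2[OF v, of "[j]"] by auto
 show "loc_integrable \<Omega> (\<lambda>x. (v x)\<^sup>2)" by (rule loc_integrable_L2[OF trace_L4(1)[OF card tr]])
 show "loc_integrable \<Omega> (\<lambda>x. 2 * (v x * wderiv \<Omega> [j] v x))"
  by (intro loc_integrable_integrable integrable_mult_right L2_mult_integrable L)
 fix q assume "test_function \<Omega> q"
 then have "smooth q" by (simp add: test_function_def)
 have "(LINT x|\<mu>. 2 * (v x * wderiv \<Omega> [j] v x) * q x) = 2 * (LINT x|\<mu>. wderiv \<Omega> [j] v x * (v x * q x))"
  by (subst integral_mult_right_zero[symmetric]) (intro Bochner_Integration.integral_cong, auto)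
 with cubic_smooth[OF tr \<open>smooth q\<close>, of j]
 show "L2_inner \<Omega> (\<lambda>x. (v x)\<^sup>2) (partials [j] q) = (- 1) ^ length [j] * L2_inner \<Omega> (\<lambda>x. 2 * (v x * wderiv \<Omega> [j] v x)) q"
  by (simp add: L2_inner_eq power2_eq_square mult.assoc)
qed

text \<open>The form -(g(v), grad w) of the convective term in coordinates. The components of g
  carry a minus sign, so both summands appear with a plus.\<close>

definition nlf :: "(real^'n \<Rightarrow> real) \<Rightarrow> (real^'n \<Rightarrow> real) \<Rightarrow> real" where
 "nlf v w = (\<Sum>j\<in>UNIV. ip v (wderiv \<Omega> [j] w) + ip (\<lambda>x. (v x)\<^sup>2) (wderiv \<Omega> [j] w) / 2)"

lemma flux_wgrad:
 assumes card: "CARD('n) \<le> 2" and tr: "has_trace 1 \<Omega> v (\<lambda>_. 0)" and w: "w \<in> W 1"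
 shows "- L2_inner \<Omega> (\<lambda>x. flux (v x)) (wgrad \<Omega> w) = nlf v w"
proof -
 have v: "v \<in> W 1" using has_traceE[OF tr] by blast
 have L: "v \<in> L2 \<mu>" "(\<lambda>x. (v x)\<^sup>2) \<in> L2 \<mu>" "wderiv \<Omega> [j] w \<in> L2 \<mu>" for j
  using W_L2[OF v] W_wderiv_L2[OF w, of "[j]"] trace_L4(1)[OF card tr] by auto
 have "- L2_inner \<Omega> (\<lambda>x. flux (v x)) (wgrad \<Omega> w) =
   (LINT x|\<mu>. - (\<Sum>j\<in>UNIV. (- (v x + (v x)\<^sup>2 / 2)) * wderiv \<Omega> [j] w x))"
  by (simp add: L2_inner_def inner_vec_def flux_def wgrad_def)
 also have "\<dots> = (LINT x|\<mu>. (\<Sum>j\<in>UNIV. v x * wderiv \<Omega> [j] w x + (v x)\<^sup>2 * wderiv \<Omega> [j] w x / 2))"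
  by (intro Bochner_Integration.integral_cong) (auto simp: sum_negf[symmetric] algebra_simps intro!: sum.cong)
 also have "\<dots> = (\<Sum>j\<in>UNIV. LINT x|\<mu>. (v x * wderiv \<Omega> [j] w x + (v x)\<^sup>2 * wderiv \<Omega> [j] w x / 2))"
  using L by (intro Bochner_Integration.integral_sum Bochner_Integration.integrable_add
    integrable_divide_zero L2_mult_integrable)
 also have "\<dots> = nlf v w"
  unfolding nlf_def ip_def using L by (intro sum.cong refl) (simp add: L2_mult_integrable)
 finally show ?thesis .
qed

text \<open>Brings the divergence form of (P1) to the form of (P1h), so that the two equations can
  be subtracted: \<open>trace_ibp\<close> moves the derivative in the linear part,
  \<open>cubic_ibp\<close> in the quadratic one.\<close>

lemma wdiv_flux:
 assumes card: "CARD('n) \<le> 2" and trv: "has_trace 1 \<Omega> v (\<lambda>_. 0)" and trw: "has_trace 1 \<Omega> w (\<lambda>_. 0)"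
 shows "L2_inner \<Omega> (wdiv \<Omega> (\<lambda>x. flux (v x))) w = nlf v w"
proof -
 have v: "v \<in> W 1" using has_traceE[OF trv] by blast
 have w: "w \<in> W 1" using has_traceE[OF trw] by blast
 have L: "v \<in> L2 \<mu>" "(\<lambda>x. (v x)\<^sup>2) \<in> L2 \<mu>" "w \<in> L2 \<mu>" "wderiv \<Omega> [j] v \<in> L2 \<mu>" for j
  using W_L2[OF v] W_L2[OF w] W_wderiv_L2[OF v, of "[j]"] trace_L4(1)[OF card trv] by auto
 have vw: "(\<lambda>x. v x * w x) \<in> L2 \<mu>"
  using L trace_L4(1)[OF card trw] by (intro L2_mult_L4(1)) (auto simp: L2_def)
 have wd: "is_weak_deriv \<Omega> [j] (\<lambda>y. flux (v y) $ j) (\<lambda>x. (-1) * wderiv \<Omega> [j] v x + (-1/2) * (2 * (v x * wderiv \<Omega> [j] v x)))" for j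
 proof -
  have "(\<lambda>y. flux (v y) $ j) = (\<lambda>y. (-1) * v y + (-1/2) * (v y)\<^sup>2)" by (auto simp: flux_def)
  then show ?thesis
   using is_weak_deriv_lincomb[OF W_is_weak_deriv[OF v, of "[j]"] weak_deriv_square[OF card trv], of "-1" "-1/2"] by simp
 qed
 have "AE x in \<mu>. \<forall>j\<in>UNIV. wderiv \<Omega> [j] (\<lambda>y. flux (v y) $ j) x = (-1) * wderiv \<Omega> [j] v x + (-1/2) * (2 * (v x * wderiv \<Omega> [j] v x))"
  by (intro AE_finite_allI wderiv_AE[OF wd]) simp
 then have ae: "AE x in \<mu>. wdiv \<Omega> (\<lambda>x. flux (v x)) x * w x = (\<Sum>j\<in>UNIV. - (wderiv \<Omega> [j] v x * w x) - wderiv \<Omega> [j] v x * (v x * w x))"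
 proof eventually_elim
  case (elim x)
  show ?case unfolding wdiv_def sum_distrib_right
  proof (intro sum.cong refl)
   fix j
   have "wderiv \<Omega> [j] (\<lambda>y. flux (v y) $ j) x = - wderiv \<Omega> [j] v x - v x * wderiv \<Omega> [j] v x"
    using elim by simp
   then show "wderiv \<Omega> [j] (\<lambda>y. flux (v y) $ j) x * w x = - (wderiv \<Omega> [j] v x * w x) - wderiv \<Omega> [j] v x * (v x * w x)"
    by (simp only:) (simp add: algebra_simps)
  qed
 qed
 have int: "integrable \<mu> (\<lambda>x. - (wderiv \<Omega> [j] v x * w x) - wderiv \<Omega> [j] v x * (v x * w x))" for j
  by (intro Bochner_Integration.integrable_diff Bochner_Integration.integrable_minus L2_mult_integrable L vw)
 have m: "(\<lambda>x. \<Sum>j\<in>UNIV. - (wderiv \<Omega> [j] v x * w x) - wderiv \<Omega> [j] v x * (v x * w x)) \<in> borel_measurable \<mu>"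
  using int by (intro borel_measurable_sum) blast
 have m': "(\<lambda>x. wdiv \<Omega> (\<lambda>x. flux (v x)) x * w x) \<in> borel_measurable \<mu>"
  by (rule borel_measurable_AE_mu[OF m]) (use ae in \<open>eventually_elim, simp\<close>)
 have "L2_inner \<Omega> (wdiv \<Omega> (\<lambda>x. flux (v x))) w = (LINT x|\<mu>. (\<Sum>j\<in>UNIV. - (wderiv \<Omega> [j] v x * w x) - wderiv \<Omega> [j] v x * (v x * w x)))"
  unfolding L2_inner_eq by (rule integral_cong_AE[OF m' m ae])
 also have "\<dots> = (\<Sum>j\<in>UNIV. LINT x|\<mu>. - (wderiv \<Omega> [j] v x * w x) - wderiv \<Omega> [j] v x * (v x * w x))"
  by (intro Bochner_Integration.integral_sum int)
 also have "\<dots> = (\<Sum>j\<in>UNIV. - ip (wderiv \<Omega> [j] v) w - ip (wderiv \<Omega> [j] v) (\<lambda>x. v x * w x))"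
  unfolding ip_def using L vw by (intro sum.cong refl) (simp add: L2_mult_integrable)
 also have "\<dots> = nlf v w"
  unfolding nlf_def
 proof (intro sum.cong refl)
  fix j
  show "- ip (wderiv \<Omega> [j] v) w - ip (wderiv \<Omega> [j] v) (\<lambda>x. v x * w x) =
    ip v (wderiv \<Omega> [j] w) + ip (\<lambda>x. (v x)\<^sup>2) (wderiv \<Omega> [j] w) / 2"
   using trace_ibp[OF trv trw, of j] cubic_ibp[OF card trv trw, of j] by linarith
 qed
 finally show ?thesis .
qed

section \<open>The spaces with vanishing traces\<close>

lemma H01_iff: "v \<in> H01 \<Omega> \<longleftrightarrow> has_trace 1 \<Omega> v (\<lambda>_. 0)"
 by (auto simp: H01_def has_trace_def)

lemma H02_iff: "v \<in> H02 \<Omega> \<longleftrightarrow> v \<in> W 2 \<and> has_trace 1 \<Omega> v (\<lambda>_. 0) \<and> vanishing_normal_derivative \<Omega> v"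
 by (simp add: H02_def sobolev_space_2)

lemma H02_subset_H01: "H02 \<Omega> \<subseteq> H01 \<Omega>"
 by (auto simp: H01_iff H02_iff)

lemma H01_lincomb: "v \<in> H01 \<Omega> \<Longrightarrow> w \<in> H01 \<Omega> \<Longrightarrow> (\<lambda>x. a * v x + b * w x) \<in> H01 \<Omega>"
 using has_trace_lincomb[of v "\<lambda>_. 0" w "\<lambda>_. 0" a b] by (simp add: H01_iff)

lemma has_trace_cong_AE:
 assumes "has_trace 1 \<Omega> v f" "w \<in> W 1" "AE x in \<mu>. v x = w x" "\<And>j. AE x in \<mu>. wderiv \<Omega> [j] v x = wderiv \<Omega> [j] w x"
 shows "has_trace 1 \<Omega> w f"
proof -
 obtain \<phi> where v: "v \<in> W 1" "f \<in> L2 surf" "tseq v f \<phi>" using has_traceE[OF assms(1)] by blast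
 have sm: "smooth (\<phi> k)" for k using v by (auto simp: tseq_def)
 have m: "v \<in> borel_measurable \<mu>" "w \<in> borel_measurable \<mu>" "\<phi> k \<in> borel_measurable \<mu>"
   "wderiv \<Omega> [j] v \<in> borel_measurable \<mu>" "wderiv \<Omega> [j] w \<in> borel_measurable \<mu>"
   "partial j (\<phi> k) \<in> borel_measurable \<mu>" for j k
  using W_L2[OF v(1)] W_L2[OF assms(2)] smooth_L2[OF sm] smooth_L2[OF smooth_partial[OF sm]]
   W_wderiv_L2[OF v(1), of "[j]"] W_wderiv_L2[OF assms(2), of "[j]"] by (auto simp: L2_def)
 have "nrm \<mu> (\<lambda>x. \<phi> k x - w x) = nrm \<mu> (\<lambda>x. \<phi> k x - v x)" for k
  by (intro nrm_cong_AE borel_measurable_diff m) (use assms(3) in \<open>eventually_elim, simp\<close>)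
 moreover have "nrm \<mu> (\<lambda>x. partial j (\<phi> k) x - wderiv \<Omega> [j] w x) = nrm \<mu> (\<lambda>x. partial j (\<phi> k) x - wderiv \<Omega> [j] v x)" for j k
  by (intro nrm_cong_AE borel_measurable_diff m) (use assms(4)[of j] in \<open>eventually_elim, simp\<close>)
 ultimately have "tseq w f \<phi>" using v(3) by (simp add: tseq_def)
 then show ?thesis by (rule has_traceI[OF assms(2) v(2)])
qed

text \<open>The derivative of a combination is the combination of the derivatives only almost
  everywhere, so its trace has to be carried over, together with agreement of the second
  derivatives.\<close>

lemma H02_lincomb:
 assumes "v \<in> H02 \<Omega>" "w \<in> H02 \<Omega>"
 shows "(\<lambda>x. a * v x + b * w x) \<in> H02 \<Omega>"
 unfolding H02_iff
proof (intro conjI)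
 have vw: "v \<in> W 2" "w \<in> W 2" using assms by (auto simp: H02_iff)
 then show W: "(\<lambda>x. a * v x + b * w x) \<in> W 2" by (rule W_lincomb)
 show "has_trace 1 \<Omega> (\<lambda>x. a * v x + b * w x) (\<lambda>_. 0)"
  using H01_lincomb[of v w a b] assms by (auto simp: H01_iff H02_iff)
 obtain f where f: "\<And>j. has_trace 1 \<Omega> (wderiv \<Omega> [j] v) (\<lambda>x. f x $ j)"
  "AE x in surf. \<forall>\<nu>. outward_normal \<Omega> x \<nu> \<longrightarrow> f x \<bullet> \<nu> = 0"
  using assms(1) by (auto simp: H02_iff vanishing_normal_derivative_def)
 obtain g where g: "\<And>j. has_trace 1 \<Omega> (wderiv \<Omega> [j] w) (\<lambda>x. g x $ j)"
  "AE x in surf. \<forall>\<nu>. outward_normal \<Omega> x \<nu> \<longrightarrow> g x \<bullet> \<nu> = 0"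
  using assms(2) by (auto simp: H02_iff vanishing_normal_derivative_def)
 show "vanishing_normal_derivative \<Omega> (\<lambda>x. a * v x + b * w x)"
  unfolding vanishing_normal_derivative_def
 proof (intro exI[of _ "\<lambda>x. a *\<^sub>R f x + b *\<^sub>R g x"] conjI allI)
  fix j
  let ?l = "\<lambda>x. a * wderiv \<Omega> [j] v x + b * wderiv \<Omega> [j] w x"
  let ?r = "wderiv \<Omega> [j] (\<lambda>x. a * v x + b * w x)"
  have tr: "has_trace 1 \<Omega> ?l (\<lambda>x. (a *\<^sub>R f x + b *\<^sub>R g x) $ j)"
   using has_trace_lincomb[OF f(1)[of j] g(1)[of j], of a b] by simp
  show "has_trace 1 \<Omega> ?r (\<lambda>x. (a *\<^sub>R f x + b *\<^sub>R g x) $ j)"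
  proof (rule has_trace_cong_AE[OF tr W2_wderiv_W1[OF W]])
   have "AE x in \<mu>. ?r x = ?l x" by (rule wderiv_lincomb[OF vw]) simp
   then show "AE x in \<mu>. ?l x = ?r x" by eventually_elim simp
   fix i
   have "AE x in \<mu>. wderiv \<Omega> [i] ?l x = a * wderiv \<Omega> [i] (wderiv \<Omega> [j] v) x + b * wderiv \<Omega> [i] (wderiv \<Omega> [j] w) x"
    by (rule wderiv_lincomb[OF W2_wderiv_W1[OF vw(1)] W2_wderiv_W1[OF vw(2)]]) simp
   moreover have "AE x in \<mu>. wderiv \<Omega> [j, i] (\<lambda>x. a * v x + b * w x) x = a * wderiv \<Omega> [j, i] v x + b * wderiv \<Omega> [j, i] w x"
    by (rule wderiv_lincomb[OF vw]) simp
   ultimately show "AE x in \<mu>. wderiv \<Omega> [i] ?l x = wderiv \<Omega> [i] ?r x"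
    using wderiv_wderiv_AE[OF vw(1), of i j] wderiv_wderiv_AE[OF vw(2), of i j] wderiv_wderiv_AE[OF W, of i j]
    by eventually_elim simp
  qed
 next
  show "AE x in surf. \<forall>\<nu>. outward_normal \<Omega> x \<nu> \<longrightarrow> (a *\<^sub>R f x + b *\<^sub>R g x) \<bullet> \<nu> = 0"
   using f(2) g(2) by eventually_elim (simp add: inner_add_left)
 qed
qed

text \<open>Integration by parts turns the squared norm of the gradient into minus the inner product
  of v and its Laplacian; Cauchy-Schwarz and Young's inequality give the factor 1/2. Hence the
  energy form alone controls \<open>norm2\<close> on H_0^2.\<close>

lemma gip_le_aip:
 assumes "v \<in> H02 \<Omega>"
 shows "gip v v \<le> aip v v / 2"
proof -
 have v: "v \<in> W 2" and tr: "has_trace 1 \<Omega> v (\<lambda>_. 0)" using assms by (auto simp: H02_iff)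
 obtain f where f: "\<And>j. has_trace 1 \<Omega> (wderiv \<Omega> [j] v) (\<lambda>x. f x $ j)"
  using assms by (auto simp: H02_iff vanishing_normal_derivative_def)
 have L: "v \<in> L2 \<mu>" "wlaplace \<Omega> v \<in> L2 \<mu>" "wderiv \<Omega> [j, j] v \<in> L2 \<mu>" "wderiv \<Omega> [j] (wderiv \<Omega> [j] v) \<in> L2 \<mu>" for j
  using W_L2[OF v] wlaplace_L2[OF v] W_wderiv_L2[OF v, of "[j, j]"] W_wderiv_L2[OF W2_wderiv_W1[OF v], of "[j]"] by auto
 have "gip v v = (\<Sum>j\<in>UNIV. - ip v (wderiv \<Omega> [j, j] v))"
  unfolding gip_def
 proof (intro sum.cong refl)
  fix j
  have "ip v (wderiv \<Omega> [j] (wderiv \<Omega> [j] v)) = ip v (wderiv \<Omega> [j, j] v)"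
   using wderiv_wderiv_AE[OF v, of j j] by (intro ip_cong_AE L) auto
  then show "ip (wderiv \<Omega> [j] v) (wderiv \<Omega> [j] v) = - ip v (wderiv \<Omega> [j, j] v)"
   using trace_ibp[OF tr f[of j], of j] by simp
 qed
 also have "\<dots> = - ip v (wlaplace \<Omega> v)"
  unfolding ip_def wlaplace_def sum_distrib_left sum_negf
  by (subst Bochner_Integration.integral_sum) (auto intro!: L2_mult_integrable L)
 also have "\<dots> \<le> nrm \<mu> v * nrm \<mu> (wlaplace \<Omega> v)" using ip_CS[OF L(1,2)] by linarith
 also have "\<dots> \<le> aip v v / 2"
  unfolding aip_def ip_self using zero_le_power2[of "nrm \<mu> v - nrm \<mu> (wlaplace \<Omega> v)"] by (simp add: power2_diff)
 finally show ?thesis .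
qed

end

section \<open>Weak time derivatives\<close>

lemma smooth1_imp_time_test_function:
 assumes "smooth1 \<psi>" "0 < a" "b < T" "\<And>t. t \<notin> {a..b} \<Longrightarrow> \<psi> t = 0"
 shows "time_test_function T \<psi>"
 unfolding time_test_function_def using assms smooth1_deriv_power by blast

lemma deriv_step_support: "x \<notin> {0..1} \<Longrightarrow> deriv step x = 0"
proof -
 assume x: "x \<notin> {0..1}"
 have "(step has_real_derivative 0) (at x)"
 proof (cases "x < 0")
  case True
  show ?thesis
   by (rule has_field_derivative_transform_within_open[where f="\<lambda>_. 0" and S="{..<0}"])
    (use True in \<open>auto simp: step_nonpos\<close>)
 next
  case False
  then have "x > 1" using x by auto
  show ?thesis
   by (rule has_field_derivative_transform_within_open[where f="\<lambda>_. 1" and S="{1<..}"])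
    (use \<open>x > 1\<close> in \<open>auto simp: step_ge_1\<close>)
 qed
 then show ?thesis by (rule DERIV_imp_deriv)
qed

lemma continuous_deriv_step: "continuous_on UNIV (deriv step)"
 by (rule smooth1_continuous_on[OF smooth1_deriv[OF smooth1_step]])

lemma integral_deriv_step: "(LINT x|lborel. deriv step x) = 1"
proof -
 have "(LINT x|lborel. deriv step x * indicator {0..1} x) = step 1 - step 0"
  by (rule integral_FTC_Icc_real)
   (use continuous_deriv_step smooth1_DERIV[OF smooth1_step] in \<open>auto simp: continuous_on_eq_continuous_at\<close>)
 moreover have "(\<lambda>x. deriv step x * indicator {0..1} x) = deriv step"
  using deriv_step_support by (fastforce simp: indicator_def)
 ultimately show ?thesis by (simp add: step_nonpos step_ge_1)
qed

lemma deriv_step_bounded: obtains B where "\<And>x. \<bar>deriv step x\<bar> \<le> B * indicator {0..1} x" "B \<ge> 0"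
proof -
 have "compact (deriv step ` {0..1})"
  using continuous_deriv_step by (intro compact_continuous_image) (auto intro: continuous_on_subset)
 then have "bounded (deriv step ` {0..1})" by (rule compact_imp_bounded)
 then obtain B where B: "\<forall>y\<in>deriv step ` {0..1}. \<bar>y\<bar> \<le> B" by (auto simp: bounded_iff)
 show ?thesis
 proof (rule that[of "max B 0"])
  fix x
  show "\<bar>deriv step x\<bar> \<le> max B 0 * indicator {0..1} x"
  proof (cases "x \<in> {0..1}")
   case True
   then have "\<bar>deriv step x\<bar> \<le> B" using B by blast
   then show ?thesis using True by simp
  next
   case False
   show ?thesis using False deriv_step_support[OF False] by simp
  qed
 qed simp
qed

lemma deriv_step_scaled: "((\<lambda>t. step (k * (t - s))) has_real_derivative k * deriv step (k * (t - s))) (at t)"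
 by (rule DERIV_cong[OF DERIV_chain2[OF smooth1_DERIV[OF smooth1_step]]])
  (auto intro!: derivative_eq_intros)

text \<open>The rescaled derivative of \<open>step\<close> has integral 1 and lives on
  [s, s + 1/(k+1)], so it averages f just to the right of s.\<close>

lemma mollify_tendsto:
 fixes f :: "real \<Rightarrow> real"
 assumes fm: "(\<lambda>t. indicator {0<..<T} t * f t) \<in> borel_measurable borel"
  and bd: "\<And>t. t \<in> {0<..<T} \<Longrightarrow> \<bar>f t\<bar> \<le> M" "M \<ge> 0" and s: "s \<in> {0<..<T}" and cont: "isCont f s"
 shows "(\<lambda>k. LINT t|lborel. (real (Suc k) * deriv step (real (Suc k) * (t - s))) * (indicator {0<..<T} t * f t)) \<longlonglongrightarrow> f s"
proof -
 obtain B where B: "\<And>x. \<bar>deriv step x\<bar> \<le> B * indicator {0..1} x" "B \<ge> 0" using deriv_step_bounded by metis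
 have dm: "deriv step \<in> borel_measurable borel" using continuous_deriv_step by (rule borel_measurable_continuous_onI)
 let ?F = "\<lambda>t. indicator {0<..<T} t * f t"
 have conv: "(LINT t|lborel. (real (Suc k) * deriv step (real (Suc k) * (t - s))) * ?F t) =
   (LINT x|lborel. deriv step x * ?F (s + x / real (Suc k)))" for k
 proof -
  let ?c = "1 / real (Suc k)"
  have "(LINT t|lborel. (real (Suc k) * deriv step (real (Suc k) * (t - s))) * ?F t) =
   \<bar>?c\<bar> *\<^sub>R (LINT x|lborel. (real (Suc k) * deriv step (real (Suc k) * ((s + ?c * x) - s))) * ?F (s + ?c * x))"
   by (rule lborel_integral_real_affine) simp
  also have "\<dots> = \<bar>?c\<bar> *\<^sub>R (LINT x|lborel. real (Suc k) * (deriv step x * ?F (s + x / real (Suc k))))"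
  proof -
   have "real (Suc k) * ((s + ?c * x) - s) = x" for x by simp
   then show ?thesis by (simp only: mult.assoc) simp
  qed
  also have "\<dots> = (LINT x|lborel. deriv step x * ?F (s + x / real (Suc k)))" by simp
  finally show ?thesis .
 qed
 have "(\<lambda>k. LINT x|lborel. deriv step x * ?F (s + x / real (Suc k))) \<longlonglongrightarrow> (LINT x|lborel. deriv step x * f s)"
 proof (rule integral_dominated_convergence)
  show "(\<lambda>x. deriv step x * f s) \<in> borel_measurable lborel" using dm by simp
  show "(\<lambda>x. deriv step x * ?F (s + x / real (Suc k))) \<in> borel_measurable lborel" for k
   using dm measurable_compose[OF _ fm, of "\<lambda>x. s + x / real (Suc k)" lborel] by simp
  show "integrable lborel (\<lambda>x. (B * M) * indicator {0..1::real} x)" by simp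
  show "AE x in lborel. (\<lambda>k. deriv step x * ?F (s + x / real (Suc k))) \<longlonglongrightarrow> deriv step x * f s"
  proof (intro always_eventually allI tendsto_mult tendsto_const)
   fix x
   have lim: "(\<lambda>k. s + x / real (Suc k)) \<longlonglongrightarrow> s"
    using tendsto_add[OF tendsto_const[of s] LIMSEQ_Suc[OF lim_const_over_n[of x]]] by simp
   have "\<forall>\<^sub>F k in sequentially. s + x / real (Suc k) \<in> {0<..<T}"
    using topological_tendstoD[OF lim, of "{0<..<T}"] s by simp
   then have "\<forall>\<^sub>F k in sequentially. f (s + x / real (Suc k)) = ?F (s + x / real (Suc k))"
    by eventually_elim simp
   with isCont_tendsto_compose[OF cont lim] show "(\<lambda>k. ?F (s + x / real (Suc k))) \<longlonglongrightarrow> f s"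
    by (rule Lim_transform_eventually)
  qed
  show "AE x in lborel. norm (deriv step x * ?F (s + x / real (Suc k))) \<le> (B * M) * indicator {0..1} x" for k
  proof (intro always_eventually allI)
   fix x
   have "\<bar>?F (s + x / real (Suc k))\<bar> \<le> M" using bd by (auto simp: indicator_def)
   then have "\<bar>deriv step x\<bar> * \<bar>?F (s + x / real (Suc k))\<bar> \<le> (B * indicator {0..1} x) * M"
    by (intro mult_mono B(1)) (use B(2) in auto)
   then show "norm (deriv step x * ?F (s + x / real (Suc k))) \<le> (B * M) * indicator {0..1} x"
    by (simp add: abs_mult mult_ac)
  qed
 qed
 then show ?thesis unfolding conv by (simp add: integral_deriv_step)
qed

text \<open>The test functions are differences of two steep steps, at s and at t. They tend to the
  indicator of (s, t], while their derivatives are mollifiers at the two end points.\<close>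

lemma weak_FTC:
 fixes f g :: "real \<Rightarrow> real"
 assumes T: "T > 0" and cont: "continuous_on {0..T} f" and g: "integrable (lebesgue_on {0<..<T}) g"
  and weak: "\<And>\<psi>. time_test_function T \<psi> \<Longrightarrow>
    (LINT t|lebesgue_on {0<..<T}. deriv \<psi> t * f t) = - (LINT t|lebesgue_on {0<..<T}. \<psi> t * g t)"
  and t: "t \<in> {0<..<T}"
 shows "f t = f 0 + (LINT s|lebesgue_on {0<..<T}. indicator {..<t} s * g s)"
proof -
 let ?\<tau> = "lebesgue_on {0<..<T}"
 have Is: "{0<..<T} \<in> sets lebesgue" by simp
 have fm: "(\<lambda>t. indicator {0<..<T} t * f t) \<in> borel_measurable borel"
 proof -
  have "continuous_on {0<..<T} f" by (rule continuous_on_subset[OF cont]) auto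
  from borel_measurable_continuous_on_indicator[OF _ this] show ?thesis by simp
 qed
 have "compact (f ` {0..T})" using cont by (intro compact_continuous_image) auto
 then have "bounded (f ` {0..T})" by (rule compact_imp_bounded)
 then obtain M0 where M0: "\<forall>y\<in>f ` {0..T}. \<bar>y\<bar> \<le> M0" by (auto simp: bounded_iff)
 have M: "\<bar>f t\<bar> \<le> max M0 0" if "t \<in> {0<..<T}" for t
 proof -
  have "\<bar>f t\<bar> \<le> M0" using M0 that by (auto simp: image_iff)
  then show ?thesis by simp
 qed
 have ic: "isCont f s" if "s \<in> {0<..<T}" for s
  by (rule continuous_on_interior[OF cont]) (use that in simp)
 have gm: "g \<in> borel_measurable ?\<tau>" using g by auto
 have ind: "(\<lambda>s. indicator A s * g s) \<in> borel_measurable ?\<tau>" if "A \<in> sets borel" for A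
  by (intro borel_measurable_times[OF borel_measurable_lebesgue_on gm] borel_measurable_indicator that)
 have main: "f t - f s = (LINT x|?\<tau>. indicator {s<..t} x * g x)" if st: "0 < s" "s < t" for s
 proof -
  \<comment> \<open>The upper transition ends at t + 1/(k+1), so only large k give a test function
    supported inside (0, T).\<close>
  obtain K :: nat where K: "1 / (T - t) < real K" using reals_Archimedean2 by blast
  have Kt: "t + 1 / real (Suc k) < T" if "k \<ge> K" for k
  proof -
   have "1 / (T - t) < real (Suc k)" using K that by simp
   then have "1 / real (Suc k) < T - t" using t by (simp add: field_simps)
   then show ?thesis by simp
  qed
  define \<psi> where "\<psi> k x = step (real (Suc k) * (x - s)) - step (real (Suc k) * (x - t))" for k x
  define \<psi>' where "\<psi>' k x = real (Suc k) * deriv step (real (Suc k) * (x - s)) - real (Suc k) * deriv step (real (Suc k) * (x - t))" for k x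
  have d: "(\<psi> k has_real_derivative \<psi>' k x) (at x)" for k x
   unfolding \<psi>_def \<psi>'_def by (intro DERIV_diff deriv_step_scaled)
  then have d': "deriv (\<psi> k) = \<psi>' k" for k by (intro ext DERIV_imp_deriv)
  have sm: "smooth1 (\<psi> k)" for k
  proof -
   have "smooth1 (\<lambda>x. step (real (Suc k) * x + (- real (Suc k) * s)) + (-1) * step (real (Suc k) * x + (- real (Suc k) * t)))"
    by (intro smooth1_add smooth1_mult smooth1_const smooth1_affine smooth1_step)
   also have "(\<lambda>x. step (real (Suc k) * x + (- real (Suc k) * s)) + (-1) * step (real (Suc k) * x + (- real (Suc k) * t))) = \<psi> k"
    by (rule ext) (simp add: \<psi>_def algebra_simps)
   finally show ?thesis .
  qed
  have test: "time_test_function T (\<psi> k)" if k: "k \<ge> K" for k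
  proof (rule smooth1_imp_time_test_function[OF sm st(1) Kt[OF k]])
   fix x assume x: "x \<notin> {s..t + 1 / real (Suc k)}"
   show "\<psi> k x = 0"
   proof (cases "x < s")
    case True
    then have "real (Suc k) * (x - s) \<le> 0" "real (Suc k) * (x - t) \<le> 0"
     using st by (auto intro: mult_nonneg_nonpos)
    then show ?thesis by (simp only: \<psi>_def step_nonpos)
   next
    case False
    then have "x - t > 1 / real (Suc k)" using x by auto
    then have 1: "real (Suc k) * (x - t) \<ge> 1" by (simp add: field_simps)
    also have "real (Suc k) * (x - t) \<le> real (Suc k) * (x - s)" using st by (intro mult_left_mono) auto
    finally show ?thesis using 1 by (simp only: \<psi>_def step_ge_1)
   qed
  qed
  have lim1: "(\<lambda>k. LINT x|?\<tau>. \<psi> k x * g x) \<longlonglongrightarrow> (LINT x|?\<tau>. indicator {s<..t} x * g x)"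
  proof (rule integral_dominated_convergence)
   show "integrable ?\<tau> (\<lambda>x. \<bar>g x\<bar>)" using g by simp
   show "(\<lambda>x. indicator {s<..t} x * g x) \<in> borel_measurable ?\<tau>" by (rule ind) simp
   fix k
   have "\<psi> k \<in> borel_measurable borel"
    by (rule borel_measurable_continuous_onI[OF smooth1_continuous_on[OF sm]])
   then show "(\<lambda>x. \<psi> k x * g x) \<in> borel_measurable ?\<tau>"
    by (intro borel_measurable_times[OF borel_measurable_lebesgue_on gm])
   have "\<bar>\<psi> k x\<bar> \<le> 1" for x
    unfolding \<psi>_def using step_nonneg step_le_1 by (smt (verit))
   then show "AE x in ?\<tau>. norm (\<psi> k x * g x) \<le> \<bar>g x\<bar>"
    by (intro always_eventually allI) (simp add: abs_mult mult_left_le_one_le)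
  next
   have ev: "(\<lambda>k. step (real (Suc k) * d)) \<longlonglongrightarrow> indicator {0<..} d" for d
   proof (cases "d > 0")
    case True
    obtain N :: nat where N: "1 / d < real N" using reals_Archimedean2 by blast
    have "\<forall>\<^sub>F k in sequentially. step (real (Suc k) * d) = 1"
     unfolding eventually_sequentially
    proof (intro exI[of _ N] allI impI step_ge_1)
     fix k assume "N \<le> k"
     then have "1 / d < real (Suc k)" using N by simp
     then show "1 \<le> real (Suc k) * d" using True by (simp add: field_simps)
    qed
    then show ?thesis using True by (simp add: tendsto_eventually)
   next
    case False
    then have "real (Suc k) * d \<le> 0" for k by (intro mult_nonneg_nonpos) auto
    then have "step (real (Suc k) * d) = 0" for k by (rule step_nonpos)
    then show ?thesis using False by simp
   qed
   show "AE x in ?\<tau>. (\<lambda>k. \<psi> k x * g x) \<longlonglongrightarrow> indicator {s<..t} x * g x"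
   proof (intro always_eventually allI tendsto_mult tendsto_const)
    fix x
    have "(\<lambda>k. \<psi> k x) \<longlonglongrightarrow> indicator {0<..} (x - s) - indicator {0<..} (x - t)"
     unfolding \<psi>_def by (intro tendsto_diff ev)
    also have "indicator {0<..} (x - s) - indicator {0<..} (x - t) = (indicator {s<..t} x :: real)"
     using st by (auto simp: indicator_def)
    finally show "(\<lambda>k. \<psi> k x) \<longlonglongrightarrow> indicator {s<..t} x" .
   qed
  qed
  have lim2: "(\<lambda>k. LINT x|?\<tau>. deriv (\<psi> k) x * f x) \<longlonglongrightarrow> f s - f t"
  proof -
   let ?m = "\<lambda>k s x. (real (Suc k) * deriv step (real (Suc k) * (x - s))) * (indicator {0<..<T} x * f x)"
   have int: "integrable lborel (?m k s)" for k s
   proof -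
    have c: "continuous_on UNIV (\<lambda>x. real (Suc k) * deriv step (real (Suc k) * (x - s)))"
     by (intro continuous_intros continuous_on_compose2[OF continuous_deriv_step]) auto
    have i: "integrable lborel (\<lambda>x. indicator {0..T} x *\<^sub>R ((real (Suc k) * deriv step (real (Suc k) * (x - s))) * f x))"
    proof (rule borel_integrable_compact)
     show "continuous_on {0..T} (\<lambda>x. (real (Suc k) * deriv step (real (Suc k) * (x - s))) * f x)"
      by (intro continuous_on_mult continuous_on_subset[OF c] cont) auto
    qed simp
    show ?thesis
    proof (rule Bochner_Integration.integrable_bound[OF i])
     show "?m k s \<in> borel_measurable lborel"
      using borel_measurable_continuous_onI[OF c] fm by simp
    qed (auto simp: indicator_def)
   qed
   have eq: "(LINT x|?\<tau>. deriv (\<psi> k) x * f x) = (LINT x|lborel. ?m k s x) - (LINT x|lborel. ?m k t x)" for k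
   proof -
    have p: "\<psi>' k \<in> borel_measurable borel"
     unfolding d'[symmetric] by (rule borel_measurable_continuous_onI[OF smooth1_continuous_on[OF smooth1_deriv[OF sm]]])
    have "(LINT x|?\<tau>. deriv (\<psi> k) x * f x) = (LINT x|lebesgue. \<psi>' k x * (indicator {0<..<T} x * f x))"
     unfolding integral_lebesgue_on_eq[OF Is] d' by (intro Bochner_Integration.integral_cong) auto
    also have "\<dots> = (LINT x|lborel. \<psi>' k x * (indicator {0<..<T} x * f x))"
     using p fm by (intro integral_completion) simp
    also have "\<dots> = (LINT x|lborel. ?m k s x - ?m k t x)"
     unfolding \<psi>'_def by (simp only: left_diff_distrib)
    also have "\<dots> = (LINT x|lborel. ?m k s x) - (LINT x|lborel. ?m k t x)"
     by (rule Bochner_Integration.integral_diff[OF int int])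
    finally show ?thesis .
   qed
   have "s \<in> {0<..<T}" using st t by auto
   then show ?thesis unfolding eq
    by (intro tendsto_diff mollify_tendsto[OF fm M] ic t) auto
  qed
  have "\<forall>\<^sub>F k in sequentially. (LINT x|?\<tau>. deriv (\<psi> k) x * f x) = - (LINT x|?\<tau>. \<psi> k x * g x)"
   unfolding eventually_sequentially using weak[OF test] by blast
  with lim2 have "(\<lambda>k. - (LINT x|?\<tau>. \<psi> k x * g x)) \<longlonglongrightarrow> f s - f t"
   by (rule Lim_transform_eventually)
  from LIMSEQ_unique[OF this tendsto_minus[OF lim1]]
  have "f s - f t = - (LINT x|?\<tau>. indicator {s<..t} x * g x)" .
  then show ?thesis by simp
 qed
 \<comment> \<open>Test functions vanish near 0, so the value at 0 is reached by letting the lower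
   end point tend to 0. The shift by 2 keeps \<open>s n\<close> strictly below t.\<close>
 define s where "s n = t / real (Suc (Suc n))" for n :: nat
 have s: "0 < s n" "s n < t" for n
 proof -
  show "0 < s n" unfolding s_def using t by (intro divide_pos_pos) auto
  have "t / real (Suc (Suc n)) < t / 1" using t by (intro divide_strict_left_mono) auto
  then show "s n < t" by (simp only: s_def div_by_1)
 qed
 have s0: "s \<longlonglongrightarrow> 0"
  unfolding s_def[abs_def] using LIMSEQ_Suc[OF LIMSEQ_Suc[OF lim_const_over_n[of t]]] by simp
 have "(\<lambda>n. f (s n)) \<longlonglongrightarrow> f 0"
 proof (rule continuous_on_tendsto_compose[OF cont s0])
  show "\<forall>\<^sub>F n in sequentially. s n \<in> {0..T}"
  proof (intro always_eventually allI)
   fix n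
   show "s n \<in> {0..T}" using s(1)[of n] s(2)[of n] t by auto
  qed
 qed (use T in simp)
 then have "(\<lambda>n. f t - f (s n)) \<longlonglongrightarrow> f t - f 0" by (intro tendsto_intros)
 moreover have "(\<lambda>n. f t - f (s n)) \<longlonglongrightarrow> (LINT x|?\<tau>. indicator {..<t} x * g x)"
  unfolding main[OF s]
 proof (rule integral_dominated_convergence)
  show "integrable ?\<tau> (\<lambda>x. \<bar>g x\<bar>)" using g by simp
  show "AE x in ?\<tau>. (\<lambda>n. indicator {s n<..t} x * g x) \<longlonglongrightarrow> indicator {..<t} x * g x"
  proof -
   have "AE x in lebesgue. x \<noteq> t" by (rule AE_completion) (rule AE_lborel_singleton)
   then have "AE x in ?\<tau>. x \<noteq> t" unfolding AE_lebesgue_on_iff[OF Is] by eventually_elim simp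
   moreover have "AE x in ?\<tau>. x \<in> {0<..<T}" by (rule AE_I2) simp
   ultimately show ?thesis
   proof eventually_elim
    case (elim x)
    have "\<forall>\<^sub>F n in sequentially. s n < x" using order_tendstoD(2)[OF s0] elim by simp
    then have "\<forall>\<^sub>F n in sequentially. indicator {s n<..t} x * g x = indicator {..<t} x * g x"
     by eventually_elim (use elim in \<open>auto simp: indicator_def\<close>)
    then show ?case by (rule tendsto_eventually)
   qed
  qed
  show "AE x in ?\<tau>. norm (indicator {s n<..t} x * g x) \<le> \<bar>g x\<bar>" for n by (auto simp: indicator_def)
 qed (intro ind, simp)+
 ultimately have "f t - f 0 = (LINT x|?\<tau>. indicator {..<t} x * g x)" by (rule LIMSEQ_unique)
 then show ?thesis by simp
qed

lemma AE_LIMSEQ_measurable: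
 fixes f :: "nat \<Rightarrow> 'a::euclidean_space \<Rightarrow> real"
 assumes S: "S \<in> sets lebesgue" and f: "\<And>k. f k \<in> borel_measurable (lebesgue_on S)"
  and lim: "AE t in lebesgue_on S. (\<lambda>k. f k t) \<longlonglongrightarrow> g t"
 shows "g \<in> borel_measurable (lebesgue_on S)"
proof -
 let ?h = "\<lambda>t. lim (\<lambda>k. f k t)"
 have h: "?h \<in> borel_measurable (lebesgue_on S)" by (rule borel_measurable_lim_metric[OF f])
 have eq: "AE t in lebesgue_on S. ?h t = g t" using lim by eventually_elim (rule limI)
 have "(\<lambda>x. ?h x * indicator S x) \<in> borel_measurable lebesgue"
  using h S by (simp add: borel_measurable_restrict_space_iff mult.commute)
 moreover have "AE x in lebesgue. ?h x * indicator S x = g x * indicator S x"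
  using eq unfolding AE_lebesgue_on_iff[OF S] by eventually_elim (auto simp: indicator_def)
 ultimately have "(\<lambda>x. g x * indicator S x) \<in> borel_measurable lebesgue"
  by (rule borel_measurable_AE)
 then show ?thesis using S by (simp add: borel_measurable_restrict_space_iff mult.commute)
qed

lemma finite_range_measurable:
 fixes h :: "'b \<Rightarrow> real"
 assumes fin: "finite (range s)" and lev: "\<And>f. {t \<in> {0<..<T}. s t = f} \<in> sets lebesgue"
 shows "(\<lambda>t. h (s t)) \<in> borel_measurable (lebesgue_on {0<..<T::real})"
proof -
 have "(\<lambda>t. \<Sum>f\<in>range s. h f * indicator {t \<in> {0<..<T}. s t = f} t) \<in> borel_measurable (lebesgue_on {0<..<T})"
 proof (intro borel_measurable_sum borel_measurable_times borel_measurable_const borel_measurable_indicator)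
  fix f
  show "{t \<in> {0<..<T}. s t = f} \<in> sets (lebesgue_on {0<..<T})"
   using lev[of f] by (subst sets_restrict_space_iff) auto
 qed
 moreover have "(\<Sum>f\<in>range s. h f * indicator {t \<in> {0<..<T}. s t = f} t) = h (s t)" if "t \<in> {0<..<T}" for t
 proof -
  have "(\<Sum>f\<in>range s. h f * indicator {t \<in> {0<..<T}. s t = f} t) = (\<Sum>f\<in>range s. if f = s t then h f else 0)"
   using that by (intro sum.cong) (auto simp: indicator_def)
  then show ?thesis using fin by simp
 qed
 ultimately show ?thesis by (subst measurable_cong[where g="\<lambda>t. \<Sum>f\<in>range s. h f * indicator {t \<in> {0<..<T}. s t = f} t"]) auto
qed

text \<open>On the simple approximants the functional takes finitely many values on measurable sets;
  the Lipschitz bound makes these functions converge to the functional along u.\<close>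

lemma strongly_measurable_compose:
 fixes h :: "('a \<Rightarrow> real) \<Rightarrow> real"
 assumes sm: "strongly_measurable T Z N u"
  and h: "AE t in lebesgue_on {0<..<T}. \<forall>f\<in>Z. \<bar>h f - h (u t)\<bar> \<le> C * N (\<lambda>x. f x - u t x)"
 shows "(\<lambda>t. h (u t)) \<in> borel_measurable (lebesgue_on {0<..<T})"
proof -
 obtain s where s: "\<And>k::nat. finite (range (s k)) \<and> range (s k) \<subseteq> Z \<and>
    (\<forall>f. {t \<in> {0<..<T}. s k t = f} \<in> sets lebesgue)"
  and lim: "AE t in lebesgue_on {0<..<T}. (\<lambda>k. N (\<lambda>x. s k t x - u t x)) \<longlonglongrightarrow> 0"
  using sm unfolding strongly_measurable_def by blast
 show ?thesis
 proof (rule AE_LIMSEQ_measurable)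
  show "(\<lambda>t. h (s k t)) \<in> borel_measurable (lebesgue_on {0<..<T})" for k
   by (rule finite_range_measurable[of "s k" T h]) (use s[of k] in blast)+
  show "AE t in lebesgue_on {0<..<T}. (\<lambda>k. h (s k t)) \<longlonglongrightarrow> h (u t)"
   using h lim
  proof eventually_elim
   case (elim t)
   have "(\<lambda>k. h (s k t) - h (u t)) \<longlonglongrightarrow> 0"
   proof (rule Lim_null_comparison[OF always_eventually])
    show "\<forall>k. norm (h (s k t) - h (u t)) \<le> C * N (\<lambda>x. s k t x - u t x)"
     using elim(1) s by fastforce
    show "(\<lambda>k. C * N (\<lambda>x. s k t x - u t x)) \<longlonglongrightarrow> 0" by (rule tendsto_mult_right_zero[OF elim(2)])
   qed
   then show ?case by (rule LIM_zero_cancel)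
  qed
 qed simp
qed

section \<open>Functions of time with values in Sobolev spaces\<close>

context bounded_open
begin

lemma nrm_wderiv_le_sobolev_norm:
 assumes "length js \<le> nat \<lfloor>r\<rfloor>"
 shows "nrm \<mu> (wderiv \<Omega> js v) \<le> sobolev_norm r \<Omega> v"
proof -
 have fin: "finite {js::'n list. length js \<le> nat \<lfloor>r\<rfloor>}"
  using finite_lists_length_le[of "UNIV :: 'n set"] by simp
 have "(nrm \<mu> (wderiv \<Omega> js v))\<^sup>2 \<le> (\<Sum>js | length js \<le> nat \<lfloor>r\<rfloor>. (L2_norm \<Omega> (wderiv \<Omega> js v))\<^sup>2)"
  unfolding L2_norm_eq using assms fin by (intro member_le_sum) auto
 also have "\<dots> \<le> (\<Sum>js | length js \<le> nat \<lfloor>r\<rfloor>. (L2_norm \<Omega> (wderiv \<Omega> js v))\<^sup>2) +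
      (if frac r > 0
      then (\<Sum>js | length js = nat \<lfloor>r\<rfloor>. enn2real (slobodeckij (frac r) \<Omega> (wderiv \<Omega> js v)))
      else 0)" by (simp add: sum_nonneg)
 finally show ?thesis unfolding sobolev_norm_def by (rule real_le_rsqrt)
qed

lemma sobolev_norm_nonneg: "sobolev_norm r \<Omega> v \<ge> 0"
 unfolding sobolev_norm_def by (auto intro!: add_nonneg_nonneg sum_nonneg)

end

text \<open>Regularity in time and space without boundary conditions: u_t is square integrable with
  values in H^r, while u(t) is in H^r for almost every t. The bound r \<ge> 2 makes the Laplacian
  available.\<close>

locale evolution = bounded_open \<Omega> for \<Omega> :: "(real^'n::finite) set" +
 fixes T r :: real and u ut :: "real \<Rightarrow> real^'n \<Rightarrow> real" and u0 :: "real^'n \<Rightarrow> real"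
 assumes T_pos: "T > 0" and r_ge: "r \<ge> 2"
  and ut_L2: "ut \<in> bochner_L2 T (sobolev_space r \<Omega>) (sobolev_norm r \<Omega>)"
  and u_AE: "AE t in lebesgue_on {0<..<T}. u t \<in> sobolev_space r \<Omega>"
  and u_ut: "weak_time_deriv T \<Omega> u ut"
  and u_cont: "\<And>t. t \<in> {0..T} \<Longrightarrow> u t \<in> L2_space \<Omega> \<and>
    ((\<lambda>s. L2_norm \<Omega> (\<lambda>x. u s x - u t x)) \<longlongrightarrow> 0) (at t within {0..T})"
  and u0_in: "u0 \<in> sobolev_space r \<Omega>" and u_init: "AE x in lebesgue_on \<Omega>. u 0 x = u0 x"
begin

abbreviation "\<tau> \<equiv> lebesgue_on {0<..<T}"
abbreviation "m \<equiv> nat \<lfloor>r\<rfloor>"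
abbreviation "N \<equiv> sobolev_norm r \<Omega>"

lemma two_le_m: "2 \<le> m"
 using r_ge by (simp add: le_nat_iff le_floor_iff)

lemma sob_W: "v \<in> sobolev_space r \<Omega> \<Longrightarrow> v \<in> W m"
 using sobolev_space_subset_W[of m r] by blast

lemma sob_W2: "v \<in> sobolev_space r \<Omega> \<Longrightarrow> v \<in> W 2"
 using sob_W W_mono[OF two_le_m] by blast

lemma finite_tau: "finite_measure \<tau>"
 by (rule finite_measure_lebesgue_on) auto

lemma ut_AE: "AE t in \<tau>. ut t \<in> sobolev_space r \<Omega>"
 using ut_L2 by (simp add: bochner_L2_def)

lemma N_ut_integrable: "integrable \<tau> (\<lambda>t. N (ut t))"
proof -
 have i2: "integrable \<tau> (\<lambda>t. (N (ut t))\<^sup>2)" using ut_L2 by (simp add: bochner_L2_def)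
 have "(\<lambda>t. sqrt ((N (ut t))\<^sup>2)) \<in> borel_measurable \<tau>"
  using i2 by (intro measurable_compose[OF borel_measurable_integrable borel_measurable_sqrt])
 then have "(\<lambda>t. N (ut t)) \<in> borel_measurable \<tau>" by (simp add: sobolev_norm_nonneg)
 then have "(\<lambda>t. N (ut t)) \<in> L2 \<tau>" using i2 by (intro L2I)
 then show ?thesis by (rule L2_integrable[OF finite_tau])
qed

lemma D_bound:
 assumes "w \<in> sobolev_space r \<Omega>" "length js \<le> m" "v \<in> L2 \<mu>"
 shows "\<bar>ip (wderiv \<Omega> js w) v\<bar> \<le> N w * nrm \<mu> v"
proof -
 have "\<bar>ip (wderiv \<Omega> js w) v\<bar> \<le> nrm \<mu> (wderiv \<Omega> js w) * nrm \<mu> v"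
  by (rule ip_CS[OF W_wderiv_L2[OF sob_W[OF assms(1)] assms(2)] assms(3)])
 also have "\<dots> \<le> N w * nrm \<mu> v"
  by (intro mult_right_mono nrm_wderiv_le_sobolev_norm assms nrm_nonneg)
 finally show ?thesis .
qed

lemma D_diff:
 assumes "f \<in> W m" "g \<in> W m" "length js \<le> m" "v \<in> L2 \<mu>"
 shows "ip (wderiv \<Omega> js f) v - ip (wderiv \<Omega> js g) v = ip (wderiv \<Omega> js (\<lambda>x. f x - g x)) v"
proof -
 have "ip (wderiv \<Omega> js (\<lambda>x. 1 * f x + (-1) * g x)) v = ip (\<lambda>x. 1 * wderiv \<Omega> js f x + (-1) * wderiv \<Omega> js g x) v"
  by (intro ip_cong_AE wderiv_lincomb[OF assms(1-3)] W_wderiv_L2[OF W_lincomb[OF assms(1,2)] assms(3)] assms(4)) simp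
 also have "\<dots> = 1 * ip (wderiv \<Omega> js f) v + (-1) * ip (wderiv \<Omega> js g) v"
  by (intro ip_lincomb W_wderiv_L2[OF assms(1) assms(3)] W_wderiv_L2[OF assms(2) assms(3)] assms(4))
 finally show ?thesis by simp
qed

lemma D_measurable:
 assumes js: "length js \<le> m" and v: "v \<in> L2 \<mu>"
 shows "(\<lambda>t. ip (wderiv \<Omega> js (ut t)) v) \<in> borel_measurable \<tau>"
proof (rule strongly_measurable_compose[where h="\<lambda>w. ip (wderiv \<Omega> js w) v" and C="nrm \<mu> v"])
 show "strongly_measurable T (sobolev_space r \<Omega>) N ut" using ut_L2 by (simp add: bochner_L2_def)
 show "AE t in \<tau>. \<forall>f\<in>sobolev_space r \<Omega>. \<bar>ip (wderiv \<Omega> js f) v - ip (wderiv \<Omega> js (ut t)) v\<bar>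
   \<le> nrm \<mu> v * N (\<lambda>x. f x - ut t x)"
  using ut_AE
 proof eventually_elim
  case (elim t)
  show ?case
  proof
   fix f assume "f \<in> sobolev_space r \<Omega>"
   then have W: "f \<in> W m" "ut t \<in> W m" using elim sob_W by auto
   have W': "(\<lambda>x. f x - ut t x) \<in> W m" using W_lincomb[OF W, of 1 "-1"] by simp
   have "\<bar>ip (wderiv \<Omega> js (\<lambda>x. f x - ut t x)) v\<bar> \<le> nrm \<mu> (wderiv \<Omega> js (\<lambda>x. f x - ut t x)) * nrm \<mu> v"
    by (rule ip_CS[OF W_wderiv_L2[OF W' js] v])
   also have "\<dots> \<le> N (\<lambda>x. f x - ut t x) * nrm \<mu> v"
    by (intro mult_right_mono nrm_wderiv_le_sobolev_norm js nrm_nonneg)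
   finally show "\<bar>ip (wderiv \<Omega> js f) v - ip (wderiv \<Omega> js (ut t)) v\<bar> \<le> nrm \<mu> v * N (\<lambda>x. f x - ut t x)"
    unfolding D_diff[OF W js v] by (simp add: mult.commute)
  qed
 qed
qed

lemma D_integrable:
 assumes js: "length js \<le> m" and v: "v \<in> L2 \<mu>"
 shows "integrable \<tau> (\<lambda>t. ip (wderiv \<Omega> js (ut t)) v)"
proof (rule Bochner_Integration.integrable_bound[OF integrable_mult_left[OF N_ut_integrable, of "nrm \<mu> v"]])
 show "AE t in \<tau>. norm (ip (wderiv \<Omega> js (ut t)) v) \<le> norm (N (ut t) * nrm \<mu> v)"
  using ut_AE
 proof eventually_elim
  case (elim t)
  show ?case using D_bound[OF elim js v] by simp
 qed
qed (rule D_measurable[OF js v])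

text \<open>The primitive that vanishes at 0. The cut-off is an indicator under the fixed measure
  \<open>\<tau>\<close>, so the function is defined for every real t and all integrals are over the
  same space.\<close>

definition prim :: "(real \<Rightarrow> real) \<Rightarrow> real \<Rightarrow> real" where
 "prim g t = (LINT s|\<tau>. indicator {..<t} s * g s)"

lemma integrable_cut:
 fixes g :: "real \<Rightarrow> real"
 shows "integrable \<tau> g \<Longrightarrow> integrable \<tau> (\<lambda>s. indicator {..<t} s * g s)"
 using integrable_mult_indicator[of "{..<t} \<inter> {0<..<T}" \<tau> g]
 by (subst Bochner_Integration.integrable_cong[where g="\<lambda>s. indicator ({..<t} \<inter> {0<..<T}) s *\<^sub>R g s"])
  (auto simp: indicator_def sets_restrict_space_iff)

lemma prim_diff: "integrable \<tau> g \<Longrightarrow> integrable \<tau> h \<Longrightarrow> prim g t - prim h t = prim (\<lambda>s. g s - h s) t"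
 unfolding prim_def using integrable_cut[of g t] integrable_cut[of h t] by (simp add: right_diff_distrib)

lemma prim_cmult: "prim (\<lambda>s. c * g s) t = c * prim g t"
proof -
 have "prim (\<lambda>s. c * g s) t = (LINT s|\<tau>. c * (indicator {..<t} s * g s))"
  unfolding prim_def by (intro Bochner_Integration.integral_cong) auto
 then show ?thesis by (simp add: prim_def)
qed

lemma prim_sum: "(\<And>i. i \<in> I \<Longrightarrow> integrable \<tau> (g i)) \<Longrightarrow> prim (\<lambda>s. \<Sum>i\<in>I. g i s) t = (\<Sum>i\<in>I. prim (g i) t)"
 unfolding prim_def sum_distrib_left by (intro Bochner_Integration.integral_sum integrable_cut)

lemma prim_cong_AE:
 assumes "AE s in \<tau>. g s = h s" "integrable \<tau> g" "integrable \<tau> h"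
 shows "prim g t = prim h t"
 unfolding prim_def using assms integrable_cut[of g t] integrable_cut[of h t]
 by (intro integral_cong_AE) auto

lemma prim_bound:
 assumes "AE s in \<tau>. \<bar>g s\<bar> \<le> h s" "integrable \<tau> g" "integrable \<tau> h"
 shows "\<bar>prim g t\<bar> \<le> (LINT s|\<tau>. h s)"
proof -
 have "\<bar>prim g t\<bar> \<le> (LINT s|\<tau>. \<bar>indicator {..<t} s * g s\<bar>)" unfolding prim_def by (rule integral_abs_bound)
 also have "\<dots> \<le> (LINT s|\<tau>. h s)"
 proof (rule integral_mono_AE)
  show "integrable \<tau> (\<lambda>s. \<bar>indicator {..<t} s * g s\<bar>)" using integrable_cut[OF assms(2)] by simp
  show "AE s in \<tau>. \<bar>indicator {..<t} s * g s\<bar> \<le> h s" using assms(1) by eventually_elim (auto simp: indicator_def)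
 qed (rule assms)
 finally show ?thesis .
qed

lemma u_L2: "t \<in> {0..T} \<Longrightarrow> u t \<in> L2 \<mu>"
 using u_cont by (simp add: L2_space_eq)

lemma ip_init: "v \<in> L2 \<mu> \<Longrightarrow> ip (u 0) v = ip u0 v"
 using u_init u_L2[of 0] T_pos by (intro ip_cong_AE) auto

lemma ip_ut_Nil: "v \<in> L2 \<mu> \<Longrightarrow> w \<in> sobolev_space r \<Omega> \<Longrightarrow> ip (wderiv \<Omega> [] w) v = ip w v"
 using wderiv_Nil_AE[OF sob_W2] W_wderiv_L2[OF sob_W2, of w "[]"] by (intro ip_cong_AE) auto

lemma ip_ut_integrable:
 assumes "v \<in> L2 \<mu>"
 shows "integrable \<tau> (\<lambda>t. ip (ut t) v)"
proof -
 have i: "integrable \<tau> (\<lambda>t. ip (wderiv \<Omega> [] (ut t)) v)" using assms by (intro D_integrable) auto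
 have ae: "AE t in \<tau>. ip (wderiv \<Omega> [] (ut t)) v = ip (ut t) v"
  using ut_AE by eventually_elim (rule ip_ut_Nil[OF assms])
 have "(\<lambda>t. ip (ut t) v) \<in> borel_measurable \<tau>"
  by (rule AE_LIMSEQ_measurable[where f="\<lambda>_ t. ip (wderiv \<Omega> [] (ut t)) v"])
   (use i ae in auto)
 then show ?thesis using i ae by (subst integrable_cong_AE[symmetric]) auto
qed

text \<open>Pairing with v reduces the weak time derivative to the scalar case; continuity of u in
  L^2 makes the pairing continuous up to time 0.\<close>

lemma ip_u_eq:
 assumes v: "v \<in> L2 \<mu>" and t: "t \<in> {0<..<T}"
 shows "ip (u t) v = ip u0 v + prim (\<lambda>s. ip (ut s) v) t"
proof -
 have "ip (u t) v = ip (u 0) v + (LINT s|\<tau>. indicator {..<t} s * ip (ut s) v)"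
 proof (rule weak_FTC[OF T_pos _ ip_ut_integrable[OF v] _ t])
  show "continuous_on {0..T} (\<lambda>t. ip (u t) v)"
   unfolding continuous_on_def
  proof
   fix t assume t: "t \<in> {0..T}"
   have "((\<lambda>s. ip (u s) v - ip (u t) v) \<longlongrightarrow> 0) (at t within {0..T})"
   proof (rule Lim_null_comparison)
    show "((\<lambda>s. L2_norm \<Omega> (\<lambda>x. u s x - u t x) * nrm \<mu> v) \<longlongrightarrow> 0) (at t within {0..T})"
     using u_cont[OF t] by (auto intro: tendsto_mult_left_zero)
    show "\<forall>\<^sub>F s in at t within {0..T}. norm (ip (u s) v - ip (u t) v) \<le> L2_norm \<Omega> (\<lambda>x. u s x - u t x) * nrm \<mu> v"
    proof (rule eventually_at_filter[THEN iffD2], intro always_eventually allI impI)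
     fix s assume "s \<in> {0..T}"
     then have s: "u s \<in> L2 \<mu>" "u t \<in> L2 \<mu>" using u_L2 t by auto
     have "ip (u s) v - ip (u t) v = ip (\<lambda>x. u s x - u t x) v"
      using ip_lincomb[OF s v, of 1 "-1"] by simp
     then show "norm (ip (u s) v - ip (u t) v) \<le> L2_norm \<Omega> (\<lambda>x. u s x - u t x) * nrm \<mu> v"
      using ip_CS[OF L2_diff[OF s] v] by (simp add: L2_norm_eq)
    qed
   qed
   then show "((\<lambda>t. ip (u t) v) \<longlongrightarrow> ip (u t) v) (at t within {0..T})" by (rule LIM_zero_cancel)
  qed
  show "(LINT t|\<tau>. deriv \<psi> t * ip (u t) v) = - (LINT t|\<tau>. \<psi> t * ip (ut t) v)" if "time_test_function T \<psi>" for \<psi>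
   using u_ut that v unfolding weak_time_deriv_def ip_L2_inner L2_space_eq by blast
 qed
 then show ?thesis by (simp add: ip_init[OF v] prim_def)
qed

text \<open>Against a test function the spatial derivative moves onto the test function, where the
  identity for u itself applies. Density extends it to all v in L^2, as the time integral is
  controlled by that of \<open>N (ut s)\<close>.\<close>

lemma D_u_eq:
 assumes ut: "u t \<in> sobolev_space r \<Omega>" and t: "t \<in> {0<..<T}" and js: "length js \<le> m" and v: "v \<in> L2 \<mu>"
 shows "ip (wderiv \<Omega> js (u t)) v = ip (wderiv \<Omega> js u0) v + prim (\<lambda>s. ip (wderiv \<Omega> js (ut s)) v) t"
proof -
 let ?P = "\<lambda>v. prim (\<lambda>s. ip (wderiv \<Omega> js (ut s)) v) t"
 have test: "ip (wderiv \<Omega> js (u t)) \<phi> = ip (wderiv \<Omega> js u0) \<phi> + ?P \<phi>" if \<phi>: "test_function \<Omega> \<phi>" for \<phi>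
 proof -
  let ?c = "(- 1) ^ length js :: real"
  have cc: "?c * ?c = 1" by (simp flip: power_mult_distrib)
  have pL: "partials js \<phi> \<in> L2 \<mu>" by (intro test_function_L2 test_function_partials \<phi>)
  have wd: "ip (wderiv \<Omega> js w) \<phi> = ?c * ip w (partials js \<phi>)" if "w \<in> sobolev_space r \<Omega>" for w
  proof -
   have "L2_inner \<Omega> w (partials js \<phi>) = ?c * L2_inner \<Omega> (wderiv \<Omega> js w) \<phi>"
    using W_is_weak_deriv[OF sob_W[OF that] js] \<phi> by (simp add: is_weak_deriv_def)
   then have "?c * ip w (partials js \<phi>) = (?c * ?c) * ip (wderiv \<Omega> js w) \<phi>" by (simp add: ip_L2_inner)
   then show ?thesis by (simp add: cc)
  qed
  have "?P \<phi> = prim (\<lambda>s. ?c * ip (ut s) (partials js \<phi>)) t"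
  proof (rule prim_cong_AE)
   show "AE s in \<tau>. ip (wderiv \<Omega> js (ut s)) \<phi> = ?c * ip (ut s) (partials js \<phi>)"
    using ut_AE by eventually_elim (rule wd)
  qed (intro D_integrable js test_function_L2 \<phi> integrable_mult_right ip_ut_integrable pL)+
  then show ?thesis
   unfolding wd[OF ut] wd[OF u0_in] ip_u_eq[OF pL t] by (simp add: prim_cmult distrib_left)
 qed
 obtain \<phi> where \<phi>: "\<And>k::nat. test_function \<Omega> (\<phi> k)" "(\<lambda>k. nrm \<mu> (\<lambda>x. \<phi> k x - v x)) \<longlonglongrightarrow> 0"
  by (rule test_functions_dense[OF v]) (rule that)
 have L: "\<And>k. \<phi> k \<in> L2 \<mu>" by (rule test_function_L2[OF \<phi>(1)])
 have conv: "(\<lambda>k. ip w (\<phi> k)) \<longlonglongrightarrow> ip w v" if "w \<in> L2 \<mu>" for w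
  using L2_inner_tendsto_left[OF L v that \<phi>(2)] unfolding ip_commute[of w] by (simp add: ip_def)
 have "(\<lambda>k. ?P (\<phi> k) - ?P v) \<longlonglongrightarrow> 0"
 proof (rule Lim_null_comparison[OF always_eventually])
  show "\<forall>k. norm (?P (\<phi> k) - ?P v) \<le> (LINT s|\<tau>. N (ut s)) * nrm \<mu> (\<lambda>x. \<phi> k x - v x)"
  proof
   fix k
   have d: "(\<lambda>x. \<phi> k x - v x) \<in> L2 \<mu>" by (intro L2_diff L v)
   have "?P (\<phi> k) - ?P v = prim (\<lambda>s. ip (wderiv \<Omega> js (ut s)) (\<phi> k) - ip (wderiv \<Omega> js (ut s)) v) t"
    by (intro prim_diff D_integrable js L v)
   also have "\<bar>\<dots>\<bar> \<le> (LINT s|\<tau>. N (ut s) * nrm \<mu> (\<lambda>x. \<phi> k x - v x))"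
   proof (rule prim_bound)
    show "AE s in \<tau>. \<bar>ip (wderiv \<Omega> js (ut s)) (\<phi> k) - ip (wderiv \<Omega> js (ut s)) v\<bar> \<le> N (ut s) * nrm \<mu> (\<lambda>x. \<phi> k x - v x)"
     using ut_AE
    proof eventually_elim
     case (elim s)
     have w: "wderiv \<Omega> js (ut s) \<in> L2 \<mu>" by (rule W_wderiv_L2[OF sob_W[OF elim] js])
     have "ip (wderiv \<Omega> js (ut s)) (\<phi> k) - ip (wderiv \<Omega> js (ut s)) v = ip (wderiv \<Omega> js (ut s)) (\<lambda>x. \<phi> k x - v x)"
      using ip_lincomb[OF L[of k] v w, of 1 "-1"] unfolding ip_commute[of "wderiv \<Omega> js (ut s)"] by simp
     then show ?case using D_bound[OF elim js d] by simp
    qed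
   qed (intro Bochner_Integration.integrable_diff D_integrable js L v integrable_mult_left N_ut_integrable)+
   finally show "norm (?P (\<phi> k) - ?P v) \<le> (LINT s|\<tau>. N (ut s)) * nrm \<mu> (\<lambda>x. \<phi> k x - v x)" by simp
  qed
  show "(\<lambda>k. (LINT s|\<tau>. N (ut s)) * nrm \<mu> (\<lambda>x. \<phi> k x - v x)) \<longlonglongrightarrow> 0"
   by (rule tendsto_mult_right_zero[OF \<phi>(2)])
 qed
 then have "(\<lambda>k. ?P (\<phi> k)) \<longlonglongrightarrow> ?P v" by (rule LIM_zero_cancel)
 then have "(\<lambda>k. ip (wderiv \<Omega> js u0) (\<phi> k) + ?P (\<phi> k)) \<longlonglongrightarrow> ip (wderiv \<Omega> js u0) v + ?P v"
  by (intro tendsto_add conv W_wderiv_L2[OF sob_W[OF u0_in] js])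
 moreover have "(\<lambda>k. ip (wderiv \<Omega> js u0) (\<phi> k) + ?P (\<phi> k)) \<longlonglongrightarrow> ip (wderiv \<Omega> js (u t)) v"
  unfolding test[OF \<phi>(1), symmetric] by (intro conv W_wderiv_L2[OF sob_W[OF ut] js])
 ultimately show ?thesis by (rule LIMSEQ_unique[rotated])
qed

end

section \<open>Truncated Gagliardo seminorms\<close>

context bounded_open
begin

abbreviation "\<mu>2 \<equiv> \<mu> \<Otimes>\<^sub>M \<mu>"

text \<open>Its squared norm on the product space is the double integral of (a(x) - a(y))^2 K(x, y),
  which turns a Gagliardo seminorm into an ordinary L^2 norm.\<close>

definition ediff :: "(real^'n \<Rightarrow> real^'n \<Rightarrow> real) \<Rightarrow> (real^'n \<Rightarrow> real) \<Rightarrow> (real^'n) \<times> (real^'n) \<Rightarrow> real" where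
 "ediff K a p = (a (fst p) - a (snd p)) * sqrt (K (fst p) (snd p))"

text \<open>The operator that represents the quadratic form of a symmetric kernel; boundedness of
  the kernel makes it map L^2 into itself.\<close>

definition eop :: "(real^'n \<Rightarrow> real^'n \<Rightarrow> real) \<Rightarrow> (real^'n \<Rightarrow> real) \<Rightarrow> real^'n \<Rightarrow> real" where
 "eop K b x = 2 * (LINT y|\<mu>. (b x - b y) * K x y)"

definition kernel :: "(real^'n \<Rightarrow> real^'n \<Rightarrow> real) \<Rightarrow> real \<Rightarrow> bool" where
 "kernel K B \<longleftrightarrow> (\<lambda>p. K (fst p) (snd p)) \<in> borel_measurable \<mu>2 \<and>
   (\<forall>x y. 0 \<le> K x y \<and> K x y \<le> B \<and> K x y = K y x)"

lemma pair_sigma_finite_mu: "pair_sigma_finite \<mu> \<mu>"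
proof -
 interpret finite_measure \<mu> by (rule finite_mu)
 show ?thesis by standard
qed

lemma L2_fst_snd:
 assumes "a \<in> L2 \<mu>"
 shows "(\<lambda>p. a (fst p)) \<in> L2 \<mu>2" "(\<lambda>p. a (snd p)) \<in> L2 \<mu>2"
proof -
 interpret F: finite_measure \<mu> by (rule finite_mu)
 interpret P: pair_sigma_finite \<mu> \<mu> by (rule pair_sigma_finite_mu)
 have am: "a \<in> borel_measurable \<mu>" and ai: "integrable \<mu> (\<lambda>x. (a x)\<^sup>2)" using assms by (auto simp: L2_def)
 have m1: "(\<lambda>p. a (fst p)) \<in> borel_measurable \<mu>2" by (rule measurable_compose[OF measurable_fst am])
 have m2: "(\<lambda>p. a (snd p)) \<in> borel_measurable \<mu>2" by (rule measurable_compose[OF measurable_snd am])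
 show "(\<lambda>p. a (fst p)) \<in> L2 \<mu>2"
 proof (rule L2I[OF m1])
  show "integrable \<mu>2 (\<lambda>p. (a (fst p))\<^sup>2)"
   by (rule P.Fubini_integrable) (use m1 ai in auto)
 qed
 show "(\<lambda>p. a (snd p)) \<in> L2 \<mu>2"
 proof (rule L2I[OF m2])
  show "integrable \<mu>2 (\<lambda>p. (a (snd p))\<^sup>2)"
   by (rule P.Fubini_integrable) (use m2 ai in auto)
 qed
qed

lemma ediff_L2:
 assumes "kernel K B" "a \<in> L2 \<mu>"
 shows "ediff K a \<in> L2 \<mu>2"
proof -
 have d: "(\<lambda>p. a (fst p) - a (snd p)) \<in> L2 \<mu>2" by (intro L2_diff L2_fst_snd assms)
 have m: "(\<lambda>p. sqrt (K (fst p) (snd p))) \<in> borel_measurable \<mu>2"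
  using assms(1) by (intro measurable_compose[OF _ borel_measurable_sqrt]) (simp add: kernel_def)
 have B: "0 \<le> B" using assms(1) unfolding kernel_def by (meson order_trans)
 have "(\<lambda>p. (a (fst p) - a (snd p)) * sqrt (K (fst p) (snd p))) \<in> L2 \<mu>2"
  by (rule L2_mult_bounded(1)[OF d m, of "sqrt B"]) (use assms(1) B in \<open>auto simp: kernel_def\<close>)
 then show ?thesis by (simp add: ediff_def[abs_def])
qed

text \<open>The product of differences splits into h(x, y) + h(y, x), where h(x, y) = a(x) (b(x) -
  b(y)) K(x, y). Both parts have the same integral, which accounts for the factor 2 in
  \<open>eop\<close>.\<close>

lemma eop_inner:
 assumes K: "kernel K B" and a: "a \<in> L2 \<mu>" and b: "b \<in> L2 \<mu>"
 shows "eop K b \<in> L2 \<mu>" "(LINT p|\<mu>2. ediff K a p * ediff K b p) = ip a (eop K b)"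
proof -
 interpret F: finite_measure \<mu> by (rule finite_mu)
 interpret P: pair_sigma_finite \<mu> \<mu> by (rule pair_sigma_finite_mu)
 have Km: "(\<lambda>p. K (fst p) (snd p)) \<in> borel_measurable \<mu>2" and Kb: "\<And>x y. 0 \<le> K x y" "\<And>x y. K x y \<le> B"
  and sym: "\<And>x y. K x y = K y x" using K by (auto simp: kernel_def)
 have B: "B \<ge> 0" using Kb order_trans by blast
 have bm: "b \<in> borel_measurable \<mu>" using b by (simp add: L2_def)
 have bi: "integrable \<mu> b" by (rule L2_integrable[OF finite_mu b])
 have dK: "(\<lambda>p. (b (fst p) - b (snd p)) * K (fst p) (snd p)) \<in> L2 \<mu>2"
  by (rule L2_mult_bounded(1)[OF L2_diff[OF L2_fst_snd[OF b]] Km _ B]) (use Kb in auto)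
 define h where "h p = a (fst p) * ((b (fst p) - b (snd p)) * K (fst p) (snd p))" for p
 have hi: "integrable \<mu>2 h" unfolding h_def by (rule L2_mult_integrable[OF L2_fst_snd(1)[OF a] dK])
 have hs: "integrable \<mu>2 (\<lambda>(x, y). h (y, x))" by (rule P.integrable_product_swap[OF hi])
 define V where "V = measure \<mu> (space \<mu>)"
 define G where "G x = 2 * B * V * \<bar>b x\<bar> + 2 * B * (LINT y|\<mu>. \<bar>b y\<bar>)" for x
 have lm: "(\<lambda>x. LINT y|\<mu>. (b x - b y) * K x y) \<in> borel_measurable \<mu>"
  using dK by (intro F.borel_measurable_lebesgue_integral) (simp add: L2_def split_beta')
 then have em: "eop K b \<in> borel_measurable \<mu>" unfolding eop_def[abs_def] by (intro borel_measurable_times borel_measurable_const)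
 have GL: "G \<in> L2 \<mu>" unfolding G_def
  by (intro L2_add L2_cmult const_L2) (use b in \<open>auto simp: L2_def\<close>)
 have eb: "\<bar>eop K b x\<bar> \<le> G x" for x
 proof -
  have "\<bar>LINT y|\<mu>. (b x - b y) * K x y\<bar> \<le> (LINT y|\<mu>. B * \<bar>b x\<bar> + B * \<bar>b y\<bar>)"
  proof (rule order_trans[OF integral_abs_bound], rule integral_mono')
   show "integrable \<mu> (\<lambda>y. B * \<bar>b x\<bar> + B * \<bar>b y\<bar>)" using bi by simp
   fix y
   have "\<bar>(b x - b y) * K x y\<bar> \<le> (\<bar>b x\<bar> + \<bar>b y\<bar>) * B"
    unfolding abs_mult using Kb[of x y] by (intro mult_mono) auto
   then show "\<bar>(b x - b y) * K x y\<bar> \<le> B * \<bar>b x\<bar> + B * \<bar>b y\<bar>" by (simp add: algebra_simps)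
  qed (use B in auto)
  also have "\<dots> = B * V * \<bar>b x\<bar> + B * (LINT y|\<mu>. \<bar>b y\<bar>)" using bi by (simp add: V_def)
  finally show ?thesis by (simp add: eop_def G_def abs_mult)
 qed
 show eL: "eop K b \<in> L2 \<mu>"
 proof (rule L2I[OF em], rule Bochner_Integration.integrable_bound[OF L2_integrable_power2[OF GL]])
  have "(eop K b x)\<^sup>2 \<le> (G x)\<^sup>2" for x
   using eb[of x] by (intro abs_le_square_iff[THEN iffD1]) linarith
  then show "AE x in \<mu>. norm ((eop K b x)\<^sup>2) \<le> norm ((G x)\<^sup>2)" by simp
 qed (use em in simp)
 have "ediff K a p * ediff K b p = h p + (case p of (x, y) \<Rightarrow> h (y, x))" for p
 proof -
  obtain x y where p: "p = (x, y)" by (cases p)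
  have "sqrt (K x y) * sqrt (K x y) = K x y" using Kb(1) by simp
  then have "ediff K a p * ediff K b p = (a x - a y) * (b x - b y) * K x y"
   unfolding ediff_def p by (simp add: mult_ac)
  then show ?thesis unfolding h_def p by (simp add: sym[of y x] algebra_simps)
 qed
 then have "(LINT p|\<mu>2. ediff K a p * ediff K b p) = (LINT p|\<mu>2. h p) + (LINT p|\<mu>2. (case p of (x, y) \<Rightarrow> h (y, x)))"
  using hi hs by simp
 also have "(LINT p|\<mu>2. (case p of (x, y) \<Rightarrow> h (y, x))) = (LINT p|\<mu>2. h p)"
  by (rule P.integral_product_swap) (use hi in auto)
 also have "(LINT p|\<mu>2. h p) = (LINT x|\<mu>. (LINT y|\<mu>. h (x, y)))"
  by (rule P.integral_fst'[OF hi, symmetric])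
 also have "\<dots> = (LINT x|\<mu>. a x * (LINT y|\<mu>. (b x - b y) * K x y))"
  by (simp add: h_def)
 finally show "(LINT p|\<mu>2. ediff K a p * ediff K b p) = ip a (eop K b)"
  unfolding ip_def eop_def by (simp only: mult.left_commute[of _ 2] integral_mult_right_zero)
qed

text \<open>The Gagliardo kernel cut off at height k to make it bounded. On the diagonal the
  quotient is 0 by the convention on division, where the difference of values vanishes
  anyway.\<close>

definition skern :: "real \<Rightarrow> nat \<Rightarrow> real^'n \<Rightarrow> real^'n \<Rightarrow> real" where
 "skern \<theta> k x y = min (real k) (1 / dist x y powr (real CARD('n) + 2 * \<theta>))"

lemma kernel_skern: "kernel (skern \<theta> k) (real k)"
 unfolding kernel_def
proof (intro conjI allI)
 have i: "(\<lambda>x. x) \<in> \<mu> \<rightarrow>\<^sub>M borel" by (rule borel_measurable_lebesgue_on) simp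
 have f: "(\<lambda>p. fst p) \<in> borel_measurable \<mu>2" "(\<lambda>p. snd p) \<in> borel_measurable \<mu>2"
  using measurable_compose[OF measurable_fst i] measurable_compose[OF measurable_snd i] by auto
 show "(\<lambda>p. skern \<theta> k (fst p) (snd p)) \<in> borel_measurable \<mu>2"
  unfolding skern_def
  by (intro borel_measurable_min borel_measurable_divide borel_measurable_const powr_real_measurable borel_measurable_dist f)
qed (auto simp: skern_def dist_commute)

lemma slobodeckij_pair:
 assumes "w \<in> borel_measurable \<mu>"
 shows "slobodeckij \<theta> \<Omega> w = (\<integral>\<^sup>+p. ennreal ((w (fst p) - w (snd p))\<^sup>2 / dist (fst p) (snd p) powr (real CARD('n) + 2 * \<theta>)) \<partial>\<mu>2)"
  and "(\<lambda>p. ennreal ((w (fst p) - w (snd p))\<^sup>2 / dist (fst p) (snd p) powr (real CARD('n) + 2 * \<theta>))) \<in> borel_measurable \<mu>2"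
proof -
 interpret F: finite_measure \<mu> by (rule finite_mu)
 have i: "(\<lambda>x. x) \<in> \<mu> \<rightarrow>\<^sub>M borel" by (rule borel_measurable_lebesgue_on) simp
 have f: "(\<lambda>p. fst p) \<in> borel_measurable \<mu>2" "(\<lambda>p. snd p) \<in> borel_measurable \<mu>2"
  using measurable_compose[OF measurable_fst i] measurable_compose[OF measurable_snd i] by auto
 show m: "(\<lambda>p. ennreal ((w (fst p) - w (snd p))\<^sup>2 / dist (fst p) (snd p) powr (real CARD('n) + 2 * \<theta>))) \<in> borel_measurable \<mu>2"
  by (intro measurable_compose[OF _ measurable_ennreal] borel_measurable_divide borel_measurable_power borel_measurable_diff
    measurable_compose[OF measurable_fst assms] measurable_compose[OF measurable_snd assms]
    powr_real_measurable borel_measurable_dist f borel_measurable_const)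
 show "slobodeckij \<theta> \<Omega> w = (\<integral>\<^sup>+p. ennreal ((w (fst p) - w (snd p))\<^sup>2 / dist (fst p) (snd p) powr (real CARD('n) + 2 * \<theta>)) \<partial>\<mu>2)"
  unfolding slobodeckij_def using F.nn_integral_fst[OF m] by simp
qed

lemma ediff_skern_power2:
 "(ediff (skern \<theta> k) w p)\<^sup>2 = (w (fst p) - w (snd p))\<^sup>2 * skern \<theta> k (fst p) (snd p)"
proof -
 have "skern \<theta> k (fst p) (snd p) \<ge> 0" by (simp add: skern_def)
 then show ?thesis by (simp add: ediff_def power_mult_distrib)
qed

lemma nrm_ediff_le_slobodeckij:
 assumes w: "w \<in> L2 \<mu>" and fin: "slobodeckij \<theta> \<Omega> w < \<infinity>"
 shows "nrm \<mu>2 (ediff (skern \<theta> k) w) \<le> sqrt (enn2real (slobodeckij \<theta> \<Omega> w))"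
proof -
 have "ennreal ((nrm \<mu>2 (ediff (skern \<theta> k) w))\<^sup>2) = (\<integral>\<^sup>+p. ennreal ((ediff (skern \<theta> k) w p)\<^sup>2) \<partial>\<mu>2)"
  by (rule nrm_nn_integral[symmetric, OF ediff_L2[OF kernel_skern w]])
 also have "\<dots> \<le> slobodeckij \<theta> \<Omega> w"
  unfolding slobodeckij_pair(1)[OF L2_measurable[OF w]]
 proof (intro nn_integral_mono ennreal_leI)
  fix p
  have "skern \<theta> k (fst p) (snd p) \<le> 1 / dist (fst p) (snd p) powr (real CARD('n) + 2 * \<theta>)" by (simp add: skern_def)
  then have "(w (fst p) - w (snd p))\<^sup>2 * skern \<theta> k (fst p) (snd p) \<le>
    (w (fst p) - w (snd p))\<^sup>2 * (1 / dist (fst p) (snd p) powr (real CARD('n) + 2 * \<theta>))" by (rule mult_left_mono) simp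
  then show "(ediff (skern \<theta> k) w p)\<^sup>2 \<le> (w (fst p) - w (snd p))\<^sup>2 / dist (fst p) (snd p) powr (real CARD('n) + 2 * \<theta>)"
   unfolding ediff_skern_power2 by simp
 qed
 also have "\<dots> = ennreal (enn2real (slobodeckij \<theta> \<Omega> w))" using fin by simp
 finally have "(nrm \<mu>2 (ediff (skern \<theta> k) w))\<^sup>2 \<le> enn2real (slobodeckij \<theta> \<Omega> w)" by (simp add: ennreal_le_iff)
 then show ?thesis by (rule real_le_rsqrt)
qed

text \<open>At each pair of points the truncation is eventually inactive, so Fatou's lemma passes a
  bound that is uniform in k to the full seminorm.\<close>

lemma slobodeckij_le:
 assumes w: "w \<in> L2 \<mu>" and bd: "\<And>k. nrm \<mu>2 (ediff (skern \<theta> k) w) \<le> C"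
 shows "enn2real (slobodeckij \<theta> \<Omega> w) \<le> C\<^sup>2"
proof -
 let ?p = "real CARD('n) + 2 * \<theta>"
 have "slobodeckij \<theta> \<Omega> w = (\<integral>\<^sup>+p. liminf (\<lambda>k. ennreal ((ediff (skern \<theta> k) w p)\<^sup>2)) \<partial>\<mu>2)"
  unfolding slobodeckij_pair(1)[OF L2_measurable[OF w]]
 proof (intro nn_integral_cong lim_imp_Liminf[symmetric] trivial_limit_sequentially tendsto_ennrealI)
  fix p :: "(real^'n) \<times> (real^'n)"
  obtain K :: nat where K: "1 / dist (fst p) (snd p) powr ?p < real K" using reals_Archimedean2 by blast
  have "\<forall>\<^sub>F k in sequentially. (ediff (skern \<theta> k) w p)\<^sup>2 = (w (fst p) - w (snd p))\<^sup>2 / dist (fst p) (snd p) powr ?p"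
   unfolding eventually_sequentially
  proof (intro exI[of _ K] allI impI)
   fix k assume "K \<le> k"
   then have "skern \<theta> k (fst p) (snd p) = 1 / dist (fst p) (snd p) powr ?p" using K by (simp add: skern_def)
   then show "(ediff (skern \<theta> k) w p)\<^sup>2 = (w (fst p) - w (snd p))\<^sup>2 / dist (fst p) (snd p) powr ?p"
    unfolding ediff_skern_power2 by simp
  qed
  then show "(\<lambda>k. (ediff (skern \<theta> k) w p)\<^sup>2) \<longlonglongrightarrow> (w (fst p) - w (snd p))\<^sup>2 / dist (fst p) (snd p) powr ?p"
   by (rule tendsto_eventually)
 qed
 also have "\<dots> \<le> liminf (\<lambda>k. \<integral>\<^sup>+p. ennreal ((ediff (skern \<theta> k) w p)\<^sup>2) \<partial>\<mu>2)"
  by (rule nn_integral_liminf)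
   (intro measurable_compose[OF _ measurable_ennreal] borel_measurable_power L2_measurable ediff_L2[OF kernel_skern w])
 also have "\<dots> \<le> liminf (\<lambda>k::nat. ennreal (C\<^sup>2))"
  unfolding nrm_nn_integral[OF ediff_L2[OF kernel_skern w]]
  by (intro Liminf_mono always_eventually allI ennreal_leI power_mono bd nrm_nonneg)
 also have "\<dots> = ennreal (C\<^sup>2)" by (simp add: Liminf_const)
 finally have "slobodeckij \<theta> \<Omega> w \<le> ennreal (C\<^sup>2)" .
 then show ?thesis by (metis enn2real_ennreal enn2real_mono ennreal_less_top zero_le_power2)
qed

lemma sqrt_slobodeckij_le_sobolev_norm:
 assumes "frac r > 0" "length js = nat \<lfloor>r\<rfloor>"
 shows "sqrt (enn2real (slobodeckij (frac r) \<Omega> (wderiv \<Omega> js v))) \<le> sobolev_norm r \<Omega> v"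
proof -
 have fin: "finite {js::'n list. length js = nat \<lfloor>r\<rfloor>}"
  using finite_lists_length_eq[of "UNIV :: 'n set"] by simp
 have "enn2real (slobodeckij (frac r) \<Omega> (wderiv \<Omega> js v)) \<le>
   (\<Sum>js | length js = nat \<lfloor>r\<rfloor>. enn2real (slobodeckij (frac r) \<Omega> (wderiv \<Omega> js v)))"
  using assms fin by (intro member_le_sum) auto
 also have "\<dots> \<le> (\<Sum>js | length js \<le> nat \<lfloor>r\<rfloor>. (L2_norm \<Omega> (wderiv \<Omega> js v))\<^sup>2) + \<dots>" by (simp add: sum_nonneg)
 finally show ?thesis unfolding sobolev_norm_def using assms(1) by (intro real_sqrt_le_mono) simp
qed

end

section \<open>Bounds uniform in time from the time derivative\<close>

context evolution
begin

text \<open>Minkowski's integral inequality for a seminorm q given by a quadratic form: the square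
  of q at g is the pairing of g with the fixed function L g, to which the weak identity in time
  applies. Cauchy-Schwarz under the integral and division by q at g finish the argument.\<close>

lemma duality_bound:
 assumes ut: "u t \<in> sobolev_space r \<Omega>" and t: "t \<in> {0<..<T}" and js: "length js \<le> m"
  and L: "\<And>b. b \<in> L2 \<mu> \<Longrightarrow> L b \<in> L2 \<mu>"
  and CS: "\<And>a b. a \<in> L2 \<mu> \<Longrightarrow> b \<in> L2 \<mu> \<Longrightarrow> \<bar>ip a (L b)\<bar> \<le> q a * q b"
  and sq: "\<And>b. b \<in> L2 \<mu> \<Longrightarrow> ip b (L b) = (q b)\<^sup>2" and q0: "\<And>b. q b \<ge> 0"
  and qN: "\<And>w. w \<in> sobolev_space r \<Omega> \<Longrightarrow> q (wderiv \<Omega> js w) \<le> N w"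
 shows "q (wderiv \<Omega> js (u t)) \<le> N u0 + (LINT s|\<tau>. N (ut s))"
proof -
 let ?g = "wderiv \<Omega> js (u t)" and ?h = "wderiv \<Omega> js u0"
 have gL: "?g \<in> L2 \<mu>" "?h \<in> L2 \<mu>" using W_wderiv_L2[OF sob_W[OF ut] js] W_wderiv_L2[OF sob_W[OF u0_in] js] .
 have Lg: "L ?g \<in> L2 \<mu>" by (rule L[OF gL(1)])
 have "(q ?g)\<^sup>2 = ip ?g (L ?g)" by (rule sq[symmetric, OF gL(1)])
 also have "\<dots> = ip ?h (L ?g) + prim (\<lambda>s. ip (wderiv \<Omega> js (ut s)) (L ?g)) t" by (rule D_u_eq[OF ut t js Lg])
 also have "\<dots> \<le> N u0 * q ?g + (LINT s|\<tau>. N (ut s) * q ?g)"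
 proof (rule add_mono)
  have "ip ?h (L ?g) \<le> q ?h * q ?g" using CS[OF gL(2,1)] by linarith
  also have "\<dots> \<le> N u0 * q ?g" by (intro mult_right_mono qN u0_in q0)
  finally show "ip ?h (L ?g) \<le> N u0 * q ?g" .
  have "\<bar>prim (\<lambda>s. ip (wderiv \<Omega> js (ut s)) (L ?g)) t\<bar> \<le> (LINT s|\<tau>. N (ut s) * q ?g)"
  proof (rule prim_bound)
   show "AE s in \<tau>. \<bar>ip (wderiv \<Omega> js (ut s)) (L ?g)\<bar> \<le> N (ut s) * q ?g"
    using ut_AE
   proof eventually_elim
    case (elim s)
    have "\<bar>ip (wderiv \<Omega> js (ut s)) (L ?g)\<bar> \<le> q (wderiv \<Omega> js (ut s)) * q ?g"
     by (rule CS[OF W_wderiv_L2[OF sob_W[OF elim] js] gL(1)])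
    also have "\<dots> \<le> N (ut s) * q ?g" by (intro mult_right_mono qN elim q0)
    finally show ?case .
   qed
  qed (intro D_integrable js Lg integrable_mult_left N_ut_integrable)+
  then show "prim (\<lambda>s. ip (wderiv \<Omega> js (ut s)) (L ?g)) t \<le> (LINT s|\<tau>. N (ut s) * q ?g)" by linarith
 qed
 also have "\<dots> = (N u0 + (LINT s|\<tau>. N (ut s))) * q ?g" by (simp add: distrib_right)
 finally have le: "q ?g * q ?g \<le> (N u0 + (LINT s|\<tau>. N (ut s))) * q ?g" by (simp add: power2_eq_square)
 show ?thesis
 proof (cases "q ?g > 0")
  case True
  then show ?thesis using le by simp
 next
  case False
  moreover have "N u0 + (LINT s|\<tau>. N (ut s)) \<ge> 0" by (intro add_nonneg_nonneg integral_nonneg_AE) (auto simp: sobolev_norm_nonneg)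
  ultimately show ?thesis by linarith
 qed
qed

text \<open>The duality bound is used with the identity operator for the L^2 norm of each
  derivative, and with \<open>eop\<close> for each truncated seminorm of the derivatives of top
  order.\<close>

lemma sobolev_norm_u_bounded: "\<exists>M. AE t in \<tau>. N (u t) \<le> M"
proof -
 let ?M = "N u0 + (LINT s|\<tau>. N (ut s))"
 let ?J = "{js::'n list. length js \<le> m}" and ?J' = "{js::'n list. length js = m}"
 have "AE t in \<tau>. t \<in> {0<..<T}" by (rule AE_I2) simp
 \<comment> \<open>The second sum is kept for integer r as well, where the seminorm is absent; this
   only enlarges the bound.\<close>
 with u_AE have "AE t in \<tau>. N (u t) \<le> sqrt ((\<Sum>js\<in>?J. ?M\<^sup>2) + (\<Sum>js\<in>?J'. ?M\<^sup>2))"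
 proof eventually_elim
  case (elim t)
  have 1: "nrm \<mu> (wderiv \<Omega> js (u t)) \<le> ?M" if "js \<in> ?J" for js
   by (rule duality_bound[OF elim, where L="\<lambda>b. b" and q="nrm \<mu>"])
    (use that nrm_wderiv_le_sobolev_norm ip_CS in \<open>auto simp: ip_self nrm_nonneg\<close>)
  have 2: "enn2real (slobodeckij (frac r) \<Omega> (wderiv \<Omega> js (u t))) \<le> ?M\<^sup>2" if js: "js \<in> ?J'" and fr: "frac r > 0" for js
  proof (rule slobodeckij_le)
   have jm: "length js \<le> m" using js by simp
   show "wderiv \<Omega> js (u t) \<in> L2 \<mu>" by (rule W_wderiv_L2[OF sob_W[OF elim(1)] jm])
   fix k
   let ?K = "skern (frac r) k"
   show "nrm \<mu>2 (ediff ?K (wderiv \<Omega> js (u t))) \<le> ?M"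
   proof (rule duality_bound[OF elim jm, where L="eop ?K" and q="\<lambda>b. nrm \<mu>2 (ediff ?K b)"])
    show "\<bar>ip a (eop ?K b)\<bar> \<le> nrm \<mu>2 (ediff ?K a) * nrm \<mu>2 (ediff ?K b)" if "a \<in> L2 \<mu>" "b \<in> L2 \<mu>" for a b
     unfolding eop_inner(2)[OF kernel_skern that, symmetric]
     by (rule L2_Cauchy_Schwarz) (intro ediff_L2[OF kernel_skern] that)+
    show "ip b (eop ?K b) = (nrm \<mu>2 (ediff ?K b))\<^sup>2" if "b \<in> L2 \<mu>" for b
     unfolding eop_inner(2)[OF kernel_skern that that, symmetric] nrm_power2 by (simp only: power2_eq_square)
    show "nrm \<mu>2 (ediff ?K (wderiv \<Omega> js w)) \<le> N w" if w: "w \<in> sobolev_space r \<Omega>" for w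
    proof -
     have "slobodeckij (frac r) \<Omega> (wderiv \<Omega> js w) < \<infinity>" using w js fr by (simp add: sobolev_space_def)
     then have "nrm \<mu>2 (ediff ?K (wderiv \<Omega> js w)) \<le> sqrt (enn2real (slobodeckij (frac r) \<Omega> (wderiv \<Omega> js w)))"
      by (rule nrm_ediff_le_slobodeckij[OF W_wderiv_L2[OF sob_W[OF w] jm]])
     also have "\<dots> \<le> N w" using js fr by (intro sqrt_slobodeckij_le_sobolev_norm) auto
     finally show ?thesis .
    qed
   qed (auto intro: eop_inner(1)[OF kernel_skern] simp: nrm_nonneg)
  qed
  have case_eq: "sobolev_norm r \<Omega> (u t) = sqrt ((\<Sum>js\<in>?J. (nrm \<mu> (wderiv \<Omega> js (u t)))\<^sup>2) +
   (if 0 < frac r then \<Sum>js\<in>?J'. enn2real (slobodeckij (frac r) \<Omega> (wderiv \<Omega> js (u t))) else 0))"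
   by (simp only: sobolev_norm_def L2_norm_eq)
  show ?case unfolding case_eq
  proof (intro real_sqrt_le_mono add_mono sum_mono power_mono 1 nrm_nonneg)
   show "(if 0 < frac r then \<Sum>js\<in>?J'. enn2real (slobodeckij (frac r) \<Omega> (wderiv \<Omega> js (u t))) else 0) \<le> (\<Sum>js\<in>?J'. ?M\<^sup>2)"
   proof (cases "0 < frac r")
    case True
    then show ?thesis by (simp only: if_True) (rule sum_mono, rule 2[OF _ True])
   qed (simp add: sum_nonneg)
  qed
 qed
 then show ?thesis by blast
qed

lemma wlaplace_ip: "w \<in> W 2 \<Longrightarrow> v \<in> L2 \<mu> \<Longrightarrow> ip (wlaplace \<Omega> w) v = (\<Sum>j\<in>UNIV. ip (wderiv \<Omega> [j, j] w) v)"
 unfolding ip_def wlaplace_def sum_distrib_right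
 by (intro Bochner_Integration.integral_sum L2_mult_integrable W_wderiv_L2) auto

text \<open>The form is a finite sum of pairings of derivatives with fixed L^2 functions, so both
  claims are inherited from \<open>D_integrable\<close> and \<open>D_u_eq\<close>.\<close>

lemma aip_ut_integrable:
 assumes v: "v \<in> W 2"
 shows "integrable \<tau> (\<lambda>s. aip (ut s) v)"
  and "\<And>t. u t \<in> sobolev_space r \<Omega> \<Longrightarrow> t \<in> {0<..<T} \<Longrightarrow> aip (u t) v = aip u0 v + prim (\<lambda>s. aip (ut s) v) t"
proof -
 have L: "v \<in> L2 \<mu>" "wlaplace \<Omega> v \<in> L2 \<mu>" using W_L2[OF v] wlaplace_L2[OF v] .
 let ?G = "\<lambda>w. ip (wderiv \<Omega> [] w) v + (\<Sum>j\<in>UNIV. ip (wderiv \<Omega> [j, j] w) (wlaplace \<Omega> v))"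
 have eq: "aip w v = ?G w" if "w \<in> sobolev_space r \<Omega>" for w
  using wlaplace_ip[OF sob_W2[OF that] L(2)] ip_ut_Nil[OF L(1) that] by (simp add: aip_def)
 have lj: "length [j, j] \<le> m" for j :: 'n using two_le_m by simp
 have i: "integrable \<tau> (\<lambda>s. ip (wderiv \<Omega> [] (ut s)) v)" "integrable \<tau> (\<lambda>s. ip (wderiv \<Omega> [j, j] (ut s)) (wlaplace \<Omega> v))" for j
  by (intro D_integrable L lj, simp) (intro D_integrable L lj)
 have iG: "integrable \<tau> (\<lambda>s. ?G (ut s))"
  by (intro Bochner_Integration.integrable_add Bochner_Integration.integrable_sum i)
 have ae: "AE s in \<tau>. ?G (ut s) = aip (ut s) v" using ut_AE by eventually_elim (rule eq[symmetric])
 have am: "(\<lambda>s. aip (ut s) v) \<in> borel_measurable \<tau>"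
  by (rule AE_LIMSEQ_measurable[where f="\<lambda>_ s. ?G (ut s)"]) (use iG ae in auto)
 show ia: "integrable \<tau> (\<lambda>s. aip (ut s) v)"
  by (rule integrable_cong_AE_imp[OF iG am ae])
 fix t assume t: "u t \<in> sobolev_space r \<Omega>" "t \<in> {0<..<T}"
 have ae': "AE s in \<tau>. aip (ut s) v = ?G (ut s)" using ae by eventually_elim simp
 have ps: "integrable \<tau> (\<lambda>s. \<Sum>j\<in>UNIV. ip (wderiv \<Omega> [j, j] (ut s)) (wlaplace \<Omega> v))"
  by (intro Bochner_Integration.integrable_sum i)
 have "prim (\<lambda>s. aip (ut s) v) t = prim (\<lambda>s. ?G (ut s)) t" by (rule prim_cong_AE[OF ae' ia iG])
 also have "\<dots> = prim (\<lambda>s. ip (wderiv \<Omega> [] (ut s)) v) t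
   + prim (\<lambda>s. \<Sum>j\<in>UNIV. ip (wderiv \<Omega> [j, j] (ut s)) (wlaplace \<Omega> v)) t"
  unfolding prim_def using integrable_cut[OF i(1)] integrable_cut[OF ps] by (simp add: distrib_left)
 also have "prim (\<lambda>s. \<Sum>j\<in>UNIV. ip (wderiv \<Omega> [j, j] (ut s)) (wlaplace \<Omega> v)) t
  = (\<Sum>j\<in>UNIV. prim (\<lambda>s. ip (wderiv \<Omega> [j, j] (ut s)) (wlaplace \<Omega> v)) t)" by (rule prim_sum) (rule i)
 finally have p: "prim (\<lambda>s. aip (ut s) v) t = prim (\<lambda>s. ip (wderiv \<Omega> [] (ut s)) v) t
  + (\<Sum>j\<in>UNIV. prim (\<lambda>s. ip (wderiv \<Omega> [j, j] (ut s)) (wlaplace \<Omega> v)) t)" .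
 have e0: "length ([] :: 'n list) \<le> m" by simp
 show "aip (u t) v = aip u0 v + prim (\<lambda>s. aip (ut s) v) t"
  unfolding p eq[OF t(1)] eq[OF u0_in] D_u_eq[OF t e0 L(1)] D_u_eq[OF t lj L(2)]
  by (simp add: sum.distrib)
qed

end

lemma finite_dim_subspace_lincomb:
 assumes "finite_dim_subspace S V" "v \<in> S" "w \<in> S"
 shows "(\<lambda>x. a * v x + b * w x) \<in> S"
proof -
 obtain B where B: "S = {v. \<exists>c. v = (\<lambda>x. \<Sum>b\<in>B. c b * b x)}"
  using assms(1) by (auto simp: finite_dim_subspace_def)
 then obtain c d where "v = (\<lambda>x. \<Sum>\<beta>\<in>B. c \<beta> * \<beta> x)" "w = (\<lambda>x. \<Sum>\<beta>\<in>B. d \<beta> * \<beta> x)"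
  using assms(2,3) by blast
 then have "(\<lambda>x. a * v x + b * w x) = (\<lambda>x. \<Sum>\<beta>\<in>B. (a * c \<beta> + b * d \<beta>) * \<beta> x)"
  by (simp add: sum.distrib sum_distrib_left distrib_right mult.assoc)
 then show ?thesis unfolding B by (intro CollectI exI[of _ "\<lambda>\<beta>. a * c \<beta> + b * d \<beta>"])
qed

lemma AE_not_singleton: "AE s in lebesgue_on S. s \<noteq> (t::real)" if "S \<in> sets lebesgue"
proof -
 have "AE s in lebesgue. s \<noteq> t"
  using AE_not_in[of "{t}" lebesgue] by (simp add: negligible_iff_null_sets[symmetric])
 then show ?thesis unfolding AE_lebesgue_on_iff[OF that] by eventually_elim simp
qed

section \<open>Primitives: squares, the fundamental theorem and Gronwall's lemma\<close>

context evolution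
begin

text \<open>Fubini on the square: the integral over the triangle y < x and that over its mirror
  image add up to the integral over the square, the diagonal being null.\<close>

lemma prim_square_aux:
 assumes G: "integrable \<tau> G"
 shows "integrable \<tau> (\<lambda>s. G s * prim G s)" "2 * (LINT s|\<tau>. G s * prim G s) = (LINT s|\<tau>. G s)\<^sup>2"
proof -
 interpret F: finite_measure \<tau> by (rule finite_tau)
 interpret P: pair_sigma_finite \<tau> \<tau> ..
 have ts: "{0<..<T} \<in> sets lebesgue" by simp
 have Gm: "G \<in> borel_measurable \<tau>" using G by simp
 have idm: "(\<lambda>x. x) \<in> \<tau> \<rightarrow>\<^sub>M borel" by (rule borel_measurable_lebesgue_on) simp
 have fm: "(\<lambda>p. fst p) \<in> borel_measurable (\<tau> \<Otimes>\<^sub>M \<tau>)" "(\<lambda>p. snd p) \<in> borel_measurable (\<tau> \<Otimes>\<^sub>M \<tau>)"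
  using measurable_compose[OF measurable_fst idm] measurable_compose[OF measurable_snd idm] by auto
 let ?GG = "\<lambda>p. G (fst p) * G (snd p)"
 have m: "?GG \<in> borel_measurable (\<tau> \<Otimes>\<^sub>M \<tau>)"
  by (intro borel_measurable_times measurable_compose[OF measurable_fst Gm] measurable_compose[OF measurable_snd Gm])
 have i: "integrable (\<tau> \<Otimes>\<^sub>M \<tau>) ?GG"
  by (rule P.Fubini_integrable[OF m]) (use G in \<open>auto simp: abs_mult\<close>)
 define h where "h p = indicator {p. snd p < fst p} p * ?GG p" for p :: "real \<times> real"
 have hm: "h \<in> borel_measurable (\<tau> \<Otimes>\<^sub>M \<tau>)"
 proof -
  have "(\<lambda>p. if snd p < fst p then ?GG p else 0) \<in> borel_measurable (\<tau> \<Otimes>\<^sub>M \<tau>)"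
   by (intro measurable_If m borel_measurable_const borel_measurable_less fm)
  also have "(\<lambda>p. if snd p < fst p then ?GG p else 0) = h" by (auto simp: h_def indicator_def)
  finally show ?thesis .
 qed
 have hi: "integrable (\<tau> \<Otimes>\<^sub>M \<tau>) h"
  by (rule Bochner_Integration.integrable_bound[OF i hm]) (auto simp: h_def indicator_def)
 have hs: "integrable (\<tau> \<Otimes>\<^sub>M \<tau>) (\<lambda>(x, y). h (y, x))" by (rule P.integrable_product_swap[OF hi])
 have inner: "(LINT y|\<tau>. h (x, y)) = G x * prim G x" for x
 proof -
  have "h (x, y) = G x * (indicator {..<x} y * G y)" for y by (auto simp: h_def indicator_def)
  then show ?thesis by (simp add: prim_def)
 qed
 show "integrable \<tau> (\<lambda>s. G s * prim G s)" using P.integrable_fst'[OF hi] by (simp add: inner)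
 have "2 * (LINT s|\<tau>. G s * prim G s) = (LINT p|(\<tau> \<Otimes>\<^sub>M \<tau>). h p) + (LINT p|(\<tau> \<Otimes>\<^sub>M \<tau>). (case p of (x, y) \<Rightarrow> h (y, x)))"
  using P.integral_fst'[OF hi] P.integral_product_swap[OF hm] by (simp add: inner)
 also have "\<dots> = (LINT p|(\<tau> \<Otimes>\<^sub>M \<tau>). h p + (case p of (x, y) \<Rightarrow> h (y, x)))"
  by (rule Bochner_Integration.integral_add[OF hi hs, symmetric])
 also have "\<dots> = (LINT x|\<tau>. (LINT y|\<tau>. h (x, y) + h (y, x)))"
  using P.integral_fst'[OF Bochner_Integration.integrable_add[OF hi hs]] by simp
 also have "\<dots> = (LINT x|\<tau>. (LINT y|\<tau>. G x * G y))"
 proof (rule Bochner_Integration.integral_cong[OF refl])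
  fix x assume x: "x \<in> space \<tau>"
  have hx: "(\<lambda>y. h (x, y)) \<in> borel_measurable \<tau>" "(\<lambda>y. h (y, x)) \<in> borel_measurable \<tau>"
   by (rule measurable_compose[OF measurable_Pair1'[OF x] hm], rule measurable_compose[OF measurable_Pair2'[OF x] hm])
  show "(LINT y|\<tau>. h (x, y) + h (y, x)) = (LINT y|\<tau>. G x * G y)"
  proof (rule integral_cong_AE)
   show "AE y in \<tau>. h (x, y) + h (y, x) = G x * G y"
    using AE_not_singleton[OF ts, of x] by eventually_elim (auto simp: h_def indicator_def)
  qed (use hx Gm in \<open>auto intro!: borel_measurable_add borel_measurable_times\<close>)
 qed
 also have "\<dots> = (LINT s|\<tau>. G s)\<^sup>2" by (simp add: power2_eq_square)
 finally show "2 * (LINT s|\<tau>. G s * prim G s) = (LINT s|\<tau>. G s)\<^sup>2" .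
qed

lemma prim_measurable:
 assumes g: "integrable \<tau> g"
 shows "prim g \<in> borel_measurable \<tau>"
proof -
 interpret F: finite_measure \<tau> by (rule finite_tau)
 have gm: "g \<in> borel_measurable \<tau>" using g by simp
 have idm: "(\<lambda>x. x) \<in> \<tau> \<rightarrow>\<^sub>M borel" by (rule borel_measurable_lebesgue_on) simp
 have "(\<lambda>p. if snd p < fst p then g (snd p) else 0) \<in> borel_measurable (\<tau> \<Otimes>\<^sub>M \<tau>)"
  by (intro measurable_If borel_measurable_const borel_measurable_less measurable_compose[OF measurable_snd gm]
   measurable_compose[OF measurable_fst idm] measurable_compose[OF measurable_snd idm])
 also have "(\<lambda>p. if snd p < fst p then g (snd p) else 0) = (\<lambda>(t, s). indicator {..<t} s * g s)"
  by (auto simp: indicator_def)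
 finally show ?thesis unfolding prim_def[abs_def] by (rule F.borel_measurable_lebesgue_integral)
qed

text \<open>The rule for the derivative of a square, in integrated form and for a merely integrable
  g. Cutting g off at t reduces it to the identity on the whole interval.\<close>

lemma prim_square:
 assumes g: "integrable \<tau> g"
 shows "integrable \<tau> (\<lambda>s. g s * (c + prim g s))" "(c + prim g t)\<^sup>2 = c\<^sup>2 + 2 * prim (\<lambda>s. g s * (c + prim g s)) t"
proof -
 have p: "integrable \<tau> (\<lambda>s. g s * prim g s)" by (rule prim_square_aux(1)[OF g])
 have eq: "(\<lambda>s. g s * (c + prim g s)) = (\<lambda>s. c * g s + g s * prim g s)" by (auto simp: algebra_simps)
 show "integrable \<tau> (\<lambda>s. g s * (c + prim g s))" unfolding eq using g p by simp
 let ?G = "\<lambda>s. indicator {..<t} s * g s"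
 have G: "?G s * prim ?G s = indicator {..<t} s * (g s * prim g s)" for s
 proof (cases "s < t")
  case True
  have "prim ?G s = prim g s"
   unfolding prim_def by (intro Bochner_Integration.integral_cong) (use True in \<open>auto simp: indicator_def\<close>)
  then show ?thesis by simp
 qed simp
 have "2 * prim (\<lambda>s. g s * prim g s) t = (prim g t)\<^sup>2"
  using prim_square_aux(2)[OF integrable_cut[OF g, of t]]
  unfolding G prim_def[of g t, symmetric] prim_def[of "\<lambda>s. g s * prim g s" t, symmetric] .
 moreover have "prim (\<lambda>s. c * g s + g s * prim g s) t = c * prim g t + prim (\<lambda>s. g s * prim g s) t"
  unfolding prim_def[of _ t] using integrable_cut[OF integrable_mult_right[OF g, of c], of t] integrable_cut[OF p, of t]
  by (simp add: distrib_left mult.left_commute[of _ c])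
 ultimately show "(c + prim g t)\<^sup>2 = c\<^sup>2 + 2 * prim (\<lambda>s. g s * (c + prim g s)) t"
  unfolding eq by (simp add: power2_eq_square algebra_simps)
qed

text \<open>Carries the fundamental theorem for the gauge integral over to \<open>prim\<close>; the
  two integrands differ at most at the null set formed by 0 and t.\<close>

lemma prim_FTC:
 fixes F f :: "real \<Rightarrow> real"
 assumes f: "continuous_on {0..T} f"
  and F: "\<And>s. s \<in> {0..T} \<Longrightarrow> (F has_vector_derivative f s) (at s within {0..T})"
 shows "integrable \<tau> f" "t \<in> {0<..<T} \<Longrightarrow> F t = F 0 + prim f t"
proof -
 have int: "integrable (lebesgue_on S) f" if "S \<in> sets lebesgue" "S \<subseteq> {0..T}" for S
  using set_integrable_subset[OF absolutely_integrable_continuous_real[OF f] that]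
  unfolding integrable_lebesgue_on_iff[OF that(1)] set_integrable_def by simp
 show "integrable \<tau> f" by (rule int) auto
 assume t: "t \<in> {0<..<T}"
 have "(f has_integral F t - F 0) {0..t}"
  using t by (intro fundamental_theorem_of_calculus has_vector_derivative_within_subset[OF F]) auto
 then have "F t - F 0 = integral {0..t} f" by (simp add: integral_unique)
 also have "\<dots> = (LINT s|lebesgue_on {0..t}. f s)"
  using t by (intro lebesgue_integral_eq_integral[symmetric] int) auto
 also have "\<dots> = (LINT s|lebesgue. indicator {0..t} s * f s)" by (simp add: integral_lebesgue_on_eq)
 also have "\<dots> = (LINT s|lebesgue. indicator {0<..<T} s * (indicator {..<t} s * f s))"
 proof (rule integral_cong_AE)
  show "(\<lambda>s. indicator {0..t} s * f s) \<in> borel_measurable lebesgue"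
   using int[of "{0..t}"] t by (simp add: integrable_lebesgue_on_iff)
  have "integrable \<tau> (\<lambda>s. indicator {..<t} s * f s)" by (intro integrable_cut int) auto
  then show "(\<lambda>s. indicator {0<..<T} s * (indicator {..<t} s * f s)) \<in> borel_measurable lebesgue"
   by (simp add: integrable_lebesgue_on_iff)
  have "AE s in lebesgue. s \<noteq> (0::real)" "AE s in lebesgue. s \<noteq> t"
   using AE_not_singleton[of UNIV 0] AE_not_singleton[of UNIV t] by (simp_all add: AE_lebesgue_on_iff)
  then show "AE s in lebesgue. indicator {0..t} s * f s = indicator {0<..<T} s * (indicator {..<t} s * f s)"
   by eventually_elim (use t in \<open>auto simp: indicator_def\<close>)
 qed
 also have "\<dots> = prim f t" unfolding prim_def by (simp add: integral_lebesgue_on_eq)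
 finally show "F t = F 0 + prim f t" by simp
qed

lemma prim_mono:
 assumes "AE s in \<tau>. g s \<le> h s" "integrable \<tau> g" "integrable \<tau> h"
 shows "prim g t \<le> prim h t"
 unfolding prim_def
proof (rule integral_mono_AE)
 show "AE s in \<tau>. indicator {..<t} s * g s \<le> indicator {..<t} s * h s"
  using assms(1) by eventually_elim (auto simp: indicator_def)
qed (intro integrable_cut assms)+

text \<open>Let S be the supremum of y(t) exp(-2 C t), finite thanks to B. The rate 2 C, twice the
  natural one, makes the integral term contribute at most S/2, so absorption gives S \<le> 2
  A.\<close>

lemma prim_gronwall:
 assumes y: "\<And>t. t \<in> {0<..<T} \<Longrightarrow> y t \<le> A + C * prim y t" "\<And>t. t \<in> {0<..<T} \<Longrightarrow> y t \<le> B"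
  and yi: "integrable \<tau> y" and A: "A \<ge> 0" and C: "C > 0" and t: "t \<in> {0<..<T}"
 shows "y t \<le> 2 * A * exp (2 * C * t)"
proof -
 let ?q = "\<lambda>t. y t * exp (- (2 * C * t))"
 define S where "S = (SUP t\<in>{0<..<T}. ?q t)"
 have ne: "{0<..<T} \<noteq> {}" using T_pos by simp
 have bdd: "bdd_above (?q ` {0<..<T})"
 proof (rule bdd_aboveI2)
  fix t assume t: "t \<in> {0<..<T}"
  have "?q t \<le> \<bar>B\<bar> * exp (- (2 * C * t))" using y(2)[OF t] by (intro mult_right_mono) auto
  also have "\<dots> \<le> \<bar>B\<bar> * 1" using t C by (intro mult_left_mono) auto
  finally show "?q t \<le> \<bar>B\<bar>" by simp
 qed
 have le: "y t \<le> S * exp (2 * C * t)" if "t \<in> {0<..<T}" for t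
 proof -
  have "?q t \<le> S" unfolding S_def by (rule cSUP_upper[OF that bdd])
  then have "?q t * exp (2 * C * t) \<le> S * exp (2 * C * t)" by (rule mult_right_mono) simp
  then show ?thesis by (simp add: mult.assoc flip: exp_add)
 qed
 let ?E = "\<lambda>s. exp (2 * C * s)"
 have d: "((\<lambda>s. exp (2 * C * s) / (2 * C)) has_vector_derivative ?E s) (at s within {0..T})" for s
  using C by (auto intro!: derivative_eq_intros simp: has_real_derivative_iff_has_vector_derivative[symmetric])
 note E = prim_FTC[of ?E, OF _ d]
 have Ei: "integrable \<tau> ?E" by (rule E(1)) (intro continuous_intros)
 have q: "?q t \<le> A + S / 2" if S: "S \<ge> 0" and t: "t \<in> {0<..<T}" for t
 proof -
  have "prim y t \<le> prim (\<lambda>s. S * ?E s) t"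
   by (rule prim_mono) (use yi Ei le in auto)
  also have "\<dots> = S * prim ?E t" by (rule prim_cmult)
  also have "prim ?E t = ?E t / (2 * C) - 1 / (2 * C)"
  proof -
   have "continuous_on {0..T} ?E" by (intro continuous_intros)
   from E(2)[OF this t] show ?thesis by simp
  qed
  also have "S * (?E t / (2 * C) - 1 / (2 * C)) \<le> S * (?E t / (2 * C))" using C S by (intro mult_left_mono) auto
  finally have "C * prim y t \<le> C * (S * (?E t / (2 * C)))" using C by (intro mult_left_mono) auto
  also have "\<dots> = S / 2 * ?E t" using C by simp
  finally have "y t \<le> A + S / 2 * ?E t" using y(1)[OF t] by linarith
  then have "?q t \<le> (A + S / 2 * ?E t) * exp (- (2 * C * t))" by (rule mult_right_mono) simp
  also have "\<dots> = A * exp (- (2 * C * t)) + S / 2" by (simp add: distrib_right mult.assoc flip: exp_add)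
  also have "\<dots> \<le> A * 1 + S / 2" using A C t by (intro add_mono mult_left_mono) auto
  finally show ?thesis by simp
 qed
 have "S \<le> 2 * A"
 proof (cases "S \<ge> 0")
  case True
  have "(SUP t\<in>{0<..<T}. ?q t) \<le> A + S / 2" by (rule cSUP_least[OF ne q[OF True]])
  then have "S \<le> A + S / 2" by (simp only: S_def[symmetric])
  then show ?thesis by simp
 qed (use A in simp)
 then have "S * exp (2 * C * t) \<le> 2 * A * exp (2 * C * t)" by (rule mult_right_mono) simp
 then show ?thesis using le[OF t] by linarith
qed

end

section \<open>Orthogonal projection onto a finite-dimensional subspace\<close>

context bounded_open
begin

lemma W_sum: "(\<And>i. i \<in> I \<Longrightarrow> f i \<in> W 2) \<Longrightarrow> (\<lambda>x. 0) \<in> W 2 \<Longrightarrow> (\<lambda>x. \<Sum>i\<in>I. c i * f i x) \<in> W 2"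
proof (induction I rule: infinite_finite_induct)
 case (insert i I)
 then have "(\<lambda>x. c i * f i x + 1 * (\<Sum>i\<in>I. c i * f i x)) \<in> W 2" by (intro W_lincomb) auto
 then show ?case using insert by simp
qed auto

lemma W_zero: "v \<in> W 2 \<Longrightarrow> (\<lambda>x. 0) \<in> W 2"
 using W_lincomb[of v 2 v 0 0] by simp

lemma aip_sum:
 assumes "\<And>i. i \<in> I \<Longrightarrow> f i \<in> W 2" "w \<in> W 2"
 shows "aip (\<lambda>x. \<Sum>i\<in>I. c i * f i x) w = (\<Sum>i\<in>I. c i * aip (f i) w)"
 using assms(1)
proof (induction I rule: infinite_finite_induct)
 case (insert i I)
 have "aip (\<lambda>x. c i * f i x + 1 * (\<Sum>i\<in>I. c i * f i x)) w = c i * aip (f i) w + 1 * aip (\<lambda>x. \<Sum>i\<in>I. c i * f i x) w"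
  using insert.prems by (intro aip_lincomb W_sum W_zero[OF assms(2)] assms(2)) auto
 then show ?case using insert by simp
qed (simp_all add: aip_zero[OF W_zero[OF assms(2)] assms(2)])

text \<open>The form is semidefinite: zero energy means that v and its Laplacian have zero L^2 norm,
  and Cauchy-Schwarz does the rest.\<close>

lemma aip_null:
 assumes "v \<in> W 2" "w \<in> W 2" "aip v v = 0"
 shows "aip v w = 0"
proof -
 have L: "v \<in> L2 \<mu>" "w \<in> L2 \<mu>" "wlaplace \<Omega> v \<in> L2 \<mu>" "wlaplace \<Omega> w \<in> L2 \<mu>"
  using assms by (auto intro: W_L2 wlaplace_L2)
 have "(nrm \<mu> v)\<^sup>2 + (nrm \<mu> (wlaplace \<Omega> v))\<^sup>2 = 0" using assms(3) by (simp add: aip_def ip_self)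
 then have "nrm \<mu> v = 0" "nrm \<mu> (wlaplace \<Omega> v) = 0" by (auto simp: add_nonneg_eq_0_iff)
 then show ?thesis using ip_CS[OF L(1,2)] ip_CS[OF L(3,4)] by (simp add: aip_def)
qed

definition orthonormal :: "nat \<Rightarrow> (nat \<Rightarrow> real^'n \<Rightarrow> real) \<Rightarrow> bool" where
 "orthonormal n b \<longleftrightarrow> (\<forall>i<n. b i \<in> W 2 \<and> (\<forall>j<n. aip (b i) (b j) = (if i = j then 1 else 0)))"

definition aproj :: "nat \<Rightarrow> (nat \<Rightarrow> real^'n \<Rightarrow> real) \<Rightarrow> (real^'n \<Rightarrow> real) \<Rightarrow> real^'n \<Rightarrow> real" where
 "aproj n b v x = (\<Sum>i<n. aip v (b i) * b i x)"

lemma aproj_W: "orthonormal n b \<Longrightarrow> v \<in> W 2 \<Longrightarrow> aproj n b v \<in> W 2"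
 unfolding aproj_def[abs_def] by (intro W_sum) (auto simp: orthonormal_def W_zero)

lemma aip_aproj: "orthonormal n b \<Longrightarrow> w \<in> W 2 \<Longrightarrow> aip (aproj n b v) w = (\<Sum>i<n. aip v (b i) * aip (b i) w)"
 unfolding aproj_def[abs_def] by (intro aip_sum) (auto simp: orthonormal_def)

lemma aip_residual: "orthonormal n b \<Longrightarrow> v \<in> W 2 \<Longrightarrow> w \<in> W 2 \<Longrightarrow>
  aip (\<lambda>x. v x - aproj n b v x) w = aip v w - (\<Sum>i<n. aip v (b i) * aip (b i) w)"
 using aip_lincomb[of v "aproj n b v" w 1 "-1"] aproj_W[of n b v] aip_aproj[of n b w v] by simp

lemma aip_residual_basis:
 assumes "orthonormal n b" "v \<in> W 2" "j < n"
 shows "aip (\<lambda>x. v x - aproj n b v x) (b j) = 0"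
proof -
 have "(\<Sum>i<n. aip v (b i) * aip (b i) (b j)) = (\<Sum>i<n. if i = j then aip v (b i) else 0)"
  using assms by (intro sum.cong) (auto simp: orthonormal_def)
 then show ?thesis using aip_residual[OF assms(1,2), of "b j"] assms by (simp add: orthonormal_def)
qed

lemma residual_W: "orthonormal n b \<Longrightarrow> v \<in> W 2 \<Longrightarrow> (\<lambda>x. v x - aproj n b v x) \<in> W 2"
 using W_lincomb[of v 2 "aproj n b v" 1 "-1"] aproj_W[of n b v] by simp

lemma aip_pythagoras:
 assumes "orthonormal n b" "v \<in> W 2"
 shows "aip v v = aip (\<lambda>x. v x - aproj n b v x) (\<lambda>x. v x - aproj n b v x) + (\<Sum>i<n. (aip v (b i))\<^sup>2)"
proof -
 let ?r = "\<lambda>x. v x - aproj n b v x"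
 have R: "?r \<in> W 2" by (rule residual_W[OF assms])
 have 0: "aip (b i) ?r = 0" if "i < n" for i
  using aip_residual_basis[OF assms that] by (simp add: aip_commute)
 have "aip ?r ?r = aip ?r v"
  using aip_residual[OF assms R] 0 by (simp add: aip_commute[of v ?r])
 also have "\<dots> = aip v v - (\<Sum>i<n. (aip v (b i))\<^sup>2)"
  using aip_residual[OF assms assms(2)] by (simp add: aip_commute[of "b _" v] power2_eq_square)
 finally show ?thesis by simp
qed

text \<open>Gram-Schmidt orthogonalisation. Spanning is expressed by Parseval's identity and not by
  linear combinations, because the form cannot distinguish functions that agree almost
  everywhere.\<close>

lemma orthonormal_basis:
 assumes fin: "finite B" and B: "B \<subseteq> S" and S: "S \<subseteq> W 2"
  and cl: "\<And>v w a b. v \<in> S \<Longrightarrow> w \<in> S \<Longrightarrow> (\<lambda>x. a * v x + b * w x) \<in> S" and S0: "(\<lambda>x. 0) \<in> S"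
 shows "\<exists>n b. orthonormal n b \<and> (\<forall>i<n. b i \<in> S) \<and>
  (\<forall>v\<in>B. \<forall>w\<in>W 2. aip v w = (\<Sum>i<n. aip v (b i) * aip (b i) w))"
 using fin B
proof (induction B)
 case empty
 show ?case by (rule exI[of _ 0]) (simp add: orthonormal_def)
next
 case (insert a B)
 then obtain n b where on: "orthonormal n b" and bS: "\<And>i. i < n \<Longrightarrow> b i \<in> S"
  and P: "\<And>v w. v \<in> B \<Longrightarrow> w \<in> W 2 \<Longrightarrow> aip v w = (\<Sum>i<n. aip v (b i) * aip (b i) w)" by auto
 have a: "a \<in> S" "a \<in> W 2" using insert.prems S by auto
 have sumS: "(\<lambda>x. \<Sum>i<k. c i * b i x) \<in> S" if "k \<le> n" for c k
  using that
 proof (induction k)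
  case (Suc k)
  then have "(\<lambda>x. 1 * (\<Sum>i<k. c i * b i x) + c k * b k x) \<in> S" by (intro cl bS) auto
  then show ?case by simp
 qed (simp add: S0)
 define e where "e = (\<lambda>x. a x - aproj n b a x)"
 have eS: "e \<in> S" using cl[OF a(1) sumS[OF order_refl], of 1 "-1" "\<lambda>i. aip a (b i)"] by (simp add: e_def aproj_def)
 have eW: "e \<in> W 2" using eS S by blast
 have ew: "aip e w = aip a w - (\<Sum>i<n. aip a (b i) * aip (b i) w)" if "w \<in> W 2" for w
  unfolding e_def by (rule aip_residual[OF on a(2) that])
 have eb: "aip e (b j) = 0" "aip (b j) e = 0" if "j < n" for j
  using aip_residual_basis[OF on a(2) that] aip_commute[of e "b j"] by (auto simp: e_def)
 show ?case
 proof (cases "aip e e = 0")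
  case True
  \<comment> \<open>A residual of zero energy is discarded: by \<open>aip_null\<close> it
    contributes nothing to the identity.\<close>
  have "aip a w = (\<Sum>i<n. aip a (b i) * aip (b i) w)" if "w \<in> W 2" for w
   using ew[OF that] aip_null[OF eW that True] by simp
  then show ?thesis using on bS P by (intro exI[of _ n] exI[of _ b]) auto
 next
  case False
  then have pos: "aip e e > 0" using aip_nonneg[of e] by simp
  define d where "d = (\<lambda>x. 1 / sqrt (aip e e) * e x)"
  have dS: "d \<in> S" using cl[OF eS eS, of "1 / sqrt (aip e e)" 0] by (simp add: d_def)
  have dw: "aip d w = aip e w / sqrt (aip e e)" if "w \<in> W 2" for w
   using aip_lincomb[OF eW eW that, of "1 / sqrt (aip e e)" 0] by (simp add: d_def)
  have dW: "d \<in> W 2" using dS S by blast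
  have dd: "aip d d = 1"
   using dw[OF dW] dw[OF eW] pos by (simp add: aip_commute[of e d] real_div_sqrt)
  let ?b = "b(n := d)"
  have bW: "b i \<in> W 2" if "i < n" for i using bS[OF that] S by blast
  have bd: "aip (b i) d = 0" "aip d (b i) = 0" if "i < n" for i
   using dw[OF bW[OF that]] eb[OF that] by (auto simp: aip_commute[of "b i" d])
  have on': "orthonormal (Suc n) ?b"
   using on bd dd dW by (auto simp: orthonormal_def less_Suc_eq)
  have P': "aip v w = (\<Sum>i<Suc n. aip v (?b i) * aip (?b i) w)" if v: "v \<in> insert a B" and w: "w \<in> W 2" for v w
  proof -
   have eq: "(\<Sum>i<Suc n. aip v (?b i) * aip (?b i) w) = (\<Sum>i<n. aip v (b i) * aip (b i) w) + aip v d * aip d w" by simp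
   show ?thesis
   proof (cases "v \<in> B")
    case True
    have "aip v d = 0" using P[OF True dW] bd by simp
    then show ?thesis unfolding eq using P[OF True w] by simp
   next
    case False
    then have va: "v = a" using v by simp
    \<comment> \<open>a and e differ by a combination of earlier basis elements, all orthogonal to
      e, so the coefficient of a along d is the square root of \<open>aip e e\<close>.\<close>
    have "aip a e = aip e e" using ew[OF eW] eb by simp
    then have "aip a d * aip d w = aip e w"
     using dw[OF w] dw[OF a(2)] pos by (simp add: aip_commute[of a d] aip_commute[of a e] real_div_sqrt)
    then show ?thesis unfolding eq va using ew[OF w] by simp
   qed
  qed
  have "?b i \<in> S" if "i < Suc n" for i using that bS dS by (cases "i = n") auto
  then show ?thesis using on' P' by (intro exI[of _ "Suc n"] exI[of _ ?b]) blast
 qed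
qed

text \<open>Both sides of Parseval's identity are linear in v, so it passes from the generating set
  to its span.\<close>

lemma subspace_basis:
 assumes S: "finite_dim_subspace S V" and V: "V \<subseteq> W 2"
 shows "\<exists>n b. orthonormal n b \<and> (\<forall>i<n. b i \<in> S) \<and>
  (\<forall>v\<in>S. \<forall>w\<in>W 2. aip v w = (\<Sum>i<n. aip v (b i) * aip (b i) w))"
proof -
 obtain B where fin: "finite B" and Seq: "S = {v. \<exists>c. v = (\<lambda>x. \<Sum>b\<in>B. c b * b x)}" and SV: "S \<subseteq> V"
  using S by (auto simp: finite_dim_subspace_def)
 have cl: "(\<lambda>x. a * v x + b * w x) \<in> S" if "v \<in> S" "w \<in> S" for v w a b
  by (rule finite_dim_subspace_lincomb[OF S that])
 have BS: "B \<subseteq> S"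
 proof
  fix \<beta> assume "\<beta> \<in> B"
  then have "\<beta> = (\<lambda>x. \<Sum>b\<in>B. (if b = \<beta> then 1 else 0) * b x)" using fin by (simp add: if_distrib[of "\<lambda>c. c * _"] cong: if_cong)
  then show "\<beta> \<in> S" unfolding Seq by (intro CollectI exI[of _ "\<lambda>b. if b = \<beta> then 1 else 0"])
 qed
 have S0: "(\<lambda>x. 0) \<in> S" unfolding Seq by (auto intro!: exI[of _ "\<lambda>_. 0"])
 have SW: "S \<subseteq> W 2" using SV V by blast
 have ex: "\<exists>n b. orthonormal n b \<and> (\<forall>i<n. b i \<in> S) \<and>
  (\<forall>v\<in>B. \<forall>w\<in>W 2. aip v w = (\<Sum>i<n. aip v (b i) * aip (b i) w))"
  by (rule orthonormal_basis[OF fin BS SW _ S0]) (rule cl)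
 obtain n b where on: "orthonormal n b" and bS: "\<forall>i<n. b i \<in> S"
  and P0: "\<forall>v\<in>B. \<forall>w\<in>W 2. aip v w = (\<Sum>i<n. aip v (b i) * aip (b i) w)"
  using ex by (elim exE conjE)
 note P = bspec[OF bspec[OF P0]]
 have bW: "b i \<in> W 2" if "i < n" for i using on that by (simp add: orthonormal_def)
 have "aip v w = (\<Sum>i<n. aip v (b i) * aip (b i) w)" if v: "v \<in> S" and w: "w \<in> W 2" for v w
 proof -
  obtain c where c: "v = (\<lambda>x. \<Sum>\<beta>\<in>B. c \<beta> * \<beta> x)" using v unfolding Seq by blast
  have BW: "\<And>\<beta>. \<beta> \<in> B \<Longrightarrow> \<beta> \<in> W 2" using BS SW by blast
  have e: "aip v w = (\<Sum>\<beta>\<in>B. c \<beta> * aip \<beta> w)" if "w \<in> W 2" for w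
   unfolding c by (rule aip_sum[OF BW that])
  have "aip v w = (\<Sum>\<beta>\<in>B. \<Sum>i<n. c \<beta> * aip \<beta> (b i) * aip (b i) w)"
   unfolding e[OF w] by (intro sum.cong refl) (simp add: P[OF _ w] sum_distrib_left mult.assoc)
  also have "\<dots> = (\<Sum>i<n. \<Sum>\<beta>\<in>B. c \<beta> * aip \<beta> (b i) * aip (b i) w)" by (rule sum.swap)
  also have "\<dots> = (\<Sum>i<n. aip v (b i) * aip (b i) w)"
   by (intro sum.cong refl) (simp add: e[OF bW] sum_distrib_right)
  finally show ?thesis .
 qed
 then show ?thesis by (intro exI[of _ n] exI[of _ b] conjI on bS ballI)
qed

end

section \<open>Triangle inequalities from quadratic forms\<close>

lemma nonneg_quadratic_form:
 fixes A C D :: real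
 assumes "\<And>a b. 0 \<le> a\<^sup>2 * A + 2 * a * b * C + b\<^sup>2 * D"
 shows "\<bar>C\<bar> \<le> sqrt A * sqrt D"
proof -
 have A: "A \<ge> 0" and D: "D \<ge> 0" using assms[of 1 0] assms[of 0 1] by auto
 have "C\<^sup>2 \<le> A * D"
 proof (cases "D = 0")
  case True
  \<comment> \<open>For D = 0 the form at a = C, b = -(A + 1) has the value -C^2 (A + 2), which
    forces C = 0.\<close>
  then have "0 \<le> (- (A + 1) * C)\<^sup>2 * 0 + C\<^sup>2 * A - 2 * C * (A + 1) * C" using assms[of C "- (A + 1)"] by (simp add: algebra_simps)
  then have "C\<^sup>2 * (A + 2) \<le> 0" by (simp add: power2_eq_square algebra_simps)
  then have "C\<^sup>2 \<le> 0" using A by (simp add: mult_le_0_iff)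
  then show ?thesis using True by simp
 next
  case False
  then have pos: "D > 0" using D by simp
  have "0 \<le> D * (A * D - C\<^sup>2)" using assms[of D "- C"] by (simp add: power2_eq_square algebra_simps)
  then have "0 \<le> A * D - C\<^sup>2" using pos by (simp add: zero_le_mult_iff)
  then show ?thesis by simp
 qed
 then show ?thesis using real_sqrt_le_mono[of "C\<^sup>2" "A * D"] by (simp add: real_sqrt_mult)
qed

text \<open>One argument for both \<open>norm1\<close> and \<open>norm2\<close>: each is the root of
  a quadratic form in the coefficients, and the bound on C is the Cauchy-Schwarz inequality.\<close>

lemma sqrt_quadratic_form_triangle:
 fixes A C D :: real
 assumes Q: "\<And>a b. Q a b = a\<^sup>2 * A + 2 * a * b * C + b\<^sup>2 * D" and nonneg: "\<And>a b. 0 \<le> Q a b"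
 shows "sqrt (Q a b) \<le> \<bar>a\<bar> * sqrt A + \<bar>b\<bar> * sqrt D"
proof -
 have A: "A \<ge> 0" and D: "D \<ge> 0" using nonneg[of 1 0] nonneg[of 0 1] by (auto simp: Q)
 have C: "\<bar>C\<bar> \<le> sqrt A * sqrt D" by (rule nonneg_quadratic_form) (use nonneg in \<open>simp add: Q\<close>)
 have "a * b * C \<le> \<bar>a * b\<bar> * \<bar>C\<bar>" by (simp flip: abs_mult)
 also have "\<dots> \<le> \<bar>a * b\<bar> * (sqrt A * sqrt D)" by (intro mult_left_mono C) simp
 finally have "Q a b \<le> (\<bar>a\<bar> * sqrt A + \<bar>b\<bar> * sqrt D)\<^sup>2"
  using A D by (simp add: Q power2_sum power_mult_distrib abs_mult mult_ac)
 then show ?thesis by (intro real_le_lsqrt) (use A D nonneg in auto)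
qed

lemma bilinear_expand:
 fixes B :: "('a \<Rightarrow> real) \<Rightarrow> ('a \<Rightarrow> real) \<Rightarrow> real"
 assumes lin: "\<And>v v' w a b. v \<in> V \<Longrightarrow> v' \<in> V \<Longrightarrow> w \<in> V \<Longrightarrow> B (\<lambda>x. a * v x + b * v' x) w = a * B v w + b * B v' w"
  and commute: "\<And>v w. B v w = B w v" and cl: "\<And>v w a b. v \<in> V \<Longrightarrow> w \<in> V \<Longrightarrow> (\<lambda>x. a * v x + b * w x) \<in> V"
  and vw: "v \<in> V" "w \<in> V"
 shows "B (\<lambda>x. a * v x + b * w x) (\<lambda>x. a * v x + b * w x) = a\<^sup>2 * B v v + 2 * a * b * B v w + b\<^sup>2 * B w w"
 unfolding lin[OF vw cl[OF vw]] commute[of v "\<lambda>x. a * v x + b * w x"] commute[of w "\<lambda>x. a * v x + b * w x"]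
  lin[OF vw vw(1)] lin[OF vw vw(2)] commute[of w v]
 by (simp add: power2_eq_square algebra_simps)

context bounded_open
begin

lemma aip_expand:
 assumes "v \<in> W 2" "w \<in> W 2"
 shows "aip (\<lambda>x. a * v x + b * w x) (\<lambda>x. a * v x + b * w x) = a\<^sup>2 * aip v v + 2 * a * b * aip v w + b\<^sup>2 * aip w w"
 by (rule bilinear_expand[where V="W 2"]) (fact assms aip_lincomb aip_commute | rule aip_lincomb W_lincomb; assumption)+

lemma gip_expand:
 assumes "v \<in> W 1" "w \<in> W 1"
 shows "gip (\<lambda>x. a * v x + b * w x) (\<lambda>x. a * v x + b * w x) = a\<^sup>2 * gip v v + 2 * a * b * gip v w + b\<^sup>2 * gip w w"
 by (rule bilinear_expand[where V="W 1"]) (fact assms gip_lincomb gip_commute | rule gip_lincomb W_lincomb; assumption)+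

lemma L2_lincomb: "v \<in> L2 \<mu> \<Longrightarrow> w \<in> L2 \<mu> \<Longrightarrow> (\<lambda>x. a * v x + b * w x) \<in> L2 \<mu>"
 by (intro L2_add L2_cmult)

lemma ip_expand:
 assumes "v \<in> L2 \<mu>" "w \<in> L2 \<mu>"
 shows "ip (\<lambda>x. a * v x + b * w x) (\<lambda>x. a * v x + b * w x) = a\<^sup>2 * ip v v + 2 * a * b * ip v w + b\<^sup>2 * ip w w"
 by (rule bilinear_expand[where V="L2 \<mu>"]) (fact assms ip_lincomb ip_commute | rule ip_lincomb L2_lincomb; assumption)+

lemma W2_W1: "v \<in> W 2 \<Longrightarrow> v \<in> W 1"
 using W_mono[of 1 2] by auto

lemma aip_CS: "v \<in> W 2 \<Longrightarrow> w \<in> W 2 \<Longrightarrow> \<bar>aip v w\<bar> \<le> sqrt (aip v v) * sqrt (aip w w)"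
 by (rule nonneg_quadratic_form) (simp add: aip_expand[symmetric] aip_nonneg)

lemma norm1_nonneg: "norm1 \<Omega> v \<ge> 0" and norm2_nonneg: "norm2 \<Omega> v \<ge> 0"
 by (auto simp: norm1_def norm2_def)

lemma ip_nonneg: "0 \<le> ip v v"
 by (simp add: ip_self)

lemma norm1_triangle:
 assumes "v \<in> W 1" "w \<in> W 1"
 shows "norm1 \<Omega> (\<lambda>x. a * v x + b * w x) \<le> \<bar>a\<bar> * norm1 \<Omega> v + \<bar>b\<bar> * norm1 \<Omega> w"
 unfolding norm1_eq[OF W_lincomb[OF assms]] norm1_eq[OF assms(1)] norm1_eq[OF assms(2)]
proof (rule sqrt_quadratic_form_triangle)
 have L: "v \<in> L2 \<mu>" "w \<in> L2 \<mu>" using assms by (auto intro: W_L2)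
 fix a b
 let ?z = "\<lambda>x. a * v x + b * w x"
 show "ip ?z ?z + gip ?z ?z = a\<^sup>2 * (ip v v + gip v v) + 2 * a * b * (ip v w + gip v w) + b\<^sup>2 * (ip w w + gip w w)"
  unfolding ip_expand[OF L] gip_expand[OF assms] by (simp add: algebra_simps)
 show "0 \<le> ip ?z ?z + gip ?z ?z" by (intro add_nonneg_nonneg gip_nonneg ip_nonneg)
qed

lemma norm2_triangle:
 assumes "v \<in> W 2" "w \<in> W 2"
 shows "norm2 \<Omega> (\<lambda>x. a * v x + b * w x) \<le> \<bar>a\<bar> * norm2 \<Omega> v + \<bar>b\<bar> * norm2 \<Omega> w"
 unfolding norm2_eq[OF W_lincomb[OF assms]] norm2_eq[OF assms(1)] norm2_eq[OF assms(2)]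
proof (rule sqrt_quadratic_form_triangle)
 have L: "v \<in> W 1" "w \<in> W 1" using assms W2_W1 by blast+
 fix a b
 let ?z = "\<lambda>x. a * v x + b * w x"
 show "aip ?z ?z + gip ?z ?z = a\<^sup>2 * (aip v v + gip v v) + 2 * a * b * (aip v w + gip v w) + b\<^sup>2 * (aip w w + gip w w)"
  unfolding aip_expand[OF assms] gip_expand[OF L] by (simp add: algebra_simps)
 show "0 \<le> aip ?z ?z + gip ?z ?z" by (intro add_nonneg_nonneg gip_nonneg aip_nonneg)
qed

lemma norm1_le_norm2: "v \<in> W 2 \<Longrightarrow> norm1 \<Omega> v \<le> norm2 \<Omega> v"
 by (simp add: norm1_eq[OF W2_W1] norm2_eq aip_def ip_self)

lemma aip_le_norm2: "v \<in> W 2 \<Longrightarrow> sqrt (aip v v) \<le> norm2 \<Omega> v"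
 by (simp add: norm2_eq gip_nonneg)

lemma norm2_minus_commute:
 assumes "v \<in> W 2" "w \<in> W 2"
 shows "norm2 \<Omega> (\<lambda>x. v x - w x) = norm2 \<Omega> (\<lambda>x. w x - v x)"
 using norm2_eq[OF W_lincomb[OF assms, of 1 "-1"]] norm2_eq[OF W_lincomb[OF assms, of "-1" 1]]
  aip_expand[OF assms, of 1 "-1"] aip_expand[OF assms, of "-1" 1]
  gip_expand[OF assms[THEN W2_W1], of 1 "-1"] gip_expand[OF assms[THEN W2_W1], of "-1" 1] by simp

end

section \<open>Estimates of the nonlinear form in the energy norm\<close>

context cut_domain
begin

lemma H02_facts:
 assumes "v \<in> H02 \<Omega>"
 shows "v \<in> W 2" "v \<in> W 1" "v \<in> L2 \<mu>" "has_trace 1 \<Omega> v (\<lambda>_. 0)" "wderiv \<Omega> [j] v \<in> L2 \<mu>"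
 using assms W2_W1[of v] by (auto simp: H02_iff intro: W_L2 W_wderiv_L2)

abbreviation anrm :: "(real^'n \<Rightarrow> real) \<Rightarrow> real" where
 "anrm v \<equiv> sqrt (aip v v)"

lemma ip_le_aip: "ip v v \<le> aip v v"
 by (simp add: aip_def ip_self)

lemma nrm_le_anrm: "nrm \<mu> v \<le> anrm v"
 using real_sqrt_le_mono[OF ip_le_aip[of v]] by (simp add: ip_self nrm_nonneg)

lemma nrm_wderiv_le_anrm:
 assumes "v \<in> H02 \<Omega>"
 shows "nrm \<mu> (wderiv \<Omega> [j] v) \<le> anrm v"
proof -
 have "ip (wderiv \<Omega> [j] v) (wderiv \<Omega> [j] v) \<le> gip v v"
  unfolding gip_def by (rule member_le_sum) (auto simp: ip_self)
 also have "\<dots> \<le> aip v v" using gip_le_aip[OF assms] aip_nonneg[of v] by simp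
 finally show ?thesis using real_sqrt_le_mono[of "(nrm \<mu> (wderiv \<Omega> [j] v))\<^sup>2" "aip v v"] by (simp add: ip_self nrm_nonneg)
qed

text \<open>For zero trace the surface term of \<open>tbound\<close> disappears; of the remaining
  two terms the first is at most the energy and the second at most half of it.\<close>

lemma nrm_square_le:
 assumes card: "CARD('n) \<le> 2" and v: "v \<in> H02 \<Omega>"
 shows "(\<lambda>x. (v x)\<^sup>2) \<in> L2 \<mu>" "nrm \<mu> (\<lambda>x. (v x)\<^sup>2) \<le> 2 * aip v v"
proof -
 show "(\<lambda>x. (v x)\<^sup>2) \<in> L2 \<mu>" by (rule trace_L4(1)[OF card H02_facts(4)[OF v]])
 have "nrm \<mu> (\<lambda>x. (v x)\<^sup>2) \<le> tbound v (\<lambda>_. 0)" by (rule trace_L4(2)[OF card H02_facts(4)[OF v]])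
 also have "\<dots> = ip v v + gip v v" by (simp add: tbound_def nrm_power2)
 also have "\<dots> \<le> 2 * aip v v" using ip_le_aip[of v] gip_le_aip[OF v] aip_nonneg[of v] by linarith
 finally show "nrm \<mu> (\<lambda>x. (v x)\<^sup>2) \<le> 2 * aip v v" .
qed

lemma nrm_mult_le:
 assumes card: "CARD('n) \<le> 2" and v: "v \<in> H02 \<Omega>" and w: "w \<in> H02 \<Omega>"
 shows "(\<lambda>x. v x * w x) \<in> L2 \<mu>" "nrm \<mu> (\<lambda>x. v x * w x) \<le> 2 * anrm v * anrm w"
proof -
 note L4 = L2_mult_L4[OF L2_measurable[OF H02_facts(3)[OF v]] nrm_square_le(1)[OF card v]
  L2_measurable[OF H02_facts(3)[OF w]] nrm_square_le(1)[OF card w]]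
 show "(\<lambda>x. v x * w x) \<in> L2 \<mu>" by (rule L4(1))
 have "(nrm \<mu> (\<lambda>x. v x * w x))\<^sup>2 \<le> (2 * aip v v) * (2 * aip w w)"
  by (rule order_trans[OF L4(2)]) (intro mult_mono nrm_square_le[OF card] v w nrm_nonneg; simp add: aip_nonneg)
 also have "\<dots> = (2 * anrm v * anrm w)\<^sup>2" by (simp add: power_mult_distrib aip_nonneg)
 finally show "nrm \<mu> (\<lambda>x. v x * w x) \<le> 2 * anrm v * anrm w"
  by (rule power2_le_imp_le) (simp add: aip_nonneg)
qed

lemma ip_wderiv_le:
 assumes "v \<in> H02 \<Omega>" "w \<in> H02 \<Omega>"
 shows "\<bar>ip v (wderiv \<Omega> [j] w)\<bar> \<le> anrm v * anrm w"
 by (rule order_trans[OF ip_CS[OF H02_facts(3)[OF assms(1)] H02_facts(5)[OF assms(2)]]])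
  (intro mult_mono nrm_le_anrm nrm_wderiv_le_anrm assms nrm_nonneg; simp add: aip_nonneg)

lemma ip_mult_wderiv_le:
 assumes card: "CARD('n) \<le> 2" and v: "v \<in> H02 \<Omega>" and z: "z \<in> H02 \<Omega>" and w: "w \<in> H02 \<Omega>"
 shows "\<bar>ip (\<lambda>x. v x * z x) (wderiv \<Omega> [j] w)\<bar> \<le> 2 * anrm v * anrm z * anrm w"
 by (rule order_trans[OF ip_CS[OF nrm_mult_le(1)[OF card v z] H02_facts(5)[OF w]]])
  (intro mult_mono nrm_mult_le(2)[OF card v z] nrm_wderiv_le_anrm w nrm_nonneg; simp add: aip_nonneg)

text \<open>Each coordinate contributes at most the product of the energy norms; the factor 2 is the
  bound on the number of coordinates.\<close>

lemma gip_le: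
 assumes card: "CARD('n) \<le> 2" and v: "v \<in> H02 \<Omega>" and w: "w \<in> H02 \<Omega>"
 shows "\<bar>gip v w\<bar> \<le> 2 * anrm v * anrm w"
proof -
 have "\<bar>gip v w\<bar> \<le> (\<Sum>j\<in>(UNIV :: 'n set). anrm v * anrm w)"
  unfolding gip_def
 proof (rule order_trans[OF sum_abs], rule sum_mono)
  fix j :: 'n
  show "\<bar>ip (wderiv \<Omega> [j] v) (wderiv \<Omega> [j] w)\<bar> \<le> anrm v * anrm w"
   by (rule order_trans[OF ip_CS[OF H02_facts(5)[OF v] H02_facts(5)[OF w]]])
    (intro mult_mono nrm_wderiv_le_anrm v w nrm_nonneg; simp add: aip_nonneg)
 qed
 also have "\<dots> = real CARD('n) * (anrm v * anrm w)" by simp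
 also have "\<dots> \<le> 2 * (anrm v * anrm w)" using card by (intro mult_right_mono) (auto simp: aip_nonneg)
 finally show ?thesis by simp
qed

text \<open>The quadratic part comes from v^2 - (v - z)^2 = 2 v z - z^2, halved.\<close>

lemma nlf_diff:
 assumes card: "CARD('n) \<le> 2" and v: "v \<in> H02 \<Omega>" and z: "z \<in> H02 \<Omega>" and w: "w \<in> H02 \<Omega>"
 shows "nlf v w - nlf (\<lambda>x. v x - z x) w =
  (\<Sum>j\<in>UNIV. ip z (wderiv \<Omega> [j] w) + ip (\<lambda>x. v x * z x) (wderiv \<Omega> [j] w) - ip (\<lambda>x. (z x)\<^sup>2) (wderiv \<Omega> [j] w) / 2)"
 unfolding nlf_def sum_subtractf[symmetric]
proof (rule sum.cong[OF refl])
 fix j :: 'n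
 let ?d = "wderiv \<Omega> [j] w"
 have i: "integrable \<mu> (\<lambda>x. v x * ?d x)" "integrable \<mu> (\<lambda>x. z x * ?d x)" "integrable \<mu> (\<lambda>x. v x * z x * ?d x)"
  "integrable \<mu> (\<lambda>x. (v x)\<^sup>2 * ?d x)" "integrable \<mu> (\<lambda>x. (z x)\<^sup>2 * ?d x)"
  by (intro L2_mult_integrable H02_facts(3)[OF v] H02_facts(3)[OF z] H02_facts(5)[OF w]
   nrm_mult_le(1)[OF card v z] nrm_square_le(1)[OF card v] nrm_square_le(1)[OF card z])+
 have "ip (\<lambda>x. v x - z x) ?d = (LINT x|\<mu>. v x * ?d x - z x * ?d x)"
  unfolding ip_def by (intro Bochner_Integration.integral_cong) (auto simp: algebra_simps)
 also have "\<dots> = ip v ?d - ip z ?d" using i by (simp add: ip_def)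
 finally have 1: "ip (\<lambda>x. v x - z x) ?d = ip v ?d - ip z ?d" .
 have "ip (\<lambda>x. (v x - z x)\<^sup>2) ?d = (LINT x|\<mu>. (v x)\<^sup>2 * ?d x - 2 * (v x * z x * ?d x) + (z x)\<^sup>2 * ?d x)"
  unfolding ip_def by (intro Bochner_Integration.integral_cong) (auto simp: power2_eq_square algebra_simps)
 also have "\<dots> = ip (\<lambda>x. (v x)\<^sup>2) ?d - 2 * ip (\<lambda>x. v x * z x) ?d + ip (\<lambda>x. (z x)\<^sup>2) ?d"
  using i by (simp add: ip_def del: mult.assoc)
 finally show "ip v ?d + ip (\<lambda>x. (v x)\<^sup>2) ?d / 2 - (ip (\<lambda>x. v x - z x) ?d + ip (\<lambda>x. (v x - z x)\<^sup>2) ?d / 2)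
   = ip z ?d + ip (\<lambda>x. v x * z x) ?d - ip (\<lambda>x. (z x)\<^sup>2) ?d / 2"
  unfolding 1 by (simp add: field_simps)
qed

lemma sum_UNIV_le:
 assumes card: "CARD('n) \<le> 2" and "\<And>j. \<bar>f j\<bar> \<le> c"
 shows "\<bar>\<Sum>j\<in>(UNIV :: 'n set). f j\<bar> \<le> 2 * (c::real)"
proof -
 have "\<bar>\<Sum>j\<in>(UNIV :: 'n set). f j\<bar> \<le> real CARD('n) * c"
  by (rule order_trans[OF sum_abs]) (rule sum_bounded_above, rule assms(2))
 also have "\<dots> \<le> 2 * c" using card assms(2)[of undefined] by (intro mult_right_mono) auto
 finally show ?thesis .
qed

text \<open>Local Lipschitz continuity in the energy norm; it yields the continuity in time of the
  derivative of the discrete solution.\<close>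

lemma nlf_diff_le:
 assumes card: "CARD('n) \<le> 2" and v: "v \<in> H02 \<Omega>" and z: "z \<in> H02 \<Omega>" and w: "w \<in> H02 \<Omega>"
 shows "\<bar>nlf v w - nlf (\<lambda>x. v x - z x) w\<bar> \<le> 2 * (anrm z * (1 + 2 * anrm v + anrm z) * anrm w)"
 unfolding nlf_diff[OF card v z w]
proof (rule sum_UNIV_le[OF card])
 fix j
 show "\<bar>ip z (wderiv \<Omega> [j] w) + ip (\<lambda>x. v x * z x) (wderiv \<Omega> [j] w) - ip (\<lambda>x. (z x)\<^sup>2) (wderiv \<Omega> [j] w) / 2\<bar>
  \<le> anrm z * (1 + 2 * anrm v + anrm z) * anrm w"
  using ip_wderiv_le[OF z w, of j] ip_mult_wderiv_le[OF card v z w, of j] ip_mult_wderiv_le[OF card z z w, of j]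
  unfolding power2_eq_square by (simp add: algebra_simps abs_le_iff)
qed

text \<open>The only term of the nonlinearity that is cubic in \<open>\<vartheta>\<close> is
 \<open>\<Sum>\<^sub>j (\<vartheta>\<^sup>2, \<partial>\<^sub>j \<vartheta>) = 0\<close>; the rest is quadratic with bounded coefficients.\<close>

lemma nlf_error_le:
 assumes card: "CARD('n) \<le> 2" and u: "u \<in> H02 \<Omega>" and \<rho>: "\<rho> \<in> H02 \<Omega>" and \<theta>: "\<theta> \<in> H02 \<Omega>"
  and orth: "aip \<rho> \<theta> = 0" and Ub: "anrm u \<le> Ub" and P: "anrm \<rho> \<le> P"
 defines "e \<equiv> (\<lambda>x. \<rho> x + \<theta> x)"
 shows "\<bar>nlf u \<theta> - nlf (\<lambda>x. u x - e x) \<theta>\<bar> \<le> 2 * ((1 + 2 * Ub + 3 * P) * (aip \<rho> \<rho> + aip \<theta> \<theta>))"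
  and "\<bar>gip e \<theta>\<bar> \<le> 2 * (aip \<rho> \<rho> + aip \<theta> \<theta>)"
proof -
 let ?E = "aip \<rho> \<rho> + aip \<theta> \<theta>"
 have e: "e \<in> H02 \<Omega>" using H02_lincomb[OF \<rho> \<theta>, of 1 1] by (simp add: e_def)
 have ee: "aip e e = ?E" using aip_expand[OF H02_facts(1)[OF \<rho>] H02_facts(1)[OF \<theta>], of 1 1] orth by (simp add: e_def)
 have q: "anrm \<theta> \<le> anrm e" unfolding ee by (simp add: aip_nonneg)
 have eq: "anrm e * anrm \<theta> \<le> ?E"
 proof -
  have "anrm e * anrm \<theta> \<le> anrm e * anrm e" by (intro mult_left_mono q) (simp add: aip_nonneg)
  then show ?thesis by (simp add: aip_nonneg ee)
 qed
 have Ub0: "Ub \<ge> 0" using Ub aip_nonneg[of u] real_sqrt_ge_zero order_trans by blast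
 have P0: "P \<ge> 0" using P aip_nonneg[of \<rho>] real_sqrt_ge_zero order_trans by blast
 have pq: "anrm \<rho> * anrm \<theta> \<le> ?E"
  using sum_squares_bound[of "anrm \<rho>" "anrm \<theta>"] aip_nonneg[of \<rho>] aip_nonneg[of \<theta>] by simp
 have "2 * anrm e * anrm \<theta> \<le> 2 * ?E" using eq by simp
 then show "\<bar>gip e \<theta>\<bar> \<le> 2 * ?E" using gip_le[OF card e \<theta>] by linarith
 show "\<bar>nlf u \<theta> - nlf (\<lambda>x. u x - e x) \<theta>\<bar> \<le> 2 * ((1 + 2 * Ub + 3 * P) * ?E)"
  unfolding nlf_diff[OF card u e \<theta>]
 proof (rule sum_UNIV_le[OF card])
  fix j
  let ?d = "wderiv \<Omega> [j] \<theta>"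
  have 1: "\<bar>ip e ?d\<bar> \<le> ?E" using ip_wderiv_le[OF e \<theta>, of j] eq by linarith
  have 2: "\<bar>ip (\<lambda>x. u x * e x) ?d\<bar> \<le> 2 * Ub * ?E"
  proof -
   have "2 * anrm u * (anrm e * anrm \<theta>) \<le> 2 * Ub * ?E"
    using Ub Ub0 eq by (intro mult_mono) (auto simp: aip_nonneg)
   then show ?thesis using ip_mult_wderiv_le[OF card u e \<theta>, of j] by (simp add: mult.assoc)
  qed
  have i: "integrable \<mu> (\<lambda>x. \<rho> x * \<rho> x * ?d x)" "integrable \<mu> (\<lambda>x. \<rho> x * \<theta> x * ?d x)" "integrable \<mu> (\<lambda>x. \<theta> x * \<theta> x * ?d x)"
   by (intro L2_mult_integrable nrm_mult_le(1)[OF card] \<rho> \<theta> H02_facts(5))+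
  \<comment> \<open>In the case v = w = \<open>\<theta>\<close> the two terms of the identity
    coincide up to the factor 2, so three times the cubic term is zero.\<close>
  have "ip (\<lambda>x. (\<theta> x)\<^sup>2) ?d + 2 * ip ?d (\<lambda>x. \<theta> x * \<theta> x) = 0"
   by (rule cubic_ibp[OF card H02_facts(4)[OF \<theta>] H02_facts(4)[OF \<theta>]])
  then have c: "ip (\<lambda>x. \<theta> x * \<theta> x) ?d = 0" unfolding ip_commute[of ?d] power2_eq_square by simp
  have "ip (\<lambda>x. (e x)\<^sup>2) ?d = (LINT x|\<mu>. \<rho> x * \<rho> x * ?d x + 2 * (\<rho> x * \<theta> x * ?d x) + \<theta> x * \<theta> x * ?d x)"
   unfolding ip_def e_def by (intro Bochner_Integration.integral_cong) (auto simp: power2_eq_square algebra_simps)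
  also have "\<dots> = ip (\<lambda>x. \<rho> x * \<rho> x) ?d + 2 * ip (\<lambda>x. \<rho> x * \<theta> x) ?d" using i c by (simp add: ip_def)
  finally have sq: "ip (\<lambda>x. (e x)\<^sup>2) ?d = ip (\<lambda>x. \<rho> x * \<rho> x) ?d + 2 * ip (\<lambda>x. \<rho> x * \<theta> x) ?d" .
  have 3: "\<bar>ip (\<lambda>x. \<rho> x * \<rho> x) ?d\<bar> \<le> 2 * (P * ?E)"
  proof -
   have "anrm \<rho> * (anrm \<rho> * anrm \<theta>) \<le> P * ?E" using P P0 pq by (intro mult_mono) (auto simp: aip_nonneg)
   then show ?thesis using ip_mult_wderiv_le[OF card \<rho> \<rho> \<theta>, of j] unfolding mult.assoc by linarith
  qed
  have 4: "\<bar>ip (\<lambda>x. \<rho> x * \<theta> x) ?d\<bar> \<le> 2 * (P * ?E)"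
  proof -
   have "anrm \<theta> * anrm \<theta> \<le> ?E" using aip_nonneg[of \<rho>] by (simp add: aip_nonneg)
   then have "anrm \<rho> * (anrm \<theta> * anrm \<theta>) \<le> P * ?E" using P P0 by (intro mult_mono) (auto simp: aip_nonneg)
   then show ?thesis using ip_mult_wderiv_le[OF card \<rho> \<theta> \<theta>, of j] by (simp add: mult.assoc)
  qed
  \<comment> \<open>Here c and d stand for the parts \<open>\<rho> * \<rho>\<close> and
    \<open>\<rho> * \<theta>\<close> of the squared error, and Y for P times the energy. Half of c
    contributes Y and d contributes 2 Y, which is the 3 P in the constant.\<close>
  have combine: "\<bar>a + b - (c + 2 * d) / 2\<bar> \<le> E + X + 3 * Y"
   if "\<bar>a\<bar> \<le> E" "\<bar>b\<bar> \<le> X" "\<bar>c\<bar> \<le> 2 * Y" "\<bar>d\<bar> \<le> 2 * Y" for a b c d E X Y :: real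
   using that unfolding abs_le_iff by argo
  have "(1 + 2 * Ub + 3 * P) * ?E = ?E + 2 * Ub * ?E + 3 * (P * ?E)" by (simp only: distrib_right mult.assoc mult_1)
  then show "\<bar>ip e ?d + ip (\<lambda>x. u x * e x) ?d - ip (\<lambda>x. (e x)\<^sup>2) ?d / 2\<bar> \<le> (1 + 2 * Ub + 3 * P) * ?E"
   unfolding sq by (simp only:) (rule combine[OF 1 2 3 4])
 qed
qed

end

section \<open>The Galerkin error at almost every time\<close>

locale galerkin = cut_domain \<Omega> HP + evolution \<Omega> T r u ut u0
 for \<Omega> :: "(real^'n::finite) set" and HP and T r :: real
  and u ut :: "real \<Rightarrow> real^'n \<Rightarrow> real" and u0 :: "real^'n \<Rightarrow> real" +
 fixes \<alpha> Ub :: real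
 assumes card: "CARD('n) \<le> 2" and alpha: "\<alpha> > 0"
  and u_H02: "AE t in \<tau>. u t \<in> H02 \<Omega>"
  and weak: "AE t in \<tau>. \<forall>v\<in>H02 \<Omega>. aip (ut t) v + \<alpha> * gip (u t) v = nlf (u t) v"
  and u_bound: "AE t in \<tau>. anrm (u t) \<le> Ub"
begin

text \<open>Twice the constant of the energy inequality: 2 \<alpha> comes from the gradient term,
  the rest from \<open>nlf_error_le\<close>, and the outer factor 2 from the derivative of a
  square.\<close>

definition growth :: "real \<Rightarrow> real" where
 "growth P = 2 * (2 * \<alpha> + 2 * (1 + 2 * Ub + 3 * P))"

end

text \<open>One mesh is fixed. \<open>\<kappa>\<close> bounds the best approximation error on it and
  shrinks with h; P bounds \<open>\<kappa>\<close> on all meshes at once, so constants built from P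
  do not depend on h.\<close>

locale semidiscrete = galerkin \<Omega> HP T r u ut u0 \<alpha> Ub
 for \<Omega> :: "(real^'n::finite) set" and HP and T r :: real
  and u ut :: "real \<Rightarrow> real^'n \<Rightarrow> real" and u0 :: "real^'n \<Rightarrow> real" and \<alpha> Ub :: real +
 fixes S :: "(real^'n \<Rightarrow> real) set" and uh uht :: "real \<Rightarrow> real^'n \<Rightarrow> real" and u0h :: "real^'n \<Rightarrow> real"
  and \<kappa> P :: real
 assumes sub: "finite_dim_subspace S (H02 \<Omega>)"
  and uh_S: "\<And>t. t \<in> {0..T} \<Longrightarrow> uh t \<in> S" and uht_S: "\<And>t. t \<in> {0..T} \<Longrightarrow> uht t \<in> S"
  and uh_deriv: "\<And>t. t \<in> {0..T} \<Longrightarrow>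
   ((\<lambda>s. norm2 \<Omega> (\<lambda>x. (uh s x - uh t x) / (s - t) - uht t x)) \<longlongrightarrow> 0) (at t within {0..T})"
  and uh_eq: "\<And>t v. t \<in> {0..T} \<Longrightarrow> v \<in> S \<Longrightarrow> aip (uht t) v + \<alpha> * gip (uh t) v = nlf (uh t) v"
  and u0h_S: "u0h \<in> S" and uh_init: "\<And>v. v \<in> S \<Longrightarrow> ip (uh 0) v = ip u0h v"
  and approx: "AE t in \<tau>. (INF \<phi>\<in>S. norm2 \<Omega> (\<lambda>x. u t x - \<phi> x)) \<le> \<kappa>" and kappa: "\<kappa> \<le> P"
begin

lemma S_H02: "S \<subseteq> H02 \<Omega>"
 using sub by (simp add: finite_dim_subspace_def)

lemma S_W: "v \<in> S \<Longrightarrow> v \<in> W 2"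
 using S_H02 H02_facts(1) by blast

lemma S_diff: "v \<in> S \<Longrightarrow> w \<in> S \<Longrightarrow> (\<lambda>x. v x - w x) \<in> S"
 using finite_dim_subspace_lincomb[OF sub, of v w 1 "-1"] by simp

lemma W_diff: "v \<in> W 2 \<Longrightarrow> w \<in> W 2 \<Longrightarrow> (\<lambda>x. v x - w x) \<in> W 2"
 using W_lincomb[of v 2 w 1 "-1"] by simp

lemma aip_diff: "v \<in> W 2 \<Longrightarrow> w \<in> W 2 \<Longrightarrow> z \<in> W 2 \<Longrightarrow> aip (\<lambda>x. v x - w x) z = aip v z - aip w z"
 using aip_lincomb[of v w z 1 "-1"] by simp

lemma uh_tendsto:
 assumes t: "t \<in> {0..T}"
 shows "((\<lambda>s. norm2 \<Omega> (\<lambda>x. uh s x - uh t x)) \<longlongrightarrow> 0) (at t within {0..T})"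
proof (rule Lim_null_comparison)
 let ?q = "\<lambda>s x. (uh s x - uh t x) / (s - t) - uht t x"
 have "((\<lambda>s. \<bar>s - t\<bar> * norm2 \<Omega> (?q s) + \<bar>s - t\<bar> * norm2 \<Omega> (uht t)) \<longlongrightarrow> \<bar>t - t\<bar> * 0 + \<bar>t - t\<bar> * norm2 \<Omega> (uht t)) (at t within {0..T})"
  by (intro tendsto_intros uh_deriv[OF t])
 then show "((\<lambda>s. \<bar>s - t\<bar> * norm2 \<Omega> (?q s) + \<bar>s - t\<bar> * norm2 \<Omega> (uht t)) \<longlongrightarrow> 0) (at t within {0..T})" by simp
 show "\<forall>\<^sub>F s in at t within {0..T}. norm (norm2 \<Omega> (\<lambda>x. uh s x - uh t x)) \<le> \<bar>s - t\<bar> * norm2 \<Omega> (?q s) + \<bar>s - t\<bar> * norm2 \<Omega> (uht t)"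
 proof (rule eventually_at_filter[THEN iffD2], intro always_eventually allI impI)
  fix s assume s: "s \<noteq> t" "s \<in> {0..T}"
  have d: "(\<lambda>x. uh s x - uh t x) \<in> W 2" by (intro S_W S_diff uh_S s t)
  have q: "?q s \<in> W 2" using W_lincomb[OF d S_W[OF uht_S[OF t]], of "1 / (s - t)" "-1"] by simp
  have "(\<lambda>x. uh s x - uh t x) = (\<lambda>x. (s - t) * ?q s x + (s - t) * uht t x)" using s by (auto simp: field_simps)
  then show "norm (norm2 \<Omega> (\<lambda>x. uh s x - uh t x)) \<le> \<bar>s - t\<bar> * norm2 \<Omega> (?q s) + \<bar>s - t\<bar> * norm2 \<Omega> (uht t)"
   using norm2_triangle[OF q S_W[OF uht_S[OF t]], of "s - t" "s - t"] by (simp add: norm2_nonneg)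
 qed
qed

lemma aip_uh_deriv:
 assumes t: "t \<in> {0..T}" and w: "w \<in> W 2"
 shows "((\<lambda>s. aip (uh s) w) has_vector_derivative aip (uht t) w) (at t within {0..T})"
 unfolding has_real_derivative_iff_has_vector_derivative[symmetric] has_field_derivative_iff
proof (rule LIM_zero_cancel, rule Lim_null_comparison)
 let ?q = "\<lambda>s x. (uh s x - uh t x) / (s - t) - uht t x"
 show "((\<lambda>s. norm2 \<Omega> (?q s) * anrm w) \<longlongrightarrow> 0) (at t within {0..T})"
  by (rule tendsto_mult_left_zero[OF uh_deriv[OF t]])
 show "\<forall>\<^sub>F s in at t within {0..T}. norm ((aip (uh s) w - aip (uh t) w) / (s - t) - aip (uht t) w) \<le> norm2 \<Omega> (?q s) * anrm w"
 proof (rule eventually_at_filter[THEN iffD2], intro always_eventually allI impI)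
  fix s assume s: "s \<noteq> t" "s \<in> {0..T}"
  have W: "uh s \<in> W 2" "uh t \<in> W 2" "uht t \<in> W 2" by (intro S_W uh_S uht_S s t)+
  have d: "(\<lambda>x. uh s x - uh t x) \<in> W 2" by (intro W_diff W)
  have q: "?q s \<in> W 2" using W_lincomb[OF d W(3), of "1 / (s - t)" "-1"] by simp
  have "aip (?q s) w = (aip (uh s) w - aip (uh t) w) / (s - t) - aip (uht t) w"
   using aip_lincomb[OF d W(3) w, of "1 / (s - t)" "-1"] aip_diff[OF W(1,2) w] by simp
  then have "norm ((aip (uh s) w - aip (uh t) w) / (s - t) - aip (uht t) w) \<le> anrm (?q s) * anrm w"
   using aip_CS[OF q w] by simp
  also have "\<dots> \<le> norm2 \<Omega> (?q s) * anrm w" by (intro mult_right_mono aip_le_norm2 q) (simp add: aip_nonneg)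
  finally show "norm ((aip (uh s) w - aip (uh t) w) / (s - t) - aip (uht t) w) \<le> norm2 \<Omega> (?q s) * anrm w" .
 qed
qed

text \<open>The problem only asks for a derivative at each time. Its continuity is read off from the
  equation, whose remaining terms are locally Lipschitz in the energy norm.\<close>

lemma uht_continuous:
 assumes w: "w \<in> S"
 shows "continuous_on {0..T} (\<lambda>t. aip (uht t) w)"
proof -
 have wH: "w \<in> H02 \<Omega>" using w S_H02 by blast
 have "continuous_on {0..T} (\<lambda>t. nlf (uh t) w - \<alpha> * gip (uh t) w)"
  unfolding continuous_on_def
 proof
  fix t assume t: "t \<in> {0..T}"
  let ?\<delta> = "\<lambda>s. norm2 \<Omega> (\<lambda>x. uh s x - uh t x)"
  let ?b = "\<lambda>s. 2 * (?\<delta> s * (1 + 2 * anrm (uh t) + ?\<delta> s) * anrm w) + \<alpha> * (2 * ?\<delta> s * anrm w)"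
  have "((\<lambda>s. (nlf (uh s) w - \<alpha> * gip (uh s) w) - (nlf (uh t) w - \<alpha> * gip (uh t) w)) \<longlongrightarrow> 0) (at t within {0..T})"
  proof (rule Lim_null_comparison)
   have "(?b \<longlongrightarrow> 2 * (0 * (1 + 2 * anrm (uh t) + 0) * anrm w) + \<alpha> * (2 * 0 * anrm w)) (at t within {0..T})"
    by (intro tendsto_intros uh_tendsto[OF t])
   then show "(?b \<longlongrightarrow> 0) (at t within {0..T})" by simp
   show "\<forall>\<^sub>F s in at t within {0..T}. norm ((nlf (uh s) w - \<alpha> * gip (uh s) w) - (nlf (uh t) w - \<alpha> * gip (uh t) w)) \<le> ?b s"
   proof (rule eventually_at_filter[THEN iffD2], intro always_eventually allI impI)
    fix s assume s: "s \<noteq> t" "s \<in> {0..T}"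
    have H: "uh s \<in> H02 \<Omega>" "uh t \<in> H02 \<Omega>" using uh_S s t S_H02 by blast+
    let ?z = "\<lambda>x. uh t x - uh s x"
    have z: "?z \<in> H02 \<Omega>" using S_diff[OF uh_S[OF t] uh_S[OF s(2)]] S_H02 by blast
    have az: "anrm ?z \<le> ?\<delta> s"
     using aip_le_norm2[OF H02_facts(1)[OF z]] norm2_minus_commute[OF H02_facts(1)[OF H(1)] H02_facts(1)[OF H(2)]] by simp
    have "\<bar>nlf (uh t) w - nlf (uh s) w\<bar> \<le> 2 * (anrm ?z * (1 + 2 * anrm (uh t) + anrm ?z) * anrm w)"
     using nlf_diff_le[OF card H(2) z wH] by simp
    also have "\<dots> \<le> 2 * (?\<delta> s * (1 + 2 * anrm (uh t) + ?\<delta> s) * anrm w)"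
     using az by (intro mult_left_mono mult_right_mono mult_mono add_mono) (auto simp: aip_nonneg norm2_nonneg)
    finally have 1: "\<bar>nlf (uh t) w - nlf (uh s) w\<bar> \<le> 2 * (?\<delta> s * (1 + 2 * anrm (uh t) + ?\<delta> s) * anrm w)" .
    have "\<bar>gip (uh t) w - gip (uh s) w\<bar> \<le> 2 * anrm ?z * anrm w"
     using gip_lincomb[OF H02_facts(2)[OF H(2)] H02_facts(2)[OF H(1)] H02_facts(2)[OF wH], of 1 "-1"] gip_le[OF card z wH] by simp
    also have "\<dots> \<le> 2 * ?\<delta> s * anrm w" using az by (intro mult_right_mono) (auto simp: aip_nonneg)
    finally have "\<alpha> * \<bar>gip (uh t) w - gip (uh s) w\<bar> \<le> \<alpha> * (2 * ?\<delta> s * anrm w)" using alpha by (intro mult_left_mono) auto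
    then have 2: "\<bar>\<alpha> * gip (uh t) w - \<alpha> * gip (uh s) w\<bar> \<le> \<alpha> * (2 * ?\<delta> s * anrm w)"
     using alpha by (simp add: abs_mult flip: right_diff_distrib)
    show "norm ((nlf (uh s) w - \<alpha> * gip (uh s) w) - (nlf (uh t) w - \<alpha> * gip (uh t) w)) \<le> ?b s"
     using 1 2 by (simp only: real_norm_def)
   qed
  qed
  then show "((\<lambda>t. nlf (uh t) w - \<alpha> * gip (uh t) w) \<longlongrightarrow> nlf (uh t) w - \<alpha> * gip (uh t) w) (at t within {0..T})"
   by (rule LIM_zero_cancel)
 qed
 moreover have "nlf (uh t) w - \<alpha> * gip (uh t) w = aip (uht t) w" if "t \<in> {0..T}" for t
  using uh_eq[OF that w] by simp
 ultimately show ?thesis by (subst continuous_on_cong[OF refl, of _ _ "\<lambda>t. nlf (uh t) w - \<alpha> * gip (uh t) w"]) auto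
qed

text \<open>The initial condition is tested with the difference of the two functions, which lies in
  S; they therefore agree almost everywhere, and the form does not see null sets.\<close>

lemma aip_uh_0:
 assumes w: "w \<in> S"
 shows "aip (uh 0) w = aip u0h w"
proof -
 have uh0: "uh 0 \<in> S" using uh_S T_pos by simp
 let ?z = "\<lambda>x. uh 0 x - u0h x"
 have z: "?z \<in> S" by (rule S_diff[OF uh0 u0h_S])
 have L: "uh 0 \<in> L2 \<mu>" "u0h \<in> L2 \<mu>" "?z \<in> L2 \<mu>" using uh0 u0h_S z S_W W_L2 by blast+
 have "ip ?z ?z = 0" using ip_lincomb[OF L, of 1 "-1"] uh_init[OF z] by simp
 then have "nrm \<mu> ?z = 0" by (simp add: ip_self)
 then have "(LINT x|\<mu>. (?z x)\<^sup>2) = 0" by (simp add: nrm_power2[symmetric])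
 then have ae: "AE x in \<mu>. ?z x = 0"
  using integral_nonneg_eq_0_iff_AE[OF L2_integrable_power2[OF L(3)]] by simp
 have "aip ?z w = 0" by (rule aip_zero[OF S_W[OF z] S_W[OF w] ae])
 then show ?thesis using aip_diff[OF S_W[OF uh0] S_W[OF u0h_S] S_W[OF w]] by simp
qed

lemma error_H02: "u t \<in> H02 \<Omega> \<Longrightarrow> t \<in> {0..T} \<Longrightarrow> (\<lambda>x. u t x - uh t x) \<in> H02 \<Omega>"
 using H02_lincomb[of "u t" "uh t" 1 "-1"] uh_S[of t] S_H02 by auto

text \<open>Worked out in the Fourier coefficients of the error with respect to an orthonormal basis
  of S, to which \<open>prim_square\<close> applies one by one. The first summand bounds the energy
  of \<open>\<rho>\<close>, the second that of \<open>\<theta>\<close>.\<close>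

lemma error_estimate:
 "AE t in \<tau>. aip (\<lambda>x. u t x - uh t x) (\<lambda>x. u t x - uh t x) \<le> \<kappa>\<^sup>2 +
  2 * (aip (\<lambda>x. u0 x - u0h x) (\<lambda>x. u0 x - u0h x) + growth P * \<kappa>\<^sup>2 * (LINT s|\<tau>. 1)) * exp (2 * growth P * T)"
proof -
 have HW: "H02 \<Omega> \<subseteq> W 2" using H02_facts(1) by blast
 obtain n b where on: "orthonormal n b" and bS: "\<forall>i<n. b i \<in> S"
  and Pv: "\<forall>v\<in>S. \<forall>w\<in>W 2. aip v w = (\<Sum>i<n. aip v (b i) * aip (b i) w)"
  using subspace_basis[OF sub HW] by (elim exE conjE)
 have bS': "b i \<in> S" and bW: "b i \<in> W 2" if "i < n" for i using bS that S_W by auto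
 define e where "e t x = u t x - uh t x" for t x
 define \<theta> where "\<theta> t = aproj n b (e t)" for t
 define \<rho> where "\<rho> t x = e t x - \<theta> t x" for t x
 define y where "y t = (\<Sum>i<n. (aip (e t) (b i))\<^sup>2)" for t
 \<comment> \<open>Collects all properties that hold almost everywhere, so that the steps below can
   argue at one fixed time.\<close>
 define regular where "regular t \<longleftrightarrow> t \<in> {0<..<T} \<and> u t \<in> H02 \<Omega> \<and> u t \<in> sobolev_space r \<Omega> \<and> ut t \<in> sobolev_space r \<Omega> \<and>
  (\<forall>v\<in>H02 \<Omega>. aip (ut t) v + \<alpha> * gip (u t) v = nlf (u t) v) \<and> anrm (u t) \<le> Ub \<and>
  (INF \<phi>\<in>S. norm2 \<Omega> (\<lambda>x. u t x - \<phi> x)) \<le> \<kappa>" for t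
 have "AE t in \<tau>. t \<in> {0<..<T}" by (rule AE_I2) simp
 then have AE_good: "AE t in \<tau>. regular t"
  using u_H02 u_AE ut_AE weak u_bound approx by eventually_elim (simp add: regular_def)
 have \<theta>_S: "aproj n b v \<in> S" for v
 proof -
  have "(\<lambda>x. \<Sum>i<k. aip v (b i) * b i x) \<in> S" if "k \<le> n" for k
   using that
  proof (induction k)
   case 0
   show ?case using S_diff[OF u0h_S u0h_S] by simp
  next
   case (Suc k)
   then show ?case using finite_dim_subspace_lincomb[OF sub _ bS'[of k], of "\<lambda>x. \<Sum>i<k. aip v (b i) * b i x" 1] by simp
  qed
  then show ?thesis by (simp add: aproj_def[abs_def])
 qed
 have facts: "e t \<in> H02 \<Omega>" "e t \<in> W 2" "\<theta> t \<in> S" "\<theta> t \<in> H02 \<Omega>" "\<theta> t \<in> W 2" "\<rho> t \<in> H02 \<Omega>" "\<rho> t \<in> W 2"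
  "\<And>v. v \<in> S \<Longrightarrow> aip (\<rho> t) v = 0" "aip (e t) (e t) = aip (\<rho> t) (\<rho> t) + y t" "aip (\<theta> t) (\<theta> t) = y t"
  "anrm (\<rho> t) \<le> \<kappa>"
  if g: "regular t" for t
 proof -
  have t: "t \<in> {0..T}" using g by (simp add: regular_def)
  have u: "u t \<in> H02 \<Omega>" using g by (simp add: regular_def)
  show e: "e t \<in> H02 \<Omega>" using error_H02[OF u t] by (simp add: e_def[abs_def])
  then show eW: "e t \<in> W 2" by (rule H02_facts(1))
  show tS: "\<theta> t \<in> S" unfolding \<theta>_def by (rule \<theta>_S)
  then show tH: "\<theta> t \<in> H02 \<Omega>" using S_H02 by blast
  then show tW: "\<theta> t \<in> W 2" by (rule H02_facts(1))
  show rH: "\<rho> t \<in> H02 \<Omega>" using H02_lincomb[OF e tH, of 1 "-1"] by (simp add: \<rho>_def[abs_def])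
  then show rW: "\<rho> t \<in> W 2" by (rule H02_facts(1))
  have rb: "aip (b i) (\<rho> t) = 0" if "i < n" for i
   using aip_residual_basis[OF on eW that] aip_commute[of "b i" "\<rho> t"] by (simp add: \<rho>_def[abs_def] \<theta>_def)
  show orth: "aip (\<rho> t) v = 0" if "v \<in> S" for v
   using Pv that rW rb by (simp add: aip_commute[of "\<rho> t" v])
  show py: "aip (e t) (e t) = aip (\<rho> t) (\<rho> t) + y t"
   using aip_pythagoras[OF on eW] by (simp add: y_def \<rho>_def[abs_def] \<theta>_def)
  have "(\<lambda>x. 1 * \<rho> t x + 1 * \<theta> t x) = e t" by (auto simp: \<rho>_def)
  then show "aip (\<theta> t) (\<theta> t) = y t"
   using aip_expand[OF rW tW, of 1 1] orth[OF tS] py by simp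
  \<comment> \<open>The function \<open>u t - \<phi>\<close> is \<open>\<rho> t\<close> plus an
    element of S, so the Pythagorean identity shows that its energy is at least that of
    \<open>\<rho> t\<close>.\<close>
  have le: "anrm (\<rho> t) \<le> norm2 \<Omega> (\<lambda>x. u t x - \<phi> x)" if \<phi>: "\<phi> \<in> S" for \<phi>
  proof -
   let ?z = "\<lambda>x. \<theta> t x + (uh t x - \<phi> x)"
   have zS: "?z \<in> S" using finite_dim_subspace_lincomb[OF sub tS S_diff[OF uh_S[OF t] \<phi>], of 1 1] by simp
   have eq: "(\<lambda>x. 1 * \<rho> t x + 1 * ?z x) = (\<lambda>x. u t x - \<phi> x)" by (auto simp: \<rho>_def e_def)
   have "aip (\<lambda>x. u t x - \<phi> x) (\<lambda>x. u t x - \<phi> x) = aip (\<rho> t) (\<rho> t) + aip ?z ?z"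
    using aip_expand[OF rW S_W[OF zS], of 1 1] orth[OF zS] unfolding eq by simp
   then have "anrm (\<rho> t) \<le> anrm (\<lambda>x. u t x - \<phi> x)" using aip_nonneg[of ?z] by simp
   also have "\<dots> \<le> norm2 \<Omega> (\<lambda>x. u t x - \<phi> x)" by (intro aip_le_norm2 W_diff S_W \<phi> H02_facts(1)[OF u])
   finally show ?thesis .
  qed
  have "anrm (\<rho> t) \<le> (INF \<phi>\<in>S. norm2 \<Omega> (\<lambda>x. u t x - \<phi> x))" by (rule cINF_greatest) (use u0h_S le in auto)
  then show "anrm (\<rho> t) \<le> \<kappa>" using g by (simp add: regular_def)
 qed
 define g where "g i s = aip (ut s) (b i) - aip (uht s) (b i)" for i s
 have FTC: "integrable \<tau> (\<lambda>s. aip (uht s) (b i))"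
  "t \<in> {0<..<T} \<Longrightarrow> aip (uh t) (b i) = aip (uh 0) (b i) + prim (\<lambda>s. aip (uht s) (b i)) t" if "i < n" for i t
  using prim_FTC[OF uht_continuous[OF bS'[OF that]] aip_uh_deriv[OF _ bW[OF that]]] by blast+
 have gi: "integrable \<tau> (g i)" if "i < n" for i
  unfolding g_def using aip_ut_integrable(1)[OF bW[OF that]] FTC(1)[OF that] by (rule Bochner_Integration.integrable_diff)
 define c where "c i = aip u0 (b i) - aip u0h (b i)" for i
 \<comment> \<open>Equals y at regular times, but the primitives define it at all times, as required
   by the supremum over (0, T) in Gronwall's lemma.\<close>
 define Y where "Y t = (\<Sum>i<n. (c i + prim (g i) t)\<^sup>2)" for t
 have \<theta>_eq: "aip (e t) (b i) = c i + prim (g i) t" if gt: "regular t" and i: "i < n" for t i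
 proof -
  have t: "t \<in> {0<..<T}" "u t \<in> sobolev_space r \<Omega>" "uh t \<in> W 2" using gt S_W[OF uh_S[of t]] by (auto simp: regular_def)
  have "aip (e t) (b i) = aip (u t) (b i) - aip (uh t) (b i)"
   unfolding e_def[abs_def] by (rule aip_diff[OF sob_W2[OF t(2)] t(3) bW[OF i]])
  also have "\<dots> = c i + (prim (\<lambda>s. aip (ut s) (b i)) t - prim (\<lambda>s. aip (uht s) (b i)) t)"
   using aip_ut_integrable(2)[OF bW[OF i] t(2,1)] FTC(2)[OF i t(1)] aip_uh_0[OF bS'[OF i]] by (simp add: c_def)
  also have "prim (\<lambda>s. aip (ut s) (b i)) t - prim (\<lambda>s. aip (uht s) (b i)) t = prim (g i) t"
   unfolding g_def by (rule prim_diff[OF aip_ut_integrable(1)[OF bW[OF i]] FTC(1)[OF i]])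
  finally show ?thesis .
 qed
 have yY: "y t = Y t" if "regular t" for t unfolding y_def Y_def using \<theta>_eq[OF that] by (intro sum.cong) auto
 define K where "K = 2 * \<alpha> + 2 * (1 + 2 * Ub + 3 * P)"
 \<comment> \<open>The time interval has positive measure, so a regular time exists; from it one
   reads off that \<open>Ub\<close> and \<open>\<kappa>\<close> are nonnegative.\<close>
 have AE_ex: "\<exists>t. regular t"
 proof -
  have "emeasure \<tau> (space \<tau>) \<noteq> 0" using T_pos by (simp add: emeasure_restrict_space)
  then have "ae_filter \<tau> \<noteq> bot" by (simp add: ae_filter_eq_bot_iff)
  then show ?thesis using eventually_happens[OF AE_good] by blast
 qed
 then obtain t0 where t0: "regular t0" ..
 have Ub0: "Ub \<ge> 0" using t0 real_sqrt_ge_zero[OF aip_nonneg[of "u t0"]] unfolding regular_def by linarith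
 have k0: "\<kappa> \<ge> 0" using facts(11)[OF t0] real_sqrt_ge_zero[OF aip_nonneg[of "\<rho> t0"]] by linarith
 have K0: "K > 0" using alpha Ub0 k0 kappa by (simp add: K_def)
 have energy: "(\<Sum>i<n. g i s * (c i + prim (g i) s)) \<le> K * (\<kappa>\<^sup>2 + Y s)" if gs: "regular s" for s
 proof -
  note f = facts[OF gs]
  have s: "s \<in> {0..T}" "u s \<in> H02 \<Omega>" "ut s \<in> W 2" "anrm (u s) \<le> Ub" using gs sob_W2 by (auto simp: regular_def)
  have uhs: "uh s \<in> S" "uht s \<in> W 2" "uh s \<in> W 1" using uh_S uht_S s(1) S_W W2_W1 by blast+
  have rP: "anrm (\<rho> s) \<le> P" using f(11) kappa by linarith
  have orth: "aip (\<rho> s) (\<theta> s) = 0" by (rule f(8)[OF f(3)])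
  have e_eq: "(\<lambda>x. \<rho> s x + \<theta> s x) = e s" by (auto simp: \<rho>_def)
  have uh_eq': "(\<lambda>x. u s x - (\<rho> s x + \<theta> s x)) = uh s" by (auto simp: \<rho>_def e_def)
  note err = nlf_error_le[OF card s(2) f(6) f(4) orth s(4) rP, unfolded e_eq uh_eq']
  \<comment> \<open>The sum of coefficients times their derivatives is the form a at the difference
    of the time derivatives and \<open>\<theta> s\<close>. Both equations apply to it because
    \<open>\<theta> s\<close> lies in S.\<close>
  have "(\<Sum>i<n. g i s * (c i + prim (g i) s)) = (\<Sum>i<n. aip (e s) (b i) * aip (b i) (ut s)) - (\<Sum>i<n. aip (e s) (b i) * aip (b i) (uht s))"
   unfolding sum_subtractf[symmetric]
  proof (intro sum.cong refl)
   fix i assume "i \<in> {..<n}"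
   then show "g i s * (c i + prim (g i) s) = aip (e s) (b i) * aip (b i) (ut s) - aip (e s) (b i) * aip (b i) (uht s)"
    using \<theta>_eq[OF gs, of i] aip_commute[of "b i" "ut s"] aip_commute[of "b i" "uht s"] by (simp add: g_def algebra_simps)
  qed
  also have "\<dots> = aip (ut s) (\<theta> s) - aip (uht s) (\<theta> s)"
   using aip_aproj[OF on s(3), of "e s"] aip_aproj[OF on uhs(2), of "e s"] aip_commute[of "\<theta> s" "ut s"] aip_commute[of "\<theta> s" "uht s"]
   by (simp add: \<theta>_def)
  also have "\<dots> = (nlf (u s) (\<theta> s) - nlf (uh s) (\<theta> s)) - \<alpha> * (gip (u s) (\<theta> s) - gip (uh s) (\<theta> s))"
  proof -
   have "aip (ut s) (\<theta> s) + \<alpha> * gip (u s) (\<theta> s) = nlf (u s) (\<theta> s)" using gs f(4) by (simp add: regular_def)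
   then show ?thesis using uh_eq[OF s(1) f(3)] by (simp add: algebra_simps)
  qed
  also have "gip (u s) (\<theta> s) - gip (uh s) (\<theta> s) = gip (e s) (\<theta> s)"
   using gip_lincomb[OF H02_facts(2)[OF s(2)] uhs(3) H02_facts(2)[OF f(4)], of 1 "-1"] by (simp add: e_def[abs_def])
  also have "(nlf (u s) (\<theta> s) - nlf (uh s) (\<theta> s)) - \<alpha> * gip (e s) (\<theta> s)
    \<le> 2 * ((1 + 2 * Ub + 3 * P) * (aip (\<rho> s) (\<rho> s) + aip (\<theta> s) (\<theta> s))) + \<alpha> * (2 * (aip (\<rho> s) (\<rho> s) + aip (\<theta> s) (\<theta> s)))"
  proof -
   have "\<alpha> * \<bar>gip (e s) (\<theta> s)\<bar> \<le> \<alpha> * (2 * (aip (\<rho> s) (\<rho> s) + aip (\<theta> s) (\<theta> s)))" using err(2) alpha by (intro mult_left_mono) auto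
   moreover have "- (\<alpha> * gip (e s) (\<theta> s)) \<le> \<alpha> * \<bar>gip (e s) (\<theta> s)\<bar>"
    using mult_left_mono[of "- gip (e s) (\<theta> s)" "\<bar>gip (e s) (\<theta> s)\<bar>" \<alpha>] alpha by simp
   ultimately show ?thesis using err(1) by linarith
  qed
  also have "\<dots> = K * (aip (\<rho> s) (\<rho> s) + Y s)" using f(10) yY[OF gs] by (simp add: K_def algebra_simps)
  also have "\<dots> \<le> K * (\<kappa>\<^sup>2 + Y s)"
  proof (intro mult_left_mono add_mono order_refl)
   have "(anrm (\<rho> s))\<^sup>2 \<le> \<kappa>\<^sup>2" by (rule power_mono[OF f(11)]) (simp add: aip_nonneg)
   then show "aip (\<rho> s) (\<rho> s) \<le> \<kappa>\<^sup>2" by (simp add: aip_nonneg)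
  qed (use K0 in simp)
  finally show ?thesis .
 qed
 have pb: "\<bar>prim (g i) t\<bar> \<le> (LINT s|\<tau>. \<bar>g i s\<bar>)" if "i < n" for i t
  by (rule prim_bound) (use gi[OF that] in auto)
 \<comment> \<open>A crude bound that depends on the mesh. It makes Y integrable and the supremum in
   Gronwall's lemma finite; the final constant does not involve it.\<close>
 have Y_bound: "Y t \<le> (\<Sum>i<n. (\<bar>c i\<bar> + (LINT s|\<tau>. \<bar>g i s\<bar>))\<^sup>2)" for t
  unfolding Y_def
 proof (rule sum_mono)
  fix i assume "i \<in> {..<n}"
  then have "\<bar>c i + prim (g i) t\<bar> \<le> \<bar>c i\<bar> + (LINT s|\<tau>. \<bar>g i s\<bar>)" using pb[of i t] by simp
  then have "\<bar>c i + prim (g i) t\<bar>\<^sup>2 \<le> (\<bar>c i\<bar> + (LINT s|\<tau>. \<bar>g i s\<bar>))\<^sup>2" by (rule power_mono) simp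
  then show "(c i + prim (g i) t)\<^sup>2 \<le> (\<bar>c i\<bar> + (LINT s|\<tau>. \<bar>g i s\<bar>))\<^sup>2" by simp
 qed
 have Y0: "Y t \<ge> 0" for t unfolding Y_def by (intro sum_nonneg) simp
 interpret F: finite_measure \<tau> by (rule finite_tau)
 have Yi: "integrable \<tau> Y"
 proof (rule F.integrable_const_bound)
  show "AE t in \<tau>. norm (Y t) \<le> (\<Sum>i<n. (\<bar>c i\<bar> + (LINT s|\<tau>. \<bar>g i s\<bar>))\<^sup>2)" using Y_bound Y0 by simp
  show "Y \<in> borel_measurable \<tau>" unfolding Y_def[abs_def]
   by (intro borel_measurable_sum borel_measurable_power borel_measurable_add borel_measurable_const prim_measurable gi) simp
 qed
 define A where "A = aip (\<lambda>x. u0 x - u0h x) (\<lambda>x. u0 x - u0h x) + growth P * \<kappa>\<^sup>2 * (LINT s|\<tau>. 1)"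
 have grow: "growth P = 2 * K" by (simp add: growth_def K_def)
 have V0: "(LINT s|\<tau>. 1 :: real) \<ge> 0" by simp
 \<comment> \<open>Bessel's inequality for the initial error, whose Fourier coefficients are the
   \<open>c i\<close>.\<close>
 have c_le: "(\<Sum>i<n. (c i)\<^sup>2) \<le> aip (\<lambda>x. u0 x - u0h x) (\<lambda>x. u0 x - u0h x)"
 proof -
  have W0: "u0 \<in> W 2" "u0h \<in> W 2" by (rule sob_W2[OF u0_in], rule S_W[OF u0h_S])
  have "aip (\<lambda>x. u0 x - u0h x) (b i) = c i" if "i < n" for i
   unfolding c_def by (rule aip_diff[OF W0 bW[OF that]])
  then have "(\<Sum>i<n. (c i)\<^sup>2) = (\<Sum>i<n. (aip (\<lambda>x. u0 x - u0h x) (b i))\<^sup>2)" by simp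
  then show ?thesis using aip_pythagoras[OF on W_diff[OF W0]] aip_nonneg by simp
 qed
 have ineq: "Y t \<le> A + 2 * K * prim Y t" for t
 proof -
  let ?G = "\<lambda>s. \<Sum>i<n. g i s * (c i + prim (g i) s)"
  have Gi: "integrable \<tau> (\<lambda>s. g i s * (c i + prim (g i) s))" if "i < n" for i by (rule prim_square(1)[OF gi[OF that]])
  have "Y t = (\<Sum>i<n. (c i)\<^sup>2) + 2 * prim ?G t"
  proof -
   have "Y t = (\<Sum>i<n. (c i)\<^sup>2 + 2 * prim (\<lambda>s. g i s * (c i + prim (g i) s)) t)"
    unfolding Y_def by (intro sum.cong refl prim_square(2) gi) simp
   also have "\<dots> = (\<Sum>i<n. (c i)\<^sup>2) + 2 * (\<Sum>i<n. prim (\<lambda>s. g i s * (c i + prim (g i) s)) t)"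
    by (simp add: sum.distrib sum_distrib_left)
   also have "(\<Sum>i<n. prim (\<lambda>s. g i s * (c i + prim (g i) s)) t) = prim ?G t"
    by (rule prim_sum[symmetric]) (simp add: Gi)
   finally show ?thesis .
  qed
  also have "prim ?G t \<le> prim (\<lambda>s. K * (\<kappa>\<^sup>2 + Y s)) t"
  proof (rule prim_mono)
   show "AE s in \<tau>. ?G s \<le> K * (\<kappa>\<^sup>2 + Y s)" using AE_good by eventually_elim (rule energy)
   show "integrable \<tau> ?G" by (intro Bochner_Integration.integrable_sum Gi) simp
   show "integrable \<tau> (\<lambda>s. K * (\<kappa>\<^sup>2 + Y s))" using Yi by simp
  qed
  also have "\<dots> = K * prim (\<lambda>s. \<kappa>\<^sup>2 + Y s) t" by (rule prim_cmult)
  also have "prim (\<lambda>s. \<kappa>\<^sup>2 + Y s) t = prim (\<lambda>_. \<kappa>\<^sup>2) t + prim Y t"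
   unfolding prim_def using integrable_cut[OF Yi, of t] integrable_cut[OF F.integrable_const[of "\<kappa>\<^sup>2"], of t]
   by (simp add: distrib_left)
  also have "prim (\<lambda>_. \<kappa>\<^sup>2) t \<le> \<kappa>\<^sup>2 * (LINT s|\<tau>. 1)"
  proof -
   have "\<bar>prim (\<lambda>_. \<kappa>\<^sup>2) t\<bar> \<le> (LINT s|\<tau>. \<kappa>\<^sup>2 * 1)" by (rule prim_bound) auto
   also have "\<dots> = \<kappa>\<^sup>2 * (LINT s|\<tau>. 1)" by (rule integral_mult_right_zero)
   finally show ?thesis by linarith
  qed
  finally have "Y t \<le> (\<Sum>i<n. (c i)\<^sup>2) + 2 * (K * (\<kappa>\<^sup>2 * (LINT s|\<tau>. 1) + prim Y t))"
   using K0 by (simp add: mult_left_mono)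
  also have "\<dots> \<le> A + 2 * K * prim Y t" using c_le unfolding A_def grow by (simp add: algebra_simps)
  finally show ?thesis .
 qed
 have A0: "A \<ge> 0" unfolding A_def grow using K0 V0 aip_nonneg by (intro add_nonneg_nonneg mult_nonneg_nonneg) auto
 have fin: "Y t \<le> 2 * A * exp (2 * growth P * T)" if t: "t \<in> {0<..<T}" for t
 proof -
  have "Y t \<le> 2 * A * exp (2 * (2 * K) * t)"
   by (rule prim_gronwall[OF ineq Y_bound Yi A0 _ t]) (use K0 in auto)
  also have "\<dots> \<le> 2 * A * exp (2 * (2 * K) * T)" using A0 K0 t by (intro mult_left_mono) auto
  finally show ?thesis by (simp add: grow)
 qed
 show ?thesis
  using AE_good
 proof eventually_elim
  case (elim t)
  have "(anrm (\<rho> t))\<^sup>2 \<le> \<kappa>\<^sup>2" by (rule power_mono[OF facts(11)[OF elim]]) (simp add: aip_nonneg)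
  then have "aip (\<rho> t) (\<rho> t) \<le> \<kappa>\<^sup>2" by (simp add: aip_nonneg)
  moreover have "Y t \<le> 2 * A * exp (2 * growth P * T)" using elim by (intro fin) (simp add: regular_def)
  ultimately have "aip (e t) (e t) \<le> \<kappa>\<^sup>2 + 2 * A * exp (2 * growth P * T)"
   using facts(9)[OF elim] yY[OF elim] by simp
  then show ?case by (simp add: e_def[abs_def] A_def)
 qed
qed

end

section \<open>Bochner measurability and norms of the error\<close>

lemma strongly_measurable_mono:
 assumes sm: "strongly_measurable T Z N u" and Z: "Z \<subseteq> Z'"
  and N: "AE t in lebesgue_on {0<..<T}. \<forall>f\<in>Z. \<bar>N' (\<lambda>x. f x - u t x)\<bar> \<le> N (\<lambda>x. f x - u t x)"
 shows "strongly_measurable T Z' N' u"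
proof -
 obtain s where s: "\<And>k::nat. finite (range (s k)) \<and> range (s k) \<subseteq> Z \<and>
    (\<forall>f. {t \<in> {0<..<T}. s k t = f} \<in> sets lebesgue)"
  and lim: "AE t in lebesgue_on {0<..<T}. (\<lambda>k. N (\<lambda>x. s k t x - u t x)) \<longlonglongrightarrow> 0"
  using sm unfolding strongly_measurable_def by blast
 have "AE t in lebesgue_on {0<..<T}. (\<lambda>k. N' (\<lambda>x. s k t x - u t x)) \<longlonglongrightarrow> 0"
  using N lim
 proof eventually_elim
  case (elim t)
  have "s k t \<in> Z" for k using s[of k] by blast
  then have "\<forall>k. norm (N' (\<lambda>x. s k t x - u t x)) \<le> N (\<lambda>x. s k t x - u t x)" using elim(1) by simp
  then show ?case by (rule Lim_null_comparison[OF always_eventually elim(2)])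
 qed
 then show ?thesis unfolding strongly_measurable_def using s Z by (intro exI[of _ s]) blast
qed

text \<open>Rounds t down to a multiple of T / (k+1), so that sampling the discrete solution yields
  simple functions. The value 0 outside the interval keeps the sampling time in [0, T].\<close>

definition grid :: "real \<Rightarrow> nat \<Rightarrow> real \<Rightarrow> real" where
 "grid T k t = (if t \<in> {0<..<T} then T / real (Suc k) * \<lfloor>real (Suc k) * t / T\<rfloor> else 0)"

lemma grid_props:
 assumes T: "T > 0"
 shows "grid T k t \<in> {0..T}" "finite (range (grid T k))" "{t \<in> {0<..<T}. grid T k t = i} \<in> sets lebesgue"
  and "t \<in> {0<..<T} \<Longrightarrow> (\<lambda>k. grid T k t) \<longlonglongrightarrow> t"
proof -
 have bounds: "t - T / real (Suc k) \<le> grid T k t" "grid T k t \<le> t" "0 \<le> grid T k t"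
  "\<lfloor>real (Suc k) * t / T\<rfloor> \<in> {0..int (Suc k)}" if t: "t \<in> {0<..<T}" for t k
 proof -
  let ?c = "real (Suc k)" and ?n = "\<lfloor>real (Suc k) * t / T\<rfloor>"
  have c: "T / ?c > 0" using T by simp
  have eq: "T / ?c * (?c * t / T) = t" using T by simp
  have g: "grid T k t = T / ?c * ?n" using t by (simp add: grid_def)
  have "T / ?c * ?n \<le> T / ?c * (?c * t / T)" using c by (intro mult_left_mono) auto
  then show "grid T k t \<le> t" unfolding eq g .
  have "T / ?c * (?c * t / T - 1) \<le> T / ?c * ?n" using c by (intro mult_left_mono) linarith+
  then show "t - T / ?c \<le> grid T k t" unfolding right_diff_distrib eq g by simp
  have n0: "?n \<ge> 0" using T t by simp
  then show "0 \<le> grid T k t" unfolding g using T by simp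
  have "?c * t / T \<le> ?c" using T t by (simp add: divide_le_eq mult_left_mono)
  then have "?n \<le> int (Suc k)" by (simp add: floor_le_iff)
  then show "?n \<in> {0..int (Suc k)}" using n0 by simp
 qed
 show "grid T k t \<in> {0..T}"
  using bounds(2,3)[of t k] T by (cases "t \<in> {0<..<T}") (auto simp: grid_def)
 have "range (grid T k) \<subseteq> insert 0 ((\<lambda>n::int. T / real (Suc k) * n) ` {0..int (Suc k)})"
 proof
  fix x assume "x \<in> range (grid T k)"
  then obtain t where x: "x = grid T k t" by blast
  show "x \<in> insert 0 ((\<lambda>n::int. T / real (Suc k) * n) ` {0..int (Suc k)})"
  proof (cases "t \<in> {0<..<T}")
   case True
   then have "x = (\<lambda>n::int. T / real (Suc k) * n) \<lfloor>real (Suc k) * t / T\<rfloor>" by (simp add: x grid_def)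
   then show ?thesis using bounds(4)[OF True, of k] by blast
  qed (auto simp: x grid_def)
 qed
 then show "finite (range (grid T k))" by (rule finite_subset) simp
 let ?f = "\<lambda>t. T / real (Suc k) * real_of_int \<lfloor>real (Suc k) * t / T\<rfloor>"
 have "?f \<in> borel_measurable borel" by measurable
 then have "?f -` {i} \<inter> space borel \<in> sets borel" by (rule measurable_sets) simp
 then have "{0<..<T} \<inter> ?f -` {i} \<in> sets borel" by auto
 moreover have "{t \<in> {0<..<T}. grid T k t = i} = {0<..<T} \<inter> ?f -` {i}" by (auto simp: grid_def)
 ultimately show "{t \<in> {0<..<T}. grid T k t = i} \<in> sets lebesgue"
  by (simp add: sets_completionI_sets)
 assume t: "t \<in> {0<..<T}"
 show "(\<lambda>k. grid T k t) \<longlonglongrightarrow> t"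
 proof (rule tendsto_sandwich)
  show "\<forall>\<^sub>F k in sequentially. t - T * inverse (real (Suc k)) \<le> grid T k t"
   using bounds(1)[OF t] by (simp add: divide_inverse)
  show "\<forall>\<^sub>F k in sequentially. grid T k t \<le> t" using bounds(2)[OF t] by simp
  have "(\<lambda>k. t - T * inverse (real (Suc k))) \<longlonglongrightarrow> t - T * 0"
   by (intro tendsto_intros LIMSEQ_inverse_real_of_nat)
  then show "(\<lambda>k. t - T * inverse (real (Suc k))) \<longlonglongrightarrow> t" by simp
 qed simp
qed

context semidiscrete
begin

abbreviation "err \<equiv> \<lambda>t x. u t x - uh t x"

lemma norm2_uh_LIMSEQ:
 assumes t: "t \<in> {0..T}" and q: "\<And>k. q k \<in> {0..T}" "q \<longlonglongrightarrow> t"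
 shows "(\<lambda>k::nat. norm2 \<Omega> (\<lambda>x. uh (q k) x - uh t x)) \<longlonglongrightarrow> 0"
proof -
 let ?\<delta> = "\<lambda>s. norm2 \<Omega> (\<lambda>x. uh s x - uh t x)"
 have W: "uh t \<in> W 2" by (rule S_W[OF uh_S[OF t]])
 have 0: "?\<delta> t = 0" using norm2_triangle[OF W W, of 0 0] norm2_nonneg[of "\<lambda>x. 0"] by simp
 have "continuous (at t within {0..T}) ?\<delta>" unfolding continuous_within 0 by (rule uh_tendsto[OF t])
 then have "(\<lambda>k. ?\<delta> (q k)) \<longlonglongrightarrow> ?\<delta> t"
  by (rule continuous_within_tendsto_compose) (use q in auto)
 then show ?thesis unfolding 0 .
qed

text \<open>The simple functions are those of u minus the discrete solution sampled on the grid; the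
  samples converge because \<open>uh\<close> is continuous with respect to
  \<open>norm2\<close>.\<close>

lemma error_strongly_measurable:
 assumes sm: "strongly_measurable T (H02 \<Omega>) (norm2 \<Omega>) u"
 shows "strongly_measurable T (H02 \<Omega>) (norm2 \<Omega>) err"
proof -
 obtain s where s: "\<And>k::nat. finite (range (s k)) \<and> range (s k) \<subseteq> H02 \<Omega> \<and>
    (\<forall>f. {t \<in> {0<..<T}. s k t = f} \<in> sets lebesgue)"
  and lim: "AE t in \<tau>. (\<lambda>k. norm2 \<Omega> (\<lambda>x. s k t x - u t x)) \<longlonglongrightarrow> 0"
  using sm unfolding strongly_measurable_def by blast
 define q where "q = grid T"
 note q = grid_props[OF T_pos, folded q_def]
 define s' where "s' k t = (\<lambda>x. s k t x - uh (q k t) x)" for k t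
 have uhH: "uh (q k t) \<in> H02 \<Omega>" for k t using uh_S[OF q(1)] S_H02 by blast
 have sH: "s k t \<in> H02 \<Omega>" for k t using s[of k] by blast
 show ?thesis unfolding strongly_measurable_def
 proof (intro exI[of _ s'] conjI allI)
  fix k
  let ?I = "range (s k) \<times> range (q k)"
  have fin: "finite ?I" using s[of k] q(2) by simp
  have "range (s' k) \<subseteq> (\<lambda>(a, i) x. a x - uh i x) ` ?I" by (auto simp: s'_def)
  then show "finite (range (s' k))" by (rule finite_subset) (rule finite_imageI[OF fin])
  show "range (s' k) \<subseteq> H02 \<Omega>"
   using H02_lincomb[OF sH uhH, of 1 _ _ "-1"] by (auto simp: s'_def)
  fix f
  let ?A = "\<lambda>p. {t \<in> {0<..<T}. s k t = fst p} \<inter> {t \<in> {0<..<T}. q k t = snd p}"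
  \<comment> \<open>Different pairs of values may have the same difference, so a level set is a
    finite union over all pairs that produce f.\<close>
  have "{t \<in> {0<..<T}. s' k t = f} = (\<Union>p\<in>{p \<in> ?I. (\<lambda>x. fst p x - uh (snd p) x) = f}. ?A p)" (is "?L = ?R")
  proof
   show "?L \<subseteq> ?R"
   proof
    fix t assume t: "t \<in> ?L"
    then have "(s k t, q k t) \<in> {p \<in> ?I. (\<lambda>x. fst p x - uh (snd p) x) = f}" by (simp add: s'_def)
    moreover have "t \<in> ?A (s k t, q k t)" using t by simp
    ultimately show "t \<in> ?R" by (rule UN_I)
   qed
   show "?R \<subseteq> ?L" by (auto simp: s'_def)
  qed
  also have "\<dots> \<in> sets lebesgue"
   using fin s[of k] q(3) by (intro sets.finite_UN sets.Int) auto
  finally show "{t \<in> {0<..<T}. s' k t = f} \<in> sets lebesgue" .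
 next
  have "AE t in \<tau>. t \<in> {0<..<T}" by (rule AE_I2) simp
  then show "AE t in \<tau>. (\<lambda>k. norm2 \<Omega> (\<lambda>x. s' k t x - (u t x - uh t x))) \<longlonglongrightarrow> 0"
   using lim u_H02
  proof eventually_elim
   case (elim t)
   have t: "t \<in> {0..T}" using elim by simp
   have "(\<lambda>k. norm2 \<Omega> (\<lambda>x. s k t x - u t x) + norm2 \<Omega> (\<lambda>x. uh (q k t) x - uh t x)) \<longlonglongrightarrow> 0 + 0"
    by (intro tendsto_add elim(2) norm2_uh_LIMSEQ[OF t] q elim(1))
   then have l: "(\<lambda>k. norm2 \<Omega> (\<lambda>x. s k t x - u t x) + norm2 \<Omega> (\<lambda>x. uh (q k t) x - uh t x)) \<longlonglongrightarrow> 0" by simp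
   have "norm (norm2 \<Omega> (\<lambda>x. s' k t x - (u t x - uh t x))) \<le> norm2 \<Omega> (\<lambda>x. s k t x - u t x) + norm2 \<Omega> (\<lambda>x. uh (q k t) x - uh t x)" for k
   proof -
    have W: "(\<lambda>x. s k t x - u t x) \<in> W 2" "(\<lambda>x. uh (q k t) x - uh t x) \<in> W 2"
     by (intro W_diff H02_facts(1) sH elim(3) uhH S_W uh_S t)+
    have eq: "(\<lambda>x. 1 * (s k t x - u t x) + (- 1) * (uh (q k t) x - uh t x)) = (\<lambda>x. s' k t x - (u t x - uh t x))"
     by (auto simp: s'_def)
    show ?thesis using norm2_triangle[OF W, of 1 "-1"] unfolding eq by (simp add: norm2_nonneg)
   qed
   then show ?case by (intro Lim_null_comparison[OF always_eventually l] allI)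
  qed
 qed
qed

text \<open>On H_0^2 the square of \<open>norm2\<close> is the energy plus the gradient term, hence
  at most 2 B. This bounds the essential supremum, and integrating it over the time interval bounds
  the second norm.\<close>

lemma error_bochner:
 assumes sm: "strongly_measurable T (H02 \<Omega>) (norm2 \<Omega>) u" and bd: "AE t in \<tau>. aip (err t) (err t) \<le> B"
 shows "err \<in> bochner_Linf T (H02 \<Omega>) (norm2 \<Omega>)" "err \<in> bochner_L2 T (H01 \<Omega>) (norm1 \<Omega>)"
  and "(bochner_Linf_norm T (norm2 \<Omega>) err)\<^sup>2 + (bochner_L2_norm T (norm1 \<Omega>) err)\<^sup>2 \<le> 2 * B * (1 + (LINT s|\<tau>. 1))"
proof -
 interpret F: finite_measure \<tau> by (rule finite_tau)
 have "AE t in \<tau>. t \<in> {0<..<T}" by (rule AE_I2) simp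
 then have eH: "AE t in \<tau>. err t \<in> H02 \<Omega>"
  using u_H02 by eventually_elim (rule error_H02; simp)
 then have eH1: "AE t in \<tau>. err t \<in> H01 \<Omega>" by eventually_elim (use H02_subset_H01 in blast)
 have b: "AE t in \<tau>. norm1 \<Omega> (err t) \<le> norm2 \<Omega> (err t) \<and> norm2 \<Omega> (err t) \<le> sqrt (2 * B)"
  using eH bd
 proof eventually_elim
  case (elim t)
  have W: "err t \<in> W 2" by (rule H02_facts(1)[OF elim(1)])
  have "aip (err t) (err t) + gip (err t) (err t) \<le> 2 * B"
   using gip_le_aip[OF elim(1)] elim(2) aip_nonneg[of "err t"] by linarith
  then show ?case using norm1_le_norm2[OF W] by (simp add: norm2_eq[OF W])
 qed
 have rev1: "\<bar>norm1 \<Omega> f - norm1 \<Omega> g\<bar> \<le> 1 * norm1 \<Omega> (\<lambda>x. f x - g x)"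
  and rev2: "\<bar>norm2 \<Omega> f - norm2 \<Omega> g\<bar> \<le> 1 * norm2 \<Omega> (\<lambda>x. f x - g x)"
  and le12: "\<bar>norm1 \<Omega> (\<lambda>x. f x - g x)\<bar> \<le> norm2 \<Omega> (\<lambda>x. f x - g x)"
  if fg: "f \<in> H02 \<Omega>" "g \<in> H02 \<Omega>" for f g
 proof -
  have W: "f \<in> W 2" "g \<in> W 2" "(\<lambda>x. f x - g x) \<in> W 2" using fg by (auto intro: W_diff H02_facts(1))
  have eqs: "(\<lambda>x. 1 * (f x - g x) + 1 * g x) = f" "(\<lambda>x. - 1 * (f x - g x) + 1 * f x) = g" by auto
  show "\<bar>norm2 \<Omega> f - norm2 \<Omega> g\<bar> \<le> 1 * norm2 \<Omega> (\<lambda>x. f x - g x)"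
   using norm2_triangle[OF W(3,2), of 1 1] norm2_triangle[OF W(3,1), of "-1" 1] unfolding eqs by simp
  have W': "f \<in> W 1" "g \<in> W 1" "(\<lambda>x. f x - g x) \<in> W 1" using W W2_W1 by blast+
  show "\<bar>norm1 \<Omega> f - norm1 \<Omega> g\<bar> \<le> 1 * norm1 \<Omega> (\<lambda>x. f x - g x)"
   using norm1_triangle[OF W'(3,2), of 1 1] norm1_triangle[OF W'(3,1), of "-1" 1] unfolding eqs by simp
  show "\<bar>norm1 \<Omega> (\<lambda>x. f x - g x)\<bar> \<le> norm2 \<Omega> (\<lambda>x. f x - g x)"
   using norm1_le_norm2[OF W(3)] by (simp add: norm1_nonneg)
 qed
 note esm = error_strongly_measurable[OF sm]
 show inf: "err \<in> bochner_Linf T (H02 \<Omega>) (norm2 \<Omega>)"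
  unfolding bochner_Linf_def
 proof (intro CollectI conjI esm eH exI)
  show "AE t in \<tau>. norm2 \<Omega> (err t) \<le> sqrt (2 * B)" using b by eventually_elim blast
 qed
 have m2: "(\<lambda>t. norm2 \<Omega> (err t)) \<in> borel_measurable \<tau>"
 proof (rule strongly_measurable_compose[OF esm])
  show "AE t in \<tau>. \<forall>f\<in>H02 \<Omega>. \<bar>norm2 \<Omega> f - norm2 \<Omega> (err t)\<bar> \<le> 1 * norm2 \<Omega> (\<lambda>x. f x - err t x)"
   using eH by eventually_elim (intro ballI rev2)
 qed
 have esm1: "strongly_measurable T (H02 \<Omega>) (norm1 \<Omega>) err"
  by (rule strongly_measurable_mono[OF esm order_refl]) (use eH in eventually_elim, intro ballI le12)
 have m1: "(\<lambda>t. norm1 \<Omega> (err t)) \<in> borel_measurable \<tau>"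
 proof (rule strongly_measurable_compose[OF esm1])
  show "AE t in \<tau>. \<forall>f\<in>H02 \<Omega>. \<bar>norm1 \<Omega> f - norm1 \<Omega> (err t)\<bar> \<le> 1 * norm1 \<Omega> (\<lambda>x. f x - err t x)"
   using eH by eventually_elim (intro ballI rev1)
 qed
 have "emeasure \<tau> (space \<tau>) \<noteq> 0" using T_pos by (simp add: emeasure_restrict_space)
 then have nt: "ae_filter \<tau> \<noteq> bot" by (simp add: ae_filter_eq_bot_iff)
 have B0: "B \<ge> 0"
 proof -
  obtain t where "aip (err t) (err t) \<le> B" using eventually_happens[OF bd] nt by blast
  then show ?thesis using aip_nonneg[of "err t"] by linarith
 qed
 have sq: "AE t in \<tau>. (norm1 \<Omega> (err t))\<^sup>2 \<le> 2 * B"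
  using b
 proof eventually_elim
  case (elim t)
  have "(norm1 \<Omega> (err t))\<^sup>2 \<le> (sqrt (2 * B))\<^sup>2" by (rule power_mono) (use elim norm1_nonneg in auto)
  then show ?case using B0 by simp
 qed
 have i1: "integrable \<tau> (\<lambda>t. (norm1 \<Omega> (err t))\<^sup>2)"
  by (rule F.integrable_const_bound[of _ "2 * B"]) (use sq m1 in auto)
 have esm': "strongly_measurable T (H01 \<Omega>) (norm1 \<Omega>) err"
  by (rule strongly_measurable_mono[OF esm H02_subset_H01]) (use eH in eventually_elim, intro ballI le12)
 show "err \<in> bochner_L2 T (H01 \<Omega>) (norm1 \<Omega>)"
  unfolding bochner_L2_def by (intro CollectI conjI esm' eH1 i1)
 let ?e = "esssup \<tau> (\<lambda>t. ereal (norm2 \<Omega> (err t)))"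
 have me: "(\<lambda>t. ereal (norm2 \<Omega> (err t))) \<in> borel_measurable \<tau>" using m2 by simp
 have "AE t in \<tau>. ereal (norm2 \<Omega> (err t)) \<le> ereal (sqrt (2 * B))" using b by eventually_elim simp
 then have e_le: "?e \<le> ereal (sqrt (2 * B))" by (rule esssup_I[OF me])
 \<comment> \<open>The essential supremum lies between 0 and a real number, so its conversion to a
   real number loses nothing.\<close>
 have e_ge: "?e \<ge> 0"
 proof -
  obtain t where "ereal (norm2 \<Omega> (err t)) \<le> ?e"
   using eventually_happens[OF esssup_AE[of "\<lambda>t. ereal (norm2 \<Omega> (err t))" \<tau>]] nt by blast
  then show ?thesis using norm2_nonneg[of "err t"] by (meson ereal_less_eq(5) order_trans)
 qed
 have "bochner_Linf_norm T (norm2 \<Omega>) err \<le> sqrt (2 * B)"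
  unfolding bochner_Linf_norm_def using e_le e_ge by (cases ?e) auto
 moreover have "bochner_Linf_norm T (norm2 \<Omega>) err \<ge> 0"
  unfolding bochner_Linf_norm_def using e_ge by (rule real_of_ereal_pos)
 ultimately have "(bochner_Linf_norm T (norm2 \<Omega>) err)\<^sup>2 \<le> (sqrt (2 * B))\<^sup>2" by (intro power_mono)
 moreover have "(bochner_L2_norm T (norm1 \<Omega>) err)\<^sup>2 \<le> 2 * B * (LINT s|\<tau>. 1)"
 proof -
  have "(bochner_L2_norm T (norm1 \<Omega>) err)\<^sup>2 = (LINT t|\<tau>. (norm1 \<Omega> (err t))\<^sup>2)"
   unfolding bochner_L2_norm_def by simp
  also have "\<dots> \<le> (LINT t|\<tau>. 2 * B * 1)" by (rule integral_mono_AE[OF i1 _]) (use sq in auto)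
  also have "\<dots> = 2 * B * (LINT s|\<tau>. 1)" by (rule integral_mult_right_zero)
  finally show ?thesis .
 qed
 ultimately show "(bochner_Linf_norm T (norm2 \<Omega>) err)\<^sup>2 + (bochner_L2_norm T (norm1 \<Omega>) err)\<^sup>2 \<le> 2 * B * (1 + (LINT s|\<tau>. 1))"
  using B0 by (simp add: distrib_left)
qed

end

section \<open>The error estimate uniformly over all meshes\<close>

theorem theorem9:
  fixes \<Omega> :: "(real^'n::finite) set" and T \<alpha> r :: real
    and H :: "real set" and \<T> :: "real \<Rightarrow> (real^'n) set set"
    and S :: "real \<Rightarrow> (real^'n \<Rightarrow> real) set"
    and u ut :: "real \<Rightarrow> real^'n \<Rightarrow> real" and u0 :: "real^'n \<Rightarrow> real"
    and uh :: "real \<Rightarrow> real \<Rightarrow> real^'n \<Rightarrow> real" and u0h :: "real \<Rightarrow> real^'n \<Rightarrow> real"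
  assumes "CARD('n) \<le> 2"
    and "polyhedral_lipschitz_domain \<Omega>"
    and "T > 0" and "\<alpha> > 0" and "r > 3"
    and "H \<subseteq> {0<..<1}"
    and "quasi_uniform_triangulations \<Omega> H \<T>"
    and "\<forall>h\<in>H. finite_dim_subspace (S h) (H02 \<Omega>)"
    and "order_of_accuracy r \<Omega> H S"
    and "weak_solution T \<Omega> \<alpha> u0 u ut"
    and "\<forall>h\<in>H. u0h h \<in> S h"
    and "\<forall>h\<in>H. semidiscrete_solution T \<Omega> \<alpha> (S h) (u0h h) (uh h)"
    and "u \<in> bochner_Linf T (H02 \<Omega>) (norm2 \<Omega>)"
    and "u \<in> bochner_L2 T (sobolev_space r \<Omega>) (sobolev_norm r \<Omega>)"
    and "ut \<in> bochner_L2 T (sobolev_space r \<Omega>) (sobolev_norm r \<Omega>)"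
    and "u0 \<in> H0 r \<Omega>"
  shows "\<exists>C>0. \<forall>h\<in>H.
    (\<lambda>t x. u t x - uh h t x) \<in> bochner_Linf T (H02 \<Omega>) (norm2 \<Omega>) \<and>
    (\<lambda>t x. u t x - uh h t x) \<in> bochner_L2 T (H01 \<Omega>) (norm1 \<Omega>) \<and>
    (bochner_Linf_norm T (norm2 \<Omega>) (\<lambda>t x. u t x - uh h t x))\<^sup>2
      + (bochner_L2_norm T (norm1 \<Omega>) (\<lambda>t x. u t x - uh h t x))\<^sup>2
    \<le> C * ((norm2 \<Omega> (\<lambda>x. u0 x - u0h h x))\<^sup>2 + h powr (2 * (r - 2)))"
proof -
  note card = assms(1) and T = assms(3) and alpha = assms(4) and r = assms(5) and H = assms(6) and sub = assms(8)
  note sol = assms(10)[unfolded weak_solution_def]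
  obtain HP where HP: "finite HP" "\<forall>(a, b)\<in>HP. a \<noteq> (0::real^'n)" "frontier \<Omega> \<subseteq> (\<Union>(a, b)\<in>HP. {x. a \<bullet> x = b})"
    using polyhedral_frontier_hyperplanes[OF assms(2)] by (elim exE conjE)
  interpret cut_domain \<Omega> HP
    by unfold_locales (use HP assms(2) in \<open>auto simp: polyhedral_lipschitz_domain_def\<close>)
  have u_H02: "AE t in lebesgue_on {0<..<T}. u t \<in> H02 \<Omega>" and sm: "strongly_measurable T (H02 \<Omega>) (norm2 \<Omega>) u"
    using assms(13) by (auto simp: bochner_Linf_def)
  obtain Ub where Ub: "AE t in lebesgue_on {0<..<T}. norm2 \<Omega> (u t) \<le> Ub"
    using assms(13) by (auto simp: bochner_Linf_def)
  interpret evolution \<Omega> T r u ut u0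
  proof unfold_locales
    show "0 < T" "2 \<le> r" using T r by auto
    show "ut \<in> bochner_L2 T (sobolev_space r \<Omega>) (sobolev_norm r \<Omega>)" by (rule assms(15))
    show "AE t in lebesgue_on {0<..<T}. u t \<in> sobolev_space r \<Omega>" using assms(14) by (simp add: bochner_L2_def)
    show "weak_time_deriv T \<Omega> u ut" "AE x in lebesgue_on \<Omega>. u 0 x = u0 x" using sol by simp_all
    show "u t \<in> L2_space \<Omega> \<and> ((\<lambda>s. L2_norm \<Omega> (\<lambda>x. u s x - u t x)) \<longlongrightarrow> 0) (at t within {0..T})"
      if "t \<in> {0..T}" for t using sol that by blast
    show "u0 \<in> sobolev_space r \<Omega>" using assms(16) by (simp add: H0_def)
  qed
  interpret galerkin \<Omega> HP T r u ut u0 \<alpha> Ub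
  proof unfold_locales
    show "CARD('n) \<le> 2" "0 < \<alpha>" "AE t in \<tau>. u t \<in> H02 \<Omega>" by (fact card, fact alpha, fact u_H02)
    have "AE t in \<tau>. \<forall>v\<in>H02 \<Omega>.
        L2_inner \<Omega> (ut t) v + L2_inner \<Omega> (wlaplace \<Omega> (ut t)) (wlaplace \<Omega> v)
          + \<alpha> * L2_inner \<Omega> (wgrad \<Omega> (u t)) (wgrad \<Omega> v)
        = L2_inner \<Omega> (wdiv \<Omega> (\<lambda>x. flux (u t x))) v"
      using sol by simp
    then show "AE t in \<tau>. \<forall>v\<in>H02 \<Omega>. aip (ut t) v + \<alpha> * gip (u t) v = nlf (u t) v"
      using u_H02
    proof eventually_elim
      case (elim t)
      show ?case
      proof
        fix v assume v: "v \<in> H02 \<Omega>"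
        show "aip (ut t) v + \<alpha> * gip (u t) v = nlf (u t) v"
          using bspec[OF elim(1) v] unfolding gip_eq[OF H02_facts(2)[OF elim(2)] H02_facts(2)[OF v]]
            wdiv_flux[OF card H02_facts(4)[OF elim(2)] H02_facts(4)[OF v]]
          unfolding ip_L2_inner aip_def .
      qed
    qed
    show "AE t in \<tau>. anrm (u t) \<le> Ub"
      using Ub u_H02 by eventually_elim (use aip_le_norm2 H02_facts(1) order_trans in blast)
  qed
  obtain M0 where M0: "AE t in \<tau>. N (u t) \<le> M0" using sobolev_norm_u_bounded by blast
  obtain K where K: "\<And>h v. h \<in> H \<Longrightarrow> v \<in> H02 \<Omega> \<inter> sobolev_space r \<Omega> \<Longrightarrow>
      (INF \<phi>\<in>S h. norm2 \<Omega> (\<lambda>x. v x - \<phi> x)) \<le> K * h powr (r - 2) * N v"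
    using assms(9) unfolding order_of_accuracy_def by blast
  \<comment> \<open>The best approximation error of u(t) is at most
    \<open>P * h powr (r - 2)\<close>, and the power is at most 1 since h < 1. K and M0 are not
    known to be nonnegative, hence the absolute value and the maximum.\<close>
  define P where "P = \<bar>K\<bar> * max 0 M0"
  define V :: real where "V = (LINT s|\<tau>. 1)"
  define E where "E = exp (2 * growth P * T)"
  \<comment> \<open>The outer factors come from \<open>error_bochner\<close>. The bracket adds the
    coefficient of the squared mesh term and that of the initial error, 2 E, from
    \<open>error_estimate\<close>.\<close>
  define C where "C = 2 * (P\<^sup>2 + 2 * growth P * P\<^sup>2 * V * E + 2 * E) * (1 + V)"
  have P0: "P \<ge> 0" by (simp add: P_def)
  have V0: "V \<ge> 0" by (simp add: V_def)
  have Ub0: "Ub \<ge> 0"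
  proof -
    have "emeasure \<tau> (space \<tau>) \<noteq> 0" using T by (simp add: emeasure_restrict_space)
    then have "ae_filter \<tau> \<noteq> bot" by (simp add: ae_filter_eq_bot_iff)
    then obtain t where "norm2 \<Omega> (u t) \<le> Ub" using eventually_happens[OF Ub] by blast
    then show ?thesis using norm2_nonneg[of "u t"] by linarith
  qed
  have G0: "growth P \<ge> 0" using alpha P0 Ub0 by (simp add: growth_def)
  have C_pos: "C > 0"
  proof -
    have "P\<^sup>2 + 2 * growth P * P\<^sup>2 * V * E + 2 * E > 0" using G0 V0 by (intro add_nonneg_pos) (auto simp: E_def)
    then show ?thesis unfolding C_def using V0 by (intro mult_pos_pos) auto
  qed
  show ?thesis
  proof (intro exI[of _ C] conjI[OF C_pos] ballI)
    fix h assume h: "h \<in> H"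
    then have h01: "0 < h" "h < 1" using H by auto
    define p where "p = h powr (r - 2)"
    have p: "0 \<le> p" "p \<le> 1" using h01 r by (auto simp: p_def intro!: powr_le1)
    have p2: "p\<^sup>2 = h powr (2 * (r - 2))" unfolding p_def power2_eq_square by (simp flip: powr_add)
    note sd = bspec[OF assms(12) h, unfolded semidiscrete_solution_def]
    obtain uht where uht: "\<forall>t\<in>{0..T}. uht t \<in> S h \<and>
        ((\<lambda>s. norm2 \<Omega> (\<lambda>x. (uh h s x - uh h t x) / (s - t) - uht t x)) \<longlongrightarrow> 0) (at t within {0..T}) \<and>
        (\<forall>v\<in>S h.
           L2_inner \<Omega> (uht t) v + L2_inner \<Omega> (wlaplace \<Omega> (uht t)) (wlaplace \<Omega> v)
             + \<alpha> * L2_inner \<Omega> (wgrad \<Omega> (uh h t)) (wgrad \<Omega> v)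
           = - L2_inner \<Omega> (\<lambda>x. flux (uh h t x)) (wgrad \<Omega> v))"
      using sd by (elim conjE exE)
    have SH: "S h \<subseteq> H02 \<Omega>" using sub h by (simp add: finite_dim_subspace_def)
    \<comment> \<open>The role of \<open>\<kappa>\<close> is played by \<open>P * p\<close>, which
      carries the power of h, while the growth constant is built from P alone.\<close>
    interpret semidiscrete \<Omega> HP T r u ut u0 \<alpha> Ub "S h" "uh h" uht "u0h h" "P * p" P
    proof unfold_locales
      show "finite_dim_subspace (S h) (H02 \<Omega>)" using sub h by blast
      show uhS: "uh h t \<in> S h" if "t \<in> {0..T}" for t using sd that by blast
      show uhtS: "uht t \<in> S h" if "t \<in> {0..T}" for t using uht that by blast
      show "((\<lambda>s. norm2 \<Omega> (\<lambda>x. (uh h s x - uh h t x) / (s - t) - uht t x)) \<longlongrightarrow> 0) (at t within {0..T})"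
        if "t \<in> {0..T}" for t using uht that by blast
      show "aip (uht t) v + \<alpha> * gip (uh h t) v = nlf (uh h t) v" if t: "t \<in> {0..T}" and v: "v \<in> S h" for t v
      proof -
        have H: "uh h t \<in> H02 \<Omega>" "v \<in> H02 \<Omega>" using uhS[OF t] v SH by blast+
        show ?thesis
          using bspec[OF uht t] v unfolding gip_eq[OF H02_facts(2)[OF H(1)] H02_facts(2)[OF H(2)], symmetric]
            flux_wgrad[OF card H02_facts(4)[OF H(1)] H02_facts(2)[OF H(2)], symmetric] aip_def ip_L2_inner[symmetric] by blast
      qed
      show "u0h h \<in> S h" using assms(11) h by blast
      show "ip (uh h 0) v = ip (u0h h) v" if "v \<in> S h" for v using sd that by (simp add: ip_L2_inner)
      show "AE t in \<tau>. (INF \<phi>\<in>S h. norm2 \<Omega> (\<lambda>x. u t x - \<phi> x)) \<le> P * p"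
        using u_H02 u_AE M0
      proof eventually_elim
        case (elim t)
        have "(INF \<phi>\<in>S h. norm2 \<Omega> (\<lambda>x. u t x - \<phi> x)) \<le> K * p * N (u t)"
          unfolding p_def using elim by (intro K[OF h]) simp
        also have "\<dots> \<le> \<bar>K\<bar> * p * max 0 M0"
          using p elim(3) by (intro mult_mono mult_right_mono) (auto simp: sobolev_norm_nonneg)
        finally show ?case by (simp add: P_def mult_ac)
      qed
      show "P * p \<le> P" using P0 p by (simp add: mult_left_le)
    qed
    let ?n = "(norm2 \<Omega> (\<lambda>x. u0 x - u0h h x))\<^sup>2"
    let ?B = "(P * p)\<^sup>2 + 2 * (aip (\<lambda>x. u0 x - u0h h x) (\<lambda>x. u0 x - u0h h x) + growth P * (P * p)\<^sup>2 * V) * E"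
    have W0: "(\<lambda>x. u0 x - u0h h x) \<in> W 2" by (intro W_diff sob_W2 u0_in S_W u0h_S)
    have a0: "aip (\<lambda>x. u0 x - u0h h x) (\<lambda>x. u0 x - u0h h x) \<le> ?n"
      by (simp add: norm2_eq[OF W0] aip_nonneg gip_nonneg)
    have bd: "AE t in \<tau>. aip (err t) (err t) \<le> ?B" unfolding V_def E_def by (rule error_estimate)
    have "(bochner_Linf_norm T (norm2 \<Omega>) err)\<^sup>2 + (bochner_L2_norm T (norm1 \<Omega>) err)\<^sup>2 \<le> 2 * ?B * (1 + V)"
      unfolding V_def by (rule error_bochner(3)[OF sm bd[unfolded V_def]])
    also have "\<dots> \<le> 2 * ((P\<^sup>2 + 2 * growth P * P\<^sup>2 * V * E + 2 * E) * (?n + p\<^sup>2)) * (1 + V)"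
    proof (intro mult_right_mono mult_left_mono)
      have E0: "E \<ge> 0" by (simp add: E_def)
      have "?B \<le> (P * p)\<^sup>2 + 2 * (?n + growth P * (P * p)\<^sup>2 * V) * E"
        using E0 by (intro order_refl a0 add_mono mult_right_mono[of _ _ E] mult_left_mono[of _ _ 2]) auto
      also have "\<dots> = (P\<^sup>2 + 2 * growth P * P\<^sup>2 * V * E) * p\<^sup>2 + 2 * E * ?n"
        by (simp add: power_mult_distrib algebra_simps)
      \<comment> \<open>Both coefficients are nonnegative and are replaced by their sum, so that a
        single constant multiplies the sum of the two error terms.\<close>
      also have "\<dots> \<le> (P\<^sup>2 + 2 * growth P * P\<^sup>2 * V * E + 2 * E) * (?n + p\<^sup>2)"
      proof -
        have "0 \<le> (P\<^sup>2 + 2 * growth P * P\<^sup>2 * V * E) * ?n" "0 \<le> 2 * E * p\<^sup>2"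
          using G0 V0 E0 by (auto intro!: mult_nonneg_nonneg add_nonneg_nonneg)
        then show ?thesis unfolding distrib_left distrib_right by linarith
      qed
      finally show "?B \<le> (P\<^sup>2 + 2 * growth P * P\<^sup>2 * V * E + 2 * E) * (?n + p\<^sup>2)" .
    qed (use V0 in auto)
    also have "\<dots> = C * (?n + h powr (2 * (r - 2)))" unfolding C_def p2 by (simp only: mult_ac)
    finally have est: "(bochner_Linf_norm T (norm2 \<Omega>) err)\<^sup>2 + (bochner_L2_norm T (norm1 \<Omega>) err)\<^sup>2
      \<le> C * (?n + h powr (2 * (r - 2)))" .
    show "err \<in> bochner_Linf T (H02 \<Omega>) (norm2 \<Omega>) \<and> err \<in> bochner_L2 T (H01 \<Omega>) (norm1 \<Omega>) \<and>
      (bochner_Linf_norm T (norm2 \<Omega>) err)\<^sup>2 + (bochner_L2_norm T (norm1 \<Omega>) err)\<^sup>2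
      \<le> C * (?n + h powr (2 * (r - 2)))"
      using error_bochner(1,2)[OF sm bd] est by blast
  qed
qed

end
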